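(* Let $u\in L^2([0,1],V)$ be a velocity field satisfying the standing assumption on velocities (see context), and let $I_j\in H^{1/2}(\Gamma_j)$, $j=0,1$, be boundary data. Then the problem $$\text{minimize } \tfrac12\,\|\mathbf b\cdot\nabla_t I\|_{0,\Omega}^2 \quad\text{over } I\in G(\mathbf b;\Omega) \quad\text{subject to } I|_{\Gamma_j}=I_j,\ j=0,1,$$ has a unique minimizer. Moreover, the associated first-order optimality conditions are necessary and sufficient: a function $I\in G(\mathbf b;\Omega)$ with $I|_{\Gamma_j}=I_j$, $j=0,1$, is the minimizer if and only if $$\langle \mathbf b\cdot\nabla_t I,\ \mathbf b\cdot\nabla_t \delta I\rangle_{0,\Omega}=0\qquad\text{for all } \delta I\in \mathring G(\mathbf b;\Omega).$$
   Context: Domains: $\omega=[0,1]^d$ is the spatial domain (either periodic in all $d$ directions, i.e. a flat torus, or non-periodic), $\Omega=[0,1]\times\omega$ is the space-time domain with points written $(x,t)$, $x\in\omega$, $t\in[0,1]$. $\Gamma_0,\Gamma_1$ are the faces $t=0$ and $t=1$ of $\Omega$, each identified with $\omega$, and $\Gamma=\Gamma_0\cup\Gamma_1$. $\|\cdot\|_{0,\Omega}$ and $\langle\cdot,\cdot\rangle_{0,\Omega}$ are the norm and inner product of $L^2(\Omega)$. Standing assumption on velocities: $V$ is a space of Lipschitz vector fields on $\omega$, continuously embedded in $W^{1,\infty}(\omega)^d$ (concretely, the paper uses fields with finite norm $\|v\|_V^2=\langle Lv,v\rangle$, $L=(\mathrm{id}-\alpha^2\Delta)^3$, an $H^3$-type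 norm). $u\in L^2([0,1],V)$ means $u(\cdot,t)\in V$ for $t\in[0,1]$ and $t\mapsto\|u(\cdot,t)\|_V$ is in $L^2([0,1])$. If $\omega$ is not periodic, additionally $u(\cdot,t)\in H^1_0(\omega)\cap W^{1,\infty}(\omega)$ (componentwise). The flow $\varphi:[0,1]\to\mathrm{Diff}(\omega)$ is the unique solution of $\dot\varphi_t(\hat x)=u(\varphi_t(\hat x),t)$, $\varphi_0=\mathrm{id}$. Write $\mathbf b=(u,1)^\top$ and $\mathbf b\cdot\nabla_t f=\partial_t f+u\cdot\nabla f$ (weak sense). Set $\|f\|_{E(\mathbf b;\Omega)}=\|\mathbf b\cdot\nabla_t f\|_{0,\Omega}$, $\|f\|_{G(\mathbf b;\Omega)}^2=\|f\|_{0,\Omega}^2+\|\mathbf b\cdot\nabla_t f\|_{0,\Omega}^2$, and $G(\mathbf b;\Omega)=\{f\in L^2(\Omega): \|f\|_{G(\mathbf b;\Omega)}<\infty\}$, a Hilbert space in which $H^1(\Omega)$ is dense. Boundary values $f|_{\Gamma_j}$ of $f\in G(\mathbf b;\Omega)$ are in the sense of the trace operator, i.e. the continuous extension (with values in $L^2(\Gamma)$) of the usual trace on $\Gamma$. $\mathring G(\mathbf b;\Omega)$ is the subspace of $f\in G(\mathbf b;\Omega)$ with zero trace on $\Gamma$. *)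

theory Defs
  imports "HOL-Analysis.Analysis"
begin

text \<open>
  The spatial domain is the unit cube of \<open>real ^ 'n\<close>; the flag \<open>per\<close> selects the flat torus
  (\<open>True\<close>) or the non-periodic cube (\<open>False\<close>).  On the torus, functions with pointwise meaning
  (velocities, test functions, \<open>C\<^sup>1\<close> functions) are 1-periodic functions on the whole space,
  whereas elements of Lebesgue spaces only matter on the unit cube.
\<close>

definition space_dom :: "(real ^ 'n) set" where
  "space_dom = cbox 0 1"

definition spacetime_dom :: "((real ^ 'n) \<times> real) set" where
  "spacetime_dom = space_dom \<times> {0..1}"

definition periodic_fun :: "(real ^ 'n \<Rightarrow> 'b) \<Rightarrow> bool" where
  "periodic_fun f \<longleftrightarrow> (\<forall>x i. f (x + axis i 1) = f x)"


subsection \<open>Lebesgue spaces\<close>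

definition L2 :: "'a::euclidean_space set \<Rightarrow> ('a \<Rightarrow> real) \<Rightarrow> bool" where
  "L2 S f \<longleftrightarrow> f \<in> borel_measurable (lebesgue_on S) \<and> integrable (lebesgue_on S) (\<lambda>x. (f x)\<^sup>2)"

definition l2_inner :: "'a::euclidean_space set \<Rightarrow> ('a \<Rightarrow> real) \<Rightarrow> ('a \<Rightarrow> real) \<Rightarrow> real" where
  "l2_inner S f g = (LINT x|lebesgue_on S. f x * g x)"

definition l2_norm :: "'a::euclidean_space set \<Rightarrow> ('a \<Rightarrow> real) \<Rightarrow> real" where
  "l2_norm S f = sqrt (l2_inner S f f)"

definition Linf_le :: "'a::euclidean_space set \<Rightarrow> ('a \<Rightarrow> real) \<Rightarrow> real \<Rightarrow> bool" where
  "Linf_le S f M \<longleftrightarrow> f \<in> borel_measurable (lebesgue_on S) \<and> (AE x in lebesgue_on S. \<bar>f x\<bar> \<le> M)"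


subsection \<open>Test functions\<close>

definition C1 :: "('a::euclidean_space \<Rightarrow> real) \<Rightarrow> bool" where
  "C1 f \<longleftrightarrow> (\<forall>x. f differentiable (at x)) \<and>
     (\<forall>b\<in>Basis. continuous_on UNIV (\<lambda>x. frechet_derivative f (at x) b))"

definition test_fun :: "bool \<Rightarrow> (real ^ 'n \<Rightarrow> real) \<Rightarrow> bool" where
  "test_fun per \<psi> \<longleftrightarrow> C1 \<psi> \<and>
     (if per then periodic_fun \<psi>
      else \<exists>K. compact K \<and> K \<subseteq> box 0 1 \<and> (\<forall>x. x \<notin> K \<longrightarrow> \<psi> x = 0))"

definition spacetime_test_fun :: "bool \<Rightarrow> ((real ^ 'n) \<times> real \<Rightarrow> real) \<Rightarrow> bool" where
  "spacetime_test_fun per \<psi> \<longleftrightarrow> C1 \<psi> \<and>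
     (if per then (\<forall>t. periodic_fun (\<lambda>x. \<psi> (x, t))) \<and>
        (\<exists>J. compact J \<and> J \<subseteq> {0<..<1} \<and> (\<forall>x t. t \<notin> J \<longrightarrow> \<psi> (x, t) = 0))
      else \<exists>K. compact K \<and> K \<subseteq> box 0 1 \<times> {0<..<1} \<and> (\<forall>z. z \<notin> K \<longrightarrow> \<psi> z = 0))"


subsection \<open>Weak derivatives and Sobolev spaces on the spatial domain\<close>

definition weak_partial :: "bool \<Rightarrow> 'n \<Rightarrow> (real ^ 'n \<Rightarrow> real) \<Rightarrow> (real ^ 'n \<Rightarrow> real) \<Rightarrow> bool" where
  "weak_partial per i f g \<longleftrightarrow>
     integrable (lebesgue_on space_dom) f \<and> integrable (lebesgue_on space_dom) g \<and>
     (\<forall>\<psi>. test_fun per \<psi> \<longrightarrow>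
        (LINT x|lebesgue_on space_dom. f x * frechet_derivative \<psi> (at x) (axis i 1))
        = - (LINT x|lebesgue_on space_dom. g x * \<psi> x))"

text \<open>Below, \<open>frechet_derivative \<psi> (at x) (v x)\<close> is the inner product of \<open>v x\<close> with the gradient
  of \<open>\<psi>\<close> at \<open>x\<close>.\<close>

definition weak_div :: "bool \<Rightarrow> (real ^ 'n \<Rightarrow> real ^ 'n) \<Rightarrow> (real ^ 'n \<Rightarrow> real) \<Rightarrow> bool" where
  "weak_div per v d \<longleftrightarrow>
     integrable (lebesgue_on space_dom) v \<and> integrable (lebesgue_on space_dom) d \<and>
     (\<forall>\<psi>. test_fun per \<psi> \<longrightarrow>
        (LINT x|lebesgue_on space_dom. frechet_derivative \<psi> (at x) (v x))
        = - (LINT x|lebesgue_on space_dom. d x * \<psi> x))"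

text \<open>\<open>W1inf_le per f M\<close>: \<open>f\<close> belongs to \<open>W\<^sup>1\<^sup>,\<^sup>\<infinity>\<close>, with norm (the maximum of the essential
  suprema of \<open>f\<close> and its weak partial derivatives) at most \<open>M\<close>.\<close>

definition W1inf_le :: "bool \<Rightarrow> (real ^ 'n \<Rightarrow> real) \<Rightarrow> real \<Rightarrow> bool" where
  "W1inf_le per f M \<longleftrightarrow> Linf_le space_dom f M \<and>
     (\<forall>i. \<exists>g. weak_partial per i f g \<and> Linf_le space_dom g M)"

definition W1inf :: "bool \<Rightarrow> (real ^ 'n \<Rightarrow> real) \<Rightarrow> bool" where
  "W1inf per f \<longleftrightarrow> (\<exists>M. W1inf_le per f M)"

text \<open>\<open>H\<^sup>1\<^sub>0\<close> of the non-periodic cube: the closure of the compactly supported test functions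
  in the \<open>H\<^sup>1\<close> norm.\<close>

definition H10 :: "(real ^ 'n \<Rightarrow> real) \<Rightarrow> bool" where
  "H10 f \<longleftrightarrow> L2 space_dom f \<and>
     (\<exists>F :: nat \<Rightarrow> real ^ 'n \<Rightarrow> real. (\<forall>k. test_fun False (F k)) \<and>
        (\<lambda>k. l2_norm space_dom (\<lambda>x. F k x - f x)) \<longlonglongrightarrow> 0 \<and>
        (\<forall>i. \<exists>g. L2 space_dom g \<and> weak_partial False i f g \<and>
           (\<lambda>k. l2_norm space_dom (\<lambda>x. frechet_derivative (F k) (at x) (axis i 1) - g x)) \<longlonglongrightarrow> 0))"

text \<open>\<open>H\<^sup>1\<^sup>/\<^sup>2\<close> in the Sobolev-Slobodeckij sense, with the geodesic distance on the torus.\<close>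

definition space_dist :: "bool \<Rightarrow> real ^ 'n \<Rightarrow> real ^ 'n \<Rightarrow> real" where
  "space_dist per x y =
     (if per then (INF k\<in>{k. \<forall>i. k $ i \<in> \<int>}. norm (x - y + k)) else dist x y)"

definition Hhalf :: "bool \<Rightarrow> (real ^ 'n \<Rightarrow> real) \<Rightarrow> bool" where
  "Hhalf per f \<longleftrightarrow> L2 space_dom f \<and>
     integrable (lebesgue_on (space_dom \<times> space_dom))
       (\<lambda>(x, y). (f x - f y)\<^sup>2 / space_dist per x y ^ (CARD('n) + 1))"


subsection \<open>Velocity fields\<close>

text \<open>\<open>V\<close> with norm \<open>nV\<close> is a normed space of Lipschitz vector fields (identified with their
  restrictions to the domain) that is continuously embedded in \<open>W\<^sup>1\<^sup>,\<^sup>\<infinity>\<close> componentwise.\<close>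

definition velocity_space ::
  "bool \<Rightarrow> (real ^ 'n \<Rightarrow> real ^ 'n) set \<Rightarrow> ((real ^ 'n \<Rightarrow> real ^ 'n) \<Rightarrow> real) \<Rightarrow> bool" where
  "velocity_space per V nV \<longleftrightarrow>
     (\<lambda>x. 0) \<in> V \<and>
     (\<forall>v\<in>V. \<forall>w\<in>V. (\<lambda>x. v x + w x) \<in> V) \<and>
     (\<forall>c. \<forall>v\<in>V. (\<lambda>x. c *\<^sub>R v x) \<in> V) \<and>
     (\<forall>v\<in>V. 0 \<le> nV v) \<and>
     (\<forall>v\<in>V. nV v = 0 \<longleftrightarrow> (\<forall>x\<in>space_dom. v x = 0)) \<and>
     (\<forall>c. \<forall>v\<in>V. nV (\<lambda>x. c *\<^sub>R v x) = \<bar>c\<bar> * nV v) \<and>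
     (\<forall>v\<in>V. \<forall>w\<in>V. nV (\<lambda>x. v x + w x) \<le> nV v + nV w) \<and>
     (\<forall>v\<in>V. per \<longrightarrow> periodic_fun v) \<and>
     (\<forall>v\<in>V. \<exists>L. L-lipschitz_on space_dom v) \<and>
     (\<exists>C. \<forall>v\<in>V. \<forall>i. W1inf_le per (\<lambda>x. v x $ i) (C * nV v))"

text \<open>The Bochner space \<open>L\<^sup>2([0,1], V)\<close>: strongly measurable (an almost everywhere limit, in the
  norm of \<open>V\<close>, of simple functions) with square integrable norm.\<close>

definition L2_in_time ::
  "(real ^ 'n \<Rightarrow> real ^ 'n) set \<Rightarrow> ((real ^ 'n \<Rightarrow> real ^ 'n) \<Rightarrow> real) \<Rightarrow>
   (real \<Rightarrow> real ^ 'n \<Rightarrow> real ^ 'n) \<Rightarrow> bool" where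
  "L2_in_time V nV u \<longleftrightarrow>
     (\<forall>t\<in>{0..1}. u t \<in> V) \<and>
     (\<exists>s :: nat \<Rightarrow> real \<Rightarrow> real ^ 'n \<Rightarrow> real ^ 'n.
        (\<forall>k. finite (s k ` {0..1}) \<and> s k ` {0..1} \<subseteq> V \<and>
             (\<forall>v. {t\<in>{0..1}. s k t = v} \<in> sets lebesgue)) \<and>
        (AE t in lebesgue_on {0..1}. (\<lambda>k. nV (\<lambda>x. s k t x - u t x)) \<longlonglongrightarrow> 0)) \<and>
     integrable (lebesgue_on {0..1}) (\<lambda>t. (nV (u t))\<^sup>2)"

definition admissible_velocity ::
  "bool \<Rightarrow> (real ^ 'n \<Rightarrow> real ^ 'n) set \<Rightarrow> ((real ^ 'n \<Rightarrow> real ^ 'n) \<Rightarrow> real) \<Rightarrow>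
   (real \<Rightarrow> real ^ 'n \<Rightarrow> real ^ 'n) \<Rightarrow> bool" where
  "admissible_velocity per V nV u \<longleftrightarrow>
     velocity_space per V nV \<and> L2_in_time V nV u \<and>
     (\<not> per \<longrightarrow> (\<forall>t\<in>{0..1}. \<forall>i. H10 (\<lambda>x. u t x $ i) \<and> W1inf False (\<lambda>x. u t x $ i)))"


subsection \<open>The transport derivative and the space G\<close>

text \<open>\<open>g\<close> is the weak derivative of \<open>f\<close> along \<open>b = (u, 1)\<close>.  Integration by parts moves the
  derivative onto the test function as \<open>div (\<psi> b) = b \<bullet> \<nabla>\<^sub>t \<psi> + \<psi> div u\<close>; the first summand is
  \<open>frechet_derivative \<psi> (at z) (u (snd z) (fst z), 1)\<close> and \<open>d\<close> is the weak spatial divergence of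
  \<open>u\<close>.\<close>

definition weak_transport ::
  "bool \<Rightarrow> (real \<Rightarrow> real ^ 'n \<Rightarrow> real ^ 'n) \<Rightarrow>
   ((real ^ 'n) \<times> real \<Rightarrow> real) \<Rightarrow> ((real ^ 'n) \<times> real \<Rightarrow> real) \<Rightarrow> bool" where
  "weak_transport per u f g \<longleftrightarrow>
     (\<exists>d. d \<in> borel_measurable (lebesgue_on spacetime_dom) \<and>
        (AE t in lebesgue_on {0..1}. weak_div per (u t) (\<lambda>x. d (x, t))) \<and>
        (\<forall>\<psi>. spacetime_test_fun per \<psi> \<longrightarrow>
           (LINT z|lebesgue_on spacetime_dom.
              f z * (frechet_derivative \<psi> (at z) (u (snd z) (fst z), 1) + \<psi> z * d z))
           = - (LINT z|lebesgue_on spacetime_dom. g z * \<psi> z)))"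

definition in_G ::
  "bool \<Rightarrow> (real \<Rightarrow> real ^ 'n \<Rightarrow> real ^ 'n) \<Rightarrow> ((real ^ 'n) \<times> real \<Rightarrow> real) \<Rightarrow> bool" where
  "in_G per u f \<longleftrightarrow> L2 spacetime_dom f \<and>
     (\<exists>g. L2 spacetime_dom g \<and> weak_transport per u f g)"

text \<open>A representative of the weak derivative, which is unique up to null sets.\<close>

definition transport ::
  "bool \<Rightarrow> (real \<Rightarrow> real ^ 'n \<Rightarrow> real ^ 'n) \<Rightarrow>
   ((real ^ 'n) \<times> real \<Rightarrow> real) \<Rightarrow> (real ^ 'n) \<times> real \<Rightarrow> real" where
  "transport per u f = (SOME g. L2 spacetime_dom g \<and> weak_transport per u f g)"

definition E_norm ::
  "bool \<Rightarrow> (real \<Rightarrow> real ^ 'n \<Rightarrow> real ^ 'n) \<Rightarrow> ((real ^ 'n) \<times> real \<Rightarrow> real) \<Rightarrow> real" where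
  "E_norm per u f = l2_norm spacetime_dom (transport per u f)"

definition G_norm ::
  "bool \<Rightarrow> (real \<Rightarrow> real ^ 'n \<Rightarrow> real ^ 'n) \<Rightarrow> ((real ^ 'n) \<times> real \<Rightarrow> real) \<Rightarrow> real" where
  "G_norm per u f = sqrt ((l2_norm spacetime_dom f)\<^sup>2 + (E_norm per u f)\<^sup>2)"


subsection \<open>Traces\<close>

text \<open>Functions that are continuously differentiable up to the boundary; their usual trace is
  restriction to the faces \<open>t = 0\<close> and \<open>t = 1\<close>.\<close>

definition C1_closed :: "bool \<Rightarrow> ((real ^ 'n) \<times> real \<Rightarrow> real) \<Rightarrow> bool" where
  "C1_closed per f \<longleftrightarrow> C1 f \<and> (per \<longrightarrow> (\<forall>t. periodic_fun (\<lambda>x. f (x, t))))"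

text \<open>\<open>has_trace per u f g0 g1\<close>: the trace of \<open>f\<close> in \<open>G\<close> is \<open>g0\<close> at \<open>t = 0\<close> and \<open>g1\<close> at \<open>t = 1\<close>.
  As the trace operator is the continuous extension of the restriction map to \<open>G\<close>, with values
  in \<open>L\<^sup>2\<close>, its graph is the closure of the graph of the restriction map.\<close>

definition has_trace ::
  "bool \<Rightarrow> (real \<Rightarrow> real ^ 'n \<Rightarrow> real ^ 'n) \<Rightarrow> ((real ^ 'n) \<times> real \<Rightarrow> real) \<Rightarrow>
   (real ^ 'n \<Rightarrow> real) \<Rightarrow> (real ^ 'n \<Rightarrow> real) \<Rightarrow> bool" where
  "has_trace per u f g0 g1 \<longleftrightarrow>
     in_G per u f \<and> L2 space_dom g0 \<and> L2 space_dom g1 \<and>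
     (\<exists>F :: nat \<Rightarrow> (real ^ 'n) \<times> real \<Rightarrow> real. (\<forall>k. C1_closed per (F k)) \<and>
        (\<lambda>k. G_norm per u (\<lambda>z. F k z - f z)) \<longlonglongrightarrow> 0 \<and>
        (\<lambda>k. l2_norm space_dom (\<lambda>x. F k (x, 0) - g0 x)) \<longlonglongrightarrow> 0 \<and>
        (\<lambda>k. l2_norm space_dom (\<lambda>x. F k (x, 1) - g1 x)) \<longlonglongrightarrow> 0)"

definition in_G0 ::
  "bool \<Rightarrow> (real \<Rightarrow> real ^ 'n \<Rightarrow> real ^ 'n) \<Rightarrow> ((real ^ 'n) \<times> real \<Rightarrow> real) \<Rightarrow> bool" where
  "in_G0 per u f \<longleftrightarrow> in_G per u f \<and> has_trace per u f (\<lambda>x. 0) (\<lambda>x. 0)"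


subsection \<open>The minimization problem\<close>

definition feasible ::
  "bool \<Rightarrow> (real \<Rightarrow> real ^ 'n \<Rightarrow> real ^ 'n) \<Rightarrow> (real ^ 'n \<Rightarrow> real) \<Rightarrow> (real ^ 'n \<Rightarrow> real) \<Rightarrow>
   ((real ^ 'n) \<times> real \<Rightarrow> real) \<Rightarrow> bool" where
  "feasible per u I0 I1 f \<longleftrightarrow> in_G per u f \<and> has_trace per u f I0 I1"

definition is_minimizer ::
  "bool \<Rightarrow> (real \<Rightarrow> real ^ 'n \<Rightarrow> real ^ 'n) \<Rightarrow> (real ^ 'n \<Rightarrow> real) \<Rightarrow> (real ^ 'n \<Rightarrow> real) \<Rightarrow>
   ((real ^ 'n) \<times> real \<Rightarrow> real) \<Rightarrow> bool" where
  "is_minimizer per u I0 I1 f \<longleftrightarrow> feasible per u I0 I1 f \<and>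
     (\<forall>h. feasible per u I0 I1 h \<longrightarrow> 1/2 * (E_norm per u f)\<^sup>2 \<le> 1/2 * (E_norm per u h)\<^sup>2)"

end

theory Submission
  imports Defs
begin

text \<open>
  The energy is the squared norm of the transport derivative, and the feasible functions form an
  affine space over the functions with zero trace.  As in any quadratic minimization problem, the first
  variation gives the optimality conditions (\<open>optimality_condition\<close>), and existence and
  uniqueness follow from three facts: the feasible set is nonempty, it is closed in the graph norm, and the
  energy controls differences of feasible functions.

  Coercivity is a Poincare inequality along the characteristics.  Multiplying the transport
  derivative by the function and using that nothing flows through the boundary, one finds that the
  energy \<open>e t\<close> of a \<open>C\<^sup>1\<close> function on the slice at time \<open>t\<close> satisfies a Gronwall inequality with a
  weight in \<open>L\<^sup>2\<close> coming from the divergence of the velocity (\<open>energy_estimate\<close>).  Traces are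
  defined through approximation by \<open>C\<^sup>1\<close> functions, so the inequality passes to all functions with
  zero trace (\<open>zero_trace_estimate\<close>).  Together with the parallelogram law it makes a minimizing
  sequence converge in the graph norm, and the limit has the same traces (\<open>minimizer_exists\<close>,
  \<open>has_trace_limit\<close>).

  The main work is to find one feasible function (\<open>extension_exists\<close>).  One would like to
  transport both boundary values along the flow and to blend them linearly in time.  In place of the
  flow itself, it suffices to have \<open>C\<^sup>1\<close> functions with prescribed values on one face, whose
  transport derivatives tend to zero in \<open>L\<^sup>2\<close>: by the energy estimate they converge.  Such
  functions come from compositions of small displacements \<open>x \<mapsto> x - \<Theta> *\<^sub>R v x\<close>, one for each short
  time slab, with smooth fields \<open>v\<close> (\<open>transport_chain\<close>, \<open>approximate_transport\<close>).  The errors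
  are multiplied by the gradient of the composition, which is bounded by the exponential of the
  time integral of the Lipschitz constants.

  This fixes what is required of the velocity, collected in the locale \<open>transport_setting\<close>: an \<open>L\<^sup>2\<close>
  bound in time for the velocity and its divergence, integration by parts up to the boundary, and an
  approximation in \<open>L\<^sup>2\<close> by smooth fields that are constant on short time slabs, with control of the
  average Lipschitz constant.  The locale \<open>velocity_field\<close> derives these properties.  Bounds on weak
  derivatives become Lipschitz bounds (\<open>weak_partial_lipschitz\<close>), so that convergence in the norm of
  \<open>V\<close> controls both sizes and Lipschitz constants; strong measurability in time provides the
  approximation (\<open>piecewise_constant_approximation\<close>); and on the cube the vanishing boundary values
  in \<open>H\<^sup>1\<^sub>0\<close> give the integration by parts (\<open>H10_by_parts\<close>).
\<close>

section \<open>Square integrable functions\<close>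

lemma L2_mult_integrable:
  assumes "L2 S f" "L2 S g"
  shows "integrable (lebesgue_on S) (\<lambda>x. f x * g x)"
proof (rule Bochner_Integration.integrable_bound)
  show "integrable (lebesgue_on S) (\<lambda>x. (f x)\<^sup>2 + (g x)\<^sup>2)"
    using assms by (auto simp: L2_def)
  show "(\<lambda>x. f x * g x) \<in> borel_measurable (lebesgue_on S)"
    using assms by (auto simp: L2_def)
  have "\<bar>a * b\<bar> \<le> a\<^sup>2 + b\<^sup>2" for a b :: real
  proof -
    have "2 * (\<bar>a\<bar> * \<bar>b\<bar>) \<le> a\<^sup>2 + b\<^sup>2"
      using sum_squares_bound[of "\<bar>a\<bar>" "\<bar>b\<bar>"] by (simp add: mult.assoc)
    moreover have "0 \<le> \<bar>a\<bar> * \<bar>b\<bar>" by simp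
    ultimately show ?thesis unfolding abs_mult by linarith
  qed
  then show "AE x in lebesgue_on S. norm (f x * g x) \<le> norm ((f x)\<^sup>2 + (g x)\<^sup>2)"
    by (intro AE_I2) simp
qed

lemma L2_zero [simp]: "L2 S (\<lambda>x. 0)"
  by (simp add: L2_def)

lemma L2_scale: "L2 S f \<Longrightarrow> L2 S (\<lambda>x. c * f x)"
  by (auto simp: L2_def power_mult_distrib)

lemma L2_add:
  assumes "L2 S f" "L2 S g"
  shows "L2 S (\<lambda>x. f x + g x)"
proof -
  have "integrable (lebesgue_on S) (\<lambda>x. (f x)\<^sup>2 + 2 * (f x * g x) + (g x)\<^sup>2)"
    using assms L2_mult_integrable[OF assms] by (auto simp: L2_def)
  then have "integrable (lebesgue_on S) (\<lambda>x. (f x + g x)\<^sup>2)"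
    by (rule back_subst[of "integrable _"]) (auto simp: power2_sum algebra_simps)
  then show ?thesis using assms by (auto simp: L2_def)
qed

lemma L2_diff: "L2 S f \<Longrightarrow> L2 S g \<Longrightarrow> L2 S (\<lambda>x. f x - g x)"
  using L2_add[of S f "\<lambda>x. (-1) * g x"] L2_scale[of S g "-1"] by simp

lemma L2_dominated:
  assumes "f \<in> borel_measurable (lebesgue_on S)" "L2 S g" "AE x in lebesgue_on S. \<bar>f x\<bar> \<le> \<bar>g x\<bar>"
  shows "L2 S f"
  unfolding L2_def
proof
  show "integrable (lebesgue_on S) (\<lambda>x. (f x)\<^sup>2)"
    by (rule Bochner_Integration.integrable_bound[of _ "\<lambda>x. (g x)\<^sup>2"])
      (use assms in \<open>auto simp: L2_def abs_le_square_iff\<close>)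
qed (fact assms)

lemma l2_inner_commute: "l2_inner S f g = l2_inner S g f"
  by (simp add: l2_inner_def mult.commute)

lemma l2_inner_add_left:
  "L2 S f \<Longrightarrow> L2 S g \<Longrightarrow> L2 S h \<Longrightarrow>
    l2_inner S (\<lambda>x. f x + g x) h = l2_inner S f h + l2_inner S g h"
  by (simp add: l2_inner_def distrib_right L2_mult_integrable)

lemma l2_inner_scale_left: "l2_inner S (\<lambda>x. c * f x) h = c * l2_inner S f h"
  by (simp add: l2_inner_def mult.assoc)

lemma l2_inner_diff_left:
  "L2 S f \<Longrightarrow> L2 S g \<Longrightarrow> L2 S h \<Longrightarrow>
    l2_inner S (\<lambda>x. f x - g x) h = l2_inner S f h - l2_inner S g h"
  by (simp add: l2_inner_def left_diff_distrib L2_mult_integrable)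

lemma l2_inner_cong_AE:
  assumes "L2 S f" "L2 S g" "L2 S f'" "L2 S g'"
    "AE x in lebesgue_on S. f x = f' x" "AE x in lebesgue_on S. g x = g' x"
  shows "l2_inner S f g = l2_inner S f' g'"
  unfolding l2_inner_def
proof (rule integral_cong_AE)
  show "AE x in lebesgue_on S. f x * g x = f' x * g' x"
    using assms(5,6) by eventually_elim simp
qed (use assms in \<open>simp_all add: L2_def borel_measurable_times\<close>)

lemma l2_inner_self_nonneg: "0 \<le> l2_inner S f f"
  by (simp add: l2_inner_def)

lemma l2_norm_nonneg: "0 \<le> l2_norm S f"
  by (simp add: l2_norm_def l2_inner_self_nonneg)

lemma l2_norm_power2: "(l2_norm S f)\<^sup>2 = l2_inner S f f"
  by (simp add: l2_norm_def l2_inner_self_nonneg)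

lemma l2_norm_power2_integral: "(l2_norm S f)\<^sup>2 = (LINT x|lebesgue_on S. (f x)\<^sup>2)"
  unfolding l2_norm_power2 by (simp add: l2_inner_def power2_eq_square)

lemma l2_norm_cong_AE:
  assumes "L2 S f" "L2 S f'" "AE x in lebesgue_on S. f x = f' x"
  shows "l2_norm S f = l2_norm S f'"
  unfolding l2_norm_def using l2_inner_cong_AE[of S f f f' f'] assms by simp

lemma l2_norm_scale: "l2_norm S (\<lambda>x. c * f x) = \<bar>c\<bar> * l2_norm S f"
proof -
  have "l2_inner S (\<lambda>x. c * f x) (\<lambda>x. c * f x) = c\<^sup>2 * l2_inner S f f"
    unfolding l2_inner_scale_left by (subst l2_inner_commute) (simp add: l2_inner_scale_left power2_eq_square)
  then show ?thesis by (simp add: l2_norm_def real_sqrt_mult)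
qed

lemma l2_norm_minus_commute: "l2_norm S (\<lambda>x. f x - g x) = l2_norm S (\<lambda>x. g x - f x)"
  using l2_norm_scale[of S "-1" "\<lambda>x. f x - g x"] by simp

lemma l2_norm_add_power2:
  assumes "L2 S f" "L2 S g"
  shows "(l2_norm S (\<lambda>x. f x + c * g x))\<^sup>2 =
    (l2_norm S f)\<^sup>2 + 2 * c * l2_inner S f g + c\<^sup>2 * (l2_norm S g)\<^sup>2"
proof -
  have "(l2_norm S (\<lambda>x. f x + c * g x))\<^sup>2 =
    (LINT x|lebesgue_on S. f x * f x + (2 * c) * (f x * g x) + c\<^sup>2 * (g x * g x))"
    unfolding l2_norm_power2 l2_inner_def
    by (rule Bochner_Integration.integral_cong) (auto simp: power2_eq_square algebra_simps)
  also have "\<dots> = (l2_norm S f)\<^sup>2 + 2 * c * l2_inner S f g + c\<^sup>2 * (l2_norm S g)\<^sup>2"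
    unfolding l2_norm_power2 l2_inner_def
    using assms by (simp add: L2_mult_integrable)
  finally show ?thesis .
qed

text \<open>The first variation: \<open>2 * c * l2_inner S f g + c\<^sup>2 * (l2_norm S g)\<^sup>2\<close> can only be nonnegative for
  all \<open>c\<close> if its linear coefficient vanishes.\<close>

lemma l2_inner_eq_0_if_minimal:
  assumes "L2 S f" "L2 S g"
    and min: "\<And>c. (l2_norm S f)\<^sup>2 \<le> (l2_norm S (\<lambda>x. f x + c * g x))\<^sup>2"
  shows "l2_inner S f g = 0"
proof (rule ccontr)
  define p q where "p = l2_inner S f g" and "q = (l2_norm S g)\<^sup>2"
  assume "l2_inner S f g \<noteq> 0"
  then have "p \<noteq> 0" by (simp add: p_def)
  have le: "0 \<le> 2 * c * p + c\<^sup>2 * q" for c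
    using min[of c] unfolding l2_norm_add_power2[OF assms(1,2)] p_def q_def by simp
  have "q \<ge> 0" by (simp add: q_def)
  define r where "r = q + 1"
  have r: "r > 0" "q = r - 1" using \<open>q \<ge> 0\<close> by (auto simp: r_def)
  \<comment> \<open>\<open>r\<close> instead of \<open>q\<close> avoids the case \<open>q = 0\<close>\<close>
  have "0 \<le> 2 * (- p / r) * p + (- p / r)\<^sup>2 * q" by (rule le)
  also have "\<dots> = (p / r)\<^sup>2 * (- r - 1)"
    using r(1) unfolding r(2) by (simp add: field_simps power2_eq_square)
  also have "\<dots> < 0"
    using \<open>p \<noteq> 0\<close> r(1) by (intro mult_pos_neg) auto
  finally show False by simp
qed

lemma l2_cauchy_schwarz:
  assumes "L2 S f" "L2 S g"
  shows "\<bar>l2_inner S f g\<bar> \<le> l2_norm S f * l2_norm S g"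
proof -
  define a b p where "a = l2_norm S f" and "b = l2_norm S g" and "p = l2_inner S f g"
  have nn: "a \<ge> 0" "b \<ge> 0" by (auto simp: a_def b_def l2_norm_nonneg)
  have le: "0 \<le> a\<^sup>2 + 2 * c * p + c\<^sup>2 * b\<^sup>2" for c
    unfolding a_def b_def p_def using l2_norm_add_power2[OF assms, of c] by (metis zero_le_power2)
  have "p\<^sup>2 \<le> a\<^sup>2 * b\<^sup>2"
  proof (cases "b = 0")
    case True
    have "p = 0"
    proof (rule ccontr)
      assume "p \<noteq> 0"
      then have "2 * (- (a\<^sup>2 + 1) / (2 * p)) * p = - (a\<^sup>2 + 1)" by simp
      with le[of "- (a\<^sup>2 + 1) / (2 * p)"] True show False by simp
    qed
    then show ?thesis by simp
  next
    case False
    with le[of "- p / b\<^sup>2"] have "0 \<le> a\<^sup>2 - p\<^sup>2 / b\<^sup>2"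
      by (simp add: power2_eq_square field_simps)
    with False show ?thesis by (simp add: field_simps)
  qed
  then have "\<bar>p\<bar> \<le> a * b"
    using nn by (metis abs_le_square_iff abs_of_nonneg mult_nonneg_nonneg power_mult_distrib)
  then show ?thesis by (simp add: a_def b_def p_def)
qed

lemma l2_norm_triangle:
  assumes "L2 S f" "L2 S g"
  shows "l2_norm S (\<lambda>x. f x + g x) \<le> l2_norm S f + l2_norm S g"
proof (rule power2_le_imp_le)
  have "(l2_norm S (\<lambda>x. f x + g x))\<^sup>2 = (l2_norm S f)\<^sup>2 + 2 * l2_inner S f g + (l2_norm S g)\<^sup>2"
    using l2_norm_add_power2[OF assms, of 1] by simp
  also have "\<dots> \<le> (l2_norm S f + l2_norm S g)\<^sup>2"
    using l2_cauchy_schwarz[OF assms] by (simp add: power2_sum)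
  finally show "(l2_norm S (\<lambda>x. f x + g x))\<^sup>2 \<le> (l2_norm S f + l2_norm S g)\<^sup>2" .
qed (simp add: l2_norm_nonneg)

lemma l2_norm_triangle_diff:
  assumes "L2 S f" "L2 S g" "L2 S h"
  shows "l2_norm S (\<lambda>x. f x - h x) \<le> l2_norm S (\<lambda>x. f x - g x) + l2_norm S (\<lambda>x. g x - h x)"
  using l2_norm_triangle[of S "\<lambda>x. f x - g x" "\<lambda>x. g x - h x"] assms by (simp add: L2_diff)

lemma l2_norm_eq_0_iff:
  assumes "L2 S f"
  shows "l2_norm S f = 0 \<longleftrightarrow> (AE x in lebesgue_on S. f x = 0)"
proof -
  have "l2_norm S f = 0 \<longleftrightarrow> (LINT x|lebesgue_on S. (f x)\<^sup>2) = 0"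
    unfolding l2_norm_power2_integral[symmetric] by simp
  also have "\<dots> \<longleftrightarrow> (AE x in lebesgue_on S. (f x)\<^sup>2 = 0)"
    using assms by (intro integral_nonneg_eq_0_iff_AE) (auto simp: L2_def)
  finally show ?thesis by simp
qed

lemma l2_norm_dominated:
  assumes "f \<in> borel_measurable (lebesgue_on S)" "L2 S g" "AE x in lebesgue_on S. \<bar>f x\<bar> \<le> \<bar>g x\<bar>"
  shows "l2_norm S f \<le> l2_norm S g"
proof (rule power2_le_imp_le)
  show "(l2_norm S f)\<^sup>2 \<le> (l2_norm S g)\<^sup>2"
    unfolding l2_norm_power2_integral
    by (rule integral_mono_AE)
      (use assms L2_dominated[OF assms] in \<open>auto simp: L2_def abs_le_square_iff\<close>)
qed (rule l2_norm_nonneg)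

lemma l2_inner_tendsto:
  assumes "\<And>k. L2 S (f k)" "L2 S g" "L2 S h"
    and lim: "(\<lambda>k. l2_norm S (\<lambda>x. f k x - g x)) \<longlonglongrightarrow> 0"
  shows "(\<lambda>k. l2_inner S (f k) h) \<longlonglongrightarrow> l2_inner S g h"
proof (rule LIM_zero_cancel, rule Lim_null_comparison)
  show "(\<lambda>k. l2_norm S (\<lambda>x. f k x - g x) * l2_norm S h) \<longlonglongrightarrow> 0"
    using tendsto_mult_left_zero[OF lim] by simp
  show "\<forall>\<^sub>F k in sequentially. norm (l2_inner S (f k) h - l2_inner S g h)
      \<le> l2_norm S (\<lambda>x. f k x - g x) * l2_norm S h"
    using l2_cauchy_schwarz[OF L2_diff[OF assms(1,2)] assms(3)]
    by (simp add: l2_inner_diff_left assms)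
qed

lemma l2_norm_tendsto:
  assumes "\<And>k. L2 S (f k)" "L2 S g"
    and lim: "(\<lambda>k. l2_norm S (\<lambda>x. f k x - g x)) \<longlonglongrightarrow> 0"
  shows "(\<lambda>k. l2_norm S (f k)) \<longlonglongrightarrow> l2_norm S g"
proof (rule LIM_zero_cancel, rule Lim_null_comparison[OF _ lim])
  have "\<bar>l2_norm S (f k) - l2_norm S g\<bar> \<le> l2_norm S (\<lambda>x. f k x - g x)" for k
    using l2_norm_triangle[of S "\<lambda>x. f k x - g x" g] l2_norm_triangle[of S "\<lambda>x. g x - f k x" "f k"]
      l2_norm_minus_commute[of S "f k" g] assms(1,2) by (simp add: L2_diff)
  then show "\<forall>\<^sub>F k in sequentially. norm (l2_norm S (f k) - l2_norm S g) \<le> l2_norm S (\<lambda>x. f k x - g x)"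
    by simp
qed

definition l2_Cauchy :: "'a::euclidean_space set \<Rightarrow> (nat \<Rightarrow> 'a \<Rightarrow> real) \<Rightarrow> bool" where
  "l2_Cauchy S f \<longleftrightarrow> (\<forall>e>0. \<exists>N. \<forall>m\<ge>N. \<forall>n\<ge>N. l2_norm S (\<lambda>x. f m x - f n x) < e)"

lemma L2_integrable:
  assumes "S \<in> lmeasurable" "L2 S f"
  shows "integrable (lebesgue_on S) f"
proof -
  interpret finite_measure "lebesgue_on S" by (rule finite_measure_lebesgue_on[OF assms(1)])
  have "L2 S (\<lambda>x. 1)" by (simp add: L2_def)
  from L2_mult_integrable[OF assms(2) this] show ?thesis by simp
qed

text \<open>A Cauchy sequence in \<open>L\<^sup>2\<close> of a set of finite measure is Cauchy in \<open>L\<^sup>1\<close>, so a subsequence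
  converges almost everywhere; Fatou's lemma identifies its pointwise limit with the limit in
  norm.\<close>

lemma L2_complete:
  assumes S: "S \<in> lmeasurable" and f: "\<And>k. L2 S (f k)" and cau: "l2_Cauchy S f"
  shows "\<exists>g. L2 S g \<and> (\<lambda>k. l2_norm S (\<lambda>x. f k x - g x)) \<longlonglongrightarrow> 0"
proof -
  interpret finite_measure "lebesgue_on S" by (rule finite_measure_lebesgue_on[OF S])
  note [measurable] = f[unfolded L2_def, THEN conjunct1]
  define K where "K = l2_norm S (\<lambda>x. 1)"
  have one: "L2 S (\<lambda>x. 1)" by (simp add: L2_def)
  have L1: "(LINT x|lebesgue_on S. norm (f i x - f j x)) \<le> l2_norm S (\<lambda>x. f i x - f j x) * K" for i j
  proof -
    have a: "L2 S (\<lambda>x. \<bar>f i x - f j x\<bar>)"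
      using L2_diff[OF f f, of i j] by (auto simp: L2_def)
    have b: "l2_norm S (\<lambda>x. \<bar>f i x - f j x\<bar>) = l2_norm S (\<lambda>x. f i x - f j x)"
      by (simp add: l2_norm_def l2_inner_def)
    show ?thesis
      using l2_cauchy_schwarz[OF a one] unfolding b K_def by (simp add: l2_inner_def)
  qed
  obtain r where r: "strict_mono r" and ae: "AE x in lebesgue_on S. Cauchy (\<lambda>i. f (r i) x)"
  proof (rule cauchy_L1_AE_cauchy_subseq[of "lebesgue_on S" f])
    show "integrable (lebesgue_on S) (f n)" for n using L2_integrable[OF S f] .
    fix e :: real assume "e > 0"
    have K: "K \<ge> 0" by (simp add: K_def l2_norm_nonneg)
    then have "e / (K + 1) > 0" using \<open>e > 0\<close> by simp
    then obtain N where N: "\<And>m n. m \<ge> N \<Longrightarrow> n \<ge> N \<Longrightarrow> l2_norm S (\<lambda>x. f m x - f n x) < e / (K + 1)"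
      using cau unfolding l2_Cauchy_def by blast
    show "\<exists>N. \<forall>i\<ge>N. \<forall>j\<ge>N. (LINT x|lebesgue_on S. norm (f i x - f j x)) < e"
    proof (intro exI allI impI)
      fix i j assume "i \<ge> N" "j \<ge> N"
      then have "l2_norm S (\<lambda>x. f i x - f j x) < e / (K + 1)" by (rule N)
      then have "l2_norm S (\<lambda>x. f i x - f j x) * K \<le> e / (K + 1) * K"
        using K by (intro mult_right_mono) auto
      also have "\<dots> < e" using K \<open>e > 0\<close> by (simp add: field_simps)
      finally show "(LINT x|lebesgue_on S. norm (f i x - f j x)) < e" using L1[of i j] by simp
    qed
  qed blast
  define g where "g x = lim (\<lambda>i. f (r i) x)" for x
  have [measurable]: "g \<in> borel_measurable (lebesgue_on S)" unfolding g_def by measurable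
  have lim: "AE x in lebesgue_on S. (\<lambda>i. f (r i) x) \<longlonglongrightarrow> g x"
    using ae unfolding g_def by eventually_elim (metis Cauchy_convergent convergent_LIMSEQ_iff)
  have est: "L2 S (\<lambda>x. f n x - g x) \<and> l2_norm S (\<lambda>x. f n x - g x) \<le> e"
    if "e > 0" and N: "\<And>m n. m \<ge> N \<Longrightarrow> n \<ge> N \<Longrightarrow> l2_norm S (\<lambda>x. f m x - f n x) < e" and "n \<ge> N"
    for n N e
  proof -
    have "(\<integral>\<^sup>+ x. ennreal ((f n x - g x)\<^sup>2) \<partial>lebesgue_on S)
        = (\<integral>\<^sup>+ x. liminf (\<lambda>i. ennreal ((f n x - f (r i) x)\<^sup>2)) \<partial>lebesgue_on S)"
    proof (rule nn_integral_cong_AE)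
      show "AE x in lebesgue_on S. ennreal ((f n x - g x)\<^sup>2)
          = liminf (\<lambda>i. ennreal ((f n x - f (r i) x)\<^sup>2))"
        using lim
      proof eventually_elim
        case (elim x)
        have "(\<lambda>i. ennreal ((f n x - f (r i) x)\<^sup>2)) \<longlonglongrightarrow> ennreal ((f n x - g x)\<^sup>2)"
          by (intro tendsto_intros elim)
        from lim_imp_Liminf[OF _ this] show ?case by simp
      qed
    qed
    also have "\<dots> \<le> liminf (\<lambda>i. \<integral>\<^sup>+ x. ennreal ((f n x - f (r i) x)\<^sup>2) \<partial>lebesgue_on S)"
      by (rule nn_integral_liminf) measurable
    also have "\<dots> \<le> ennreal (e\<^sup>2)"
    proof (rule Liminf_le)
      show "\<forall>\<^sub>F i in sequentially. (\<integral>\<^sup>+ x. ennreal ((f n x - f (r i) x)\<^sup>2) \<partial>lebesgue_on S) \<le> ennreal (e\<^sup>2)"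
        using eventually_ge_at_top[of N]
      proof eventually_elim
        case (elim i)
        then have "r i \<ge> N" using strict_mono_imp_increasing[OF r, of i] by linarith
        then have "l2_norm S (\<lambda>x. f n x - f (r i) x) \<le> e" using N[OF \<open>n \<ge> N\<close>] by (simp add: less_imp_le)
        then have "(l2_norm S (\<lambda>x. f n x - f (r i) x))\<^sup>2 \<le> e\<^sup>2"
          by (simp add: l2_norm_nonneg power_mono)
        moreover have "(\<integral>\<^sup>+ x. ennreal ((f n x - f (r i) x)\<^sup>2) \<partial>lebesgue_on S)
            = ennreal ((l2_norm S (\<lambda>x. f n x - f (r i) x))\<^sup>2)"
          unfolding l2_norm_power2_integral using L2_diff[OF f f, of n "r i"]
          by (intro nn_integral_eq_integral) (auto simp: L2_def)
        ultimately show ?case by (simp add: ennreal_leI)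
      qed
    qed simp
    finally have le: "(\<integral>\<^sup>+ x. ennreal ((f n x - g x)\<^sup>2) \<partial>lebesgue_on S) \<le> ennreal (e\<^sup>2)" .
    have int: "integrable (lebesgue_on S) (\<lambda>x. (f n x - g x)\<^sup>2)"
      by (rule integrableI_bounded) (use le_less_trans[OF le ennreal_less_top] in \<open>simp_all\<close>)
    have "ennreal ((l2_norm S (\<lambda>x. f n x - g x))\<^sup>2) \<le> ennreal (e\<^sup>2)"
      using le unfolding l2_norm_power2_integral by (subst (asm) nn_integral_eq_integral[OF int]) auto
    then have "l2_norm S (\<lambda>x. f n x - g x) \<le> e"
      using \<open>e > 0\<close> by (auto simp: ennreal_le_iff intro: power2_le_imp_le)
    with int show ?thesis by (auto simp: L2_def)
  qed
  obtain N1 where "\<And>m n. m \<ge> N1 \<Longrightarrow> n \<ge> N1 \<Longrightarrow> l2_norm S (\<lambda>x. f m x - f n x) < 1"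
    using cau unfolding l2_Cauchy_def by (meson zero_less_one)
  from est[of 1, OF _ this order_refl] have "L2 S (\<lambda>x. f N1 x - g x)" by simp
  from L2_diff[OF f[of N1] this] have g: "L2 S g" by simp
  moreover have "(\<lambda>k. l2_norm S (\<lambda>x. f k x - g x)) \<longlonglongrightarrow> 0"
  proof (rule LIMSEQ_I)
    fix e :: real assume "e > 0"
    then have "e / 2 > 0" by simp
    then obtain N where N: "\<And>m n. m \<ge> N \<Longrightarrow> n \<ge> N \<Longrightarrow> l2_norm S (\<lambda>x. f m x - f n x) < e / 2"
      using cau unfolding l2_Cauchy_def by meson
    have le: "l2_norm S (\<lambda>x. f n x - g x) \<le> e / 2" if "n \<ge> N" for n
      using est[OF \<open>e / 2 > 0\<close> N that] by simp
    show "\<exists>no. \<forall>n\<ge>no. norm (l2_norm S (\<lambda>x. f n x - g x) - 0) < e"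
    proof (intro exI allI impI)
      fix n assume "n \<ge> N"
      then have "l2_norm S (\<lambda>x. f n x - g x) \<le> e / 2"
        by (rule le)
      then show "norm (l2_norm S (\<lambda>x. f n x - g x) - 0) < e"
        using \<open>e > 0\<close> by (simp add: l2_norm_nonneg)
    qed
  qed
  ultimately show ?thesis by blast
qed

lemma tendsto_imp_l2_Cauchy:
  assumes "\<And>k. L2 S (f k)" "L2 S g" and lim: "(\<lambda>k. l2_norm S (\<lambda>x. f k x - g x)) \<longlonglongrightarrow> 0"
  shows "l2_Cauchy S f"
  unfolding l2_Cauchy_def
proof (intro allI impI)
  fix e :: real assume "e > 0"
  then obtain N where N: "\<And>n. n \<ge> N \<Longrightarrow> l2_norm S (\<lambda>x. f n x - g x) < e / 2"
    using LIMSEQ_D[OF lim, of "e / 2"] by (auto simp: l2_norm_nonneg)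
  have "l2_norm S (\<lambda>x. f m x - f n x) < e" if "m \<ge> N" "n \<ge> N" for m n
    using l2_norm_triangle_diff[OF assms(1)[of m] assms(2) assms(1)[of n]] N[OF that(1)] N[OF that(2)]
      l2_norm_minus_commute[of S g "f n"] by simp
  then show "\<exists>N. \<forall>m\<ge>N. \<forall>n\<ge>N. l2_norm S (\<lambda>x. f m x - f n x) < e" by blast
qed

text \<open>The parallelogram law makes a norm-minimizing sequence in a midpoint-convex set Cauchy.
  Midpoints are taken up to null sets because weak derivatives are chosen representatives.\<close>

lemma minimizing_sequence:
  fixes K :: "('a::euclidean_space \<Rightarrow> real) set"
  assumes K: "\<And>f. f \<in> K \<Longrightarrow> L2 S f" and ne: "K \<noteq> {}"
    and mid: "\<And>f g. f \<in> K \<Longrightarrow> g \<in> K \<Longrightarrow>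
      \<exists>h\<in>K. AE x in lebesgue_on S. h x = 1/2 * (f x + g x)"
  shows "\<exists>f. (\<forall>k. f k \<in> K) \<and> l2_Cauchy S f \<and>
    (\<forall>h\<in>K. \<forall>e>0. \<exists>N. \<forall>k\<ge>N. l2_norm S (f k) \<le> l2_norm S h + e)"
proof -
  define I where "I = Inf ((\<lambda>f. (l2_norm S f)\<^sup>2) ` K)"
  have bdd: "bdd_below ((\<lambda>f. (l2_norm S f)\<^sup>2) ` K)" by (rule bdd_belowI[of _ 0]) auto
  have I_le: "I \<le> (l2_norm S f)\<^sup>2" if "f \<in> K" for f
    unfolding I_def using that bdd by (auto intro: cInf_lower)
  have I0: "0 \<le> I" unfolding I_def using ne by (intro cInf_greatest) auto
  have "\<exists>f\<in>K. (l2_norm S f)\<^sup>2 < I + 1 / Suc k" for k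
    using cInf_lessD[of "(\<lambda>f. (l2_norm S f)\<^sup>2) ` K" "I + 1 / Suc k"] ne by (auto simp: I_def)
  then obtain f where fK: "\<And>k. f k \<in> K" and fI: "\<And>k. (l2_norm S (f k))\<^sup>2 < I + 1 / Suc k"
    by metis
  have par: "(l2_norm S (\<lambda>x. f m x - f n x))\<^sup>2 \<le> 2 / Suc m + 2 / Suc n" for m n
  proof -
    obtain h where h: "h \<in> K" "AE x in lebesgue_on S. h x = 1/2 * (f m x + f n x)"
      using mid[OF fK fK] by blast
    have L: "L2 S (f m)" "L2 S (f n)" using K fK by auto
    have "(l2_norm S h)\<^sup>2 = (l2_norm S (\<lambda>x. 1/2 * (f m x + f n x)))\<^sup>2"
      using l2_norm_cong_AE[OF K[OF h(1)] L2_scale[OF L2_add[OF L]] h(2)] by simp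
    also have "\<dots> = 1/4 * (l2_norm S (\<lambda>x. f m x + f n x))\<^sup>2"
      unfolding l2_norm_scale by (simp add: power_mult_distrib power2_eq_square)
    finally have "(l2_norm S (\<lambda>x. f m x + f n x))\<^sup>2 \<ge> 4 * I" using I_le[OF h(1)] by simp
    then show ?thesis
      using l2_norm_add_power2[OF L, of 1] l2_norm_add_power2[OF L, of "-1"] fI[of m] fI[of n] by simp
  qed
  have "l2_Cauchy S f"
    unfolding l2_Cauchy_def
  proof (intro allI impI)
    fix e :: real assume "e > 0"
    then obtain N where N: "4 / e\<^sup>2 < real (Suc N)"
      using reals_Archimedean2[of "4 / e\<^sup>2"] by (metis less_trans lessI of_nat_less_iff)
    have "l2_norm S (\<lambda>x. f m x - f n x) < e" if "m \<ge> N" "n \<ge> N" for m n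
    proof (rule power2_less_imp_less)
      have a: "2 / real (Suc m) \<le> 2 / Suc N" "2 / real (Suc n) \<le> 2 / Suc N"
        using that by (auto intro!: divide_left_mono)
      have "(l2_norm S (\<lambda>x. f m x - f n x))\<^sup>2 \<le> 4 / Suc N" using par[of m n] a by simp
      also have "\<dots> < e\<^sup>2" using N \<open>e > 0\<close> by (simp add: field_simps)
      finally show "(l2_norm S (\<lambda>x. f m x - f n x))\<^sup>2 < e\<^sup>2" .
    qed (use \<open>e > 0\<close> in auto)
    then show "\<exists>N. \<forall>m\<ge>N. \<forall>n\<ge>N. l2_norm S (\<lambda>x. f m x - f n x) < e" by blast
  qed
  moreover have "\<exists>N. \<forall>k\<ge>N. l2_norm S (f k) \<le> l2_norm S h + e" if "h \<in> K" "e > 0" for h e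
  proof -
    obtain N where N: "1 / e\<^sup>2 < real (Suc N)"
      using reals_Archimedean2[of "1 / e\<^sup>2"] by (metis less_trans lessI of_nat_less_iff)
    have "l2_norm S (f k) \<le> l2_norm S h + e" if "k \<ge> N" for k
    proof (rule power2_le_imp_le)
      have "1 / real (Suc k) \<le> 1 / Suc N" using that by (auto intro!: divide_left_mono)
      also have "\<dots> < e\<^sup>2" using N \<open>e > 0\<close> by (simp add: field_simps)
      finally have "(l2_norm S (f k))\<^sup>2 \<le> (l2_norm S h)\<^sup>2 + e\<^sup>2"
        using fI[of k] I_le[OF \<open>h \<in> K\<close>] by simp
      also have "\<dots> \<le> (l2_norm S h + e)\<^sup>2"
        using \<open>e > 0\<close> l2_norm_nonneg[of S h] by (simp add: power2_sum)
      finally show "(l2_norm S (f k))\<^sup>2 \<le> (l2_norm S h + e)\<^sup>2" .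
    qed (use \<open>e > 0\<close> l2_norm_nonneg[of S h] in auto)
    then show ?thesis by blast
  qed
  ultimately show ?thesis using fK by blast
qed

section \<open>Continuously differentiable functions\<close>

text \<open>Continuous differentiability with the derivative packed into one continuous map into the bounded
  linear maps.  For real functions this is \<open>C1\<close>, which asks for continuous partial derivatives; the
  packed form is the one that is stable under composition and available for vector fields.\<close>

definition cont_diff :: "('a::euclidean_space \<Rightarrow> 'b::euclidean_space) \<Rightarrow> bool" where
  "cont_diff f \<longleftrightarrow>
     (\<exists>f'. (\<forall>x. (f has_derivative blinfun_apply (f' x)) (at x)) \<and> continuous_on UNIV f')"

lemma cont_diffI:
  "(\<And>x. (f has_derivative blinfun_apply (f' x)) (at x)) \<Longrightarrow> continuous_on UNIV f' \<Longrightarrow> cont_diff f"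
  by (auto simp: cont_diff_def)

lemma cont_diff_has_derivative:
  "cont_diff f \<Longrightarrow> (f has_derivative frechet_derivative f (at x)) (at x)"
  unfolding cont_diff_def by (metis frechet_derivative_at)

lemma cont_diff_continuous: "cont_diff f \<Longrightarrow> continuous_on S f"
  by (meson cont_diff_has_derivative continuous_at_imp_continuous_on has_derivative_continuous)

text \<open>Point and direction may both vary, which is how derivatives along the velocity field occur.\<close>

lemma cont_diff_continuous_derivative:
  fixes f :: "'a::euclidean_space \<Rightarrow> 'b::euclidean_space" and g :: "'c::topological_space \<Rightarrow> 'a"
  assumes "cont_diff f" "continuous_on S g" "continuous_on S h"
  shows "continuous_on S (\<lambda>x. frechet_derivative f (at (g x)) (h x))"
proof -
  obtain f' where f': "\<And>x. (f has_derivative blinfun_apply (f' x)) (at x)" "continuous_on UNIV f'"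
    using assms(1) by (auto simp: cont_diff_def)
  have eq: "frechet_derivative f (at x) = blinfun_apply (f' x)" for x
    using frechet_derivative_at[OF f'(1)] by simp
  have "continuous_on S (\<lambda>x. f' (g x))"
    using continuous_on_compose2[OF f'(2) assms(2)] by simp
  then show ?thesis unfolding eq using assms(3) by (intro continuous_intros)
qed

lemma cont_diffI_componentwise:
  fixes f :: "'a::euclidean_space \<Rightarrow> 'b::euclidean_space"
  assumes "\<And>x. (f has_derivative D x) (at x)"
    and "\<And>b. b \<in> Basis \<Longrightarrow> continuous_on UNIV (\<lambda>x. D x b)"
  shows "cont_diff f"
proof (rule cont_diffI)
  have D: "blinfun_apply (Blinfun (D x)) = D x" for x
    using has_derivative_bounded_linear[OF assms(1)] by (rule bounded_linear_Blinfun_apply)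
  show "(f has_derivative blinfun_apply (Blinfun (D x))) (at x)" for x
    unfolding D by (rule assms)
  show "continuous_on UNIV (\<lambda>x. Blinfun (D x))"
    by (rule continuous_on_blinfun_componentwise) (simp add: D assms)
qed

lemma C1_iff_cont_diff: "C1 f \<longleftrightarrow> cont_diff f"
proof
  assume "C1 f"
  then show "cont_diff f"
    by (intro cont_diffI_componentwise[where D = "\<lambda>x. frechet_derivative f (at x)"])
      (auto simp: C1_def frechet_derivative_works)
next
  assume f: "cont_diff f"
  show "C1 f"
    unfolding C1_def
    using cont_diff_has_derivative[OF f] cont_diff_continuous_derivative[OF f]
    by (auto simp: differentiable_def intro!: continuous_intros)
qed

lemma cont_diff_const [simp]: "cont_diff (\<lambda>x. c)"
  by (rule cont_diffI[where f' = "\<lambda>x. 0"]) (auto intro!: derivative_eq_intros continuous_intros)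

lemma cont_diff_bounded_linear:
  assumes "bounded_linear f" shows "cont_diff f"
  using bounded_linear_imp_has_derivative[OF assms]
  by (intro cont_diffI_componentwise[where D = "\<lambda>x. f"]) auto

lemma cont_diff_compose:
  assumes f: "cont_diff f" and g: "cont_diff g"
  shows "cont_diff (\<lambda>x. f (g x))"
proof (rule cont_diffI_componentwise)
  show "((\<lambda>x. f (g x)) has_derivative
      (\<lambda>h. frechet_derivative f (at (g x)) (frechet_derivative g (at x) h))) (at x)" for x
    by (rule has_derivative_compose[OF cont_diff_has_derivative[OF g] cont_diff_has_derivative[OF f]])
  show "continuous_on UNIV (\<lambda>x. frechet_derivative f (at (g x)) (frechet_derivative g (at x) b))" for b
    by (intro cont_diff_continuous_derivative f g cont_diff_continuous continuous_intros)
qed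

lemma cont_diff_Pair:
  assumes f: "cont_diff f" and g: "cont_diff g"
  shows "cont_diff (\<lambda>x. (f x, g x))"
proof (rule cont_diffI_componentwise)
  show "((\<lambda>x. (f x, g x)) has_derivative
      (\<lambda>h. (frechet_derivative f (at x) h, frechet_derivative g (at x) h))) (at x)" for x
    by (intro has_derivative_Pair cont_diff_has_derivative f g)
  show "continuous_on UNIV (\<lambda>x. (frechet_derivative f (at x) b, frechet_derivative g (at x) b))" for b
    by (intro cont_diff_continuous_derivative f g continuous_intros)
qed

lemma cont_diff_add:
  assumes f: "cont_diff f" and g: "cont_diff g"
  shows "cont_diff (\<lambda>x. f x + g x)"
proof (rule cont_diffI_componentwise)
  show "((\<lambda>x. f x + g x) has_derivative
      (\<lambda>h. frechet_derivative f (at x) h + frechet_derivative g (at x) h)) (at x)" for x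
    by (intro has_derivative_add cont_diff_has_derivative f g)
  show "continuous_on UNIV (\<lambda>x. frechet_derivative f (at x) b + frechet_derivative g (at x) b)" for b
    by (intro cont_diff_continuous_derivative f g continuous_intros)
qed

lemma cont_diff_scaleR:
  fixes f :: "'a::euclidean_space \<Rightarrow> real" and g :: "'a \<Rightarrow> 'b::euclidean_space"
  assumes f: "cont_diff f" and g: "cont_diff g"
  shows "cont_diff (\<lambda>x. f x *\<^sub>R g x)"
proof (rule cont_diffI_componentwise)
  show "((\<lambda>x. f x *\<^sub>R g x) has_derivative
      (\<lambda>h. f x *\<^sub>R frechet_derivative g (at x) h + frechet_derivative f (at x) h *\<^sub>R g x)) (at x)" for x
    by (intro has_derivative_scaleR cont_diff_has_derivative f g)
  show "continuous_on UNIV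
      (\<lambda>x. f x *\<^sub>R frechet_derivative g (at x) b + frechet_derivative f (at x) b *\<^sub>R g x)" for b
    by (intro cont_diff_continuous_derivative cont_diff_continuous f g continuous_intros)
qed

lemma cont_diff_mult:
  fixes f g :: "'a::euclidean_space \<Rightarrow> real"
  shows "cont_diff f \<Longrightarrow> cont_diff g \<Longrightarrow> cont_diff (\<lambda>x. f x * g x)"
  using cont_diff_scaleR[of f g] by simp

lemma cont_diff_minus: "cont_diff f \<Longrightarrow> cont_diff (\<lambda>x. - f x)"
  using cont_diff_scaleR[of "\<lambda>x. -1" f] by simp

lemma cont_diff_diff: "cont_diff f \<Longrightarrow> cont_diff g \<Longrightarrow> cont_diff (\<lambda>x. f x - g x)"
  using cont_diff_add[of f "\<lambda>x. - g x"] cont_diff_minus[of g] by simp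

lemma cont_diff_prod:
  fixes f :: "'i \<Rightarrow> 'a::euclidean_space \<Rightarrow> real"
  assumes "\<And>i. i \<in> I \<Longrightarrow> cont_diff (f i)"
  shows "cont_diff (\<lambda>x. \<Prod>i\<in>I. f i x)"
  using assms by (induction I rule: infinite_finite_induct) (auto intro: cont_diff_mult)

lemma cont_diff_real:
  fixes f :: "real \<Rightarrow> real"
  assumes "\<And>x. (f has_real_derivative f' x) (at x)" "continuous_on UNIV f'"
  shows "cont_diff f"
  by (rule cont_diffI_componentwise[where D = "\<lambda>x h. f' x * h"])
    (use assms in \<open>auto simp: has_field_derivative_def\<close>)

lemmas cont_diff_intros = cont_diff_const cont_diff_Pair cont_diff_add
  cont_diff_mult cont_diff_minus cont_diff_diff cont_diff_scaleR

lemma cont_diff_fst: "cont_diff fst" and cont_diff_snd: "cont_diff snd"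
  and cont_diff_ident: "cont_diff (\<lambda>x. x)"
  by (intro cont_diff_bounded_linear bounded_linear_fst bounded_linear_snd bounded_linear_ident)+

lemma cont_diff_inner: "cont_diff (\<lambda>x. x \<bullet> b)"
  by (intro cont_diff_bounded_linear bounded_linear_inner_left)

lemma frechet_derivative_linear:
  assumes "cont_diff f"
  shows "linear (frechet_derivative f (at x))"
  using has_derivative_linear[OF cont_diff_has_derivative[OF assms]] .

lemma frechet_derivative_mult:
  fixes f g :: "'a::euclidean_space \<Rightarrow> real"
  assumes "cont_diff f" "cont_diff g"
  shows "frechet_derivative (\<lambda>x. f x * g x) (at x) h
    = f x * frechet_derivative g (at x) h + frechet_derivative f (at x) h * g x"
  using frechet_derivative_at[OF has_derivative_mult[OF cont_diff_has_derivative[OF assms(1)]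
        cont_diff_has_derivative[OF assms(2)], of x]] by (metis (no_types, lifting))

lemma frechet_derivative_diff:
  fixes f g :: "'a::euclidean_space \<Rightarrow> real"
  assumes "cont_diff f" "cont_diff g"
  shows "frechet_derivative (\<lambda>x. f x - g x) (at x) h
    = frechet_derivative f (at x) h - frechet_derivative g (at x) h"
  using frechet_derivative_at[OF has_derivative_diff[OF cont_diff_has_derivative[OF assms(1)]
        cont_diff_has_derivative[OF assms(2)], of x]] by metis

lemma frechet_derivative_add:
  fixes f g :: "'a::euclidean_space \<Rightarrow> real"
  assumes "cont_diff f" "cont_diff g"
  shows "frechet_derivative (\<lambda>x. f x + g x) (at x) h
    = frechet_derivative f (at x) h + frechet_derivative g (at x) h"
  using frechet_derivative_at[OF has_derivative_add[OF cont_diff_has_derivative[OF assms(1)]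
        cont_diff_has_derivative[OF assms(2)], of x]] by metis

lemma frechet_derivative_comp:
  assumes "cont_diff f" "cont_diff g"
  shows "frechet_derivative (\<lambda>x. f (g x)) (at x) h
    = frechet_derivative f (at (g x)) (frechet_derivative g (at x) h)"
  using frechet_derivative_at[OF has_derivative_compose[OF cont_diff_has_derivative[OF assms(2)]
        cont_diff_has_derivative[OF assms(1)], of x]] by metis

lemma frechet_derivative_fst:
  assumes "cont_diff F"
  shows "frechet_derivative (\<lambda>x. F (x, t)) (at x) h = frechet_derivative F (at (x, t)) (h, 0)"
proof -
  have "((\<lambda>x. (x, t)) has_derivative (\<lambda>h. (h, 0))) (at x)"
    by (auto intro!: derivative_eq_intros)
  from frechet_derivative_at[OF has_derivative_compose[OF this cont_diff_has_derivative[OF assms]]]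
  show ?thesis by metis
qed

lemma cont_diff_slice: "cont_diff F \<Longrightarrow> cont_diff (\<lambda>x. F (x, t))"
  by (rule cont_diff_compose[of F]) (auto intro!: cont_diff_intros cont_diff_ident)

lemma directional_derivative:
  fixes f :: "'a::euclidean_space \<Rightarrow> real"
  assumes "cont_diff f"
  shows "((\<lambda>t. f (x + t *\<^sub>R h)) has_real_derivative frechet_derivative f (at (x + t *\<^sub>R h)) h) (at t)"
proof -
  have "((\<lambda>t. x + t *\<^sub>R h) has_derivative (\<lambda>s. s *\<^sub>R h)) (at t)"
    by (auto intro!: derivative_eq_intros)
  from has_derivative_compose[OF this cont_diff_has_derivative[OF assms]]
  have "((\<lambda>t. f (x + t *\<^sub>R h)) has_derivative
      (\<lambda>s. frechet_derivative f (at (x + t *\<^sub>R h)) (s *\<^sub>R h))) (at t)" .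
  moreover have "(\<lambda>s. frechet_derivative f (at (x + t *\<^sub>R h)) (s *\<^sub>R h))
      = (*) (frechet_derivative f (at (x + t *\<^sub>R h)) h)"
    by (auto simp: linear_scale[OF frechet_derivative_linear[OF assms]])
  ultimately show ?thesis by (simp add: has_field_derivative_def)
qed

text \<open>A gradient is computed along a single line, provided differentiability is known beforehand.\<close>

lemma directional_derivative_0:
  fixes f :: "'a::euclidean_space \<Rightarrow> real"
  assumes "cont_diff f" "((\<lambda>t. f (x + t *\<^sub>R h)) has_real_derivative d) (at 0)"
  shows "frechet_derivative f (at x) h = d"
  using DERIV_unique[OF directional_derivative[OF assms(1), of x h 0] assms(2)] by simp

lemma frechet_derivative_bound_lipschitz:
  fixes f :: "'a::euclidean_space \<Rightarrow> 'b::euclidean_space"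
  assumes f: "cont_diff f" and L: "L-lipschitz_on UNIV f"
  shows "norm (frechet_derivative f (at x) h) \<le> L * norm h"
proof -
  define w where "w = frechet_derivative f (at x) h"
  define g where "g t = f (x + t *\<^sub>R h) \<bullet> w" for t
  have "cont_diff (\<lambda>y. f y \<bullet> w)" by (rule cont_diff_compose[OF cont_diff_inner f])
  moreover have "frechet_derivative (\<lambda>y. f y \<bullet> w) (at x) h = w \<bullet> w"
    using frechet_derivative_at[OF has_derivative_inner_left[OF cont_diff_has_derivative[OF f, of x], of w]]
    unfolding w_def by metis
  ultimately have "(g has_real_derivative w \<bullet> w) (at 0)"
    using directional_derivative[of "\<lambda>y. f y \<bullet> w" x h 0] by (simp add: g_def[abs_def])
  then have "((\<lambda>t. \<bar>(g (0 + t) - g 0) / t\<bar>) \<longlongrightarrow> \<bar>w \<bullet> w\<bar>) (at 0)"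
    unfolding DERIV_def by (rule tendsto_rabs)
  moreover have "\<bar>(g (0 + t) - g 0) / t\<bar> \<le> L * norm h * norm w" if "t \<noteq> 0" for t
  proof -
    have "\<bar>g (0 + t) - g 0\<bar> = \<bar>(f (x + t *\<^sub>R h) - f x) \<bullet> w\<bar>"
      by (simp add: g_def inner_diff_left)
    also have "\<dots> \<le> norm (f (x + t *\<^sub>R h) - f x) * norm w" by (rule Cauchy_Schwarz_ineq2)
    also have "\<dots> \<le> (L * (\<bar>t\<bar> * norm h)) * norm w"
      using lipschitz_onD[OF L, of "x + t *\<^sub>R h" x] by (intro mult_right_mono) (auto simp: dist_norm)
    finally show ?thesis using that by (simp add: field_simps)
  qed
  ultimately have "\<bar>w \<bullet> w\<bar> \<le> L * norm h * norm w"
    by (intro tendsto_upperbound) (auto simp: eventually_at intro!: exI[of _ 1])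
  then have "norm w * norm w \<le> (L * norm h) * norm w"
    by (simp add: norm_eq_sqrt_inner)
  then have "norm w \<le> L * norm h \<or> norm w = 0"
    by (auto simp: mult_le_cancel_right)
  moreover have "0 \<le> L * norm h" using lipschitz_on_nonneg[OF L] by simp
  ultimately show ?thesis unfolding w_def by auto
qed

section \<open>A smooth step\<close>

definition pos_sq :: "real \<Rightarrow> real" where "pos_sq y = (max 0 y)\<^sup>2"

lemma pos_sq_deriv: "(pos_sq has_real_derivative 2 * max 0 y) (at y)"
proof -
  consider "y < 0" | "y = 0" | "y > 0" by linarith
  then show ?thesis
  proof cases
    case 1
    have "((\<lambda>y. 0) has_real_derivative 2 * max 0 y) (at y)" using 1 by simp
    then show ?thesis
      by (rule has_field_derivative_transform_within_open[of _ _ _ "{..<0}"])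
        (use 1 in \<open>auto simp: pos_sq_def\<close>)
  next
    case 3
    have "((\<lambda>y. y\<^sup>2) has_real_derivative 2 * max 0 y) (at y)"
      using 3 by (auto intro!: derivative_eq_intros)
    then show ?thesis
      by (rule has_field_derivative_transform_within_open[of _ _ _ "{0<..}"])
        (use 3 in \<open>auto simp: pos_sq_def\<close>)
  next
    case 2
    have "((\<lambda>h. (pos_sq (0 + h) - pos_sq 0) / h) \<longlongrightarrow> 0) (at 0)"
    proof (rule Lim_null_comparison)
      show "\<forall>\<^sub>F h in at 0. norm ((pos_sq (0 + h) - pos_sq 0) / h) \<le> \<bar>h\<bar>"
        by (auto simp: pos_sq_def power2_eq_square max_def)
      show "((\<lambda>h::real. \<bar>h\<bar>) \<longlongrightarrow> 0) (at 0)" by (rule tendsto_eq_intros | simp)+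
    qed
    with 2 show ?thesis by (simp add: DERIV_def)
  qed
qed

text \<open>The second antiderivative of \<open>4\<close> on \<open>(0, 1/2)\<close> and \<open>-4\<close> on \<open>(1/2, 1)\<close>: a monotone
  \<open>C\<^sup>1\<close> function rising from \<open>0\<close> to \<open>1\<close> on the unit interval.  Every cutoff below is
  assembled from it.\<close>

definition step :: "real \<Rightarrow> real" where
  "step y = 2 * pos_sq y - 4 * pos_sq (y - 1/2) + 2 * pos_sq (y - 1)"

definition step' :: "real \<Rightarrow> real" where
  "step' y = 4 * max 0 y - 8 * max 0 (y - 1/2) + 4 * max 0 (y - 1)"

lemma step_deriv: "(step has_real_derivative step' y) (at y)"
proof -
  have shift: "((\<lambda>y. pos_sq (y - c)) has_real_derivative 2 * max 0 (y - c)) (at y)" for c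
    using DERIV_chain2[where f = pos_sq and g = "\<lambda>y. y - c", OF pos_sq_deriv, of 1 y UNIV]
    by (simp add: DERIV_diff[where E = 0, simplified])
  show ?thesis
    unfolding step_def[abs_def] step'_def
    by (rule derivative_eq_intros pos_sq_deriv shift | simp)+
qed

lemma step'_continuous: "continuous_on S step'"
  unfolding step'_def by (intro continuous_intros)

lemma cont_diff_step: "cont_diff step"
  by (rule cont_diff_real[OF step_deriv step'_continuous])

lemma step_le0: "y \<le> 0 \<Longrightarrow> step y = 0"
  by (simp add: step_def pos_sq_def max_def)

lemma step_ge1: "y \<ge> 1 \<Longrightarrow> step y = 1"
  by (simp add: step_def pos_sq_def max_def power2_eq_square algebra_simps)

lemma step'_outside: "y \<le> 0 \<or> y \<ge> 1 \<Longrightarrow> step' y = 0"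
  and step'_nonneg: "0 \<le> step' y" and step'_le2: "step' y \<le> 2"
  and step'_ge1: "1/4 \<le> y \<Longrightarrow> y \<le> 3/4 \<Longrightarrow> 1 \<le> step' y"
  by (auto simp: step'_def max_def)

lemma step_mono: "x \<le> y \<Longrightarrow> step x \<le> step y"
  by (rule DERIV_nonneg_imp_nondecreasing) (use step_deriv step'_nonneg in blast)+

lemma step_bounds: "0 \<le> step y" "step y \<le> 1"
  using step_mono[of "min y 0" y] step_mono[of y "max y 1"] step_le0[of "min y 0"] step_ge1[of "max y 1"]
  by auto

lemma cont_diff_affine_step: "cont_diff (\<lambda>y. step (a * y + b))"
  by (rule cont_diff_compose[OF cont_diff_step])
    (auto intro!: cont_diff_intros cont_diff_ident)

section \<open>Periodic extension\<close>

text \<open>A function of one variable supported inside \<open>(0, 1)\<close> becomes 1-periodic when its argument is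
  replaced by the fractional part, and stays unchanged on \<open>[0, 1]\<close>.  With the flag, test functions
  on the torus and on the cube are written by the same formula.\<close>

definition wrap :: "bool \<Rightarrow> real \<Rightarrow> real" where
  "wrap per y = (if per then frac y else y)"

text \<open>Near a point with integer part \<open>k\<close> the periodic extension is a translate of the function; the
  interval reaches below \<open>k\<close>, because to its left the extension already vanishes.  This makes the
  extension smooth across the integers.\<close>

lemma wrap_local:
  fixes f :: "real \<Rightarrow> real"
  assumes f: "\<And>y. y \<notin> {a..b} \<Longrightarrow> f y = 0" and ab: "0 < a" "b < 1"
    and z: "of_int k - 1 + b < z" "z < of_int k + 1"
  shows "f (frac z) = f (z - of_int k)"
proof (cases "z \<ge> of_int k")
  case True
  then have "\<lfloor>z\<rfloor> = k" using z by (simp add: floor_unique)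
  then show ?thesis by (simp add: frac_def)
next
  case False
  show ?thesis
  proof (cases "b \<ge> 0")
    case True
    then have "\<lfloor>z\<rfloor> = k - 1" using z False by (intro floor_unique) auto
    then have "frac z = z - of_int k + 1" by (simp add: frac_def)
    then have "f (frac z) = 0" using z by (intro f) auto
    moreover have "f (z - of_int k) = 0" using False ab by (intro f) auto
    ultimately show ?thesis by simp
  next
    case b: False
    then have "{a..b} = {}" using ab by auto
    then show ?thesis using f by simp
  qed
qed

lemma wrap_continuous:
  fixes f :: "real \<Rightarrow> real"
  assumes f: "\<And>y. y \<notin> {a..b} \<Longrightarrow> f y = 0" and ab: "0 < a" "b < 1" and cont: "continuous_on UNIV f"
  shows "continuous_on UNIV (\<lambda>y. f (wrap per y))"
proof (cases per)
  case False then show ?thesis using cont by (simp add: wrap_def)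
next
  case True
  have "isCont (\<lambda>y. f (frac y)) y" for y
  proof -
    define k where "k = \<lfloor>y\<rfloor>"
    define U where "U = {of_int k - 1 + b <..< (of_int k + 1 :: real)}"
    have y: "y \<in> U" unfolding U_def k_def using ab by (auto; linarith)
    have "isCont (\<lambda>z. f (z - of_int k)) y"
      using continuous_on_compose2[OF cont, of UNIV "\<lambda>z. z - of_int k"]
      by (simp add: continuous_on_eq_continuous_at continuous_intros)
    moreover have "\<forall>\<^sub>F z in nhds y. f (frac z) = f (z - of_int k)"
      using eventually_nhds_in_open[of U y] y wrap_local[of a b f, OF f ab]
      by (auto simp: U_def elim!: eventually_mono)
    ultimately show ?thesis by (subst isCont_cong)
  qed
  then show ?thesis using True by (simp add: wrap_def continuous_at_imp_continuous_on)
qed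

lemma wrap_deriv:
  fixes f :: "real \<Rightarrow> real"
  assumes f: "\<And>y. y \<notin> {a..b} \<Longrightarrow> f y = 0" and f': "\<And>y. y \<notin> {a..b} \<Longrightarrow> f' y = 0"
    and ab: "0 < a" "b < 1" and d: "\<And>y. (f has_real_derivative f' y) (at y)"
  shows "((\<lambda>y. f (wrap per y)) has_real_derivative f' (wrap per y)) (at y)"
proof (cases per)
  case False then show ?thesis using d by (simp add: wrap_def)
next
  case True
  define k where "k = \<lfloor>y\<rfloor>"
  define U where "U = {of_int k - 1 + b <..< (of_int k + 1 :: real)}"
  have y: "y \<in> U" unfolding U_def k_def using ab by (auto; linarith)
  have "((\<lambda>z. f (z - of_int k)) has_real_derivative f' (y - of_int k)) (at y)"
    using DERIV_chain2[where f = f and g = "\<lambda>z. z - of_int k", OF d, of 1 y UNIV]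
    by (simp add: DERIV_diff[where E = 0, simplified])
  then have "((\<lambda>z. f (frac z)) has_real_derivative f' (y - of_int k)) (at y)"
    by (rule has_field_derivative_transform_within_open[of _ _ _ U])
      (use y wrap_local[of a b f, OF f ab] in \<open>auto simp: U_def\<close>)
  moreover have "f' (y - of_int k) = f' (frac y)"
    using wrap_local[of a b f', OF f' ab, of k y] y by (simp add: U_def)
  ultimately show ?thesis using True by (simp add: wrap_def)
qed

lemma wrap_unit:
  assumes "\<And>y. y \<notin> {a..b} \<Longrightarrow> f y = (0::real)" and "0 < a" "b < 1" and "y \<in> {0..1}"
  shows "f (wrap per y) = f y"
proof (cases "y = 1")
  case True then show ?thesis using assms by (simp add: wrap_def)
next
  case False
  then have "frac y = y" using assms(4) by (simp add: frac_eq)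
  then show ?thesis by (simp add: wrap_def)
qed

lemma wrap_periodic: "wrap True (y + 1) = wrap True y"
  by (simp add: wrap_def frac_1_eq)

section \<open>Test functions and the fundamental lemma\<close>

lemma space_dom_lmeasurable [simp]: "space_dom \<in> lmeasurable" "space_dom \<in> sets lebesgue"
  by (auto simp: space_dom_def)

lemma spacetime_dom_cbox: "spacetime_dom = cbox (0, 0) (1, 1)"
  by (simp add: spacetime_dom_def space_dom_def cbox_Pair_eq)

lemma spacetime_dom_lmeasurable [simp]: "spacetime_dom \<in> lmeasurable" "spacetime_dom \<in> sets lebesgue"
  by (auto simp: spacetime_dom_cbox)

lemma continuous_integrable_cbox:
  fixes f :: "'a::euclidean_space \<Rightarrow> real"
  assumes "continuous_on (cbox a b) f"
  shows "integrable (lebesgue_on (cbox a b)) f"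
  using absolutely_integrable_continuous[OF assms]
  by (simp add: absolutely_integrable_imp_integrable)

lemma continuous_L2_cbox:
  fixes f :: "'a::euclidean_space \<Rightarrow> real"
  assumes "continuous_on (cbox a b) f"
  shows "L2 (cbox a b) f"
  unfolding L2_def
  using continuous_integrable_cbox[OF assms] continuous_integrable_cbox[of a b "\<lambda>x. (f x)\<^sup>2"] assms
  by (auto intro!: continuous_intros)

lemma continuous_L2_space: "continuous_on UNIV f \<Longrightarrow> L2 space_dom f"
  unfolding space_dom_def by (rule continuous_L2_cbox) (rule continuous_on_subset, auto)

lemma continuous_L2_spacetime: "continuous_on UNIV f \<Longrightarrow> L2 spacetime_dom f"
  unfolding spacetime_dom_cbox by (rule continuous_L2_cbox) (rule continuous_on_subset, auto)

text \<open>Open boxes form an intersection-stable generator of the Borel sets, so the integral vanishes over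
  every Borel set, and the density is null.\<close>

lemma AE_zero_if_box_integrals_zero:
  fixes h :: "'a::euclidean_space \<Rightarrow> real"
  assumes h: "integrable (lebesgue_on (cbox A B)) h"
    and zero: "\<And>l r. box l r \<subseteq> box A B \<Longrightarrow>
      (LINT x|lebesgue_on (cbox A B). h x * indicator (box l r) x) = 0"
  shows "AE x in lebesgue_on (cbox A B). h x = 0"
proof -
  define H where "H x = indicator (box A B) x * h x" for x
  have H0: "integrable lebesgue (\<lambda>x. indicator (cbox A B) x *\<^sub>R h x)"
    using h by (subst (asm) integrable_restrict_space) auto
  have int_set: "integrable lebesgue (\<lambda>x. indicator X x * H x)" if "X \<in> sets borel" for X
  proof -
    have "integrable lebesgue (\<lambda>x. indicator (X \<inter> box A B) x *\<^sub>R (indicator (cbox A B) x *\<^sub>R h x))"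
      using that by (intro integrable_mult_indicator H0) auto
    then show ?thesis
      by (rule back_subst[of "integrable _"])
        (auto simp: H_def indicator_def fun_eq_iff box_subset_cbox[THEN subsetD])
  qed
  have H_meas: "H \<in> borel_measurable lebesgue" using int_set[of UNIV] by simp
  from completion_ex_borel_measurable_real[OF this]
  obtain H' where [measurable]: "H' \<in> borel_measurable lborel" and eq: "AE x in lborel. H x = H' x"
    by blast
  have eq': "AE x in lebesgue. H x = H' x" using eq by (rule AE_completion)
  have H'_meas: "H' \<in> borel_measurable lebesgue" by (rule measurable_completion) simp
  have "integrable lebesgue H'"
    using int_set[of UNIV] H'_meas eq' by (auto intro: integrable_cong_AE_imp)
  then have H'_int: "integrable lborel H'" by (simp add: integrable_completion)
  have base: "(LINT x|lborel. indicator (box l r) x * H' x) = 0" for l r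
  proof -
    obtain l' r' where lr: "box l r \<inter> box A B = box l' r'" using box_Int_box[of l r A B] by blast
    have "(LINT x|lborel. indicator (box l r) x * H' x) = (LINT x|lebesgue. indicator (box l r) x * H' x)"
      by (rule integral_completion[symmetric]) simp
    also have "\<dots> = (LINT x|lebesgue. indicator (cbox A B) x *\<^sub>R (h x * indicator (box l' r') x))"
    proof (rule integral_cong_AE)
      show "(\<lambda>x. indicator (box l r) x * H' x) \<in> borel_measurable lebesgue"
        by (rule measurable_completion) simp
      have "integrable lebesgue (\<lambda>x. indicator (box l' r') x *\<^sub>R (indicator (cbox A B) x *\<^sub>R h x))"
        by (intro integrable_mult_indicator H0) auto
      then show "(\<lambda>x. indicator (cbox A B) x *\<^sub>R (h x * indicator (box l' r') x)) \<in> borel_measurable lebesgue"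
        by (auto simp: mult_ac dest: borel_measurable_integrable)
      show "AE x in lebesgue. indicator (box l r) x * H' x =
          indicator (cbox A B) x *\<^sub>R (h x * indicator (box l' r') x)"
        using eq'
      proof eventually_elim
        case (elim x)
        have "indicator (box l' r') x = (indicator (box l r) x * indicator (box A B) x :: real)"
          unfolding lr[symmetric] by (rule indicator_inter_arith)
        then show ?case unfolding elim[symmetric] H_def
          using box_subset_cbox[of A B] by (auto simp: indicator_def)
      qed
    qed
    also have "\<dots> = (LINT x|lebesgue_on (cbox A B). h x * indicator (box l' r') x)"
      by (subst integral_restrict_space) auto
    also have "\<dots> = 0" by (rule zero) (use lr in auto)
    finally show ?thesis .
  qed
  have set_zero: "(LINT x|lborel. indicator X x * H' x) = 0" if "X \<in> sets borel" for X
  proof -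
    define S where "S = range (\<lambda>(a, b). box a b :: 'a set)"
    have Int: "Int_stable S"
      unfolding S_def Int_stable_def by (auto simp: box_Int_box)
    have sS: "sigma_sets UNIV S = sets borel" unfolding S_def borel_eq_box by simp
    have "box A B \<in> S" unfolding S_def by auto
    have total: "(LINT x|lborel. H' x) = 0"
    proof -
      have "(LINT x|lborel. H' x) = (LINT x|lborel. indicator (box A B) x * H' x)"
        by (rule integral_cong_AE) (use eq in \<open>auto simp: H_def indicator_def elim!: eventually_mono\<close>)
      then show ?thesis using base by simp
    qed
    have X: "X \<in> sigma_sets UNIV S" using that sS by simp
    have sub: "S \<subseteq> Pow UNIV" by simp
    from Int sub X show ?thesis
    proof (induction rule: sigma_sets_induct_disjoint)
      case (basic X)
      then show ?case using base by (auto simp: S_def)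
    next
      case empty show ?case by simp
    next
      case (compl X)
      then have X: "X \<in> sets lborel" using sS by simp
      have "integrable lborel (\<lambda>x. indicator X x * H' x)"
        using integrable_mult_indicator[OF X H'_int] by simp
      moreover have "indicator (UNIV - X) x * H' x = H' x - indicator X x * H' x" for x
        by (auto simp: indicator_def)
      ultimately show ?case using total compl.IH H'_int by simp
    next
      case (union X)
      then have X: "X i \<in> sets lborel" for i using sS by (auto simp: image_subset_iff)
      have int: "set_integrable lborel (\<Union> (range X)) H'"
        unfolding set_integrable_def using X by (intro integrable_mult_indicator H'_int) auto
      have "set_lebesgue_integral lborel (\<Union> (range X)) H' = (\<Sum>i. set_lebesgue_integral lborel (X i) H')"
        using X int union.hyps(1)
        by (intro lebesgue_integral_countable_add) (auto simp: disjoint_family_on_def)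
      then show ?case
        using union.IH by (simp add: set_lebesgue_integral_def)
    qed
  qed
  have "AE x in lborel. H' x = 0"
    by (rule sigma_finite_measure.density_zero[OF sigma_finite_lborel H'_int]) (simp add: set_lebesgue_integral_def set_zero)
  then have "AE x in lebesgue. H' x = 0" by (rule AE_completion)
  moreover have "AE x in lebesgue. x \<notin> cbox A B - box A B"
    by (intro AE_not_in) (metis negligible_frontier_interval negligible_iff_null_sets)
  ultimately have "AE x in lebesgue. x \<in> cbox A B \<longrightarrow> h x = 0"
    using eq' by eventually_elim (auto simp: H_def)
  then show ?thesis by (subst AE_restrict_space_iff) auto
qed

text \<open>Vanishes within distance \<open>1 / (n + 1)\<close> of the end points and outside, and increases to the
  indicator of the open interval.\<close>

definition bump1 :: "real \<Rightarrow> real \<Rightarrow> nat \<Rightarrow> real \<Rightarrow> real" where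
  "bump1 l r n y = step (real (Suc n) * (y - l) - 1) * step (real (Suc n) * (r - y) - 1)"

lemma bump1_outside: "y \<notin> {l + 1 / Suc n .. r - 1 / Suc n} \<Longrightarrow> bump1 l r n y = 0"
  unfolding bump1_def
  by (auto simp: not_le field_simps intro!: step_le0)

lemma bump1_bounds: "0 \<le> bump1 l r n y" "bump1 l r n y \<le> 1"
  unfolding bump1_def using step_bounds by (auto intro: mult_le_one)

lemma cont_diff_bump1: "cont_diff (bump1 l r n)"
proof -
  have "cont_diff (\<lambda>y. step (real (Suc n) * y + (- real (Suc n) * l - 1)) *
      step ((- real (Suc n)) * y + (real (Suc n) * r - 1)))"
    by (intro cont_diff_mult cont_diff_affine_step)
  then show ?thesis
    by (rule back_subst[of cont_diff]) (auto simp: bump1_def fun_eq_iff algebra_simps)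
qed

lemma tendsto_step:
  assumes "y > 0" shows "(\<lambda>n. step (real (Suc n) * y - 1)) \<longlonglongrightarrow> 1"
proof (rule tendsto_eventually)
  obtain N where N: "2 / y < real N" using reals_Archimedean2 by blast
  show "\<forall>\<^sub>F n in sequentially. step (real (Suc n) * y - 1) = 1"
    using eventually_ge_at_top[of N]
  proof eventually_elim
    case (elim n)
    then have "2 / y \<le> real (Suc n)" using N by linarith
    then have "2 \<le> real (Suc n) * y" using assms by (simp add: field_simps)
    then show ?case by (intro step_ge1) simp
  qed
qed

lemma bump1_tendsto: "(\<lambda>n. bump1 l r n y) \<longlonglongrightarrow> indicator {l<..<r} y"
proof (cases "y \<in> {l<..<r}")
  case True
  then have "(\<lambda>n. bump1 l r n y) \<longlonglongrightarrow> 1 * 1"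
    unfolding bump1_def by (intro tendsto_mult tendsto_step) auto
  with True show ?thesis by simp
next
  case False
  have "bump1 l r n y = 0" for n
  proof (rule bump1_outside)
    obtain e where "e = 1 / real (Suc n)" "e > 0" by simp
    with False show "y \<notin> {l + 1 / real (Suc n)..r - 1 / real (Suc n)}"
      by (auto simp del: of_nat_Suc simp flip: \<open>e = _\<close>)
  qed
  with False show ?thesis by simp
qed

lemma cont_diff_bump1_wrap:
  assumes "0 \<le> l" "r \<le> 1"
  shows "cont_diff (\<lambda>y. bump1 l r n (wrap per y))"
proof -
  define a b where "a = l + 1 / real (Suc n)" and "b = r - 1 / real (Suc n)"
  have "0 < 1 / real (Suc n)" by simp
  then have ab: "0 < a" "b < 1" unfolding a_def b_def using assms by linarith+
  define D where "D y = frechet_derivative (bump1 l r n) (at y) 1" for y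
  have D: "(bump1 l r n has_real_derivative D y) (at y)" for y
    using directional_derivative[OF cont_diff_bump1[of l r n], of 0 1 y] by (simp add: D_def)
  have D0: "D y = 0" if "y \<notin> {a..b}" for y
  proof -
    have "((\<lambda>y. 0) has_real_derivative 0) (at y)" by simp
    then have "(bump1 l r n has_real_derivative 0) (at y)"
      by (rule has_field_derivative_transform_within_open[of _ _ _ "- {a..b}"])
        (use that bump1_outside[where l = l and n = n and r = r] in \<open>auto simp: a_def b_def\<close>)
    with D show ?thesis by (rule DERIV_unique)
  qed
  have Dc: "continuous_on UNIV D"
    unfolding D_def by (intro cont_diff_continuous_derivative cont_diff_bump1 continuous_intros)
  have 0: "\<And>y. y \<notin> {a..b} \<Longrightarrow> bump1 l r n y = 0" unfolding a_def b_def by (rule bump1_outside)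
  show ?thesis
    by (rule cont_diff_real[OF wrap_deriv[of a b "bump1 l r n" D, OF 0 D0 ab D]
          wrap_continuous[of a b D, OF D0 ab Dc]])
qed

text \<open>The flag \<open>P b\<close> decides for each coordinate whether the factor is extended periodically: on
  space-time the torus is periodic in space but not in time.\<close>

definition bump :: "('a::euclidean_space \<Rightarrow> bool) \<Rightarrow> 'a \<Rightarrow> 'a \<Rightarrow> nat \<Rightarrow> 'a \<Rightarrow> real" where
  "bump P l r n z = (\<Prod>b\<in>Basis. bump1 (l \<bullet> b) (r \<bullet> b) n (wrap (P b) (z \<bullet> b)))"

lemma bump_bounds: "0 \<le> bump P l r n z" "bump P l r n z \<le> 1"
  unfolding bump_def using bump1_bounds by (auto intro!: prod_nonneg prod_le_1)

lemma bump_eq_0: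
  assumes "b \<in> Basis" "wrap (P b) (z \<bullet> b) \<notin> {l \<bullet> b + 1 / Suc n .. r \<bullet> b - 1 / Suc n}"
  shows "bump P l r n z = 0"
  unfolding bump_def using bump1_outside[OF assms(2)] assms(1) by (intro prod_zero) auto

context
  fixes A B :: "'a::euclidean_space"
  assumes unit: "\<And>b. b \<in> Basis \<Longrightarrow> A \<bullet> b = 0 \<and> B \<bullet> b = 1"
begin

lemma unit_box_corners:
  assumes "box l r \<subseteq> box A B" "box l r \<noteq> {}" "b \<in> Basis"
  shows "0 \<le> l \<bullet> b" "r \<bullet> b \<le> 1"
proof -
  have "\<forall>i\<in>Basis. l \<bullet> i < r \<bullet> i" using assms(2) unfolding box_ne_empty .
  with assms(1) have "A \<bullet> b \<le> l \<bullet> b \<and> r \<bullet> b \<le> B \<bullet> b"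
    using assms(3) unfolding subset_box by blast
  then show "0 \<le> l \<bullet> b" "r \<bullet> b \<le> 1" using unit[OF assms(3)] by auto
qed

lemma cont_diff_bump:
  assumes "box l r \<subseteq> box A B" "box l r \<noteq> {}"
  shows "cont_diff (bump P l r n)"
  unfolding bump_def[abs_def]
proof (rule cont_diff_prod)
  fix b :: 'a assume "b \<in> Basis"
  then show "cont_diff (\<lambda>z. bump1 (l \<bullet> b) (r \<bullet> b) n (wrap (P b) (z \<bullet> b)))"
    using unit_box_corners[OF assms] by (intro cont_diff_compose[OF cont_diff_bump1_wrap cont_diff_inner])
qed

lemma bump_tendsto:
  assumes "box l r \<subseteq> box A B" "box l r \<noteq> {}" "z \<in> cbox A B"
  shows "(\<lambda>n. bump P l r n z) \<longlonglongrightarrow> indicator (box l r) z"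
proof -
  have eq: "bump P l r n z = (\<Prod>b\<in>Basis. bump1 (l \<bullet> b) (r \<bullet> b) n (z \<bullet> b))" for n
    unfolding bump_def
  proof (rule prod.cong[OF refl])
    fix b :: 'a assume b: "b \<in> Basis"
    have "z \<bullet> b \<in> {0..1}" using assms(3) b unit by (auto simp: mem_box)
    moreover have "0 < 1 / real (Suc n)" by simp
    then have "0 < l \<bullet> b + 1 / real (Suc n)" "r \<bullet> b - 1 / real (Suc n) < 1"
      using unit_box_corners[OF assms(1,2) b] by linarith+
    ultimately show "bump1 (l \<bullet> b) (r \<bullet> b) n (wrap (P b) (z \<bullet> b)) = bump1 (l \<bullet> b) (r \<bullet> b) n (z \<bullet> b)"
      using bump1_outside by (intro wrap_unit)
  qed
  have "(\<lambda>n. \<Prod>b\<in>Basis. bump1 (l \<bullet> b) (r \<bullet> b) n (z \<bullet> b))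
      \<longlonglongrightarrow> (\<Prod>b\<in>Basis. indicator {l \<bullet> b<..<r \<bullet> b} (z \<bullet> b))"
    by (intro tendsto_prod bump1_tendsto)
  moreover have "(\<Prod>b\<in>Basis. indicator {l \<bullet> b<..<r \<bullet> b} (z \<bullet> b)) = (indicator (box l r) z :: real)"
  proof (cases "z \<in> box l r")
    case True then show ?thesis by (auto simp: mem_box intro!: prod.neutral)
  next
    case False
    then obtain b where "b \<in> Basis" "z \<bullet> b \<notin> {l \<bullet> b<..<r \<bullet> b}" by (auto simp: mem_box)
    then show ?thesis using False by (auto intro!: prod_zero bexI[of _ b])
  qed
  ultimately show ?thesis by (simp add: eq)
qed

lemma AE_zero_if_bump_integrals_zero:
  assumes h: "integrable (lebesgue_on (cbox A B)) h"
    and zero: "\<And>l r n. box l r \<subseteq> box A B \<Longrightarrow> box l r \<noteq> {} \<Longrightarrow>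
      (LINT x|lebesgue_on (cbox A B). h x * bump P l r n x) = 0"
  shows "AE x in lebesgue_on (cbox A B). h x = 0"
proof (rule AE_zero_if_box_integrals_zero[OF h])
  fix l r assume sub: "box l r \<subseteq> box A B"
  show "(LINT x|lebesgue_on (cbox A B). h x * indicator (box l r) x) = 0"
  proof (cases "box l r = {}")
    case False
    have [measurable]: "h \<in> borel_measurable (lebesgue_on (cbox A B))" using h by auto
    have [measurable]: "bump P l r n \<in> borel_measurable (lebesgue_on (cbox A B))" for n
      by (intro continuous_imp_measurable_on_sets_lebesgue cont_diff_continuous
          cont_diff_bump[OF sub False]) auto
    have ind: "indicator (box l r) \<in> borel_measurable (lebesgue_on (cbox A B))"
      by (rule measurable_restrict_space1) (simp add: borel_measurable_indicator)
    have "(\<lambda>n. LINT x|lebesgue_on (cbox A B). h x * bump P l r n x)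
        \<longlonglongrightarrow> (LINT x|lebesgue_on (cbox A B). h x * indicator (box l r) x)"
    proof (rule integral_dominated_convergence[where w = "\<lambda>x. \<bar>h x\<bar>"])
      show "AE x in lebesgue_on (cbox A B). (\<lambda>n. h x * bump P l r n x) \<longlonglongrightarrow> h x * indicator (box l r) x"
        by (intro AE_I2 tendsto_intros bump_tendsto[OF sub False]) auto
      show "AE x in lebesgue_on (cbox A B). norm (h x * bump P l r n x) \<le> \<bar>h x\<bar>" for n
        using bump_bounds[of P l r n] by (intro AE_I2) (auto simp: abs_mult intro: mult_left_le)
    qed (use h borel_measurable_times[OF _ ind] in auto)
    then show ?thesis using zero[OF sub False] by (simp add: LIMSEQ_const_iff)
  qed simp
qed

end

lemma unit_space: "b \<in> Basis \<Longrightarrow> (0 :: real ^ 'n) \<bullet> b = 0 \<and> (1 :: real ^ 'n) \<bullet> b = 1"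
  by (auto simp: Basis_vec_def inner_axis)

lemma unit_spacetime:
  "b \<in> Basis \<Longrightarrow> ((0, 0) :: (real ^ 'n) \<times> real) \<bullet> b = 0 \<and> ((1, 1) :: (real ^ 'n) \<times> real) \<bullet> b = 1"
  using unit_space by (auto simp: Basis_prod_def)

lemma wrap_axis:
  assumes "b \<in> Basis"
  shows "wrap True ((x + axis i 1 :: real ^ 'n) \<bullet> b) = wrap True (x \<bullet> b)"
proof -
  from assms obtain j where "b = axis j 1" by (auto simp: Basis_vec_def)
  then have "(x + axis i 1) \<bullet> b = x \<bullet> b + (if i = j then 1 else 0)"
    by (simp add: inner_add_left inner_axis_axis)
  then show ?thesis by (auto simp: wrap_periodic)
qed

lemma mem_shrunk_box:
  "z \<in> cbox (l + c *\<^sub>R One) (r - c *\<^sub>R One) \<longleftrightarrow> (\<forall>b\<in>Basis. z \<bullet> b \<in> {l \<bullet> b + c .. r \<bullet> b - c})"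
proof -
  have "(l + c *\<^sub>R One) \<bullet> b = l \<bullet> b + c" "(r - c *\<^sub>R One) \<bullet> b = r \<bullet> b - c" if "b \<in> Basis" for b
    using that by (simp_all add: inner_add_left inner_diff_left)
  then show ?thesis by (auto simp: mem_box)
qed

lemma bump_support:
  assumes "\<And>b. b \<in> Basis \<Longrightarrow> \<not> P b" and z: "z \<notin> cbox (l + (1 / Suc n) *\<^sub>R One) (r - (1 / Suc n) *\<^sub>R One)"
  shows "bump P l r n z = 0"
proof -
  from z obtain b where "b \<in> Basis" "z \<bullet> b \<notin> {l \<bullet> b + 1 / Suc n .. r \<bullet> b - 1 / Suc n}"
    unfolding mem_shrunk_box by blast
  with assms(1)[of b] show ?thesis by (intro bump_eq_0[of b]) (auto simp: wrap_def)
qed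

lemma shrunk_box_subset: "cbox (l + (1 / Suc n) *\<^sub>R One) (r - (1 / Suc n) *\<^sub>R One) \<subseteq> box l r"
proof
  fix z assume "z \<in> cbox (l + (1 / Suc n) *\<^sub>R One) (r - (1 / Suc n) *\<^sub>R One)"
  then have z: "l \<bullet> b + 1 / Suc n \<le> z \<bullet> b" "z \<bullet> b \<le> r \<bullet> b - 1 / Suc n" if "b \<in> Basis" for b
    using that unfolding mem_shrunk_box by auto
  have "0 < 1 / real (Suc n)" by simp
  then have "l \<bullet> b < z \<bullet> b \<and> z \<bullet> b < r \<bullet> b" if "b \<in> Basis" for b
    using z[OF that] by linarith
  then show "z \<in> box l r" by (simp add: mem_box)
qed

lemma test_fun_bump:
  fixes l r :: "real ^ 'n"
  assumes "box l r \<subseteq> box 0 1" "box l r \<noteq> {}"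
  shows "test_fun per (bump (\<lambda>_. per) l r n)"
proof -
  have "C1 (bump (\<lambda>_. per) l r n)"
    unfolding C1_iff_cont_diff by (rule cont_diff_bump[OF unit_space assms])
  moreover have "periodic_fun (bump (\<lambda>_. True) l r n)"
    unfolding periodic_fun_def bump_def by (auto simp: wrap_axis)
  moreover have "\<exists>K. compact K \<and> K \<subseteq> box 0 1 \<and> (\<forall>x. x \<notin> K \<longrightarrow> bump (\<lambda>_. False) l r n x = 0)"
    using bump_support[of "\<lambda>_. False" _ l n r] shrunk_box_subset[of l n r] assms(1)
    by (intro exI[of _ "cbox (l + (1 / Suc n) *\<^sub>R One) (r - (1 / Suc n) *\<^sub>R One)"]) auto
  ultimately show ?thesis unfolding test_fun_def by (cases per) simp_all
qed

lemma box_Pair: "box (a, b) (c, d) = box a c \<times> box b d"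
  by (force simp: box_def Basis_prod_def)

lemma spacetime_test_fun_bump:
  fixes l r :: "(real ^ 'n) \<times> real"
  assumes "box l r \<subseteq> box (0, 0) (1, 1)" "box l r \<noteq> {}"
  shows "spacetime_test_fun per (bump (\<lambda>b. per \<and> snd b = 0) l r n)"
proof -
  have "C1 (bump (\<lambda>b. per \<and> snd b = 0) l r n)"
    unfolding C1_iff_cont_diff by (rule cont_diff_bump[OF unit_spacetime assms])
  moreover have "periodic_fun (\<lambda>x. bump (\<lambda>b. True \<and> snd b = 0) l r n (x, t))" for t
    unfolding periodic_fun_def bump_def
  proof (intro allI prod.cong refl)
    fix x :: "real ^ 'n" and i and b :: "(real ^ 'n) \<times> real" assume "b \<in> Basis"
    then consider c where "b = (c, 0)" "c \<in> Basis" | "b = (0, 1)" by (auto simp: Basis_prod_def)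
    then show "bump1 (l \<bullet> b) (r \<bullet> b) n (wrap (True \<and> snd b = 0) ((x + axis i 1, t) \<bullet> b)) =
        bump1 (l \<bullet> b) (r \<bullet> b) n (wrap (True \<and> snd b = 0) ((x, t) \<bullet> b))"
      by cases (auto simp: wrap_axis)
  qed
  moreover have "\<exists>J. compact J \<and> J \<subseteq> {0<..<1} \<and>
      (\<forall>x t. t \<notin> J \<longrightarrow> bump (\<lambda>b. True \<and> snd b = 0) l r n (x, t) = 0)"
  proof (intro exI conjI allI impI)
    let ?J = "{snd l + 1 / Suc n .. snd r - 1 / Suc n}"
    have b: "(0, 1) \<in> (Basis :: ((real ^ 'n) \<times> real) set)" by (simp add: Basis_prod_def)
    show "compact ?J" by simp
    have "0 \<le> snd l" "snd r \<le> 1"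
      using unit_box_corners[OF unit_spacetime assms b] by (auto simp: inner_prod_def)
    moreover obtain e where "e = 1 / real (Suc n)" "e > 0" by simp
    ultimately show "?J \<subseteq> {0<..<1}" by (auto simp del: of_nat_Suc simp flip: \<open>e = _\<close>)
    fix x t assume "t \<notin> ?J"
    then show "bump (\<lambda>b. True \<and> snd b = 0) l r n (x, t) = 0"
      by (intro bump_eq_0[OF b]) (auto simp: wrap_def inner_prod_def)
  qed
  moreover have "\<exists>K. compact K \<and> K \<subseteq> box 0 1 \<times> {0<..<1} \<and>
      (\<forall>z. z \<notin> K \<longrightarrow> bump (\<lambda>b. False \<and> snd b = 0) l r n z = 0)"
    using bump_support[of "\<lambda>b. False \<and> snd b = 0" _ l n r] shrunk_box_subset[of l n r] assms(1)
    unfolding box_Pair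
    by (intro exI[of _ "cbox (l + (1 / Suc n) *\<^sub>R One) (r - (1 / Suc n) *\<^sub>R One)"]) (auto simp: box_real)
  ultimately show ?thesis unfolding spacetime_test_fun_def by (cases per) simp_all
qed

text \<open>Bumps are test functions and approximate the indicators of all open boxes.\<close>

lemma fundamental_lemma_space:
  fixes h :: "real ^ 'n \<Rightarrow> real"
  assumes "integrable (lebesgue_on space_dom) h"
    and "\<And>\<psi>. test_fun per \<psi> \<Longrightarrow> (LINT x|lebesgue_on space_dom. h x * \<psi> x) = 0"
  shows "AE x in lebesgue_on space_dom. h x = 0"
  unfolding space_dom_def
proof (rule AE_zero_if_bump_integrals_zero[where P = "\<lambda>_. per"])
  show "(LINT x|lebesgue_on (cbox 0 1). h x * bump (\<lambda>_. per) l r n x) = 0"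
    if "box l r \<subseteq> box 0 1" "box l r \<noteq> {}" for l r :: "real ^ 'n" and n
    using assms(2)[OF test_fun_bump[OF that]] by (simp add: space_dom_def)
qed (use assms(1) unit_space in \<open>auto simp: space_dom_def\<close>)

lemma fundamental_lemma_spacetime:
  fixes h :: "(real ^ 'n) \<times> real \<Rightarrow> real"
  assumes "integrable (lebesgue_on spacetime_dom) h"
    and "\<And>\<psi>. spacetime_test_fun per \<psi> \<Longrightarrow> (LINT x|lebesgue_on spacetime_dom. h x * \<psi> x) = 0"
  shows "AE x in lebesgue_on spacetime_dom. h x = 0"
  unfolding spacetime_dom_cbox
proof (rule AE_zero_if_bump_integrals_zero[where P = "\<lambda>b. per \<and> snd b = 0"])
  show "(LINT x|lebesgue_on (cbox (0, 0) (1, 1)). h x * bump (\<lambda>b. per \<and> snd b = 0) l r n x) = 0"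
    if "box l r \<subseteq> box (0, 0) (1, 1)" "box l r \<noteq> {}" for l r :: "(real ^ 'n) \<times> real" and n
    using assms(2)[OF spacetime_test_fun_bump[OF that]] by (simp add: spacetime_dom_cbox)
qed (use assms(1) unit_spacetime in \<open>auto simp: spacetime_dom_cbox\<close>)

lemma test_fun_cont_diff: "test_fun per \<psi> \<Longrightarrow> cont_diff \<psi>"
  by (simp add: test_fun_def C1_iff_cont_diff)

lemma test_fun_combination:
  assumes "test_fun per \<phi>" "test_fun per \<psi>"
  shows "test_fun per (\<lambda>x. \<phi> x + c * \<psi> x)"
proof -
  have "C1 (\<lambda>x. \<phi> x + c * \<psi> x)"
    using assms[THEN test_fun_cont_diff] unfolding C1_iff_cont_diff
    by (intro cont_diff_intros)
  moreover have "\<exists>K. compact K \<and> K \<subseteq> box 0 1 \<and> (\<forall>x. x \<notin> K \<longrightarrow> \<phi> x + c * \<psi> x = 0)" if "\<not> per"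
  proof -
    from assms(1) that obtain K1 where "compact K1" "K1 \<subseteq> box 0 1" "\<And>x. x \<notin> K1 \<Longrightarrow> \<phi> x = 0"
      by (auto simp: test_fun_def)
    moreover from assms(2) that obtain K2 where "compact K2" "K2 \<subseteq> box 0 1" "\<And>x. x \<notin> K2 \<Longrightarrow> \<psi> x = 0"
      by (auto simp: test_fun_def)
    ultimately show ?thesis by (intro exI[of _ "K1 \<union> K2"]) auto
  qed
  ultimately show ?thesis using assms by (auto simp: test_fun_def periodic_fun_def)
qed

lemma test_fun_0: "test_fun per (\<lambda>x. 0)"
  by (auto simp: test_fun_def C1_iff_cont_diff periodic_fun_def intro!: exI[of _ "{}"])

lemma test_fun_L2: "test_fun per \<psi> \<Longrightarrow> L2 space_dom \<psi>"
  by (intro continuous_L2_space cont_diff_continuous test_fun_cont_diff)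

text \<open>The distance of an \<open>L\<^sup>2\<close> function to the test functions is approached by a Cauchy
  sequence, whose limit leaves a residual orthogonal to every test function.\<close>

lemma test_fun_dense:
  assumes a: "L2 space_dom a"
  shows "\<exists>\<phi>. (\<forall>k. test_fun per (\<phi> k)) \<and> (\<lambda>k. l2_norm space_dom (\<lambda>x. \<phi> k x - a x)) \<longlonglongrightarrow> 0"
proof -
  define K where "K = {\<lambda>x. a x - \<psi> x |\<psi>. test_fun per \<psi>}"
  have K_L2: "L2 space_dom f" if "f \<in> K" for f
    using that a by (auto simp: K_def intro: L2_diff test_fun_L2)
  have "\<exists>h\<in>K. AE x in lebesgue_on space_dom. h x = 1/2 * (f x + g x)" if "f \<in> K" "g \<in> K" for f g
  proof -
    from that(1) obtain \<phi> where \<phi>: "test_fun per \<phi>" "f = (\<lambda>x. a x - \<phi> x)" by (auto simp: K_def)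
    from that(2) obtain \<psi> where \<psi>: "test_fun per \<psi>" "g = (\<lambda>x. a x - \<psi> x)" by (auto simp: K_def)
    from \<phi>(1) \<psi>(1) have "test_fun per (\<lambda>x. 0 + 1/2 * (\<phi> x + 1 * \<psi> x))"
      by (intro test_fun_combination test_fun_0)
    then have "(\<lambda>x. a x - (0 + 1/2 * (\<phi> x + 1 * \<psi> x))) \<in> K"
      unfolding K_def by (intro CollectI exI[of _ "\<lambda>x. 0 + 1/2 * (\<phi> x + 1 * \<psi> x)"] conjI refl)
    then show ?thesis by (rule bexI[rotated]) (auto simp: \<phi>(2) \<psi>(2) field_simps)
  qed
  moreover have "K \<noteq> {}" using test_fun_0[of per] by (auto simp: K_def)
  ultimately obtain f where fK: "\<And>k. f k \<in> K" and cau: "l2_Cauchy space_dom f"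
    and min: "\<And>h e. h \<in> K \<Longrightarrow> e > 0 \<Longrightarrow> \<exists>N. \<forall>k\<ge>N. l2_norm space_dom (f k) \<le> l2_norm space_dom h + e"
    using minimizing_sequence[of K space_dom] K_L2 by blast
  obtain p where p: "L2 space_dom p" and lim: "(\<lambda>k. l2_norm space_dom (\<lambda>x. f k x - p x)) \<longlonglongrightarrow> 0"
    using L2_complete[OF _ K_L2[OF fK] cau] by auto
  have lim_norm: "(\<lambda>k. l2_norm space_dom (f k)) \<longlonglongrightarrow> l2_norm space_dom p"
    by (rule l2_norm_tendsto[OF K_L2[OF fK] p lim])
  have p_le: "l2_norm space_dom p \<le> l2_norm space_dom h" if "h \<in> K" for h
  proof (rule field_le_epsilon)
    fix e :: real assume "e > 0"
    then show "l2_norm space_dom p \<le> l2_norm space_dom h + e"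
      using min[OF that \<open>e > 0\<close>] by (intro LIMSEQ_le_const2[OF lim_norm]) auto
  qed
  have orth: "l2_inner space_dom p \<psi> = 0" if \<psi>: "test_fun per \<psi>" for \<psi>
  proof (rule l2_inner_eq_0_if_minimal[OF p test_fun_L2[OF \<psi>]])
    fix c
    have L: "L2 space_dom (\<lambda>x. f k x + c * \<psi> x)" for k
      by (intro L2_add L2_scale K_L2 fK test_fun_L2[OF \<psi>])
    have "(\<lambda>k. l2_norm space_dom (\<lambda>x. f k x + c * \<psi> x)) \<longlonglongrightarrow> l2_norm space_dom (\<lambda>x. p x + c * \<psi> x)"
      by (rule l2_norm_tendsto[OF L]) (auto intro!: L2_add L2_scale p test_fun_L2[OF \<psi>] simp: lim)
    moreover have "l2_norm space_dom p \<le> l2_norm space_dom (\<lambda>x. f k x + c * \<psi> x)" for k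
    proof (rule p_le)
      obtain \<phi> where "test_fun per \<phi>" "f k = (\<lambda>x. a x - \<phi> x)" using fK[of k] by (auto simp: K_def)
      then show "(\<lambda>x. f k x + c * \<psi> x) \<in> K"
        using test_fun_combination[OF _ \<psi>, of \<phi> "- c"] by (auto simp: K_def intro!: exI[of _ "\<lambda>x. \<phi> x + - c * \<psi> x"])
    qed
    ultimately have "l2_norm space_dom p \<le> l2_norm space_dom (\<lambda>x. p x + c * \<psi> x)"
      by (intro LIMSEQ_le_const) auto
    then show "(l2_norm space_dom p)\<^sup>2 \<le> (l2_norm space_dom (\<lambda>x. p x + c * \<psi> x))\<^sup>2"
      by (simp add: l2_norm_nonneg power_mono)
  qed
  have "AE x in lebesgue_on space_dom. p x = 0"
    using orth by (intro fundamental_lemma_space[where per = per] L2_integrable p) (auto simp: l2_inner_def)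
  then have "l2_norm space_dom p = 0" using l2_norm_eq_0_iff[OF p] by simp
  moreover obtain \<phi> where \<phi>: "\<And>k. test_fun per (\<phi> k)" "\<And>k. f k = (\<lambda>x. a x - \<phi> k x)"
    using fK unfolding K_def by (simp, metis)
  moreover have "l2_norm space_dom (\<lambda>x. \<phi> k x - a x) = l2_norm space_dom (f k)" for k
    unfolding \<phi>(2) by (rule l2_norm_minus_commute)
  ultimately show ?thesis using lim_norm by (intro exI[of _ \<phi>]) simp
qed

section \<open>Lebesgue measure on a product\<close>

text \<open>Here it matters that Lebesgue measure is complete.\<close>

lemma lebesgue_measurable_AE:
  fixes f g :: "'a::euclidean_space \<Rightarrow> real"
  assumes g: "g \<in> borel_measurable lebesgue" and ae: "AE x in lebesgue. f x = g x"
  shows "f \<in> borel_measurable lebesgue"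
proof (rule measurableI)
  fix B :: "real set" assume "B \<in> sets borel"
  then have "g -` B \<inter> space lebesgue \<in> sets lebesgue" by (rule measurable_sets[OF g])
  moreover have "AE x in lebesgue. x \<in> g -` B \<inter> space lebesgue \<longleftrightarrow> x \<in> f -` B \<inter> space lebesgue"
    using ae by eventually_elim simp
  ultimately show "f -` B \<inter> space lebesgue \<in> sets lebesgue"
    by - (rule completion.in_sets_AE, auto)
qed simp

lemma lebesgue_on_measurable_AE:
  fixes f g :: "'a::euclidean_space \<Rightarrow> real"
  assumes g: "g \<in> borel_measurable (lebesgue_on S)" and ae: "AE x in lebesgue_on S. f x = g x"
    and S: "S \<in> sets lebesgue"
  shows "f \<in> borel_measurable (lebesgue_on S)"
proof -
  have "(\<lambda>x. if x \<in> S then g x else 0) \<in> borel_measurable lebesgue"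
    using borel_measurable_if[OF S] g by blast
  moreover have "AE x in lebesgue. (if x \<in> S then f x else 0) = (if x \<in> S then g x else 0)"
    using ae S by (subst (asm) AE_restrict_space_iff) (auto elim: eventually_mono)
  ultimately have "(\<lambda>x. if x \<in> S then f x else 0) \<in> borel_measurable lebesgue"
    by (rule lebesgue_measurable_AE)
  then show ?thesis using borel_measurable_if[OF S] by blast
qed

text \<open>Lebesgue measure on a product is the completion of the product measure, so statements about
  sections are transferred from the Borel sets, where every null set is covered by a Borel null set.\<close>

lemma AE_lebesgue_sections:
  fixes P :: "'a::euclidean_space \<times> 'b::euclidean_space \<Rightarrow> bool"
  assumes "AE z in lebesgue. P z"
  shows "AE t in lebesgue. AE x in lebesgue. P (x, t)"
proof -
  have "AE z in lborel. P z" using assms by (simp add: AE_completion_iff)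
  then obtain N where N: "{z. \<not> P z} \<subseteq> N" "N \<in> null_sets (lborel :: ('a \<times> 'b) measure)"
    by (auto simp: eventually_ae_filter)
  have "AE z in (lborel \<Otimes>\<^sub>M lborel :: ('a \<times> 'b) measure). z \<notin> N"
    unfolding lborel_prod using N(2) by (rule AE_not_in)
  then have "AE x in (lborel :: 'a measure). AE t in (lborel :: 'b measure). (x, t) \<notin> N"
    by (rule lborel_pair.AE_pair)
  moreover have "{z \<in> space (lborel \<Otimes>\<^sub>M lborel :: ('a \<times> 'b) measure). (fst z, snd z) \<notin> N}
      \<in> sets (lborel \<Otimes>\<^sub>M lborel)"
  proof -
    have "- N \<in> sets (lborel :: ('a \<times> 'b) measure)"
      using sets.compl_sets[OF null_setsD2[OF N(2)]] by (simp add: Compl_eq_Diff_UNIV)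
    then show ?thesis unfolding lborel_prod by (simp add: Compl_eq)
  qed
  ultimately have "AE t in (lborel :: 'b measure). AE x in (lborel :: 'a measure). (x, t) \<notin> N"
    by (subst (asm) lborel_pair.AE_commute) auto
  then have "AE t in (lborel :: 'b measure). AE x in (lborel :: 'a measure). P (x, t)"
    by (rule eventually_mono) (rule eventually_mono, use N(1) in auto)
  then show ?thesis by (simp add: AE_completion_iff)
qed

lemma AE_lebesgue_fst:
  assumes "AE x in lebesgue. P x"
  shows "AE z in (lebesgue :: ('a::euclidean_space \<times> 'b::euclidean_space) measure). P (fst z)"
proof -
  have "AE x in lborel. P x" using assms by (simp add: AE_completion_iff)
  then obtain N where N: "{x. \<not> P x} \<subseteq> N" "N \<in> null_sets (lborel :: 'a measure)"
    by (auto simp: eventually_ae_filter)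
  have [measurable]: "N \<in> sets borel" using N(2) by auto
  have "AE z in (lborel \<Otimes>\<^sub>M lborel :: ('a \<times> 'b) measure). fst z \<notin> N"
  proof (rule lborel_pair.AE_pair_measure)
    show "AE x in lborel. AE y in lborel. fst (x, y) \<notin> N" using AE_not_in[OF N(2)] by eventually_elim simp
  qed measurable
  then have "AE z in (lborel :: ('a \<times> 'b) measure). P (fst z)"
    unfolding lborel_prod by (rule eventually_mono) (use N(1) in auto)
  then show ?thesis by (simp add: AE_completion_iff)
qed

lemma AE_lebesgue_snd:
  assumes "AE x in lebesgue. P x"
  shows "AE z in (lebesgue :: ('a::euclidean_space \<times> 'b::euclidean_space) measure). P (snd z)"
proof -
  have "AE x in lborel. P x" using assms by (simp add: AE_completion_iff)
  then obtain N where N: "{x. \<not> P x} \<subseteq> N" "N \<in> null_sets (lborel :: 'b measure)"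
    by (auto simp: eventually_ae_filter)
  have [measurable]: "N \<in> sets borel" using N(2) by auto
  have "AE z in (lborel \<Otimes>\<^sub>M lborel :: ('a \<times> 'b) measure). snd z \<notin> N"
  proof (rule lborel_pair.AE_pair_measure)
    show "AE x in lborel. AE y in lborel. snd (x, y) \<notin> N" using AE_not_in[OF N(2)] by simp
  qed measurable
  then have "AE z in (lborel :: ('a \<times> 'b) measure). P (snd z)"
    unfolding lborel_prod by (rule eventually_mono) (use N(1) in auto)
  then show ?thesis by (simp add: AE_completion_iff)
qed

lemma lebesgue_measurable_fst:
  fixes f :: "'a::euclidean_space \<Rightarrow> real"
  assumes "f \<in> borel_measurable lebesgue"
  shows "(\<lambda>z::'a \<times> 'b::euclidean_space. f (fst z)) \<in> borel_measurable lebesgue"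
proof -
  obtain g where g: "g \<in> borel_measurable lborel" "AE x in lborel. f x = g x"
    using completion_ex_borel_measurable_real[OF assms] by blast
  have "(\<lambda>z::'a \<times> 'b. g (fst z)) \<in> borel_measurable (lborel \<Otimes>\<^sub>M lborel)"
    by (rule measurable_compose[OF measurable_fst g(1)])
  then have "(\<lambda>z::'a \<times> 'b. g (fst z)) \<in> borel_measurable lebesgue"
    unfolding lborel_prod by (rule measurable_completion)
  then show ?thesis
    using AE_lebesgue_fst[OF AE_completion[OF g(2)]] by (rule lebesgue_measurable_AE)
qed

lemma lebesgue_measurable_snd:
  fixes f :: "'b::euclidean_space \<Rightarrow> real"
  assumes "f \<in> borel_measurable lebesgue"
  shows "(\<lambda>z::'a::euclidean_space \<times> 'b. f (snd z)) \<in> borel_measurable lebesgue"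
proof -
  obtain g where g: "g \<in> borel_measurable lborel" "AE x in lborel. f x = g x"
    using completion_ex_borel_measurable_real[OF assms] by blast
  have "(\<lambda>z::'a \<times> 'b. g (snd z)) \<in> borel_measurable (lborel \<Otimes>\<^sub>M lborel)"
    by (rule measurable_compose[OF measurable_snd g(1)])
  then have "(\<lambda>z::'a \<times> 'b. g (snd z)) \<in> borel_measurable lebesgue"
    unfolding lborel_prod by (rule measurable_completion)
  then show ?thesis
    using AE_lebesgue_snd[OF AE_completion[OF g(2)]] by (rule lebesgue_measurable_AE)
qed

lemma lebesgue_Times:
  assumes "S \<in> sets lebesgue" "T \<in> sets lebesgue"
  shows "S \<times> T \<in> sets (lebesgue :: ('a::euclidean_space \<times> 'b::euclidean_space) measure)"
proof -
  have "(\<lambda>z::'a \<times> 'b. indicator S (fst z) :: real) \<in> borel_measurable lebesgue"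
    "(\<lambda>z::'a \<times> 'b. indicator T (snd z) :: real) \<in> borel_measurable lebesgue"
    using assms by (auto intro!: lebesgue_measurable_fst lebesgue_measurable_snd)
  then have "(\<lambda>z::'a \<times> 'b. indicator S (fst z) * indicator T (snd z) :: real) \<in> borel_measurable lebesgue"
    by (rule borel_measurable_times)
  moreover have "(\<lambda>z::'a \<times> 'b. indicator S (fst z) * indicator T (snd z) :: real) = indicator (S \<times> T)"
    by (auto simp: indicator_def fun_eq_iff)
  ultimately have "(indicator (S \<times> T) :: 'a \<times> 'b \<Rightarrow> real) \<in> borel_measurable lebesgue"
    by simp
  then have "indicator (S \<times> T) -` {1 :: real} \<inter> space (lebesgue :: ('a \<times> 'b) measure) \<in> sets lebesgue"
    by (rule measurable_sets) simp
  moreover have "indicator (S \<times> T) -` {1 :: real} \<inter> space (lebesgue :: ('a \<times> 'b) measure) = S \<times> T"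
    by (auto simp: indicator_def split: if_splits)
  ultimately show ?thesis by simp
qed

text \<open>A Lebesgue integrable function agrees almost everywhere with a Borel function, to which Fubini's
  theorem for the product of Borel measures applies; almost every section agrees as well.\<close>

lemma lebesgue_Fubini_UNIV:
  fixes g :: "'a::euclidean_space \<times> 'b::euclidean_space \<Rightarrow> real"
  assumes g: "integrable lebesgue g"
  shows "AE t in lebesgue. integrable lebesgue (\<lambda>x. g (x, t))"
    and "integrable lebesgue (\<lambda>t. LINT x|lebesgue. g (x, t))"
    and "(LINT z|lebesgue. g z) = (LINT t|lebesgue. LINT x|lebesgue. g (x, t))"
proof -
  obtain h where h: "h \<in> borel_measurable lborel" and ae: "AE z in lborel. g z = h z"
    using completion_ex_borel_measurable_real[OF borel_measurable_integrable[OF g]] by blast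
  have hl: "h \<in> borel_measurable lebesgue" using h by (rule measurable_completion)
  have ae': "AE z in lebesgue. g z = h z" using ae by (rule AE_completion)
  have "integrable lebesgue h" using g hl ae' by (rule integrable_cong_AE_imp)
  then have "integrable lborel h" using h by (simp add: integrable_completion)
  then have hp: "integrable (lborel \<Otimes>\<^sub>M lborel) (case_prod (\<lambda>x t. h (x, t)))"
    by (simp add: lborel_prod)
  have sec_meas: "(\<lambda>x. h (x, t)) \<in> borel_measurable lborel" for t
  proof -
    have "(\<lambda>x. (x, t)) \<in> measurable lborel (lborel \<Otimes>\<^sub>M lborel)"
      by (intro measurable_Pair) auto
    then show ?thesis using h unfolding lborel_prod by (rule measurable_compose)
  qed
  have sec: "AE t in lebesgue. AE x in lebesgue. g (x, t) = h (x, t)"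
    by (rule AE_lebesgue_sections[OF ae'])
  have sec_meas_g: "AE t in lebesgue. (\<lambda>x. g (x, t)) \<in> borel_measurable lebesgue"
    using sec by eventually_elim (rule lebesgue_measurable_AE[OF measurable_completion[OF sec_meas]])
  have "AE t in lborel. integrable lborel (\<lambda>x. h (x, t))"
    by (rule lborel_pair.AE_integrable_snd[OF hp])
  then have hi: "AE t in lebesgue. integrable lebesgue (\<lambda>x. h (x, t))"
    using sec_meas by (simp add: AE_completion_iff integrable_completion)
  show "AE t in lebesgue. integrable lebesgue (\<lambda>x. g (x, t))"
    using hi sec sec_meas_g
    by eventually_elim (rule integrable_cong_AE_imp, auto elim: eventually_mono)
  have eq: "AE t in lebesgue. (LINT x|lebesgue. h (x, t)) = (LINT x|lebesgue. g (x, t))"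
    using hi sec sec_meas_g
    by eventually_elim (rule integral_cong_AE, auto elim: eventually_mono)
  have hl_eq: "(LINT x|lebesgue. h (x, t)) = (LINT x|lborel. h (x, t))" for t
    by (rule integral_completion[OF sec_meas])
  have "integrable lborel (\<lambda>t. LINT x|lborel. h (x, t))"
    by (rule lborel_pair.integrable_snd[OF hp])
  then have hI: "integrable lebesgue (\<lambda>t. LINT x|lebesgue. h (x, t))"
    unfolding hl_eq by (simp add: integrable_completion borel_measurable_integrable)
  have gm: "(\<lambda>t. LINT x|lebesgue. g (x, t)) \<in> borel_measurable lebesgue"
    by (rule lebesgue_measurable_AE[OF borel_measurable_integrable[OF hI]])
      (use eq in \<open>auto elim: eventually_mono\<close>)
  show "integrable lebesgue (\<lambda>t. LINT x|lebesgue. g (x, t))"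
    using hI gm eq by (rule integrable_cong_AE_imp)
  have "(LINT z|lebesgue. g z) = (LINT z|lebesgue. h z)"
    by (rule integral_cong_AE[OF borel_measurable_integrable[OF g] hl ae'])
  also have "\<dots> = (LINT z|lborel. h z)" by (rule integral_completion[OF h])
  also have "\<dots> = (LINT t|lborel. LINT x|lborel. h (x, t))"
    using lborel_pair.integral_snd[OF hp] by (simp add: lborel_prod)
  also have "\<dots> = (LINT t|lebesgue. LINT x|lebesgue. h (x, t))"
    unfolding hl_eq
    by (rule integral_completion[symmetric, OF borel_measurable_integrable[OF lborel_pair.integrable_snd[OF hp]]])
  also have "\<dots> = (LINT t|lebesgue. LINT x|lebesgue. g (x, t))"
    by (rule integral_cong_AE[OF borel_measurable_integrable[OF hI] gm eq])
  finally show "(LINT z|lebesgue. g z) = (LINT t|lebesgue. LINT x|lebesgue. g (x, t))" .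
qed

context
  fixes S :: "'a::euclidean_space set" and T :: "'b::euclidean_space set"
  assumes S: "S \<in> sets lebesgue" and T: "T \<in> sets lebesgue"
begin

lemma lebesgue_Fubini:
  fixes g :: "'a \<times> 'b \<Rightarrow> real"
  assumes g: "integrable (lebesgue_on (S \<times> T)) g"
  shows "AE t in lebesgue_on T. integrable (lebesgue_on S) (\<lambda>x. g (x, t))"
    and "integrable (lebesgue_on T) (\<lambda>t. LINT x|lebesgue_on S. g (x, t))"
    and "(LINT z|lebesgue_on (S \<times> T). g z) = (LINT t|lebesgue_on T. LINT x|lebesgue_on S. g (x, t))"
proof -
  define G where "G z = indicator (S \<times> T) z *\<^sub>R g z" for z
  have G: "integrable lebesgue G"
    using g lebesgue_Times[OF S T] unfolding G_def by (subst (asm) integrable_restrict_space) auto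
  have split: "G (x, t) = indicator T t *\<^sub>R (indicator S x *\<^sub>R g (x, t))" for x t
    by (auto simp: G_def indicator_def)
  have sec: "(LINT x|lebesgue. G (x, t)) = indicator T t *\<^sub>R (LINT x|lebesgue_on S. g (x, t))" for t
    unfolding split using S by (subst integral_restrict_space) auto
  show "AE t in lebesgue_on T. integrable (lebesgue_on S) (\<lambda>x. g (x, t))"
    using lebesgue_Fubini_UNIV(1)[OF G] S T
    by (subst AE_restrict_space_iff, simp, subst integrable_restrict_space)
      (auto simp: split elim!: eventually_mono)
  show "integrable (lebesgue_on T) (\<lambda>t. LINT x|lebesgue_on S. g (x, t))"
    using lebesgue_Fubini_UNIV(2)[OF G] T unfolding sec by (subst integrable_restrict_space) auto
  have "(LINT z|lebesgue_on (S \<times> T). g z) = (LINT z|lebesgue. G z)"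
    unfolding G_def using lebesgue_Times[OF S T] by (subst integral_restrict_space) auto
  also have "\<dots> = (LINT t|lebesgue_on T. LINT x|lebesgue_on S. g (x, t))"
    unfolding lebesgue_Fubini_UNIV(3)[OF G] sec using T by (subst integral_restrict_space) auto
  finally show "(LINT z|lebesgue_on (S \<times> T). g z) = (LINT t|lebesgue_on T. LINT x|lebesgue_on S. g (x, t))" .
qed

lemma lebesgue_on_measurable_fst:
  fixes f :: "'a \<Rightarrow> real"
  assumes "f \<in> borel_measurable (lebesgue_on S)"
  shows "(\<lambda>z. f (fst z)) \<in> borel_measurable (lebesgue_on (S \<times> T))"
proof -
  have "(\<lambda>x. if x \<in> S then f x else 0) \<in> borel_measurable lebesgue"
    using borel_measurable_if[OF S] assms by blast
  from lebesgue_measurable_fst[OF this]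
  have "(\<lambda>z::'a \<times> 'b. if fst z \<in> S then f (fst z) else 0) \<in> borel_measurable (lebesgue_on (S \<times> T))"
    by (rule measurable_restrict_space1)
  then show ?thesis by (rule measurable_cong[THEN iffD1, rotated]) auto
qed

lemma lebesgue_on_measurable_snd:
  fixes f :: "'b \<Rightarrow> real"
  assumes "f \<in> borel_measurable (lebesgue_on T)"
  shows "(\<lambda>z. f (snd z)) \<in> borel_measurable (lebesgue_on (S \<times> T))"
proof -
  have "(\<lambda>x. if x \<in> T then f x else 0) \<in> borel_measurable lebesgue"
    using borel_measurable_if[OF T] assms by blast
  from lebesgue_measurable_snd[OF this]
  have "(\<lambda>z::'a \<times> 'b. if snd z \<in> T then f (snd z) else 0) \<in> borel_measurable (lebesgue_on (S \<times> T))"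
    by (rule measurable_restrict_space1)
  then show ?thesis by (rule measurable_cong[THEN iffD1, rotated]) auto
qed

lemma AE_lebesgue_on_snd:
  assumes "AE t in lebesgue_on T. P t"
  shows "AE z in lebesgue_on (S \<times> T). P (snd z)"
proof -
  have "AE t in lebesgue. t \<in> T \<longrightarrow> P t"
    using assms T by (subst (asm) AE_restrict_space_iff) auto
  from AE_lebesgue_snd[OF this] show ?thesis
    using lebesgue_Times[OF S T] by (subst AE_restrict_space_iff) (auto elim!: eventually_mono)
qed

text \<open>A measurable function vanishing on almost every section integrates to zero; applied to the
  absolute value, cut off at one, this turns section-wise statements into statements almost
  everywhere.\<close>

lemma AE_lebesgue_on_zero_if_sections:
  fixes f :: "'a \<times> 'b \<Rightarrow> real"
  assumes f: "f \<in> borel_measurable (lebesgue_on (S \<times> T))"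
    and sec: "AE t in lebesgue_on T. AE x in lebesgue_on S. f (x, t) = 0"
    and ST: "S \<in> lmeasurable" "T \<in> lmeasurable"
  shows "AE z in lebesgue_on (S \<times> T). f z = 0"
proof -
  have ST': "S \<times> T \<in> sets lebesgue" by (rule lebesgue_Times[OF S T])
  define F where "F z = (if z \<in> S \<times> T then f z else 0)" for z
  have F: "F \<in> borel_measurable lebesgue"
    unfolding F_def using borel_measurable_if[OF ST'] f by blast
  obtain h where h: "h \<in> borel_measurable lborel" and ae: "AE z in lborel. F z = h z"
    using completion_ex_borel_measurable_real[OF F] by blast
  have "AE t in lebesgue. t \<in> T \<longrightarrow> (AE x in lebesgue. x \<in> S \<longrightarrow> f (x, t) = 0)"
    using sec S T by (subst (asm) AE_restrict_space_iff, simp, subst (asm) AE_restrict_space_iff) auto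
  moreover have "AE t in lebesgue. AE x in lebesgue. F (x, t) = h (x, t)"
    by (rule AE_lebesgue_sections[OF AE_completion[OF ae]])
  ultimately have "AE t in lebesgue. AE x in lebesgue. h (x, t) = 0"
  proof eventually_elim
    case (elim t)
    show ?case
    proof (cases "t \<in> T")
      case True
      then have "AE x in lebesgue. x \<in> S \<longrightarrow> f (x, t) = 0" using elim(1) by simp
      then show ?thesis using elim(2) by eventually_elim (auto simp: F_def split: if_splits)
    next
      case False
      then show ?thesis using elim(2) by (auto simp: F_def elim: eventually_mono)
    qed
  qed
  then have "AE t in lborel. AE x in lborel. h (x, t) = 0" by (simp add: AE_completion_iff)
  moreover have hm: "h \<in> borel_measurable (lborel \<Otimes>\<^sub>M lborel)" using h by (simp add: lborel_prod)
  moreover have hz: "{z \<in> space (lborel \<Otimes>\<^sub>M lborel). h z = 0} \<in> sets (lborel \<Otimes>\<^sub>M lborel)"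
    using measurable_sets[OF hm, of "{0}"] by (simp add: vimage_def Int_def conj_commute)
  ultimately have "AE x in lborel. AE t in lborel. h (x, t) = 0"
    by (subst lborel_pair.AE_commute) auto
  then have "AE z in lborel \<Otimes>\<^sub>M lborel. h z = 0"
    using hz by - (rule lborel_pair.AE_pair_measure)
  then have "AE z in lborel. F z = 0" using ae unfolding lborel_prod by eventually_elim simp
  then have "AE z in lebesgue. F z = 0" by (rule AE_completion)
  then show ?thesis
    using ST' by (subst AE_restrict_space_iff) (auto simp: F_def elim!: eventually_mono split: if_splits)
qed

end

section \<open>Mollification of Lipschitz fields\<close>

lemma cont_diff_local:
  assumes "\<And>x0. \<exists>U f'. open U \<and> x0 \<in> U \<and>
    (\<forall>x\<in>U. (f has_derivative blinfun_apply (f' x)) (at x)) \<and> continuous_on U f'"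
  shows "cont_diff f"
proof -
  define D where "D x = Blinfun (frechet_derivative f (at x))" for x
  have loc: "(f has_derivative blinfun_apply (D x)) (at x) \<and> isCont D x" for x
  proof -
    obtain U f' where U: "open U" "x \<in> U" "\<And>x. x \<in> U \<Longrightarrow> (f has_derivative blinfun_apply (f' x)) (at x)"
      "continuous_on U f'"
      using assms[of x] by metis
    have eq: "D y = f' y" if "y \<in> U" for y
      using frechet_derivative_at[OF U(3)[OF that]] by (metis D_def blinfun_apply_inverse)
    have "isCont f' x" using U by (simp add: continuous_on_eq_continuous_at)
    moreover have "\<forall>\<^sub>F y in nhds x. D y = f' y"
      using eventually_nhds_in_open[OF U(1,2)] by (rule eventually_mono) (rule eq)
    ultimately have "isCont D x" by (subst isCont_cong)
    then show ?thesis using U(2,3) eq by simp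
  qed
  show ?thesis
    by (rule cont_diffI[where f' = D]) (use loc in \<open>auto simp: continuous_on_eq_continuous_at\<close>)
qed

text \<open>A bump supported in the unit cube; dividing by its integral is left to the mollification.\<close>

definition kernel :: "'a::euclidean_space \<Rightarrow> real" where
  "kernel y = (\<Prod>b\<in>Basis. step (2 * (y \<bullet> b)) * step (2 - 2 * (y \<bullet> b)))"

lemma cont_diff_kernel: "cont_diff (kernel :: 'a::euclidean_space \<Rightarrow> real)"
proof -
  have "cont_diff (\<lambda>y::'a. step (2 * (y \<bullet> b) + 0) * step (- 2 * (y \<bullet> b) + 2))" for b
    by (intro cont_diff_mult cont_diff_compose[OF cont_diff_affine_step cont_diff_inner])
  then have "cont_diff (\<lambda>y::'a. \<Prod>b\<in>Basis. step (2 * (y \<bullet> b) + 0) * step (- 2 * (y \<bullet> b) + 2))"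
    by (intro cont_diff_prod)
  then show ?thesis by (rule back_subst[of cont_diff]) (auto simp: kernel_def fun_eq_iff)
qed

lemma kernel_continuous: "continuous_on S kernel"
  by (rule cont_diff_continuous[OF cont_diff_kernel])

lemma kernel_nonneg: "0 \<le> kernel y"
  unfolding kernel_def by (intro prod_nonneg ballI mult_nonneg_nonneg step_bounds)

lemma kernel_outside:
  assumes "y \<notin> cbox 0 One" shows "kernel y = 0"
proof -
  from assms obtain b where b: "b \<in> Basis" "y \<bullet> b < 0 \<or> 1 < y \<bullet> b"
    by (auto simp: mem_box not_le)
  then have "step (2 * (y \<bullet> b)) * step (2 - 2 * (y \<bullet> b)) = 0" by (auto simp: step_le0)
  with b(1) show ?thesis unfolding kernel_def by (intro prod_zero) auto
qed

lemma kernel_integral_pos: "0 < integral (cbox 0 One) (kernel :: 'a::euclidean_space \<Rightarrow> real)"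
proof -
  have int: "(kernel :: 'a \<Rightarrow> real) integrable_on cbox 0 One"
    by (intro integrable_continuous cont_diff_continuous cont_diff_kernel)
  have "integral (cbox 0 One) (kernel :: 'a \<Rightarrow> real) \<noteq> 0"
  proof
    assume "integral (cbox 0 One) (kernel :: 'a \<Rightarrow> real) = 0"
    then have "(kernel has_integral 0) (cbox 0 (One::'a))" using int by (simp add: has_integral_iff)
    then have "kernel ((1/2) *\<^sub>R One :: 'a) = 0"
      by (rule has_integral_0_cbox_imp_0[rotated 2])
        (auto intro!: cont_diff_continuous cont_diff_kernel kernel_nonneg simp: mem_box box_ne_empty)
    moreover have "kernel ((1/2) *\<^sub>R One :: 'a) = 1"
      unfolding kernel_def by (rule prod.neutral) (simp add: step_ge1)
    ultimately show False by simp
  qed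
  then show ?thesis
    using integral_nonneg[OF int kernel_nonneg] by (simp add: less_le)
qed

definition mollify :: "real \<Rightarrow> ('a::euclidean_space \<Rightarrow> 'b::euclidean_space) \<Rightarrow> 'a \<Rightarrow> 'b" where
  "mollify \<delta> v x = (1 / integral (cbox 0 One) (kernel :: 'a \<Rightarrow> real)) *\<^sub>R
     integral (cbox 0 One) (\<lambda>y. kernel y *\<^sub>R v (x + \<delta> *\<^sub>R y))"

context
  fixes v :: "'a::euclidean_space \<Rightarrow> 'b::euclidean_space" and L \<delta> :: real
  assumes lip: "L-lipschitz_on UNIV v" and \<delta>: "0 < \<delta>" "\<delta> \<le> 1"
begin

lemma v_continuous: "continuous_on S v"
  using lipschitz_on_continuous_on[OF lip] continuous_on_subset by blast

lemma mollify_integrand_continuous: "continuous_on S (\<lambda>y. kernel y *\<^sub>R v (x + \<delta> *\<^sub>R y))"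
  by (intro continuous_intros cont_diff_continuous cont_diff_kernel continuous_on_compose2[OF v_continuous[of UNIV]]) auto

text \<open>Averages against the kernel satisfy the same bounds as the averaged function.  The Lipschitz
  constant and the error of the mollification are both read off from this.\<close>

lemma mollify_weighted_bound:
  assumes "continuous_on (cbox 0 One) g" "\<And>y. y \<in> cbox 0 One \<Longrightarrow> norm (g y) \<le> B"
  shows "norm (integral (cbox 0 One) (\<lambda>y::'a. kernel y *\<^sub>R (g y :: 'b)))
    \<le> B * integral (cbox 0 One) (kernel :: 'a \<Rightarrow> real)"
proof -
  have "norm (integral (cbox 0 One) (\<lambda>y::'a. kernel y *\<^sub>R (g y :: 'b)))
      \<le> integral (cbox 0 One) (\<lambda>y::'a. B * kernel y)"
  proof (rule integral_norm_bound_integral)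
    show "(\<lambda>y. kernel y *\<^sub>R g y) integrable_on cbox 0 One" "(\<lambda>y::'a. B * kernel y) integrable_on cbox 0 One"
      using assms(1) by (auto intro!: integrable_continuous continuous_intros kernel_continuous)
    show "norm (kernel y *\<^sub>R g y) \<le> B * kernel y" if "y \<in> cbox 0 One" for y
      using mult_left_mono[OF assms(2)[OF that] kernel_nonneg[of y]] kernel_nonneg[of y]
      by (simp add: mult.commute)
  qed
  then show ?thesis by simp
qed

lemma mollify_lipschitz: "L-lipschitz_on UNIV (mollify \<delta> v)"
proof (rule lipschitz_onI)
  show "0 \<le> L" using lip by (rule lipschitz_on_nonneg)
  fix x x' :: 'a
  define c where "c = integral (cbox 0 One) (kernel :: 'a \<Rightarrow> real)"
  have c: "c > 0" unfolding c_def by (rule kernel_integral_pos)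
  have i: "(\<lambda>y. kernel y *\<^sub>R v (x + \<delta> *\<^sub>R y)) integrable_on cbox 0 One" for x
    by (intro integrable_continuous mollify_integrand_continuous)
  have "mollify \<delta> v x - mollify \<delta> v x' =
      (1 / c) *\<^sub>R integral (cbox 0 One) (\<lambda>y. kernel y *\<^sub>R (v (x + \<delta> *\<^sub>R y) - v (x' + \<delta> *\<^sub>R y)))"
    unfolding mollify_def c_def scaleR_right_diff_distrib
    by (subst Henstock_Kurzweil_Integration.integral_diff[OF i i]) (simp add: scaleR_right_diff_distrib)
  moreover have "norm (integral (cbox 0 One) (\<lambda>y. kernel y *\<^sub>R (v (x + \<delta> *\<^sub>R y) - v (x' + \<delta> *\<^sub>R y))))
      \<le> (L * dist x x') * c"
    unfolding c_def
  proof (rule mollify_weighted_bound)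
    show "continuous_on (cbox 0 One) (\<lambda>y. v (x + \<delta> *\<^sub>R y) - v (x' + \<delta> *\<^sub>R y))"
      by (intro continuous_intros continuous_on_compose2[OF v_continuous[of UNIV]]) auto
    show "norm (v (x + \<delta> *\<^sub>R y) - v (x' + \<delta> *\<^sub>R y)) \<le> L * dist x x'" for y
      using lipschitz_onD[OF lip, of "x + \<delta> *\<^sub>R y" "x' + \<delta> *\<^sub>R y"] by (simp add: dist_norm)
  qed
  ultimately show "dist (mollify \<delta> v x) (mollify \<delta> v x') \<le> L * dist x x'"
    using c by (simp add: dist_norm field_simps)
qed

lemma mollify_close: "norm (mollify \<delta> v x - v x) \<le> L * \<delta> * norm (One :: 'a)"
proof -
  define c where "c = integral (cbox 0 One) (kernel :: 'a \<Rightarrow> real)"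
  have c: "c > 0" unfolding c_def by (rule kernel_integral_pos)
  have i: "(\<lambda>y::'a. kernel y *\<^sub>R v (x + \<delta> *\<^sub>R y)) integrable_on cbox 0 One"
    by (intro integrable_continuous mollify_integrand_continuous)
  have i': "(\<lambda>y::'a. kernel y *\<^sub>R v x) integrable_on cbox 0 One"
    by (intro integrable_continuous continuous_intros cont_diff_continuous cont_diff_kernel)
  have ki: "(kernel :: 'a \<Rightarrow> real) integrable_on cbox 0 One"
    by (intro integrable_continuous cont_diff_continuous cont_diff_kernel)
  have "integral (cbox 0 One) (\<lambda>y::'a. kernel y *\<^sub>R v x) = c *\<^sub>R v x"
    unfolding c_def using integral_linear[OF ki bounded_linear_scaleR_left[of "v x"]] by (simp add: o_def)
  then have "v x = (1 / c) *\<^sub>R integral (cbox 0 One) (\<lambda>y::'a. kernel y *\<^sub>R v x)"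
    using c by simp
  then have "mollify \<delta> v x - v x =
      (1 / c) *\<^sub>R (integral (cbox 0 One) (\<lambda>y::'a. kernel y *\<^sub>R v (x + \<delta> *\<^sub>R y)) - integral (cbox 0 One) (\<lambda>y::'a. kernel y *\<^sub>R v x))"
    unfolding scaleR_right_diff_distrib by (simp add: mollify_def c_def[symmetric])
  also have "\<dots> = (1 / c) *\<^sub>R integral (cbox 0 One) (\<lambda>y::'a. kernel y *\<^sub>R (v (x + \<delta> *\<^sub>R y) - v x))"
    by (subst Henstock_Kurzweil_Integration.integral_diff[OF i i', symmetric]) (simp add: scaleR_right_diff_distrib)
  finally have eq: "mollify \<delta> v x - v x = (1 / c) *\<^sub>R integral (cbox 0 One) (\<lambda>y::'a. kernel y *\<^sub>R (v (x + \<delta> *\<^sub>R y) - v x))" .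
  have "norm (integral (cbox 0 One) (\<lambda>y::'a. kernel y *\<^sub>R (v (x + \<delta> *\<^sub>R y) - v x)))
      \<le> (L * \<delta> * norm (One :: 'a)) * c"
    unfolding c_def
  proof (rule mollify_weighted_bound)
    show "continuous_on (cbox 0 One) (\<lambda>y. v (x + \<delta> *\<^sub>R y) - v x)"
      by (intro continuous_intros continuous_on_compose2[OF v_continuous[of UNIV]]) auto
    fix y :: 'a assume y: "y \<in> cbox 0 One"
    have "norm y \<le> norm (One :: 'a)"
      using y by (intro norm_le_componentwise) (auto simp: mem_box)
    have "norm (v (x + \<delta> *\<^sub>R y) - v x) \<le> L * (\<delta> * norm y)"
      using lipschitz_onD[OF lip, of "x + \<delta> *\<^sub>R y" x] \<delta> by (simp add: dist_norm)
    also have "\<dots> \<le> L * (\<delta> * norm (One :: 'a))"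
      using \<open>norm y \<le> norm One\<close> \<delta> lipschitz_on_nonneg[OF lip] by (intro mult_left_mono) auto
    finally show "norm (v (x + \<delta> *\<^sub>R y) - v x) \<le> L * \<delta> * norm (One :: 'a)" by (simp add: mult.assoc)
  qed
  then show ?thesis unfolding eq using c by (simp add: field_simps)
qed

text \<open>After the substitution \<open>z = x + \<delta> * y\<close> the parameter \<open>x\<close> occurs in the smooth kernel only, and for
  \<open>x\<close> near \<open>x0\<close> the domain of integration is fixed.  Hence one may differentiate under the
  integral although \<open>v\<close> is merely Lipschitz.\<close>

lemma mollify_fixed_domain:
  fixes x x0 :: 'a
  assumes x: "x \<in> box (x0 - One) (x0 + One)"
  shows "integral (cbox 0 One) (\<lambda>y. kernel y *\<^sub>R v (x + \<delta> *\<^sub>R y)) =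
    (1 / \<delta> ^ DIM('a)) *\<^sub>R integral (cbox (x0 - 2 *\<^sub>R One) (x0 + 2 *\<^sub>R One))
      (\<lambda>z. kernel ((1 / \<delta>) *\<^sub>R z + - (1 / \<delta>) *\<^sub>R x) *\<^sub>R v z)"
proof -
  define f where "f y = kernel y *\<^sub>R v (x + \<delta> *\<^sub>R y)" for y :: 'a
  have "(f has_integral integral (cbox 0 One) f) (cbox 0 One)"
    unfolding f_def by (intro integrable_integral integrable_continuous mollify_integrand_continuous)
  from has_integral_affinity[OF this, of "1 / \<delta>" "- (1 / \<delta>) *\<^sub>R x"] \<delta>
  have "((\<lambda>z. f ((1 / \<delta>) *\<^sub>R z + - (1 / \<delta>) *\<^sub>R x)) has_integral (\<delta> ^ DIM('a)) *\<^sub>R integral (cbox 0 One) f)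
      ((\<lambda>z. \<delta> *\<^sub>R z + x) ` cbox 0 One)"
    by (simp add: power_one_over)
  moreover have "f ((1 / \<delta>) *\<^sub>R z + - (1 / \<delta>) *\<^sub>R x) = kernel ((1 / \<delta>) *\<^sub>R z + - (1 / \<delta>) *\<^sub>R x) *\<^sub>R v z" for z
  proof -
    have "x + \<delta> *\<^sub>R ((1 / \<delta>) *\<^sub>R z + - (1 / \<delta>) *\<^sub>R x) = z"
      using \<delta> by (simp add: scaleR_right_diff_distrib)
    then show ?thesis unfolding f_def by metis
  qed
  ultimately have "((\<lambda>z. kernel ((1 / \<delta>) *\<^sub>R z + - (1 / \<delta>) *\<^sub>R x) *\<^sub>R v z) has_integral
      (\<delta> ^ DIM('a)) *\<^sub>R integral (cbox 0 One) f) ((\<lambda>z. \<delta> *\<^sub>R z + x) ` cbox 0 One)"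
    by simp
  then have "((\<lambda>z. kernel ((1 / \<delta>) *\<^sub>R z + - (1 / \<delta>) *\<^sub>R x) *\<^sub>R v z) has_integral
      (\<delta> ^ DIM('a)) *\<^sub>R integral (cbox 0 One) f) (cbox (x0 - 2 *\<^sub>R One) (x0 + 2 *\<^sub>R One))"
  proof (rule has_integral_on_superset)
    fix z assume "z \<notin> (\<lambda>z. \<delta> *\<^sub>R z + x) ` cbox 0 One"
    moreover have "z = \<delta> *\<^sub>R ((1 / \<delta>) *\<^sub>R z + - (1 / \<delta>) *\<^sub>R x) + x"
      using \<delta> by (simp add: scaleR_right_diff_distrib)
    ultimately have "(1 / \<delta>) *\<^sub>R z + - (1 / \<delta>) *\<^sub>R x \<notin> cbox 0 One" by blast
    from kernel_outside[OF this] show "kernel ((1 / \<delta>) *\<^sub>R z + - (1 / \<delta>) *\<^sub>R x) *\<^sub>R v z = 0" by simp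
  next
    show "(\<lambda>z. \<delta> *\<^sub>R z + x) ` cbox 0 One \<subseteq> cbox (x0 - 2 *\<^sub>R One) (x0 + 2 *\<^sub>R One)"
    proof (clarsimp simp: mem_box)
      fix y b :: 'a assume y: "\<forall>b\<in>Basis. 0 \<le> y \<bullet> b \<and> y \<bullet> b \<le> 1" and b: "b \<in> Basis"
      have xb: "x0 \<bullet> b - 1 < x \<bullet> b" "x \<bullet> b < x0 \<bullet> b + 1"
        using x b by (auto simp: mem_box inner_diff_left inner_add_left)
      have "0 \<le> \<delta> * (y \<bullet> b)" "\<delta> * (y \<bullet> b) \<le> 1"
        using y b \<delta> by (auto intro: mult_le_one)
      then show "(x0 - 2 *\<^sub>R One) \<bullet> b \<le> (\<delta> *\<^sub>R y + x) \<bullet> b \<and> (\<delta> *\<^sub>R y + x) \<bullet> b \<le> (x0 + 2 *\<^sub>R One) \<bullet> b"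
        using xb b by (simp add: inner_diff_left inner_add_left)
    qed
  qed
  then have "integral (cbox (x0 - 2 *\<^sub>R One) (x0 + 2 *\<^sub>R One))
      (\<lambda>z. kernel ((1 / \<delta>) *\<^sub>R z + - (1 / \<delta>) *\<^sub>R x) *\<^sub>R v z) = (\<delta> ^ DIM('a)) *\<^sub>R integral (cbox 0 One) f"
    by (rule integral_unique)
  then show ?thesis using \<delta> by (simp add: f_def[abs_def])
qed

lemma cont_diff_mollify: "cont_diff (mollify \<delta> v)"
proof (rule cont_diff_local)
  fix x0 :: 'a
  define U where "U = box (x0 - One) (x0 + One)"
  define Q where "Q = cbox (x0 - 2 *\<^sub>R One) (x0 + 2 *\<^sub>R One)"
  obtain k' where k': "\<And>y. (kernel has_derivative blinfun_apply (k' y)) (at (y :: 'a))" "continuous_on UNIV k'"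
    using cont_diff_kernel by (auto simp: cont_diff_def)
  define A where "A x z = (1 / \<delta>) *\<^sub>R z + - (1 / \<delta>) *\<^sub>R x" for x z :: 'a
  define fx where "fx x z = - ((1 / \<delta>) *\<^sub>R (blinfun_scaleR_left (v z) o\<^sub>L k' (A x z)))" for x z
  have der: "((\<lambda>x. kernel (A x z) *\<^sub>R v z) has_derivative blinfun_apply (fx x z)) (at x within S)" for x z S
  proof -
    have "((\<lambda>x. A x z) has_derivative (\<lambda>h. - (1 / \<delta>) *\<^sub>R h)) (at x)"
      unfolding A_def by (auto intro!: derivative_eq_intros)
    from has_derivative_compose[OF this k'(1)]
    have "((\<lambda>x. kernel (A x z)) has_derivative (\<lambda>h. blinfun_apply (k' (A x z)) (- (1 / \<delta>) *\<^sub>R h))) (at x)" .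
    then have "((\<lambda>x. kernel (A x z) *\<^sub>R v z) has_derivative
        (\<lambda>h. blinfun_apply (k' (A x z)) (- (1 / \<delta>) *\<^sub>R h) *\<^sub>R v z)) (at x)"
      by (rule has_derivative_scaleR_left)
    moreover have "(\<lambda>h. blinfun_apply (k' (A x z)) (- (1 / \<delta>) *\<^sub>R h) *\<^sub>R v z) = blinfun_apply (fx x z)"
      by (auto simp: fx_def fun_eq_iff blinfun.minus_left blinfun.scaleR_left blinfun.scaleR_right blinfun.minus_right)
    ultimately show ?thesis by (simp add: has_derivative_at_withinI)
  qed
  have cont: "continuous_on (U \<times> Q) (\<lambda>(x, z). fx x z)"
  proof -
    have "continuous_on (U \<times> Q) (\<lambda>p. k' (A (fst p) (snd p)))"
      by (rule continuous_on_compose2[OF k'(2)]) (auto simp: A_def intro!: continuous_intros)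
    moreover have "continuous_on (U \<times> Q) (\<lambda>p. v (snd p))"
      by (rule continuous_on_compose2[OF v_continuous[of UNIV]]) (auto intro!: continuous_intros)
    ultimately show ?thesis
      unfolding fx_def split_beta by (intro continuous_intros)
  qed
  have int: "(\<lambda>z. kernel (A x z) *\<^sub>R v z) integrable_on Q" for x
    unfolding Q_def A_def
    by (intro integrable_continuous continuous_intros v_continuous
        continuous_on_compose2[OF cont_diff_continuous[OF cont_diff_kernel, of UNIV]]) auto
  define C where "C = (1 / integral (cbox 0 One) (kernel :: 'a \<Rightarrow> real)) * (1 / \<delta> ^ DIM('a))"
  have eq: "mollify \<delta> v x = C *\<^sub>R integral Q (\<lambda>z. kernel (A x z) *\<^sub>R v z)" if "x \<in> U" for x
    unfolding mollify_def using mollify_fixed_domain[of x x0] that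
    by (simp add: U_def Q_def A_def C_def)
  have "((\<lambda>x. integral Q (\<lambda>z. kernel (A x z) *\<^sub>R v z)) has_derivative blinfun_apply (integral Q (fx x))) (at x within U)"
    if "x \<in> U" for x
    unfolding Q_def
    by (rule leibniz_rule) (use that der int cont in \<open>auto simp: Q_def U_def\<close>)
  then have "((\<lambda>x. C *\<^sub>R integral Q (\<lambda>z. kernel (A x z) *\<^sub>R v z)) has_derivative
      blinfun_apply (C *\<^sub>R integral Q (fx x))) (at x)" if "x \<in> U" for x
  proof -
    have "at x within U = at x" using at_within_open[OF that] by (simp add: U_def open_box)
    with \<open>\<And>x. x \<in> U \<Longrightarrow> (_ has_derivative _) (at x within U)\<close>[OF that]
    have "((\<lambda>x. integral Q (\<lambda>z. kernel (A x z) *\<^sub>R v z)) has_derivative blinfun_apply (integral Q (fx x))) (at x)"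
      by simp
    from has_derivative_scaleR_right[OF this, of C] show ?thesis
      by (simp add: scaleR_blinfun.rep_eq)
  qed
  then have "(mollify \<delta> v has_derivative blinfun_apply (C *\<^sub>R integral Q (fx x))) (at x)" if "x \<in> U" for x
    by (rule has_derivative_transform_within_open[OF _ _ that]) (use that eq in \<open>auto simp: U_def\<close>)
  moreover have "continuous_on U (\<lambda>x. C *\<^sub>R integral Q (fx x))"
    unfolding Q_def using cont
    by (intro continuous_intros integral_continuous_on_param) (simp add: Q_def)
  moreover have "x0 \<in> U" by (auto simp: U_def mem_box inner_diff_left inner_add_left)
  ultimately show "\<exists>U f'. open U \<and> x0 \<in> U \<and>
      (\<forall>x\<in>U. (mollify \<delta> v has_derivative blinfun_apply (f' x)) (at x)) \<and> continuous_on U f'"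
    by (intro exI[of _ U] exI[of _ "\<lambda>x. C *\<^sub>R integral Q (fx x)"]) (auto simp: U_def)
qed

end

text \<open>Mollification does not increase the Lipschitz constant.  This is essential: the constants enter
  an exponential in the estimates for the transport equation.\<close>

lemma lipschitz_smooth_approximation:
  fixes v :: "real ^ 'n \<Rightarrow> real ^ 'n"
  assumes lip: "L-lipschitz_on UNIV v" and e: "e > 0"
  shows "\<exists>w. cont_diff w \<and> L-lipschitz_on UNIV w \<and> (\<forall>x. norm (w x - v x) \<le> e) \<and>
    (periodic_fun v \<longrightarrow> periodic_fun w)"
proof -
  define M where "M = L * norm (One :: real ^ 'n) + 1"
  have M: "M > 0" using lipschitz_on_nonneg[OF lip] by (simp add: M_def add_nonneg_pos)
  define \<delta> where "\<delta> = min 1 (e / M)"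
  have \<delta>: "0 < \<delta>" "\<delta> \<le> 1" using M e by (auto simp: \<delta>_def)
  have "L * \<delta> * norm (One :: real ^ 'n) \<le> M * \<delta>" using \<delta> by (simp add: M_def algebra_simps)
  also have "\<dots> \<le> M * (e / M)" using M by (intro mult_left_mono) (auto simp: \<delta>_def)
  also have "\<dots> = e" using M by simp
  finally have "norm (mollify \<delta> v x - v x) \<le> e" for x
    using mollify_close[OF lip \<delta>, of x] by linarith
  moreover have "periodic_fun (mollify \<delta> v)" if "periodic_fun v"
  proof -
    have "v (x + axis i 1 + \<delta> *\<^sub>R y) = v (x + \<delta> *\<^sub>R y)" for x i y
    proof -
      have "x + axis i 1 + \<delta> *\<^sub>R y = (x + \<delta> *\<^sub>R y) + axis i 1" by simp
      then show ?thesis using that unfolding periodic_fun_def by metis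
    qed
    then show ?thesis unfolding periodic_fun_def mollify_def by simp
  qed
  ultimately show ?thesis
    using mollify_lipschitz[OF lip \<delta>] cont_diff_mollify[OF lip \<delta>] by blast
qed

section \<open>Composing small displacements\<close>

text \<open>Instead of solving for the flow, the initial value \<open>a\<close> is transported by a composition of
  explicit small displacements: in the \<open>j\<close>-th time slab it is precomposed with
  \<open>x \<mapsto> x - \<Theta> j t *\<^sub>R v j x\<close>, where \<open>\<Theta> j\<close> grows from \<open>0\<close> to at most \<open>T\<close> at speed \<open>\<theta> j\<close>.
  Later displacements act on the inside, so each one is followed by the composition already built.
  The spatial gradient grows by the factor \<open>1 + T * L i\<close> per slab.  Within slab \<open>j\<close> the derivative
  along \<open>(w, 1)\<close> is the gradient applied to \<open>w - \<theta> j t *\<^sub>R v j x\<close>, up to the derivative of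
  \<open>v j\<close>, which contributes the factor \<open>T * L j\<close> and is therefore small for short slabs.\<close>

lemma transport_chain:
  fixes a :: "real ^ 'n \<Rightarrow> real" and v :: "nat \<Rightarrow> real ^ 'n \<Rightarrow> real ^ 'n"
    and \<Theta> \<theta> :: "nat \<Rightarrow> real \<Rightarrow> real" and s :: "nat \<Rightarrow> real"
  assumes a: "cont_diff a" "\<And>x h. \<bar>frechet_derivative a (at x) h\<bar> \<le> K * norm h" "per \<Longrightarrow> periodic_fun a"
    and v: "\<And>j. cont_diff (v j)" "\<And>j. (L j)-lipschitz_on UNIV (v j)" "\<And>j. per \<Longrightarrow> periodic_fun (v j)"
    and \<Theta>: "\<And>j t. (\<Theta> j has_real_derivative \<theta> j t) (at t)" "\<And>j. continuous_on UNIV (\<theta> j)"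
      "\<And>j t. 0 \<le> \<Theta> j t" "\<And>j t. \<Theta> j t \<le> T"
    and before: "\<And>j t. t \<le> s j \<Longrightarrow> \<Theta> j t = 0 \<and> \<theta> j t = 0"
    and after: "\<And>j t. s (Suc j) \<le> t \<Longrightarrow> \<theta> j t = 0"
    and s: "mono s"
  shows "\<exists>F. cont_diff F \<and> (\<forall>x t. t \<le> s 0 \<longrightarrow> F (x, t) = a x) \<and>
    (per \<longrightarrow> (\<forall>t. periodic_fun (\<lambda>x. F (x, t)))) \<and>
    (\<forall>x t h r. s N \<le> t \<longrightarrow> frechet_derivative F (at (x, t)) (h, r) = frechet_derivative F (at (x, t)) (h, 0)) \<and>
    (\<forall>x t h. \<bar>frechet_derivative F (at (x, t)) (h, 0)\<bar> \<le> K * (\<Prod>i<N. 1 + T * L i) * norm h) \<and>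
    (\<forall>j<N. \<forall>t\<in>{s j..s (Suc j)}. \<forall>x w. \<bar>frechet_derivative F (at (x, t)) (w, 1)\<bar>
       \<le> K * (\<Prod>i<N. 1 + T * L i) * (norm (w - \<theta> j t *\<^sub>R v j x) + T * L j * norm w))"
proof (induction N)
  case 0
  have "frechet_derivative (\<lambda>z. a (fst z)) (at (x, t)) (h, r) = frechet_derivative a (at x) h"
    for x h and t r :: real
    using frechet_derivative_comp[OF a(1) cont_diff_fst, of "(x, t)" "(h, r)"]
      frechet_derivative_at[OF bounded_linear_imp_has_derivative[OF bounded_linear_fst], of "(x, t)"]
    by (metis fst_conv)
  then show ?case
    using a cont_diff_compose[OF a(1) cont_diff_fst]
    by (intro exI[of _ "\<lambda>z. a (fst z)"]) auto
next
  case (Suc N)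
  then obtain F where F: "cont_diff F"
    and init: "\<And>x t. t \<le> s 0 \<Longrightarrow> F (x, t) = a x"
    and per: "\<And>t. per \<Longrightarrow> periodic_fun (\<lambda>x. F (x, t))"
    and still: "\<And>x t h r. s N \<le> t \<Longrightarrow> frechet_derivative F (at (x, t)) (h, r) = frechet_derivative F (at (x, t)) (h, 0)"
    and grad: "\<And>x t h. \<bar>frechet_derivative F (at (x, t)) (h, 0)\<bar> \<le> K * (\<Prod>i<N. 1 + T * L i) * norm h"
    and slab: "\<And>j t x w. j < N \<Longrightarrow> t \<in> {s j..s (Suc j)} \<Longrightarrow> \<bar>frechet_derivative F (at (x, t)) (w, 1)\<bar>
       \<le> K * (\<Prod>i<N. 1 + T * L i) * (norm (w - \<theta> j t *\<^sub>R v j x) + T * L j * norm w)"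
    apply (elim exE conjE)
    subgoal for F by (rule that[of F]) (assumption | blast)+
    done
  define P where "P = K * (\<Prod>i<N. 1 + T * L i)"
  have P': "K * (\<Prod>i<Suc N. 1 + T * L i) = P * (1 + T * L N)" by (simp add: P_def)
  have T: "0 \<le> T" by (rule order_trans[OF \<Theta>(3) \<Theta>(4)])
  have L: "0 \<le> L j" for j using v(2) by (rule lipschitz_on_nonneg)
  have "0 \<le> K * norm (axis undefined 1 :: real ^ 'n)" by (rule order_trans[OF abs_ge_zero a(2)])
  then have K: "0 \<le> K" by simp
  have P: "0 \<le> P" unfolding P_def using K T L by (intro mult_nonneg_nonneg prod_nonneg) auto
  have PP': "P \<le> P * (1 + T * L N)" using P T L[of N] by (simp add: algebra_simps)
  \<comment> \<open>the displacement of slab \<open>N\<close>: the identity before time \<open>s N\<close>, and stationary after the slab\<close>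
  define G where "G z = (fst z - \<Theta> N (snd z) *\<^sub>R v N (fst z), snd z)" for z :: "(real ^ 'n) \<times> real"
  have cd\<Theta>: "cont_diff (\<Theta> N)" by (rule cont_diff_real[OF \<Theta>(1,2)])
  have cdG: "cont_diff G"
    unfolding G_def[abs_def]
    by (intro cont_diff_intros cont_diff_fst cont_diff_snd cont_diff_compose[OF cd\<Theta> cont_diff_snd]
        cont_diff_compose[OF v(1) cont_diff_fst])
  have DG: "frechet_derivative G (at (x, t)) (h, r) =
      (h - \<Theta> N t *\<^sub>R frechet_derivative (v N) (at x) h - (r * \<theta> N t) *\<^sub>R v N x, r)" for x t h r
  proof -
    have "((\<lambda>z. v N (fst z)) has_derivative (\<lambda>k. frechet_derivative (v N) (at x) (fst k))) (at (x, t))"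
      using has_derivative_compose[OF bounded_linear_imp_has_derivative[OF bounded_linear_fst], of "v N" _ "(x, t)"]
        cont_diff_has_derivative[OF v(1), of N x] by simp
    moreover have "((\<lambda>z. \<Theta> N (snd z)) has_derivative (\<lambda>k. \<theta> N t * snd k)) (at (x, t))"
      using has_derivative_compose[OF bounded_linear_imp_has_derivative[OF bounded_linear_snd], of "\<Theta> N" _ "(x, t)"]
        \<Theta>(1)[of N t, unfolded has_field_derivative_def] by simp
    ultimately have "((\<lambda>z. \<Theta> N (snd z) *\<^sub>R v N (fst z)) has_derivative
        (\<lambda>k. \<Theta> N t *\<^sub>R frechet_derivative (v N) (at x) (fst k) + (\<theta> N t * snd k) *\<^sub>R v N x)) (at (x, t))"
      using has_derivative_scaleR[of "\<lambda>z. \<Theta> N (snd z)" _ "(x, t)" UNIV "\<lambda>z. v N (fst z)"] by fastforce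
    then have "(G has_derivative (\<lambda>k. (fst k - (\<Theta> N t *\<^sub>R frechet_derivative (v N) (at x) (fst k)
        + (\<theta> N t * snd k) *\<^sub>R v N x), snd k))) (at (x, t))"
      unfolding G_def[abs_def]
      by (intro has_derivative_Pair has_derivative_diff bounded_linear_imp_has_derivative
          bounded_linear_fst bounded_linear_snd)
    from frechet_derivative_at[OF this, symmetric] show ?thesis
      by (simp add: diff_diff_eq mult.commute)
  qed
  define H where "H z = F (G z)" for z
  have cdH: "cont_diff H" unfolding H_def[abs_def] by (rule cont_diff_compose[OF F cdG])
  have DH: "frechet_derivative H (at (x, t)) (h, r) = frechet_derivative F (at (x - \<Theta> N t *\<^sub>R v N x, t))
      (h - \<Theta> N t *\<^sub>R frechet_derivative (v N) (at x) h - (r * \<theta> N t) *\<^sub>R v N x, r)" for x t h r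
    unfolding H_def[abs_def] using frechet_derivative_comp[OF F cdG, of "(x, t)" "(h, r)"]
    by (simp add: DG) (simp add: G_def)
  have Dv: "norm (\<Theta> N t *\<^sub>R frechet_derivative (v N) (at x) h) \<le> T * L N * norm h" for x t h
  proof -
    have "norm (\<Theta> N t *\<^sub>R frechet_derivative (v N) (at x) h) \<le> T * (L N * norm h)"
      using frechet_derivative_bound_lipschitz[OF v(1,2), of N x h] \<Theta>(3,4)[of N t] T
      by (simp add: mult_mono)
    then show ?thesis by (simp add: mult.assoc)
  qed
  have sN: "s j \<le> s k" if "j \<le> k" for j k using s that by (rule monoD)
  show ?case
    unfolding P'
  proof (intro exI[of _ H] conjI allI impI ballI)
    show "cont_diff H" by (rule cdH)
    show "H (x, t) = a x" if "t \<le> s 0" for x t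
      using init[OF that] before[of t N] sN[of 0 N] that by (simp add: H_def G_def)
    show "periodic_fun (\<lambda>x. H (x, t))" if "per" for t
    proof -
      have "x + axis i 1 - \<Theta> N t *\<^sub>R v N (x + axis i 1) = (x - \<Theta> N t *\<^sub>R v N x) + axis i 1" for x i
        using v(3)[OF that, of N] by (simp add: periodic_fun_def)
      then show ?thesis
        using per[OF that, of t] unfolding periodic_fun_def H_def G_def fst_conv snd_conv by metis
    qed
    show "frechet_derivative H (at (x, t)) (h, r) = frechet_derivative H (at (x, t)) (h, 0)"
      if "s (Suc N) \<le> t" for x t h r
      unfolding DH using after[OF that] still[of t _ _ r] sN[of N "Suc N"] that by simp
    show "\<bar>frechet_derivative H (at (x, t)) (h, 0)\<bar> \<le> P * (1 + T * L N) * norm h" for x t h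
    proof -
      have "\<bar>frechet_derivative H (at (x, t)) (h, 0)\<bar> \<le> P * norm (h - \<Theta> N t *\<^sub>R frechet_derivative (v N) (at x) h)"
        unfolding DH P_def using grad by simp
      also have "\<dots> \<le> P * (norm h + T * L N * norm h)"
        using Dv[of t x h] P by (intro mult_left_mono order_trans[OF norm_triangle_ineq4]) auto
      finally show ?thesis by (simp add: algebra_simps)
    qed
    show "\<bar>frechet_derivative H (at (x, t)) (w, 1)\<bar>
        \<le> P * (1 + T * L N) * (norm (w - \<theta> j t *\<^sub>R v j x) + T * L j * norm w)"
      if j: "j < Suc N" and t: "t \<in> {s j..s (Suc j)}" for j t x w
    proof -
      have nn: "0 \<le> norm (w - \<theta> j t *\<^sub>R v j x) + T * L j * norm w" using T L[of j] by simp
      have "\<bar>frechet_derivative H (at (x, t)) (w, 1)\<bar> \<le> P * (norm (w - \<theta> j t *\<^sub>R v j x) + T * L j * norm w)"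
      proof (cases "j < N")
        case True
        then have "t \<le> s N" using t sN[of "Suc j" N] by auto
        then show ?thesis using slab[OF True t] before[of t N] unfolding DH P_def by simp
      next
        case False
        then have [simp]: "j = N" using j by simp
        have "\<bar>frechet_derivative H (at (x, t)) (w, 1)\<bar> =
            \<bar>frechet_derivative F (at (x - \<Theta> N t *\<^sub>R v N x, t))
              (w - \<Theta> N t *\<^sub>R frechet_derivative (v N) (at x) w - \<theta> N t *\<^sub>R v N x, 0)\<bar>"
          unfolding DH using still[of t _ _ 1] t by simp
        also have "\<dots> \<le> P * norm (w - \<Theta> N t *\<^sub>R frechet_derivative (v N) (at x) w - \<theta> N t *\<^sub>R v N x)"
          unfolding P_def by (rule grad)
        also have "\<dots> = P * norm ((w - \<theta> N t *\<^sub>R v N x) - \<Theta> N t *\<^sub>R frechet_derivative (v N) (at x) w)"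
          by (simp add: diff_diff_eq add.commute)
        also have "\<dots> \<le> P * (norm (w - \<theta> N t *\<^sub>R v N x) + T * L N * norm w)"
          using Dv[of t x w] P by (intro mult_left_mono order_trans[OF norm_triangle_ineq4]) auto
        finally show ?thesis by simp
      qed
      also have "\<dots> \<le> P * (1 + T * L N) * (norm (w - \<theta> j t *\<^sub>R v j x) + T * L j * norm w)"
        by (rule mult_right_mono[OF PP' nn])
      finally show ?thesis .
    qed
  qed
qed

section \<open>Time profiles\<close>

text \<open>A continuous trapezoid: \<open>1\<close> on \<open>[a + \<kappa>, b - \<kappa>]\<close> and \<open>0\<close> outside \<open>[a, b]\<close>.  The displacement
  of a slab is switched on and off with it, so that consecutive slabs fit together continuously
  differentiably.\<close>

definition ramp :: "real \<Rightarrow> real \<Rightarrow> real \<Rightarrow> real \<Rightarrow> real" where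
  "ramp \<kappa> a b t = (max 0 (t - a) - max 0 (t - a - \<kappa>) - max 0 (t - b + \<kappa>) + max 0 (t - b)) / \<kappa>"

definition ramp_int :: "real \<Rightarrow> real \<Rightarrow> real \<Rightarrow> real \<Rightarrow> real" where
  "ramp_int \<kappa> a b t =
     (pos_sq (t - a) - pos_sq (t - a - \<kappa>) - pos_sq (t - b + \<kappa>) + pos_sq (t - b)) / (2 * \<kappa>)"

context
  fixes \<kappa> a b :: real
  assumes \<kappa>: "0 < \<kappa>" "2 * \<kappa> \<le> b - a"
begin

lemma ramp_int_deriv: "(ramp_int \<kappa> a b has_real_derivative ramp \<kappa> a b t) (at t)"
proof -
  have shift: "((\<lambda>y. pos_sq (y - c)) has_real_derivative 2 * max 0 (y - c)) (at y)" for c y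
    using DERIV_chain2[where f = pos_sq and g = "\<lambda>y. y - c", OF pos_sq_deriv, of 1 y UNIV]
    by (simp add: DERIV_diff[where E = 0, simplified])
  have "((\<lambda>t. (pos_sq (t - a) - pos_sq (t - (a + \<kappa>)) - pos_sq (t - (b - \<kappa>)) + pos_sq (t - b)) / (2 * \<kappa>))
      has_real_derivative (2 * max 0 (t - a) - 2 * max 0 (t - (a + \<kappa>)) - 2 * max 0 (t - (b - \<kappa>))
        + 2 * max 0 (t - b)) / (2 * \<kappa>)) (at t)"
    by (intro DERIV_cdivide DERIV_add DERIV_diff shift)
  moreover have "(2 * max 0 (t - a) - 2 * max 0 (t - (a + \<kappa>)) - 2 * max 0 (t - (b - \<kappa>))
        + 2 * max 0 (t - b)) / (2 * \<kappa>) = ramp \<kappa> a b t"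
    using \<kappa> by (simp add: ramp_def field_simps)
  moreover have "t - (a + \<kappa>) = t - a - \<kappa>" "t - (b - \<kappa>) = t - b + \<kappa>" for t by auto
  ultimately show ?thesis unfolding ramp_int_def[abs_def] by simp
qed

lemma ramp_continuous: "continuous_on S (ramp \<kappa> a b)"
  unfolding ramp_def[abs_def] using \<kappa> by (intro continuous_intros) auto

lemma ramp_bounds: "0 \<le> ramp \<kappa> a b t" "ramp \<kappa> a b t \<le> 1"
  using \<kappa> by (auto simp: ramp_def max_def field_simps)

lemma ramp_outside: "t \<le> a \<or> b \<le> t \<Longrightarrow> ramp \<kappa> a b t = 0"
  using \<kappa> by (auto simp: ramp_def max_def field_simps)

lemma ramp_inside: "a + \<kappa> \<le> t \<Longrightarrow> t \<le> b - \<kappa> \<Longrightarrow> ramp \<kappa> a b t = 1"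
  using \<kappa> by (auto simp: ramp_def max_def field_simps)

lemma ramp_int_before: "t \<le> a \<Longrightarrow> ramp_int \<kappa> a b t = 0"
  using \<kappa> by (auto simp: ramp_int_def pos_sq_def max_def)

lemma ramp_int_nonneg: "0 \<le> ramp_int \<kappa> a b t"
proof -
  have "ramp_int \<kappa> a b (min a t) \<le> ramp_int \<kappa> a b t"
    by (rule DERIV_nonneg_imp_nondecreasing) (use ramp_int_deriv ramp_bounds in auto)
  then show ?thesis using ramp_int_before[of "min a t"] by simp
qed

lemma ramp_int_le: "ramp_int \<kappa> a b t \<le> b - a"
proof -
  have *: "ramp_int \<kappa> a b t \<le> b - a" if "t \<le> b" for t
  proof (cases "t \<le> a")
    case True then show ?thesis using ramp_int_before \<kappa> by simp
  next
    case False
    have "\<exists>y. ((\<lambda>t. t - ramp_int \<kappa> a b t) has_real_derivative y) (at x) \<and> 0 \<le> y" for x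
      using DERIV_diff[OF DERIV_ident ramp_int_deriv[of x]] ramp_bounds(2)[of x]
      by (intro exI[of _ "1 - ramp \<kappa> a b x"]) auto
    then have "a - ramp_int \<kappa> a b a \<le> t - ramp_int \<kappa> a b t"
      using DERIV_nonneg_imp_nondecreasing[of a t "\<lambda>t. t - ramp_int \<kappa> a b t"] False by simp
    then show ?thesis using ramp_int_before[of a] that by simp
  qed
  show ?thesis
  proof (cases "t \<le> b")
    case False
    have "\<exists>y. (ramp_int \<kappa> a b has_real_derivative y) (at x) \<and> y \<le> 0" if "b \<le> x" for x
      using ramp_int_deriv[of x] ramp_outside[of x] that by auto
    then have "ramp_int \<kappa> a b t \<le> ramp_int \<kappa> a b b"
      using DERIV_nonpos_imp_nonincreasing[of b t "ramp_int \<kappa> a b"] False by simp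
    then show ?thesis using *[of b] by simp
  qed (rule *)
qed

end

lemma ramp_reflect: "ramp \<kappa> (c - b) (c - a) (c - t) = ramp \<kappa> a b t"
  unfolding ramp_def by (auto simp: max_def divide_simps)

section \<open>Functions of time on space-time\<close>

lemma spacetime_dom_Times: "spacetime_dom = space_dom \<times> {0..1}"
  by (simp add: spacetime_dom_def)

lemma integrable_snd_Times:
  fixes f :: "'b::euclidean_space \<Rightarrow> real" and A B :: "'a::euclidean_space"
  assumes T: "T \<in> sets lebesgue" and f: "integrable (lebesgue_on T) f"
  shows "integrable (lebesgue_on (cbox A B \<times> T)) (\<lambda>z. f (snd z))"
proof -
  have ST: "cbox A B \<times> T \<in> sets lebesgue" using T by (intro lebesgue_Times) auto
  define g where "g t = indicator T t *\<^sub>R f t" for t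
  have g: "integrable lebesgue g"
    using f T unfolding g_def by (subst (asm) integrable_restrict_space) auto
  obtain h where h: "h \<in> borel_measurable lborel" and ae: "AE t in lborel. g t = h t"
    using completion_ex_borel_measurable_real[OF borel_measurable_integrable[OF g]] by blast
  have hl: "h \<in> borel_measurable lebesgue" using h by (rule measurable_completion)
  have "integrable lebesgue h" using g hl AE_completion[OF ae] by (rule integrable_cong_AE_imp)
  then have hi: "integrable lborel h" using h by (simp add: integrable_completion)
  define H where "H z = indicator (cbox A B) (fst z) * h (snd z)" for z :: "'a \<times> 'b"
  have "(\<lambda>z::'a \<times> 'b. indicator (cbox A B) (fst z) :: real) \<in> borel_measurable (lborel \<Otimes>\<^sub>M lborel)"
    by (rule measurable_compose[OF measurable_fst]) simp
  moreover have "(\<lambda>z::'a \<times> 'b. h (snd z)) \<in> borel_measurable (lborel \<Otimes>\<^sub>M lborel)"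
    by (rule measurable_compose[OF measurable_snd h])
  ultimately have H: "H \<in> borel_measurable (lborel \<Otimes>\<^sub>M lborel)"
    unfolding H_def by (rule borel_measurable_times)
  have "integrable (lborel \<Otimes>\<^sub>M lborel) H"
  proof (rule lborel_pair.Fubini_integrable[OF H])
    have "integrable lborel (\<lambda>x. indicator (cbox A B) x *\<^sub>R (LBINT y. \<bar>h y\<bar>) :: real)"
      by (intro integrable_scaleR_left integrable_real_indicator) (auto simp: emeasure_lborel_cbox_eq)
    then show "integrable lborel (\<lambda>x. LBINT y. norm (H (x, y)))"
      by (simp add: H_def abs_mult)
    show "AE x in lborel. integrable lborel (\<lambda>y. H (x, y))"
      using hi by (simp add: H_def)
  qed
  then have "integrable lborel H" by (simp add: lborel_prod)
  moreover have H': "H \<in> borel_measurable lborel" using H by (simp add: lborel_prod)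
  ultimately have Hl: "integrable lebesgue H" by (simp add: integrable_completion)
  have fm: "(\<lambda>z. f (snd z)) \<in> borel_measurable (lebesgue_on (cbox A B \<times> T))"
    using f T by (intro lebesgue_on_measurable_snd) auto
  have "(\<lambda>z. indicator (cbox A B \<times> T) z *\<^sub>R f (snd z)) \<in> borel_measurable lebesgue"
  proof -
    have "(\<lambda>z. if z \<in> cbox A B \<times> T then f (snd z) else 0) \<in> borel_measurable lebesgue"
      using borel_measurable_if[OF ST, of "\<lambda>z. f (snd z)"] fm by blast
    moreover have "(\<lambda>z. if z \<in> cbox A B \<times> T then f (snd z) else 0)
        = (\<lambda>z. indicator (cbox A B \<times> T) z *\<^sub>R f (snd z))"
      by (auto simp: fun_eq_iff indicator_def)
    ultimately show ?thesis by simp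
  qed
  moreover have "AE z in lebesgue. H z = indicator (cbox A B \<times> T) z *\<^sub>R f (snd z)"
    using AE_lebesgue_snd[OF AE_completion[OF ae]]
  proof (rule eventually_mono)
    fix z :: "'a \<times> 'b" assume "g (snd z) = h (snd z)"
    then show "H z = indicator (cbox A B \<times> T) z *\<^sub>R f (snd z)"
      by (cases "snd z \<in> T"; cases z) (auto simp: H_def g_def indicator_def)
  qed
  ultimately have "integrable lebesgue (\<lambda>z. indicator (cbox A B \<times> T) z *\<^sub>R f (snd z))"
    using Hl by - (rule integrable_cong_AE_imp)
  then show ?thesis using ST by (subst integrable_restrict_space) auto
qed

lemma measure_space_dom: "measure lebesgue (space_dom :: (real ^ 'n) set) = 1"
proof -
  have "measure lborel (cbox 0 (1 :: real ^ 'n)) = (\<Prod>b\<in>Basis. (1 - 0 :: real ^ 'n) \<bullet> b)"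
    by (intro measure_lborel_cbox) (simp add: unit_space)
  also have "\<dots> = 1" by (intro prod.neutral) (simp add: unit_space)
  finally show ?thesis by (simp add: space_dom_def)
qed

lemma integral_snd_spacetime:
  fixes f :: "real \<Rightarrow> real"
  assumes f: "integrable (lebesgue_on {0..1}) f"
  shows "(LINT z|lebesgue_on (spacetime_dom :: ((real ^ 'n) \<times> real) set). f (snd z))
    = (LINT t|lebesgue_on {0..1}. f t)"
proof -
  have i: "integrable (lebesgue_on ((space_dom :: (real ^ 'n) set) \<times> {0..1})) (\<lambda>z. f (snd z))"
    unfolding space_dom_def using f by (intro integrable_snd_Times) auto
  have eq: "(LINT x|lebesgue_on (space_dom :: (real ^ 'n) set). f t) = f t" for t
  proof -
    have "measure (lebesgue_on (space_dom :: (real ^ 'n) set)) space_dom = 1"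
      using measure_space_dom by (subst measure_restrict_space) auto
    then show ?thesis by simp
  qed
  have "(LINT z|lebesgue_on ((space_dom :: (real ^ 'n) set) \<times> {0..1}). f (snd z))
      = (LINT t|lebesgue_on {0..1}. LINT x|lebesgue_on (space_dom :: (real ^ 'n) set). f (snd (x, t)))"
    by (rule lebesgue_Fubini(3)[OF _ _ i]) auto
  then show ?thesis unfolding spacetime_dom_Times snd_conv eq .
qed

lemma L2_snd:
  fixes r :: "real \<Rightarrow> real"
  assumes r: "L2 {0..1} r"
  shows "L2 (spacetime_dom :: ((real ^ 'n) \<times> real) set) (\<lambda>z. r (snd z))"
    and "l2_norm (spacetime_dom :: ((real ^ 'n) \<times> real) set) (\<lambda>z. r (snd z)) = l2_norm {0..1} r"
proof -
  show "L2 (spacetime_dom :: ((real ^ 'n) \<times> real) set) (\<lambda>z. r (snd z))"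
    using r lebesgue_on_measurable_snd[of "space_dom :: (real ^ 'n) set" "{0..1}" r]
      integrable_snd_Times[of "{0..1}" "\<lambda>t. (r t)\<^sup>2" "0 :: real ^ 'n" 1]
    unfolding L2_def spacetime_dom_Times space_dom_def by auto
  have "(l2_norm (spacetime_dom :: ((real ^ 'n) \<times> real) set) (\<lambda>z. r (snd z)))\<^sup>2 = (l2_norm {0..1} r)\<^sup>2"
    unfolding l2_norm_power2_integral
    using r integral_snd_spacetime[of "\<lambda>t. (r t)\<^sup>2"] by (auto simp: L2_def)
  then show "l2_norm (spacetime_dom :: ((real ^ 'n) \<times> real) set) (\<lambda>z. r (snd z)) = l2_norm {0..1} r"
    by (simp add: l2_norm_nonneg)
qed

lemma AE_spacetime_snd:
  assumes "AE t in lebesgue_on {0..1}. P t"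
  shows "AE z in lebesgue_on spacetime_dom. P (snd z)"
  unfolding spacetime_dom_Times using assms by (intro AE_lebesgue_on_snd) auto

lemma AE_spacetime_zero_if_sections:
  fixes f :: "(real ^ 'n) \<times> real \<Rightarrow> real"
  assumes "f \<in> borel_measurable (lebesgue_on spacetime_dom)"
    and "AE t in lebesgue_on {0..1}. AE x in lebesgue_on space_dom. f (x, t) = 0"
  shows "AE z in lebesgue_on spacetime_dom. f z = 0"
  using assms unfolding spacetime_dom_Times by (intro AE_lebesgue_on_zero_if_sections) auto

section \<open>The transport derivative of continuously differentiable functions\<close>

text \<open>The derivative \<open>\<partial>\<^sub>t F + u \<bullet> \<nabla> F\<close> in the classical sense.\<close>

definition tder :: "(real \<Rightarrow> real ^ 'n \<Rightarrow> real ^ 'n) \<Rightarrow> ((real ^ 'n) \<times> real \<Rightarrow> real) \<Rightarrow> (real ^ 'n) \<times> real \<Rightarrow> real" where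
  "tder u F z = frechet_derivative F (at z) (u (snd z) (fst z), 1)"

lemma C1_closed_cont_diff: "C1_closed per F \<Longrightarrow> cont_diff F"
  by (simp add: C1_closed_def C1_iff_cont_diff)

lemma C1_closed_mult: "C1_closed per F \<Longrightarrow> C1_closed per G \<Longrightarrow> C1_closed per (\<lambda>z. F z * G z)"
  by (auto simp: C1_closed_def C1_iff_cont_diff periodic_fun_def intro: cont_diff_mult)

lemma C1_closed_combination:
  "C1_closed per F \<Longrightarrow> C1_closed per G \<Longrightarrow> C1_closed per (\<lambda>z. F z + c * G z)"
  by (auto simp: C1_closed_def C1_iff_cont_diff periodic_fun_def intro!: cont_diff_add cont_diff_mult)

lemma C1_closed_time: "cont_diff f \<Longrightarrow> C1_closed per (\<lambda>z. f (snd z))"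
  using cont_diff_compose[OF _ cont_diff_snd]
  by (auto simp: C1_closed_def C1_iff_cont_diff periodic_fun_def)

lemma C1_closed_test_fun: "spacetime_test_fun per \<psi> \<Longrightarrow> C1_closed per \<psi>"
  by (auto simp: C1_closed_def spacetime_test_fun_def)

lemma tder_mult: "cont_diff F \<Longrightarrow> cont_diff G \<Longrightarrow> tder u (\<lambda>z. F z * G z) z = F z * tder u G z + tder u F z * G z"
  unfolding tder_def by (rule frechet_derivative_mult)

lemma tder_add: "cont_diff F \<Longrightarrow> cont_diff G \<Longrightarrow> tder u (\<lambda>z. F z + G z) z = tder u F z + tder u G z"
  unfolding tder_def by (rule frechet_derivative_add)

lemma tder_diff: "cont_diff F \<Longrightarrow> cont_diff G \<Longrightarrow> tder u (\<lambda>z. F z - G z) z = tder u F z - tder u G z"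
  unfolding tder_def by (rule frechet_derivative_diff)

lemma tder_time: "cont_diff f \<Longrightarrow> tder u (\<lambda>z. f (snd z)) z = frechet_derivative f (at (snd z)) 1"
proof -
  assume "cont_diff f"
  from frechet_derivative_comp[OF this cont_diff_snd, of z]
  show ?thesis unfolding tder_def
    using frechet_derivative_at[OF bounded_linear_imp_has_derivative[OF bounded_linear_snd], of z]
    by (metis snd_conv)
qed

lemma vec_Basis_sum: "(h :: real ^ 'n) = (\<Sum>i\<in>UNIV. (h $ i) *\<^sub>R axis i 1)"
  by (simp add: vec_eq_iff axis_def if_distrib[of "\<lambda>x. _ * x"] cong: if_cong)

lemma frechet_derivative_spacetime:
  fixes F :: "(real ^ 'n) \<times> real \<Rightarrow> real"
  assumes "cont_diff F"
  shows "frechet_derivative F (at z) (h, r) =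
    (\<Sum>i\<in>UNIV. h $ i * frechet_derivative F (at z) (axis i 1, 0)) + r * frechet_derivative F (at z) (0, 1)"
proof -
  interpret D: linear "frechet_derivative F (at z)" by (rule frechet_derivative_linear[OF assms])
  have "(h, r) = (\<Sum>i\<in>UNIV. (h $ i) *\<^sub>R (axis i 1, 0)) + r *\<^sub>R (0, 1 :: real)"
    using vec_Basis_sum[of h] by (auto simp: prod_eq_iff fst_sum snd_sum)
  then have "frechet_derivative F (at z) (h, r) =
      frechet_derivative F (at z) ((\<Sum>i\<in>UNIV. (h $ i) *\<^sub>R (axis i 1, 0)) + r *\<^sub>R (0, 1))"
    by simp
  also have "\<dots> = (\<Sum>i\<in>UNIV. h $ i * frechet_derivative F (at z) (axis i 1, 0)) + r * frechet_derivative F (at z) (0, 1)"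
    by (simp only: D.add D.sum D.scale real_scaleR_def)
  finally show ?thesis .
qed

lemma continuous_bounded_spacetime:
  fixes f :: "(real ^ 'n) \<times> real \<Rightarrow> real"
  assumes "continuous_on UNIV f"
  shows "\<exists>B\<ge>0. \<forall>z\<in>spacetime_dom. \<bar>f z\<bar> \<le> B"
proof -
  have "compact (f ` spacetime_dom)"
    unfolding spacetime_dom_cbox
    by (intro compact_continuous_image continuous_on_subset[OF assms]) auto
  then have "bounded (f ` spacetime_dom)" by (rule compact_imp_bounded)
  then obtain B where "\<forall>z\<in>spacetime_dom. \<bar>f z\<bar> \<le> B" unfolding bounded_iff by auto
  then show ?thesis by (intro exI[of _ "max 0 B"]) (auto simp: le_max_iff_disj)
qed

lemma integrable_mult_continuous_space:
  fixes f \<psi> :: "real ^ 'n \<Rightarrow> real"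
  assumes f: "integrable (lebesgue_on space_dom) f" and \<psi>: "continuous_on UNIV \<psi>"
  shows "integrable (lebesgue_on space_dom) (\<lambda>x. f x * \<psi> x)"
proof -
  have "compact (\<psi> ` space_dom)" unfolding space_dom_def
    by (intro compact_continuous_image continuous_on_subset[OF \<psi>]) auto
  then obtain B where B: "\<And>x. x \<in> space_dom \<Longrightarrow> \<bar>\<psi> x\<bar> \<le> B"
    using compact_imp_bounded bounded_iff by (metis image_eqI real_norm_def)
  show ?thesis
  proof (rule Bochner_Integration.integrable_bound[of _ "\<lambda>x. B * f x"])
    show "integrable (lebesgue_on space_dom) (\<lambda>x. B * f x)" using f by simp
    show "(\<lambda>x. f x * \<psi> x) \<in> borel_measurable (lebesgue_on space_dom)"
      using f continuous_L2_space[OF \<psi>] by (intro borel_measurable_times) (auto simp: L2_def)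
    have "norm (f x * \<psi> x) \<le> norm (B * f x)" if "x \<in> space_dom" for x
      using B[OF that] by (simp add: abs_mult mult.commute mult_right_mono)
    then show "AE x in lebesgue_on space_dom. norm (f x * \<psi> x) \<le> norm (B * f x)" by (intro AE_I2) simp
  qed
qed

text \<open>By the fundamental lemma; in particular the divergence that occurs existentially in
  \<open>weak_transport\<close> is determined.\<close>

lemma weak_div_unique:
  fixes v :: "real ^ 'n \<Rightarrow> real ^ 'n"
  assumes "weak_div per v d1" "weak_div per v d2"
  shows "AE x in lebesgue_on space_dom. d1 x = d2 x"
proof -
  have "AE x in lebesgue_on space_dom. d1 x - d2 x = 0"
  proof (rule fundamental_lemma_space[where per = per])
    show "integrable (lebesgue_on space_dom) (\<lambda>x. d1 x - d2 x)" using assms by (auto simp: weak_div_def)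
    fix \<psi> :: "real ^ 'n \<Rightarrow> real" assume \<psi>: "test_fun per \<psi>"
    have i: "integrable (lebesgue_on space_dom) (\<lambda>x. f x * \<psi> x)" if "integrable (lebesgue_on space_dom) f" for f
      by (rule integrable_mult_continuous_space[OF that cont_diff_continuous[OF test_fun_cont_diff[OF \<psi>]]])
    have "(LINT x|lebesgue_on space_dom. d1 x * \<psi> x) = (LINT x|lebesgue_on space_dom. d2 x * \<psi> x)"
    proof -
      have "(LINT x|lebesgue_on space_dom. frechet_derivative \<psi> (at x) (v x)) = - (LINT x|lebesgue_on space_dom. d1 x * \<psi> x)"
        using assms(1) \<psi> unfolding weak_div_def by blast
      moreover have "(LINT x|lebesgue_on space_dom. frechet_derivative \<psi> (at x) (v x)) = - (LINT x|lebesgue_on space_dom. d2 x * \<psi> x)"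
        using assms(2) \<psi> unfolding weak_div_def by blast
      ultimately show ?thesis by linarith
    qed
    then show "(LINT x|lebesgue_on space_dom. (d1 x - d2 x) * \<psi> x) = 0"
      using assms i by (simp add: left_diff_distrib weak_div_def)
  qed
  then show ?thesis by (rule eventually_mono) simp
qed

text \<open>What the variational problem needs to know about the velocity.  The function \<open>m\<close> dominates the
  velocity and its divergence \<open>d\<close> at each time.  Integration by parts is demanded for all \<open>C\<^sup>1\<close>
  functions \<open>G\<close> up to the boundary, which expresses that nothing flows through the boundary of the
  cube.  The last assumption replaces the flow: up to an error \<open>r\<close> that is small in \<open>L\<^sup>2\<close>, the
  velocity is constant in time on each of \<open>N\<close> slabs and equal to a smooth field there.  The Lipschitz
  constants \<open>L j\<close> of these fields may be large individually, but their time average is bounded by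
  \<open>C\<close>, uniformly in the accuracy.\<close>

locale transport_setting =
  fixes per :: bool and u :: "real \<Rightarrow> real ^ 'n \<Rightarrow> real ^ 'n"
    and d :: "(real ^ 'n) \<times> real \<Rightarrow> real" and m :: "real \<Rightarrow> real" and C :: real
  assumes u_meas: "\<And>i. (\<lambda>z. u (snd z) (fst z) $ i) \<in> borel_measurable (lebesgue_on spacetime_dom)"
    and d_meas: "d \<in> borel_measurable (lebesgue_on spacetime_dom)"
    and m_L2: "L2 {0..1} m" and m_nonneg: "\<And>t. t \<in> {0..1} \<Longrightarrow> 0 \<le> m t"
    and u_bound: "\<And>t x. t \<in> {0..1} \<Longrightarrow> x \<in> space_dom \<Longrightarrow> norm (u t x) \<le> m t"
    and d_bound: "AE t in lebesgue_on {0..1}. AE x in lebesgue_on space_dom. \<bar>d (x, t)\<bar> \<le> m t"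
    and d_div: "AE t in lebesgue_on {0..1}. weak_div per (u t) (\<lambda>x. d (x, t))"
    and ibp: "AE t in lebesgue_on {0..1}. \<forall>G. cont_diff G \<longrightarrow> (per \<longrightarrow> periodic_fun G) \<longrightarrow>
       (LINT x|lebesgue_on space_dom. frechet_derivative G (at x) (u t x)) =
       - (LINT x|lebesgue_on space_dom. d (x, t) * G x)"
    and approx: "\<And>\<epsilon>. \<epsilon> > 0 \<Longrightarrow> \<exists>N>0. \<exists>v L r.
       (\<forall>j. cont_diff (v j) \<and> (L j)-lipschitz_on UNIV (v j) \<and> (per \<longrightarrow> periodic_fun (v j)) \<and>
          (\<forall>x\<in>space_dom. norm (v j x) \<le> L j) \<and> L j \<le> \<epsilon> * real N) \<and>
       (\<Sum>j<N. L j / real N) \<le> C \<and>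
       L2 {0..1} r \<and> l2_norm {0..1} r \<le> \<epsilon> \<and> (\<forall>t\<in>{0..1}. 0 \<le> r t) \<and>
       (\<forall>j<N. \<forall>t\<in>{real j / real N ..< real (Suc j) / real N}. \<forall>x\<in>space_dom. norm (u t x - v j x) \<le> r t)"
begin

abbreviation "\<Omega> \<equiv> (spacetime_dom :: ((real ^ 'n) \<times> real) set)"
abbreviation "\<omega> \<equiv> (space_dom :: (real ^ 'n) set)"

lemma m_snd_L2: "L2 \<Omega> (\<lambda>z. m (snd z))"
  by (rule L2_snd[OF m_L2])

lemma one_L2: "L2 \<Omega> (\<lambda>z. c)"
  by (rule continuous_L2_spacetime) simp

lemma d_bound_AE: "AE z in lebesgue_on \<Omega>. \<bar>d z\<bar> \<le> m (snd z)"
proof -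
  have "AE z in lebesgue_on \<Omega>. max 0 (\<bar>d z\<bar> - m (snd z)) = 0"
  proof (rule AE_spacetime_zero_if_sections)
    have "(\<lambda>z. m (snd z)) \<in> borel_measurable (lebesgue_on \<Omega>)" using m_snd_L2 by (simp add: L2_def)
    then show "(\<lambda>z. max 0 (\<bar>d z\<bar> - m (snd z))) \<in> borel_measurable (lebesgue_on \<Omega>)"
      using d_meas by (intro borel_measurable_max borel_measurable_diff borel_measurable_abs) auto
    show "AE t in lebesgue_on {0..1}. AE x in lebesgue_on \<omega>. max 0 (\<bar>d (x, t)\<bar> - m (snd (x, t))) = 0"
      using d_bound by (rule eventually_mono) (auto elim!: eventually_mono)
  qed
  then show ?thesis by (rule eventually_mono) (auto simp: max_def split: if_splits)
qed

lemma d_L2: "L2 \<Omega> d"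
  by (rule L2_dominated[OF d_meas m_snd_L2]) (rule eventually_mono[OF d_bound_AE], auto)

lemma tder_measurable:
  assumes "cont_diff F"
  shows "tder u F \<in> borel_measurable (lebesgue_on \<Omega>)"
proof -
  have c: "(\<lambda>z. frechet_derivative F (at z) k) \<in> borel_measurable (lebesgue_on \<Omega>)" for k
    by (intro continuous_imp_measurable_on_sets_lebesgue cont_diff_continuous_derivative assms continuous_intros) auto
  have "(\<lambda>z. (\<Sum>i\<in>UNIV. u (snd z) (fst z) $ i * frechet_derivative F (at z) (axis i 1, 0))
      + 1 * frechet_derivative F (at z) (0, 1)) \<in> borel_measurable (lebesgue_on \<Omega>)"
    by (intro borel_measurable_add borel_measurable_sum borel_measurable_times u_meas c) auto
  then show ?thesis
    unfolding tder_def[abs_def] by (subst frechet_derivative_spacetime[OF assms])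
qed

lemma space_derivative_bound:
  assumes F: "cont_diff F"
  shows "\<exists>B\<ge>0. \<forall>z\<in>\<Omega>. \<forall>h r. \<bar>frechet_derivative F (at z) (h, r)\<bar> \<le> B * (norm h + \<bar>r\<bar>)"
proof -
  have c: "continuous_on UNIV (\<lambda>z. frechet_derivative F (at z) k)" for k
    by (intro cont_diff_continuous_derivative F continuous_intros)
  define g where "g z = (\<Sum>i\<in>UNIV. \<bar>frechet_derivative F (at z) (axis i 1, 0)\<bar>) + \<bar>frechet_derivative F (at z) (0, 1)\<bar>" for z
  have "continuous_on UNIV g" unfolding g_def by (intro continuous_intros c)
  then obtain B where B: "B \<ge> 0" "\<And>z. z \<in> \<Omega> \<Longrightarrow> \<bar>g z\<bar> \<le> B" using continuous_bounded_spacetime by metis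
  have "\<bar>frechet_derivative F (at z) (h, r)\<bar> \<le> B * (norm h + \<bar>r\<bar>)" if z: "z \<in> \<Omega>" for z h r
  proof -
    have "\<bar>frechet_derivative F (at z) (h, r)\<bar> \<le>
        (\<Sum>i\<in>UNIV. \<bar>h $ i * frechet_derivative F (at z) (axis i 1, 0)\<bar>) + \<bar>r * frechet_derivative F (at z) (0, 1)\<bar>"
      unfolding frechet_derivative_spacetime[OF F, of z h r]
      by (rule order_trans[OF abs_triangle_ineq]) (intro add_mono sum_abs order_refl)
    also have "\<dots> \<le> (\<Sum>i\<in>UNIV. (norm h + \<bar>r\<bar>) * \<bar>frechet_derivative F (at z) (axis i 1, 0)\<bar>)
        + (norm h + \<bar>r\<bar>) * \<bar>frechet_derivative F (at z) (0, 1)\<bar>"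
      unfolding abs_mult
    proof (intro add_mono sum_mono mult_right_mono)
      show "\<bar>h $ i\<bar> \<le> norm h + \<bar>r\<bar>" for i using component_le_norm_cart[of h i] by linarith
    qed auto
    also have "\<dots> = (norm h + \<bar>r\<bar>) * g z" by (simp add: g_def sum_distrib_left distrib_left)
    also have "\<dots> \<le> (norm h + \<bar>r\<bar>) * B" using B(2)[OF z] by (intro mult_left_mono) auto
    finally show ?thesis by (simp add: mult.commute)
  qed
  then show ?thesis using B(1) by blast
qed

lemma tder_L2:
  assumes F: "cont_diff F"
  shows "L2 \<Omega> (tder u F)"
proof -
  obtain B where B: "B \<ge> 0" "\<And>z h r. z \<in> \<Omega> \<Longrightarrow> \<bar>frechet_derivative F (at z) (h, r)\<bar> \<le> B * (norm h + \<bar>r\<bar>)"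
    using space_derivative_bound[OF F] by metis
  have "\<bar>tder u F z\<bar> \<le> \<bar>B * (m (snd z) + 1)\<bar>" if z: "z \<in> \<Omega>" for z
  proof -
    have z': "snd z \<in> {0..1}" "fst z \<in> \<omega>" using z by (auto simp: spacetime_dom_Times)
    have "\<bar>tder u F z\<bar> \<le> B * (norm (u (snd z) (fst z)) + 1)"
      unfolding tder_def using B(2)[OF z, of "u (snd z) (fst z)" 1] by simp
    also have "\<dots> \<le> B * (m (snd z) + 1)" using u_bound[OF z'] B(1) by (intro mult_left_mono) auto
    finally show ?thesis by linarith
  qed
  then show ?thesis
    by (intro L2_dominated[OF tder_measurable[OF F] L2_scale[OF L2_add[OF m_snd_L2 one_L2]]] AE_I2) auto
qed

lemma bounded_mult_L2:
  assumes "continuous_on UNIV f" "L2 \<Omega> g"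
  shows "L2 \<Omega> (\<lambda>z. f z * g z)"
proof -
  obtain B where B: "B \<ge> 0" "\<And>z. z \<in> \<Omega> \<Longrightarrow> \<bar>f z\<bar> \<le> B" using continuous_bounded_spacetime[OF assms(1)] by metis
  have f: "f \<in> borel_measurable (lebesgue_on \<Omega>)"
    using continuous_L2_spacetime[OF assms(1)] by (simp add: L2_def)
  have g: "g \<in> borel_measurable (lebesgue_on \<Omega>)" using assms(2) by (simp add: L2_def)
  show ?thesis
  proof (rule L2_dominated[OF borel_measurable_times[OF f g] L2_scale[OF assms(2), of B]])
    show "AE z in lebesgue_on \<Omega>. \<bar>f z * g z\<bar> \<le> \<bar>B * g z\<bar>"
      using B by (intro AE_I2) (auto simp: abs_mult intro!: mult_right_mono)
  qed
qed

lemma C1_L2: "cont_diff F \<Longrightarrow> L2 \<Omega> F"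
  by (intro continuous_L2_spacetime cont_diff_continuous)

lemma sub_slab:
  assumes "0 \<le> a" "b \<le> 1"
  shows "\<omega> \<times> {a..b} \<subseteq> \<Omega>" "\<omega> \<times> {a..b} \<in> sets lebesgue"
  using assms by (auto simp: spacetime_dom_Times intro!: lebesgue_Times)

lemma integrable_sub_slab:
  fixes f :: "(real ^ 'n) \<times> real \<Rightarrow> real"
  assumes "0 \<le> a" "b \<le> 1" "integrable (lebesgue_on \<Omega>) f"
  shows "integrable (lebesgue_on (\<omega> \<times> {a..b})) f"
proof -
  have "integrable lebesgue (\<lambda>z. indicator \<Omega> z *\<^sub>R f z)"
    using assms(3) by (subst (asm) integrable_restrict_space) auto
  then have "integrable lebesgue (\<lambda>z. indicator (\<omega> \<times> {a..b}) z *\<^sub>R (indicator \<Omega> z *\<^sub>R f z))"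
    by (rule integrable_mult_indicator[OF sub_slab(2)[OF assms(1,2)]])
  moreover have "(\<lambda>z. indicator (\<omega> \<times> {a..b}) z *\<^sub>R (indicator \<Omega> z *\<^sub>R f z))
      = (\<lambda>z. indicator (\<omega> \<times> {a..b}) z *\<^sub>R f z)"
  proof
    fix z show "indicator (\<omega> \<times> {a..b}) z *\<^sub>R (indicator \<Omega> z *\<^sub>R f z) = indicator (\<omega> \<times> {a..b}) z *\<^sub>R f z"
      using subsetD[OF sub_slab(1)[OF assms(1,2)], of z] by (cases "z \<in> \<omega> \<times> {a..b}") simp_all
  qed
  ultimately show ?thesis
    using sub_slab(2)[OF assms(1,2)] by (subst integrable_restrict_space) auto
qed

lemma AE_sub_interval:
  assumes "0 \<le> a" "b \<le> (1::real)" "AE t in lebesgue_on {0..1}. P t"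
  shows "AE t in lebesgue_on {a..b}. P t"
  using assms by (subst AE_restrict_space_iff, simp, subst (asm) AE_restrict_space_iff)
    (auto elim!: eventually_mono)

lemma time_integral:
  fixes G :: "(real ^ 'n) \<times> real \<Rightarrow> real"
  assumes G: "cont_diff G" and ab: "a \<le> b"
  shows "(LINT z|lebesgue_on (\<omega> \<times> {a..b}). frechet_derivative G (at z) (0, 1)) =
    (LINT x|lebesgue_on \<omega>. G (x, b)) - (LINT x|lebesgue_on \<omega>. G (x, a))"
proof -
  have c: "continuous_on S (\<lambda>z. frechet_derivative G (at z) (0, 1))" for S
    by (intro cont_diff_continuous_derivative G continuous_intros)
  have dom: "\<omega> \<times> {a..b} = cbox (0, a) (1, b)" by (simp add: space_dom_def cbox_Pair_eq)
  have hk: "(LINT x|lebesgue_on (cbox p q). f x) = integral (cbox p q) f" if "continuous_on (cbox p q) f"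
    for p q :: "'x::euclidean_space" and f :: "'x \<Rightarrow> real"
    using lebesgue_integral_eq_integral[OF continuous_integrable_cbox[OF that]] by simp
  have ftc: "integral (cbox a b) (\<lambda>t. frechet_derivative G (at (x, t)) (0, 1)) = G (x, b) - G (x, a)" for x
  proof -
    have "((\<lambda>t. G (x, t)) has_vector_derivative frechet_derivative G (at (x, t)) (0, 1)) (at t within {a..b})" for t
      using directional_derivative[OF G, of "(x, 0)" "(0, 1)" t]
      by (simp add: has_real_derivative_iff_has_vector_derivative has_vector_derivative_at_within)
    from fundamental_theorem_of_calculus[OF ab this] show ?thesis by (simp add: integral_unique)
  qed
  have "(LINT z|lebesgue_on (\<omega> \<times> {a..b}). frechet_derivative G (at z) (0, 1))
      = integral (cbox 0 1) (\<lambda>x. integral (cbox a b) (\<lambda>t. frechet_derivative G (at (x, t)) (0, 1)))"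
    unfolding dom by (subst hk[OF c], subst integral_prod_continuous[OF c]) simp
  also have "\<dots> = integral (cbox 0 1) (\<lambda>x. G (x, b) - G (x, a))" unfolding ftc ..
  also have "\<dots> = (LINT x|lebesgue_on \<omega>. G (x, b) - G (x, a))"
    unfolding space_dom_def
    by (rule hk[symmetric]) (intro continuous_intros cont_diff_continuous cont_diff_slice G)
  also have "\<dots> = (LINT x|lebesgue_on \<omega>. G (x, b)) - (LINT x|lebesgue_on \<omega>. G (x, a))"
    unfolding space_dom_def
    by (intro Bochner_Integration.integral_diff continuous_integrable_cbox cont_diff_continuous cont_diff_slice G)
  finally show ?thesis .
qed

text \<open>Reynolds' transport identity: Fubini's theorem, integration by parts in space at almost every
  time, and the fundamental theorem of calculus in time.\<close>

lemma transport_identity: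
  assumes G: "C1_closed per G" and ab: "0 \<le> a" "a \<le> b" "b \<le> 1"
  shows "(LINT z|lebesgue_on (\<omega> \<times> {a..b}). tder u G z + d z * G z) =
    (LINT x|lebesgue_on \<omega>. G (x, b)) - (LINT x|lebesgue_on \<omega>. G (x, a))"
proof -
  have cG: "cont_diff G" using G by (rule C1_closed_cont_diff)
  have c: "continuous_on UNIV (\<lambda>z. frechet_derivative G (at z) (0, 1))"
    by (intro cont_diff_continuous_derivative cG continuous_intros)
  define s where "s z = tder u G z - frechet_derivative G (at z) (0, 1) + d z * G z" for z
  have dG: "L2 \<Omega> (\<lambda>z. d z * G z)"
    using bounded_mult_L2[OF cont_diff_continuous[OF cG] d_L2] by (simp add: mult.commute)
  have s: "L2 \<Omega> s"
    unfolding s_def by (intro L2_add L2_diff tder_L2[OF cG] continuous_L2_spacetime[OF c] dG)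
  have si: "integrable (lebesgue_on (\<omega> \<times> {a..b})) s"
    using ab by (intro integrable_sub_slab L2_integrable s) auto
  have s_eq: "s (x, t) = frechet_derivative (\<lambda>x. G (x, t)) (at x) (u t x) + d (x, t) * G (x, t)" for x t
    unfolding s_def tder_def frechet_derivative_fst[OF cG]
    using linear_add[OF frechet_derivative_linear[OF cG], of "(x, t)" "(u t x, 0)" "(0, 1)"] by simp
  have sec_d: "AE t in lebesgue_on {a..b}. integrable (lebesgue_on \<omega>) (\<lambda>x. d (x, t) * G (x, t))"
    using lebesgue_Fubini(1)[OF _ _ integrable_sub_slab[OF ab(1,3) L2_integrable[OF _ dG]]] by simp
  have sec_s: "AE t in lebesgue_on {a..b}. integrable (lebesgue_on \<omega>) (\<lambda>x. s (x, t))"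
    using lebesgue_Fubini(1)[OF _ _ si] by simp
  have zero: "AE t in lebesgue_on {a..b}. (LINT x|lebesgue_on \<omega>. s (x, t)) = 0"
    using AE_sub_interval[OF ab(1,3) ibp] sec_d sec_s
  proof eventually_elim
    case (elim t)
    have "cont_diff (\<lambda>x. G (x, t))" by (rule cont_diff_slice[OF cG])
    moreover have "per \<longrightarrow> periodic_fun (\<lambda>x. G (x, t))" using G by (simp add: C1_closed_def)
    ultimately have "(LINT x|lebesgue_on \<omega>. frechet_derivative (\<lambda>x. G (x, t)) (at x) (u t x)) =
        - (LINT x|lebesgue_on \<omega>. d (x, t) * G (x, t))"
      using elim(1) by blast
    moreover have "integrable (lebesgue_on \<omega>) (\<lambda>x. frechet_derivative (\<lambda>x. G (x, t)) (at x) (u t x))"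
      using Bochner_Integration.integrable_diff[OF elim(3,2)] by (simp add: s_eq)
    ultimately show ?case unfolding s_eq using elim(2) by simp
  qed
  have "(LINT z|lebesgue_on (\<omega> \<times> {a..b}). s z) = (LINT t|lebesgue_on {a..b}. LINT x|lebesgue_on \<omega>. s (x, t))"
    by (rule lebesgue_Fubini(3)[OF _ _ si]) auto
  also have "\<dots> = 0"
    by (rule integral_eq_zero_AE[OF zero])
  finally have "(LINT z|lebesgue_on (\<omega> \<times> {a..b}). s z) = 0" .
  moreover have "(LINT z|lebesgue_on (\<omega> \<times> {a..b}). tder u G z + d z * G z) =
      (LINT z|lebesgue_on (\<omega> \<times> {a..b}). s z + frechet_derivative G (at z) (0, 1))"
    by (simp add: s_def)
  moreover have "\<dots> = (LINT z|lebesgue_on (\<omega> \<times> {a..b}). s z)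
      + (LINT z|lebesgue_on (\<omega> \<times> {a..b}). frechet_derivative G (at z) (0, 1))"
    using ab by (intro Bochner_Integration.integral_add si integrable_sub_slab L2_integrable continuous_L2_spacetime[OF c]) auto
  ultimately show ?thesis using time_integral[OF cG ab(2)] by simp
qed

subsection \<open>Weak transport derivatives\<close>

text \<open>The formal adjoint of the transport derivative, up to sign.\<close>

definition adj :: "((real ^ 'n) \<times> real \<Rightarrow> real) \<Rightarrow> (real ^ 'n) \<times> real \<Rightarrow> real" where
  "adj \<psi> z = tder u \<psi> z + \<psi> z * d z"

lemma adj_L2: "spacetime_test_fun per \<psi> \<Longrightarrow> L2 \<Omega> (adj \<psi>)"
  unfolding adj_def[abs_def] using C1_closed_cont_diff[OF C1_closed_test_fun]
  by (intro L2_add tder_L2 bounded_mult_L2 cont_diff_continuous d_L2) auto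

lemma test_L2: "spacetime_test_fun per \<psi> \<Longrightarrow> L2 \<Omega> \<psi>"
  using C1_closed_cont_diff[OF C1_closed_test_fun] C1_L2 by blast

text \<open>The divergence hidden in the definition agrees with \<open>d\<close> almost everywhere, hence the weak
  derivative is characterized by \<open>L\<^sup>2\<close> inner products.  Uniqueness, linearity and closedness of the weak
  derivative follow from this form.\<close>

lemma weak_transport_iff:
  assumes f: "L2 \<Omega> f"
  shows "weak_transport per u f g \<longleftrightarrow>
    (\<forall>\<psi>. spacetime_test_fun per \<psi> \<longrightarrow> l2_inner \<Omega> f (adj \<psi>) = - l2_inner \<Omega> g \<psi>)" (is "_ \<longleftrightarrow> ?R")
proof
  assume ?R
  then show "weak_transport per u f g"
    unfolding weak_transport_def l2_inner_def adj_def tder_def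
    using d_meas d_div by (intro exI[of _ d]) auto
next
  assume "weak_transport per u f g"
  then obtain d' where d': "d' \<in> borel_measurable (lebesgue_on \<Omega>)"
    and div: "AE t in lebesgue_on {0..1}. weak_div per (u t) (\<lambda>x. d' (x, t))"
    and eq: "\<And>\<psi>. spacetime_test_fun per \<psi> \<Longrightarrow>
      (LINT z|lebesgue_on \<Omega>. f z * (tder u \<psi> z + \<psi> z * d' z)) = - l2_inner \<Omega> g \<psi>"
    unfolding weak_transport_def tder_def l2_inner_def by blast
  have "AE z in lebesgue_on \<Omega>. d' z - d z = 0"
  proof (rule AE_spacetime_zero_if_sections)
    show "(\<lambda>z. d' z - d z) \<in> borel_measurable (lebesgue_on \<Omega>)"
      by (rule borel_measurable_diff[OF d' d_meas])
    show "AE t in lebesgue_on {0..1}. AE x in lebesgue_on \<omega>. d' (x, t) - d (x, t) = 0"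
      using div d_div
    proof eventually_elim
      case (elim t)
      from weak_div_unique[OF this] show ?case by (rule eventually_mono) simp
    qed
  qed
  then have ae: "AE z in lebesgue_on \<Omega>. d' z = d z" by (rule eventually_mono) simp
  show ?R
  proof (intro allI impI)
    fix \<psi> :: "(real ^ 'n) \<times> real \<Rightarrow> real" assume \<psi>: "spacetime_test_fun per \<psi>"
    have fm: "f \<in> borel_measurable (lebesgue_on \<Omega>)" using f by (simp add: L2_def)
    have \<psi>m: "\<psi> \<in> borel_measurable (lebesgue_on \<Omega>)" using test_L2[OF \<psi>] by (simp add: L2_def)
    have tm: "tder u \<psi> \<in> borel_measurable (lebesgue_on \<Omega>)"
      by (rule tder_measurable[OF C1_closed_cont_diff[OF C1_closed_test_fun[OF \<psi>]]])
    have "l2_inner \<Omega> f (adj \<psi>) = (LINT z|lebesgue_on \<Omega>. f z * (tder u \<psi> z + \<psi> z * d' z))"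
      unfolding l2_inner_def adj_def
    proof (rule integral_cong_AE)
      show "AE z in lebesgue_on \<Omega>. f z * (tder u \<psi> z + \<psi> z * d z) = f z * (tder u \<psi> z + \<psi> z * d' z)"
        using ae by eventually_elim simp
    qed (intro borel_measurable_times borel_measurable_add fm \<psi>m tm d' d_meas)+
    then show "l2_inner \<Omega> f (adj \<psi>) = - l2_inner \<Omega> g \<psi>" using eq[OF \<psi>] by simp
  qed
qed

lemma weak_transport_unique:
  assumes "L2 \<Omega> f" "L2 \<Omega> g" "L2 \<Omega> g'" "weak_transport per u f g" "weak_transport per u f g'"
  shows "AE z in lebesgue_on \<Omega>. g z = g' z"
proof -
  have "AE z in lebesgue_on \<Omega>. g z - g' z = 0"
  proof (rule fundamental_lemma_spacetime[where per = per])
    show "integrable (lebesgue_on \<Omega>) (\<lambda>z. g z - g' z)" using assms by (intro L2_integrable L2_diff) auto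
    fix \<psi> :: "(real ^ 'n) \<times> real \<Rightarrow> real" assume \<psi>: "spacetime_test_fun per \<psi>"
    have "l2_inner \<Omega> g \<psi> = l2_inner \<Omega> g' \<psi>"
    proof -
      have "l2_inner \<Omega> f (adj \<psi>) = - l2_inner \<Omega> g \<psi>"
        using assms(4) \<psi> unfolding weak_transport_iff[OF assms(1)] by blast
      moreover have "l2_inner \<Omega> f (adj \<psi>) = - l2_inner \<Omega> g' \<psi>"
        using assms(5) \<psi> unfolding weak_transport_iff[OF assms(1)] by blast
      ultimately show ?thesis by linarith
    qed
    then show "(LINT z|lebesgue_on \<Omega>. (g z - g' z) * \<psi> z) = 0"
      using l2_inner_diff_left[OF assms(2,3) test_L2[OF \<psi>]] by (simp add: l2_inner_def)
  qed
  then show ?thesis by (rule eventually_mono) simp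
qed

lemma weak_transport_combination:
  assumes L: "L2 \<Omega> f" "L2 \<Omega> g" "L2 \<Omega> f'" "L2 \<Omega> g'"
    and w: "weak_transport per u f g" "weak_transport per u f' g'"
  shows "weak_transport per u (\<lambda>z. f z + c * f' z) (\<lambda>z. g z + c * g' z)"
  unfolding weak_transport_iff[OF L2_add[OF L(1) L2_scale[OF L(3)]]]
  using w unfolding weak_transport_iff[OF L(1)] weak_transport_iff[OF L(3)]
  by (simp add: l2_inner_add_left l2_inner_scale_left L L2_scale adj_L2 test_L2)

lemma weak_transport_limit:
  assumes L: "\<And>k. L2 \<Omega> (f k)" "\<And>k. L2 \<Omega> (g k)" "L2 \<Omega> f0" "L2 \<Omega> g0"
    and w: "\<And>k. weak_transport per u (f k) (g k)"
    and lim: "(\<lambda>k. l2_norm \<Omega> (\<lambda>z. f k z - f0 z)) \<longlonglongrightarrow> 0" "(\<lambda>k. l2_norm \<Omega> (\<lambda>z. g k z - g0 z)) \<longlonglongrightarrow> 0"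
  shows "weak_transport per u f0 g0"
  unfolding weak_transport_iff[OF L(3)]
proof (intro allI impI)
  fix \<psi> :: "(real ^ 'n) \<times> real \<Rightarrow> real" assume \<psi>: "spacetime_test_fun per \<psi>"
  have "(\<lambda>k. l2_inner \<Omega> (f k) (adj \<psi>)) \<longlonglongrightarrow> l2_inner \<Omega> f0 (adj \<psi>)"
    by (rule l2_inner_tendsto[OF L(1,3) adj_L2[OF \<psi>] lim(1)])
  moreover have "(\<lambda>k. - l2_inner \<Omega> (g k) \<psi>) \<longlonglongrightarrow> - l2_inner \<Omega> g0 \<psi>"
    by (intro tendsto_minus l2_inner_tendsto[OF L(2,4) test_L2[OF \<psi>] lim(2)])
  moreover have "l2_inner \<Omega> (f k) (adj \<psi>) = - l2_inner \<Omega> (g k) \<psi>" for k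
    using w \<psi> unfolding weak_transport_iff[OF L(1)] by blast
  ultimately show "l2_inner \<Omega> f0 (adj \<psi>) = - l2_inner \<Omega> g0 \<psi>"
    using LIMSEQ_unique by simp
qed

lemma test_fun_vanishes:
  assumes "spacetime_test_fun per \<psi>"
  shows "\<psi> (x, 0) = 0" "\<psi> (x, 1) = 0"
proof -
  have "\<psi> (x, t) = 0" if "t \<notin> {0<..<1}" for t
  proof (cases per)
    case True
    then obtain J where "J \<subseteq> {0<..<1}" "\<forall>x t. t \<notin> J \<longrightarrow> \<psi> (x, t) = 0"
      using assms by (auto simp: spacetime_test_fun_def)
    then show ?thesis using that by blast
  next
    case False
    then obtain K where "K \<subseteq> box 0 1 \<times> {0<..<1}" "\<forall>z. z \<notin> K \<longrightarrow> \<psi> z = 0"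
      using assms by (auto simp: spacetime_test_fun_def)
    then show ?thesis using that by blast
  qed
  then show "\<psi> (x, 0) = 0" "\<psi> (x, 1) = 0" by auto
qed

text \<open>Apply the transport identity to the product with a test function, which vanishes at both
  times.\<close>

lemma weak_transport_C1:
  assumes F: "C1_closed per F"
  shows "weak_transport per u F (tder u F)"
proof -
  have cF: "cont_diff F" using F by (rule C1_closed_cont_diff)
  show ?thesis
    unfolding weak_transport_iff[OF C1_L2[OF cF]]
  proof (intro allI impI)
    fix \<psi> :: "(real ^ 'n) \<times> real \<Rightarrow> real" assume \<psi>: "spacetime_test_fun per \<psi>"
    have c\<psi>: "cont_diff \<psi>" by (rule C1_closed_cont_diff[OF C1_closed_test_fun[OF \<psi>]])
    have "(LINT z|lebesgue_on \<Omega>. tder u (\<lambda>z. F z * \<psi> z) z + d z * (F z * \<psi> z)) = 0"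
      using transport_identity[OF C1_closed_mult[OF F C1_closed_test_fun[OF \<psi>]], of 0 1]
      by (simp add: spacetime_dom_Times test_fun_vanishes[OF \<psi>])
    also have "(LINT z|lebesgue_on \<Omega>. tder u (\<lambda>z. F z * \<psi> z) z + d z * (F z * \<psi> z))
        = (LINT z|lebesgue_on \<Omega>. F z * adj \<psi> z + tder u F z * \<psi> z)"
      by (rule Bochner_Integration.integral_cong) (auto simp: tder_mult[OF cF c\<psi>] adj_def algebra_simps)
    also have "\<dots> = l2_inner \<Omega> F (adj \<psi>) + l2_inner \<Omega> (tder u F) \<psi>"
      unfolding l2_inner_def
      by (intro Bochner_Integration.integral_add L2_mult_integrable C1_L2 cF adj_L2 tder_L2 test_L2 \<psi>)
    finally show "l2_inner \<Omega> F (adj \<psi>) = - l2_inner \<Omega> (tder u F) \<psi>" by simp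
  qed
qed

lemma transport_spec:
  assumes "in_G per u f"
  shows "L2 \<Omega> f" "L2 \<Omega> (transport per u f)" "weak_transport per u f (transport per u f)"
proof -
  have "\<exists>g. L2 \<Omega> g \<and> weak_transport per u f g" using assms by (simp add: in_G_def)
  from someI_ex[OF this] show "L2 \<Omega> (transport per u f)" "weak_transport per u f (transport per u f)"
    by (auto simp: transport_def)
qed (use assms in \<open>simp add: in_G_def\<close>)

lemma transport_eq:
  assumes "L2 \<Omega> f" "L2 \<Omega> g" "weak_transport per u f g"
  shows "in_G per u f" "AE z in lebesgue_on \<Omega>. transport per u f z = g z"
proof -
  show G: "in_G per u f" using assms by (auto simp: in_G_def)
  show "AE z in lebesgue_on \<Omega>. transport per u f z = g z"
    using transport_spec[OF G] assms by (intro weak_transport_unique[of f]) auto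
qed

lemma E_norm_eq:
  assumes "L2 \<Omega> f" "L2 \<Omega> g" "weak_transport per u f g"
  shows "E_norm per u f = l2_norm \<Omega> g"
  unfolding E_norm_def using transport_eq[OF assms] transport_spec assms(2)
  by (intro l2_norm_cong_AE) auto

lemma G_norm_eq:
  assumes "L2 \<Omega> f" "L2 \<Omega> g" "weak_transport per u f g"
  shows "G_norm per u f = sqrt ((l2_norm \<Omega> f)\<^sup>2 + (l2_norm \<Omega> g)\<^sup>2)"
  unfolding G_norm_def E_norm_eq[OF assms] ..

end

section \<open>Lipschitz bounds from coordinate directions\<close>

text \<open>Replaces the coordinates of \<open>x\<close> in \<open>S\<close> by those of \<open>y\<close>.  Running through increasing \<open>S\<close> joins
  two points by a path parallel to the axes, which stays inside the cube.\<close>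

definition mix :: "'n set \<Rightarrow> real ^ 'n \<Rightarrow> real ^ 'n \<Rightarrow> real ^ 'n" where
  "mix S x y = (\<chi> i. if i \<in> S then y $ i else x $ i)"

lemma mix_insert: "i \<notin> S \<Longrightarrow> mix (insert i S) x y = mix S x y + (y $ i - x $ i) *\<^sub>R axis i 1"
  by (auto simp: mix_def vec_eq_iff axis_def)

lemma lipschitz_from_coordinates:
  fixes f :: "real ^ 'n \<Rightarrow> 'b::real_normed_vector"
  assumes B: "\<And>S x y. x \<in> B \<Longrightarrow> y \<in> B \<Longrightarrow> mix S x y \<in> B" and L: "0 \<le> L"
    and f: "\<And>x i s. x \<in> B \<Longrightarrow> x + s *\<^sub>R axis i 1 \<in> B \<Longrightarrow> norm (f (x + s *\<^sub>R axis i 1) - f x) \<le> L * \<bar>s\<bar>"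
  shows "(real CARD('n) * L)-lipschitz_on B f"
proof (rule lipschitz_onI)
  fix x y assume xy: "x \<in> B" "y \<in> B"
  have "norm (f (mix S x y) - f x) \<le> (\<Sum>i\<in>S. L * \<bar>y $ i - x $ i\<bar>)" if "finite S" for S
    using that
  proof (induction S)
    case empty
    have "mix {} x y = x" by (simp add: mix_def vec_eq_iff)
    then show ?case by simp
  next
    case (insert i S)
    have "norm (f (mix (insert i S) x y) - f (mix S x y)) \<le> L * \<bar>y $ i - x $ i\<bar>"
      using f[of "mix S x y" "y $ i - x $ i" i] B[OF xy, of S] B[OF xy, of "insert i S"]
      by (simp add: mix_insert[OF insert(2)])
    moreover have "f (mix (insert i S) x y) - f x
        = (f (mix (insert i S) x y) - f (mix S x y)) + (f (mix S x y) - f x)" by simp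
    ultimately show ?case
      using insert norm_triangle_ineq[of "f (mix (insert i S) x y) - f (mix S x y)" "f (mix S x y) - f x"]
      by simp
  qed
  from this[of UNIV] have "norm (f y - f x) \<le> (\<Sum>i\<in>UNIV. L * \<bar>y $ i - x $ i\<bar>)"
    by (simp add: mix_def vec_nth_inverse)
  also have "\<dots> \<le> (\<Sum>i\<in>(UNIV :: 'n set). L * norm (y - x))"
    using component_le_norm_cart[of "y - x"] L by (intro sum_mono mult_left_mono) auto
  finally show "dist (f x) (f y) \<le> real CARD('n) * L * dist x y"
    by (simp add: dist_norm norm_minus_commute mult.assoc)
qed (use L in simp)

lemma mem_space_dom: "x \<in> space_dom \<longleftrightarrow> (\<forall>i. 0 \<le> x $ i \<and> x $ i \<le> 1)"
  by (simp add: space_dom_def mem_box_cart)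

lemma periodic_int_shift:
  assumes "periodic_fun f"
  shows "f (x + of_int k *\<^sub>R axis i 1) = f x"
proof (induction k rule: int_induct[of _ 0])
  case (step1 k)
  have "x + of_int (k + 1) *\<^sub>R axis i 1 = (x + of_int k *\<^sub>R axis i 1) + axis i 1"
    by (simp add: scaleR_add_left)
  then show ?case using assms step1 unfolding periodic_fun_def by metis
next
  case (step2 k)
  have "x + of_int k *\<^sub>R axis i 1 = (x + of_int (k - 1) *\<^sub>R axis i 1) + axis i 1"
    by (simp add: scaleR_diff_left)
  then show ?case using assms step2 unfolding periodic_fun_def by metis
qed simp

definition frac_on :: "'n set \<Rightarrow> real ^ 'n \<Rightarrow> real ^ 'n" where
  "frac_on S x = (\<chi> i. if i \<in> S then frac (x $ i) else x $ i)"

lemma periodic_frac_on: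
  fixes f :: "real ^ 'n \<Rightarrow> 'b"
  assumes "periodic_fun f"
  shows "f (frac_on S x) = f x"
proof -
  have "finite S" by simp
  then show ?thesis
  proof (induction S)
    case empty
    have "frac_on {} x = x" by (simp add: frac_on_def vec_eq_iff)
    then show ?case by simp
  next
    case (insert i S)
    have "frac_on S x = frac_on (insert i S) x + of_int \<lfloor>x $ i\<rfloor> *\<^sub>R axis i 1"
      using insert(2) by (auto simp: frac_on_def vec_eq_iff axis_def frac_def)
    then show ?case using periodic_int_shift[OF assms] insert by metis
  qed
qed

text \<open>Along a coordinate line, an increment within one period cell is controlled by the estimate in the
  unit cube.  For points in different cells one uses that the function takes equal values at all
  integers, so only the two partial cells at the ends contribute.\<close>

lemma periodic_lipschitz:
  fixes f :: "real ^ 'n \<Rightarrow> 'b::real_normed_vector"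
  assumes per: "periodic_fun f" and lip: "L-lipschitz_on space_dom f"
  shows "(real CARD('n) * L)-lipschitz_on UNIV f"
proof (rule lipschitz_from_coordinates)
  show L: "0 \<le> L" using lip by (rule lipschitz_on_nonneg)
  fix x :: "real ^ 'n" and i :: 'n and s :: real
  define p where "p r = f (\<chi> j. if j = i then r else frac (x $ j))" for r
  have vec: "(\<chi> j. if j = i then r else frac (x $ j)) = frac_on (- {i}) (x + (r - x $ i) *\<^sub>R axis i 1)" for r
    by (auto simp: frac_on_def vec_eq_iff axis_def)
  have p_eq: "p r = f (x + (r - x $ i) *\<^sub>R axis i 1)" for r
    unfolding p_def vec by (rule periodic_frac_on[OF per])
  have p_int: "p (r + of_int k) = p r" for r k
    using periodic_int_shift[OF per, of "x + (r - x $ i) *\<^sub>R axis i 1" k i]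
    by (simp add: p_eq algebra_simps)
  have p01: "norm (p r - p r') \<le> L * \<bar>r - r'\<bar>" if "r \<in> {0..1}" "r' \<in> {0..1}" for r r'
  proof -
    have in_dom: "(\<chi> j. if j = i then q else frac (x $ j)) \<in> space_dom" if "q \<in> {0..1}" for q
      using that by (auto simp: mem_space_dom less_imp_le[OF frac_lt_1])
    have "(\<chi> j. if j = i then r else frac (x $ j)) - (\<chi> j. if j = i then r' else frac (x $ j)) = (r - r') *\<^sub>R axis i 1"
      by (auto simp: vec_eq_iff axis_def)
    then show ?thesis
      using lipschitz_onD[OF lip in_dom[OF that(1)] in_dom[OF that(2)]]
      by (simp add: p_def dist_norm norm_axis_1)
  qed
  have cell: "norm (p r - p r') \<le> L * \<bar>r - r'\<bar>" if "r \<in> {of_int k..of_int k + 1}" "r' \<in> {of_int k..of_int k + 1}" for r r' k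
    using p01[of "r - of_int k" "r' - of_int k"] p_int[of "r - of_int k" k] p_int[of "r' - of_int k" k] that by simp
  have ordered: "norm (p r' - p r) \<le> L * (r' - r)" if "r \<le> r'" for r r'
  proof (cases "of_int \<lfloor>r'\<rfloor> \<le> r")
    case True
    have up: "r' \<le> of_int \<lfloor>r'\<rfloor> + 1" by linarith
    have "norm (p r' - p r) \<le> L * \<bar>r' - r\<bar>"
    proof (rule cell)
      show "r' \<in> {of_int \<lfloor>r'\<rfloor>..of_int \<lfloor>r'\<rfloor> + 1}" using up by simp
      show "r \<in> {of_int \<lfloor>r'\<rfloor>..of_int \<lfloor>r'\<rfloor> + 1}" using True order_trans[OF that up] by simp
    qed
    then show ?thesis using that by simp
  next
    case False
    define k where "k = \<lfloor>r'\<rfloor>"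
    define l where "l = \<lfloor>r\<rfloor> + 1"
    have lk: "l \<le> k" using False unfolding l_def k_def by linarith
    have kl: "p (of_int k) = p (of_int l)" using p_int[of "of_int l" "k - l"] by simp
    have "norm (p r' - p (of_int k)) \<le> L * (r' - of_int k)"
      using cell[of r' k "of_int k"] unfolding k_def by auto
    moreover have "norm (p (of_int l) - p r) \<le> L * (of_int l - r)"
      using cell[of "of_int l" "l - 1" r] unfolding l_def by auto
    moreover have "p r' - p r = (p r' - p (of_int k)) + (p (of_int l) - p r)" using kl by simp
    ultimately have "norm (p r' - p r) \<le> L * (r' - of_int k) + L * (of_int l - r)"
      using norm_triangle_ineq[of "p r' - p (of_int k)" "p (of_int l) - p r"] by simp
    also have "\<dots> = L * (r' - r - (of_int k - of_int l))" by (simp add: algebra_simps)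
    also have "\<dots> \<le> L * (r' - r)" using lk L by (intro mult_left_mono) auto
    finally show ?thesis .
  qed
  have "norm (p (x $ i + s) - p (x $ i)) \<le> L * \<bar>s\<bar>"
    using ordered[of "x $ i" "x $ i + s"] ordered[of "x $ i + s" "x $ i"]
    by (cases "s \<ge> 0") (auto simp: norm_minus_commute)
  then show "norm (f (x + s *\<^sub>R axis i 1) - f x) \<le> L * \<bar>s\<bar>" by (simp add: p_eq)
qed auto

lemma test_fun_derivative_bounded:
  fixes a :: "real ^ 'n \<Rightarrow> real"
  assumes a: "test_fun per a"
  shows "\<exists>K. \<forall>x h. \<bar>frechet_derivative a (at x) h\<bar> \<le> K * norm h"
proof -
  have ca: "cont_diff a" by (rule test_fun_cont_diff[OF a])
  define g where "g x = (\<Sum>i\<in>UNIV. \<bar>frechet_derivative a (at x) (axis i 1)\<bar>)" for x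
  have gc: "continuous_on S g" for S
    unfolding g_def by (intro continuous_intros cont_diff_continuous_derivative ca)
  have bound: "\<bar>frechet_derivative a (at x) h\<bar> \<le> g x * norm h" for x h
  proof -
    interpret D: linear "frechet_derivative a (at x)" by (rule frechet_derivative_linear[OF ca])
    have "frechet_derivative a (at x) h = (\<Sum>i\<in>UNIV. h $ i * frechet_derivative a (at x) (axis i 1))"
      by (subst vec_Basis_sum[of h]) (simp add: D.sum D.scale)
    also have "\<bar>\<dots>\<bar> \<le> (\<Sum>i\<in>UNIV. \<bar>h $ i * frechet_derivative a (at x) (axis i 1)\<bar>)" by (rule sum_abs)
    also have "\<dots> \<le> (\<Sum>i\<in>UNIV. norm h * \<bar>frechet_derivative a (at x) (axis i 1)\<bar>)"
      unfolding abs_mult by (intro sum_mono mult_right_mono component_le_norm_cart) auto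
    finally show ?thesis by (simp add: g_def sum_distrib_left mult.commute)
  qed
  have g_bdd: "\<exists>K. \<forall>x\<in>S. g x \<le> K" if "compact S" for S
    using compact_imp_bounded[OF compact_continuous_image[OF gc that]] unfolding bounded_iff
    by (auto simp: abs_le_iff)
  show ?thesis
  proof (cases per)
    case True
    then have p: "periodic_fun a" using a by (simp add: test_fun_def)
    obtain K where K: "\<And>x. x \<in> space_dom \<Longrightarrow> g x \<le> K"
      using g_bdd[of space_dom] by (auto simp: space_dom_def)
    have "(0 :: real ^ 'n) \<in> space_dom" by (simp add: mem_space_dom)
    moreover have "0 \<le> g 0" by (simp add: g_def sum_nonneg)
    ultimately have K0: "K \<ge> 0" using K[of 0] by linarith
    have "K-lipschitz_on space_dom a"
    proof (rule bounded_derivative_imp_lipschitz)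
      show "(a has_derivative frechet_derivative a (at x)) (at x within space_dom)" for x
        by (rule has_derivative_at_withinI[OF cont_diff_has_derivative[OF ca]])
      show "convex (space_dom :: (real ^ 'n) set)" by (simp add: space_dom_def)
      show "onorm (frechet_derivative a (at x)) \<le> K" if "x \<in> space_dom" for x
      proof (rule onorm_le)
        show "norm (frechet_derivative a (at x) h) \<le> K * norm h" for h
          using bound[of x h] mult_right_mono[OF K[OF that], of "norm h"] by simp
      qed
    qed (rule K0)
    from frechet_derivative_bound_lipschitz[OF ca periodic_lipschitz[OF p this]]
    show ?thesis by auto
  next
    case False
    then obtain S where S: "compact S" "\<And>x. x \<notin> S \<Longrightarrow> a x = 0"
      using a by (auto simp: test_fun_def)
    obtain K where K: "\<And>x. x \<in> S \<Longrightarrow> g x \<le> K" using g_bdd[OF S(1)] by blast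
    have "\<bar>frechet_derivative a (at x) h\<bar> \<le> max 0 K * norm h" for x h
    proof (cases "x \<in> S")
      case True
      then have "g x \<le> K" by (rule K)
      then have "g x \<le> max 0 K" by simp
      from order_trans[OF bound mult_right_mono[OF this norm_ge_zero]] show ?thesis .
    next
      case False
      have "((\<lambda>x. 0) has_derivative (\<lambda>h. 0)) (at x)" by simp
      then have "(a has_derivative (\<lambda>h. 0)) (at x)"
        by (rule has_derivative_transform_within_open[of _ _ _ _ "- S"])
          (use False S compact_imp_closed in auto)
      from frechet_derivative_at[OF this] show ?thesis by (metis abs_zero mult_nonneg_nonneg max.cobounded1 norm_ge_zero)
    qed
    then show ?thesis by blast
  qed
qed

context transport_setting
begin

section \<open>The energy estimate\<close>

lemma slab_integral_mono:
  fixes f :: "(real ^ 'n) \<times> real \<Rightarrow> real"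
  assumes "0 \<le> a" "b \<le> 1" "integrable (lebesgue_on \<Omega>) f" "\<And>z. 0 \<le> f z"
  shows "(LINT z|lebesgue_on (\<omega> \<times> {a..b}). f z) \<le> (LINT z|lebesgue_on \<Omega>. f z)"
proof -
  have "integrable lebesgue (\<lambda>z. indicator (\<omega> \<times> {a..b}) z *\<^sub>R f z)"
    using integrable_sub_slab[OF assms(1-3)] sub_slab(2)[OF assms(1,2)]
    by (subst (asm) integrable_restrict_space) auto
  moreover have "integrable lebesgue (\<lambda>z. indicator \<Omega> z *\<^sub>R f z)"
    using assms(3) by (subst (asm) integrable_restrict_space) auto
  moreover have "indicator (\<omega> \<times> {a..b}) z *\<^sub>R f z \<le> indicator \<Omega> z *\<^sub>R f z" for z
    using subsetD[OF sub_slab(1)[OF assms(1,2)], of z] assms(4)[of z]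
    by (cases "z \<in> \<omega> \<times> {a..b}") (simp_all add: indicator_def)
  ultimately have "(LINT z|lebesgue. indicator (\<omega> \<times> {a..b}) z *\<^sub>R f z) \<le> (LINT z|lebesgue. indicator \<Omega> z *\<^sub>R f z)"
    by (intro integral_mono) auto
  then show ?thesis
    using sub_slab(2)[OF assms(1,2)] by (subst (1 2) integral_restrict_space) auto
qed

text \<open>The transport identity for \<open>F\<^sup>2\<close>, whose transport derivative is \<open>2 * F * tder u F\<close>, together with
  \<open>2 * \<bar>x * y\<bar> \<le> x\<^sup>2 + y\<^sup>2\<close> and \<open>\<bar>d\<bar> \<le> m\<close>.\<close>

lemma energy_increment:
  fixes F :: "(real ^ 'n) \<times> real \<Rightarrow> real"
  assumes F: "C1_closed per F" and ab: "0 \<le> a" "a \<le> b" "b \<le> 1"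
  defines "e \<equiv> \<lambda>t. LINT x|lebesgue_on \<omega>. (F (x, t))\<^sup>2"
  shows "\<bar>e b - e a\<bar> \<le> (l2_norm \<Omega> (tder u F))\<^sup>2 + (LINT t|lebesgue_on {a..b}. (1 + m t) * e t)"
    and "integrable (lebesgue_on {a..b}) (\<lambda>t. (1 + m t) * e t)"
proof -
  have cF: "cont_diff F" using F by (rule C1_closed_cont_diff)
  define T where "T = tder u F"
  have T: "L2 \<Omega> T" unfolding T_def by (rule tder_L2[OF cF])
  define w where "w z = (1 + m (snd z)) * (F z * F z)" for z
  have FF: "L2 \<Omega> (\<lambda>z. F z * F z)" by (intro C1_L2 cont_diff_mult cF)
  have w: "integrable (lebesgue_on \<Omega>) w"
    unfolding w_def by (intro L2_mult_integrable FF L2_add one_L2 m_snd_L2)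
  have wi: "integrable (lebesgue_on (\<omega> \<times> {a..b})) w" by (rule integrable_sub_slab[OF ab(1,3) w])
  have T2: "integrable (lebesgue_on \<Omega>) (\<lambda>z. (T z)\<^sup>2)" using T by (simp add: L2_def)
  have T2i: "integrable (lebesgue_on (\<omega> \<times> {a..b})) (\<lambda>z. (T z)\<^sup>2)" by (rule integrable_sub_slab[OF ab(1,3) T2])
  have sec: "(LINT x|lebesgue_on \<omega>. w (x, t)) = (1 + m t) * e t" for t
    by (simp add: w_def e_def power2_eq_square)
  show int: "integrable (lebesgue_on {a..b}) (\<lambda>t. (1 + m t) * e t)"
    using lebesgue_Fubini(2)[OF _ _ wi] by (simp add: sec)
  have "e b - e a = (LINT z|lebesgue_on (\<omega> \<times> {a..b}). tder u (\<lambda>z. F z * F z) z + d z * (F z * F z))"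
    using transport_identity[OF C1_closed_mult[OF F F] ab] by (simp add: e_def power2_eq_square)
  also have "\<bar>\<dots>\<bar> \<le> (LINT z|lebesgue_on (\<omega> \<times> {a..b}). (T z)\<^sup>2 + w z)"
  proof (rule order_trans[OF integral_abs_bound integral_mono_AE])
    have "integrable (lebesgue_on \<Omega>) (\<lambda>z. tder u (\<lambda>z. F z * F z) z + d z * (F z * F z))"
      by (intro Bochner_Integration.integrable_add L2_mult_integrable d_L2 FF L2_integrable tder_L2 cont_diff_mult cF) auto
    then show "integrable (lebesgue_on (\<omega> \<times> {a..b})) (\<lambda>z. \<bar>tder u (\<lambda>z. F z * F z) z + d z * (F z * F z)\<bar>)"
      by (intro integrable_abs integrable_sub_slab[OF ab(1,3)])
    show "integrable (lebesgue_on (\<omega> \<times> {a..b})) (\<lambda>z. (T z)\<^sup>2 + w z)" using T2i wi by simp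
  next
    have "AE z in lebesgue. z \<in> \<Omega> \<longrightarrow> \<bar>d z\<bar> \<le> m (snd z)"
      using d_bound_AE by (subst (asm) AE_restrict_space_iff) auto
    then have "AE z in lebesgue_on (\<omega> \<times> {a..b}). \<bar>d z\<bar> \<le> m (snd z)"
      using sub_slab[OF ab(1,3)] by (subst AE_restrict_space_iff) (auto elim!: eventually_mono)
    then show "AE z in lebesgue_on (\<omega> \<times> {a..b}).
        \<bar>tder u (\<lambda>z. F z * F z) z + d z * (F z * F z)\<bar> \<le> (T z)\<^sup>2 + w z"
    proof eventually_elim
      case (elim z)
      have "tder u (\<lambda>z. F z * F z) z = 2 * (F z * T z)" by (simp add: tder_mult[OF cF cF] T_def)
      moreover have "\<bar>2 * (F z * T z)\<bar> \<le> (T z)\<^sup>2 + F z * F z"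
        using sum_squares_bound[of "\<bar>F z\<bar>" "\<bar>T z\<bar>"] by (simp add: abs_mult power2_eq_square)
      moreover have "\<bar>d z * (F z * F z)\<bar> \<le> m (snd z) * (F z * F z)"
        using mult_right_mono[OF elim, of "F z * F z"] by (simp add: abs_mult)
      ultimately show ?case by (simp add: w_def distrib_right)
    qed
  qed
  also have "\<dots> = (LINT z|lebesgue_on (\<omega> \<times> {a..b}). (T z)\<^sup>2) + (LINT z|lebesgue_on (\<omega> \<times> {a..b}). w z)"
    using T2i wi by simp
  also have "(LINT z|lebesgue_on (\<omega> \<times> {a..b}). w z) = (LINT t|lebesgue_on {a..b}. (1 + m t) * e t)"
    by (subst lebesgue_Fubini(3)[OF _ _ wi]) (auto simp: sec)
  also have "(LINT z|lebesgue_on (\<omega> \<times> {a..b}). (T z)\<^sup>2) \<le> (l2_norm \<Omega> T)\<^sup>2"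
    unfolding l2_norm_power2_integral by (rule slab_integral_mono[OF ab(1,3) T2]) simp
  finally show "\<bar>e b - e a\<bar> \<le> (l2_norm \<Omega> (tder u F))\<^sup>2 + (LINT t|lebesgue_on {a..b}. (1 + m t) * e t)"
    by (simp add: T_def)
qed

text \<open>The integral of \<open>m\<close> is uniformly small over short intervals because \<open>m\<close> is square integrable.\<close>

lemma short_interval: "\<exists>\<delta>>0. \<forall>a b. 0 \<le> a \<longrightarrow> a \<le> b \<longrightarrow> b \<le> 1 \<longrightarrow> b - a \<le> \<delta> \<longrightarrow>
    integrable (lebesgue_on {a..b}) m \<and> (LINT t|lebesgue_on {a..b}. 1 + m t) \<le> 1/2"
proof -
  define M where "M = (LINT t|lebesgue_on {0..1}. (m t)\<^sup>2)"
  have M: "M \<ge> 0" by (simp add: M_def)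
  define \<delta> where "\<delta> = 1 / (4 * (M + 2))"
  have "integrable (lebesgue_on {a..b}) m \<and> (LINT t|lebesgue_on {a..b}. 1 + m t) \<le> 1/2"
    if ab: "0 \<le> a" "a \<le> b" "b \<le> 1" "b - a \<le> \<delta>" for a b
  proof -
    have sub: "integrable (lebesgue_on {a..b}) f" if "integrable (lebesgue_on {0..1}) f" for f :: "real \<Rightarrow> real"
    proof -
      have "integrable lebesgue (\<lambda>z. indicator {0..1} z *\<^sub>R f z)"
        using that by (subst (asm) integrable_restrict_space) auto
      then have "integrable lebesgue (\<lambda>z. indicator {a..b} z *\<^sub>R (indicator {0..1} z *\<^sub>R f z))"
        by (rule integrable_mult_indicator[rotated]) simp
      moreover have "(\<lambda>z. indicator {a..b} z *\<^sub>R (indicator {0..1} z *\<^sub>R f z)) = (\<lambda>z. indicator {a..b} z *\<^sub>R f z)"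
        using ab by (auto simp: fun_eq_iff indicator_def)
      ultimately show ?thesis by (subst integrable_restrict_space) auto
    qed
    have m2: "integrable (lebesgue_on {0..1}) (\<lambda>t. (m t)\<^sup>2)" using m_L2 by (simp add: L2_def)
    have mi: "integrable (lebesgue_on {a..b}) m" by (intro sub L2_integrable m_L2) auto
    have m2i: "integrable (lebesgue_on {a..b}) (\<lambda>t. (m t)\<^sup>2)" by (rule sub[OF m2])
    have ci: "integrable (lebesgue_on {a..b}) (\<lambda>t. c)" for c :: real
      using continuous_integrable_cbox[of a b "\<lambda>t. c"] by simp
    have "(LINT t|lebesgue_on {a..b}. 1 + m t) \<le> (LINT t|lebesgue_on {a..b}. (M + 2) + 1 / (4 * (M + 1)) * (m t)\<^sup>2)"
    proof (rule integral_mono)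
      \<comment> \<open>completing the square, with weights that bring the integral of the right-hand side below \<open>1/4 + 1/4\<close>\<close>
      show "1 + m t \<le> (M + 2) + 1 / (4 * (M + 1)) * (m t)\<^sup>2" for t
      proof -
        define c where "c = M + 1"
        have c: "c > 0" using M by (simp add: c_def)
        have "0 \<le> (m t / (2 * c) - 1)\<^sup>2 * c" using c by simp
        also have "\<dots> = 1 / (4 * c) * (m t)\<^sup>2 - m t + c"
          using c by (simp add: power2_eq_square field_simps)
        finally show ?thesis by (simp add: c_def)
      qed
    qed (intro Bochner_Integration.integrable_add ci mi integrable_mult_right m2i)+
    also have "\<dots> = (b - a) * (M + 2) + 1 / (4 * (M + 1)) * (LINT t|lebesgue_on {a..b}. (m t)\<^sup>2)"
      using ab by (simp add: ci m2i measure_restrict_space)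
    also have "(LINT t|lebesgue_on {a..b}. (m t)\<^sup>2) \<le> M"
    proof -
      have "(LINT t|lebesgue. indicator {a..b} t *\<^sub>R (m t)\<^sup>2) \<le> (LINT t|lebesgue. indicator {0..1} t *\<^sub>R (m t)\<^sup>2)"
      proof (rule integral_mono)
        show "integrable lebesgue (\<lambda>t. indicator {a..b} t *\<^sub>R (m t)\<^sup>2)" "integrable lebesgue (\<lambda>t. indicator {0..1} t *\<^sub>R (m t)\<^sup>2)"
          using m2 m2i by (auto simp: integrable_restrict_space)
      qed (use ab in \<open>auto simp: indicator_def\<close>)
      then show ?thesis unfolding M_def by (subst (1 2) integral_restrict_space) auto
    qed
    also have "(b - a) * (M + 2) \<le> \<delta> * (M + 2)" using ab M by (intro mult_right_mono) auto
    also have "\<delta> * (M + 2) = 1/4" using M by (simp add: \<delta>_def field_simps)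
    finally have "(LINT t|lebesgue_on {a..b}. 1 + m t) \<le> 1/4 + 1 / (4 * (M + 1)) * M"
      using M by (simp add: divide_right_mono)
    also have "\<dots> \<le> 1/2" using M by (simp add: field_simps)
    finally show ?thesis using mi by simp
  qed
  moreover have "\<delta> > 0" using M by (simp add: \<delta>_def)
  ultimately show ?thesis by blast
qed

text \<open>Gronwall's inequality in finitely many steps.  On an interval so short that \<open>1 + m\<close> integrates to at
  most \<open>1/2\<close>, the integral term in the energy increment is absorbed into the maximum of the energy;
  each step multiplies the bound by at most \<open>3\<close>, and the number of steps depends on \<open>m\<close> only.
  The estimate starts from any time \<open>t0\<close>, in particular from either face.\<close>

lemma energy_estimate: "\<exists>K\<ge>0. \<forall>F t0. C1_closed per F \<longrightarrow> t0 \<in> {0..1} \<longrightarrow>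
    (l2_norm \<Omega> F)\<^sup>2 \<le> K * ((l2_norm \<omega> (\<lambda>x. F (x, t0)))\<^sup>2 + (l2_norm \<Omega> (tder u F))\<^sup>2)"
proof -
  obtain \<delta> where \<delta>: "\<delta> > 0" and short: "\<And>a b. 0 \<le> a \<Longrightarrow> a \<le> b \<Longrightarrow> b \<le> 1 \<Longrightarrow> b - a \<le> \<delta> \<Longrightarrow>
      integrable (lebesgue_on {a..b}) m \<and> (LINT t|lebesgue_on {a..b}. 1 + m t) \<le> 1/2"
    using short_interval by blast
  obtain N where N: "1 / \<delta> < real N" using reals_Archimedean2 by blast
  then have N\<delta>: "1 \<le> real N * \<delta>" using \<delta> by (simp add: field_simps)
  have N0: "N > 0" using N \<delta> by (metis gr0I less_asym of_nat_0 zero_less_divide_1_iff)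
  define K where "K n = (3 ^ (n + 1) :: real)" for n :: nat
  have main: "(l2_norm \<Omega> F)\<^sup>2 \<le> K N * ((l2_norm \<omega> (\<lambda>x. F (x, t0)))\<^sup>2 + (l2_norm \<Omega> (tder u F))\<^sup>2)"
    if F: "C1_closed per F" and t0: "t0 \<in> {0..1}" for F t0
  proof -
    have cF: "cont_diff F" using F by (rule C1_closed_cont_diff)
    define A where "A = (l2_norm \<Omega> (tder u F))\<^sup>2"
    define e where "e t = (LINT x|lebesgue_on \<omega>. (F (x, t))\<^sup>2)" for t
    have e_nonneg: "0 \<le> e t" for t by (simp add: e_def)
    have A: "0 \<le> A" by (simp add: A_def)
    have e_hk: "e t = integral (cbox 0 1) (\<lambda>x. (F (x, t))\<^sup>2)" for t
      unfolding e_def space_dom_def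
      by (intro lebesgue_integral_eq_integral continuous_integrable_cbox continuous_intros
          cont_diff_continuous cont_diff_slice cF) auto
    have e_cont: "continuous_on {0..1} e"
      unfolding e_hk
    proof (rule integral_continuous_on_param)
      have "continuous_on ({0..1} \<times> cbox 0 1) (\<lambda>p. F (snd p, fst p))"
        by (rule continuous_on_compose2[OF cont_diff_continuous[OF cF, of UNIV]]) (auto intro!: continuous_intros)
      then show "continuous_on ({0..1} \<times> cbox 0 1) (\<lambda>(t, x). (F (x, t))\<^sup>2)"
        unfolding split_beta by (intro continuous_intros)
    qed
    have absorb: "e p \<le> 2 * (e q + A)"
      if pq: "p \<in> {0..1}" "q \<in> {0..1}" "\<bar>p - q\<bar> \<le> \<delta>" for p q
    proof -
      define a b where "a = min p q" and "b = max p q"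
      have ab: "0 \<le> a" "a \<le> b" "b \<le> 1" "b - a \<le> \<delta>" using pq by (auto simp: a_def b_def)
      obtain r where r: "r \<in> {a..b}" and rmax: "\<And>t. t \<in> {a..b} \<Longrightarrow> e t \<le> e r"
        using continuous_attains_sup[of "{a..b}" e] continuous_on_subset[OF e_cont, of "{a..b}"] ab by auto
      have "\<bar>e r - e q\<bar> \<le> A + 1/2 * e r"
      proof -
        define a' b' where "a' = min r q" and "b' = max r q"
        have ab': "0 \<le> a'" "a' \<le> b'" "b' \<le> 1" "b' - a' \<le> \<delta>" "{a'..b'} \<subseteq> {a..b}"
          using ab r by (auto simp: a'_def b'_def a_def b_def)
        have mi: "integrable (lebesgue_on {a'..b'}) (\<lambda>t. 1 + m t)" and le: "(LINT t|lebesgue_on {a'..b'}. 1 + m t) \<le> 1/2"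
          using short[OF ab'(1-4)] continuous_integrable_cbox[of a' b' "\<lambda>t. 1"] by auto
        have "\<bar>e b' - e a'\<bar> \<le> A + (LINT t|lebesgue_on {a'..b'}. (1 + m t) * e t)"
          unfolding A_def e_def by (rule energy_increment(1)[OF F ab'(1-3)])
        also have "(LINT t|lebesgue_on {a'..b'}. (1 + m t) * e t) \<le> (LINT t|lebesgue_on {a'..b'}. (1 + m t) * e r)"
        proof (rule integral_mono)
          show "integrable (lebesgue_on {a'..b'}) (\<lambda>t. (1 + m t) * e t)"
            unfolding e_def by (rule energy_increment(2)[OF F ab'(1-3)])
          show "integrable (lebesgue_on {a'..b'}) (\<lambda>t. (1 + m t) * e r)" using mi by simp
          show "(1 + m t) * e t \<le> (1 + m t) * e r" if "t \<in> space (lebesgue_on {a'..b'})" for t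
            using that ab' m_nonneg[of t] rmax[of t] by (intro mult_left_mono) auto
        qed
        also have "(LINT t|lebesgue_on {a'..b'}. (1 + m t) * e r) \<le> 1/2 * e r"
          using mult_right_mono[OF le e_nonneg[of r]] by simp
        finally show ?thesis by (auto simp: a'_def b'_def min_def max_def split: if_splits)
      qed
      then have "e r - e q \<le> A + 1/2 * e r" by (rule order_trans[OF abs_ge_self])
      then have "e r \<le> 2 * (e q + A)" by (simp add: field_simps)
      moreover have "e p \<le> e r" by (rule rmax) (auto simp: a_def b_def)
      ultimately show ?thesis by simp
    qed
    have chain: "p \<in> {0..1} \<Longrightarrow> \<bar>p - t0\<bar> \<le> real n * \<delta> \<Longrightarrow> e p \<le> K n * (e t0 + A)" for n p
    proof (induction n arbitrary: p)
      case 0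
      then show ?case using A e_nonneg[of t0] by (simp add: K_def)
    next
      case (Suc n)
      \<comment> \<open>the previous of \<open>n + 1\<close> equidistant points between \<open>t0\<close> and \<open>p\<close>\<close>
      define q where "q = t0 + (p - t0) * (real n / real (Suc n))"
      have frac: "0 \<le> real n / real (Suc n)" "real n / real (Suc n) \<le> 1" by auto
      have q01: "q \<in> {0..1}"
      proof -
        have "q = (1 - f) *\<^sub>R t0 + f *\<^sub>R p" if "f = real n / real (Suc n)" for f
          unfolding q_def that[symmetric] by (simp add: algebra_simps)
        from this[OF refl] have "q = (1 - real n / real (Suc n)) *\<^sub>R t0 + (real n / real (Suc n)) *\<^sub>R p" .
        moreover have "convex {0..1::real}" by simp
        ultimately show ?thesis using frac t0 Suc.prems(1) by (simp only:) (rule convexD, auto)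
      qed
      have pq: "\<bar>p - q\<bar> \<le> \<delta>"
      proof -
        have "p - q = (p - t0) * (1 / real (Suc n))" by (simp add: q_def field_simps)
        then have "\<bar>p - q\<bar> = \<bar>p - t0\<bar> / real (Suc n)" by (simp add: abs_mult)
        also have "\<dots> \<le> \<delta>" using Suc.prems(2) by (simp add: field_simps)
        finally show ?thesis .
      qed
      have "\<bar>q - t0\<bar> = \<bar>p - t0\<bar> * (real n / real (Suc n))" by (simp add: q_def abs_mult)
      also have "\<dots> \<le> (real (Suc n) * \<delta>) * (real n / real (Suc n))"
        using Suc.prems(2) by (intro mult_right_mono) auto
      also have "\<dots> = real n * \<delta>" by simp
      finally have "e q \<le> K n * (e t0 + A)" by (rule Suc.IH[OF q01])
      moreover have "e p \<le> 2 * (e q + A)" by (rule absorb[OF Suc.prems(1) q01 pq])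
      moreover have "A \<le> 1 * (e t0 + A)" using e_nonneg[of t0] by simp
      ultimately have "e p \<le> (2 * K n + 2) * (e t0 + A)" by (simp add: algebra_simps)
      also have "\<dots> \<le> K (Suc n) * (e t0 + A)"
      proof (rule mult_right_mono)
        have "(1::real) \<le> 3 ^ n" by simp
        then have "(2::real) \<le> 3 * 3 ^ n" by linarith
        then have "(2::real) \<le> 3 ^ (n + 1)" by simp
        then show "2 * K n + 2 \<le> K (Suc n)" by (simp add: K_def)
      qed (use A e_nonneg in auto)
      finally show ?case .
    qed
    have bound: "e t \<le> K N * (e t0 + A)" if "t \<in> {0..1}" for t
      using that t0 N\<delta> by (intro chain) auto
    have F2: "integrable (lebesgue_on (\<omega> \<times> {0..1})) (\<lambda>z. (F z)\<^sup>2)"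
      using C1_L2[OF cF] by (simp add: L2_def spacetime_dom_Times)
    have "(l2_norm \<Omega> F)\<^sup>2 = (LINT t|lebesgue_on {0..1}. e t)"
      unfolding l2_norm_power2_integral e_def spacetime_dom_Times by (rule lebesgue_Fubini(3)[OF _ _ F2]) auto
    also have "\<dots> \<le> (LINT t|lebesgue_on {0..1::real}. K N * (e t0 + A))"
    proof (rule integral_mono)
      show "integrable (lebesgue_on {0..1}) e" unfolding e_def by (rule lebesgue_Fubini(2)[OF _ _ F2]) auto
      show "integrable (lebesgue_on {0..1::real}) (\<lambda>t. K N * (e t0 + A))"
        using continuous_integrable_cbox[of 0 1 "\<lambda>t::real. K N * (e t0 + A)"] by simp
    qed (use bound in auto)
    also have "\<dots> = K N * (e t0 + A)" by (simp add: measure_restrict_space)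
    finally show ?thesis by (simp add: e_def A_def l2_norm_power2_integral)
  qed
  then show ?thesis by (intro exI[of _ "K N"]) (auto simp: K_def)
qed

section \<open>Approximate solutions of the transport equation\<close>

text \<open>Away from the ends of the slabs the displacement runs at full speed and the error is
  \<open>u - v j\<close>, hence at most \<open>r\<close>.  Near the ends the error is of size \<open>L j \<le> \<epsilon> * N\<close>, but this happens on
  a set of measure \<open>2 * N * \<kappa>\<close>, and the third bound on \<open>\<kappa>\<close> makes the contribution to the \<open>L\<^sup>2\<close> norm
  at most \<open>\<epsilon>\<close>.\<close>

lemma transport_chain_small:
  assumes N: "N > 0"
    and v: "\<And>j. (L j)-lipschitz_on UNIV (v j)" "\<And>j x. x \<in> \<omega> \<Longrightarrow> norm (v j x) \<le> L j" "\<And>j. L j \<le> \<epsilon> * real N"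
    and r: "L2 {0..1} r" "l2_norm {0..1} r \<le> \<epsilon>" "\<And>t. t \<in> {0..1} \<Longrightarrow> 0 \<le> r t"
      "\<And>j t x. j < N \<Longrightarrow> t \<in> {real j / real N ..< real (Suc j) / real N} \<Longrightarrow> x \<in> \<omega> \<Longrightarrow> norm (u t x - v j x) \<le> r t"
    and \<kappa>: "0 < \<kappa>" "2 * \<kappa> \<le> 1 / real N" "2 * real N * \<kappa> * (real N)\<^sup>2 \<le> 1" and \<epsilon>: "0 < \<epsilon>" and P: "0 \<le> P"
    and F: "cont_diff F"
    and bound: "\<And>j t x. j < N \<Longrightarrow> t \<in> {real j / real N ..< real (Suc j) / real N} \<Longrightarrow> x \<in> \<omega> \<Longrightarrow>
      \<bar>tder u F (x, t)\<bar> \<le> P * (norm (u t x - ramp \<kappa> (real j / real N) (real (Suc j) / real N) t *\<^sub>R v j x)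
        + (1 / real N) * L j * norm (u t x))"
  shows "l2_norm \<Omega> (tder u F) \<le> P * (2 + l2_norm {0..1} m) * \<epsilon>"
proof -
  define bad where "bad = (\<Union>j<N. {real j / real N .. real j / real N + \<kappa>} \<union> {real (Suc j) / real N - \<kappa> .. real (Suc j) / real N})"
  define q where "q t = \<epsilon> * real N * indicator bad t" for t :: real
  have bad_sets: "bad \<in> sets lebesgue" unfolding bad_def by (intro sets.finite_UN) auto
  have q_meas: "q \<in> borel_measurable (lebesgue_on {0..1})"
    unfolding q_def using bad_sets by (intro borel_measurable_times measurable_restrict_space1) auto
  have q_L2: "L2 {0..1} q"
  proof (rule L2_dominated[OF q_meas])
    show "L2 {0..1::real} (\<lambda>t. \<epsilon> * real N)" using continuous_L2_cbox[of 0 "1::real"] by simp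
    show "AE t in lebesgue_on {0..1}. \<bar>q t\<bar> \<le> \<bar>\<epsilon> * real N\<bar>"
      by (intro AE_I2) (auto simp: q_def indicator_def)
  qed
  have bad_meas: "measure lebesgue bad \<le> 2 * real N * \<kappa>" and bad_lm: "bad \<in> lmeasurable"
  proof -
    have "measure lebesgue bad \<le> (\<Sum>j<N. measure lebesgue ({real j / real N .. real j / real N + \<kappa>} \<union> {real (Suc j) / real N - \<kappa> .. real (Suc j) / real N}))"
      unfolding bad_def by (rule measure_UNION_le) auto
    also have "\<dots> \<le> (\<Sum>j<N. 2 * \<kappa>)"
    proof (rule sum_mono)
      fix j
      have "measure lebesgue ({real j / real N .. real j / real N + \<kappa>} \<union> {real (Suc j) / real N - \<kappa> .. real (Suc j) / real N})
          \<le> measure lebesgue {real j / real N .. real j / real N + \<kappa>} + measure lebesgue {real (Suc j) / real N - \<kappa> .. real (Suc j) / real N}"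
        by (rule measure_Un_le) auto
      then show "measure lebesgue ({real j / real N .. real j / real N + \<kappa>} \<union> {real (Suc j) / real N - \<kappa> .. real (Suc j) / real N}) \<le> 2 * \<kappa>"
        using \<kappa>(1) by simp
    qed
    finally show "measure lebesgue bad \<le> 2 * real N * \<kappa>" by simp
    show "bad \<in> lmeasurable" unfolding bad_def by (intro fmeasurable.finite_UN) auto
  qed
  have q_norm: "l2_norm {0..1} q \<le> \<epsilon>"
  proof (rule power2_le_imp_le)
    have "(l2_norm {0..1} q)\<^sup>2 = (LINT t|lebesgue_on {0..1}. (\<epsilon> * real N)\<^sup>2 * indicator bad t)"
      unfolding l2_norm_power2_integral q_def
      by (rule Bochner_Integration.integral_cong) (auto simp: indicator_def)
    also have "\<dots> = (\<epsilon> * real N)\<^sup>2 * (LINT t|lebesgue_on {0..1}. indicator bad t)" by simp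
    also have "(LINT t|lebesgue_on {0..1}. indicator bad t) \<le> measure lebesgue bad"
    proof -
      have "(LINT t|lebesgue_on {0..1}. indicator bad t :: real) = (LINT t|lebesgue. indicator {0..1} t *\<^sub>R indicator bad t)"
        by (subst integral_restrict_space) auto
      also have "\<dots> = (LINT t|lebesgue. indicator ({0..1} \<inter> bad) t)"
        by (rule Bochner_Integration.integral_cong) (auto simp: indicator_def)
      also have "\<dots> = measure lebesgue ({0..1} \<inter> bad)" by simp
      also have "\<dots> \<le> measure lebesgue bad"
        using bad_lm bad_sets by (intro measure_mono_fmeasurable) auto
      finally show ?thesis .
    qed
    also have "(\<epsilon> * real N)\<^sup>2 * measure lebesgue bad \<le> (\<epsilon> * real N)\<^sup>2 * (2 * real N * \<kappa>)"
      by (rule mult_left_mono[OF bad_meas]) simp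
    also have "\<dots> = \<epsilon>\<^sup>2 * (2 * real N * \<kappa> * (real N)\<^sup>2)" by (simp add: power_mult_distrib mult_ac)
    also have "\<dots> \<le> \<epsilon>\<^sup>2 * 1" by (rule mult_left_mono[OF \<kappa>(3)]) simp
    finally show "(l2_norm {0..1} q)\<^sup>2 \<le> \<epsilon>\<^sup>2" by (simp add: mult_left_mono)
  qed (use \<epsilon> in simp)
  define R where "R t = P * ((r t + q t) + \<epsilon> * m t)" for t
  have R: "L2 {0..1} R" unfolding R_def by (intro L2_scale L2_add r q_L2 m_L2)
  have "\<bar>tder u F z\<bar> \<le> \<bar>R (snd z)\<bar>" if z: "z \<in> \<Omega>" "snd z \<noteq> 1" for z
  proof -
    obtain x t where zx: "z = (x, t)" by (cases z)
    have x: "x \<in> \<omega>" and t: "0 \<le> t" "t < 1" using z by (auto simp: zx spacetime_dom_Times)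
    define j where "j = nat \<lfloor>t * real N\<rfloor>"
    have jt: "real j \<le> t * real N" "t * real N < real (Suc j)"
      using t N unfolding j_def by (auto simp: of_nat_nat) (linarith+)
    have jN: "j < N" using jt(1) t(2) N
      by (metis mult_less_cancel_right_disj mult_1 of_nat_0_less_iff of_nat_less_iff order_le_less_trans)
    have slab: "t \<in> {real j / real N ..< real (Suc j) / real N}" using jt N by (auto simp: field_simps)
    define \<theta> where "\<theta> = ramp \<kappa> (real j / real N) (real (Suc j) / real N) t"
    have \<kappa>': "2 * \<kappa> \<le> real (Suc j) / real N - real j / real N"
      using \<kappa>(2) N by (simp add: field_simps)
    have \<theta>: "0 \<le> \<theta>" "\<theta> \<le> 1" unfolding \<theta>_def by (rule ramp_bounds[OF \<kappa>(1) \<kappa>'])+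
    have L: "0 \<le> L j" using v(1) by (rule lipschitz_on_nonneg)
    have "(1 - \<theta>) * L j \<le> q t"
    proof (cases "t \<in> bad")
      case True
      have "(1 - \<theta>) * L j \<le> 1 * L j" using \<theta> L by (intro mult_right_mono) auto
      also have "\<dots> \<le> q t" using v(3)[of j] True by (simp add: q_def)
      finally show ?thesis .
    next
      case False
      then have "real j / real N + \<kappa> \<le> t" "t \<le> real (Suc j) / real N - \<kappa>"
        using jN slab unfolding bad_def by force+
      then have "\<theta> = 1" unfolding \<theta>_def by (rule ramp_inside[OF \<kappa>(1) \<kappa>'])
      then show ?thesis using \<epsilon> by (simp add: q_def)
    qed
    moreover have "norm (u t x - \<theta> *\<^sub>R v j x) \<le> norm (u t x - v j x) + (1 - \<theta>) * L j"
    proof -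
      have "u t x - \<theta> *\<^sub>R v j x = (u t x - v j x) + (1 - \<theta>) *\<^sub>R v j x" by (simp add: algebra_simps)
      then have "norm (u t x - \<theta> *\<^sub>R v j x) \<le> norm (u t x - v j x) + norm ((1 - \<theta>) *\<^sub>R v j x)"
        using norm_triangle_ineq by metis
      also have "norm ((1 - \<theta>) *\<^sub>R v j x) \<le> (1 - \<theta>) * L j"
        using \<theta> v(2)[OF x, of j] by (simp add: mult_left_mono)
      finally show ?thesis by simp
    qed
    moreover have "norm (u t x - v j x) \<le> r t" by (rule r(4)[OF jN slab x])
    moreover have "(1 / real N) * L j * norm (u t x) \<le> \<epsilon> * m t"
      using v(3)[of j] N u_bound[of t x] t x L \<epsilon> by (intro mult_mono) (auto simp: field_simps)
    ultimately have "norm (u t x - \<theta> *\<^sub>R v j x) + (1 / real N) * L j * norm (u t x) \<le> (r t + q t) + \<epsilon> * m t"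
      by linarith
    then have "P * (norm (u t x - \<theta> *\<^sub>R v j x) + (1 / real N) * L j * norm (u t x)) \<le> R t"
      unfolding R_def using P by (rule mult_left_mono)
    then show ?thesis using bound[OF jN slab x] unfolding zx \<theta>_def by simp
  qed
  moreover have "AE z in lebesgue_on \<Omega>. snd z \<noteq> 1"
  proof (rule AE_spacetime_snd)
    have "AE t in lebesgue. t \<noteq> (1::real)"
      using AE_not_in[of "{1::real}" lebesgue] by (simp add: null_sets_completionI finite_imp_null_set_lborel)
    then show "AE t in lebesgue_on {0..1}. t \<noteq> (1::real)"
      by (subst AE_restrict_space_iff) (auto elim: eventually_mono)
  qed
  moreover have "AE z in lebesgue_on \<Omega>. z \<in> \<Omega>" by (rule AE_I2) simp
  ultimately have "AE z in lebesgue_on \<Omega>. \<bar>tder u F z\<bar> \<le> \<bar>R (snd z)\<bar>"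
    by (auto elim: eventually_elim2)
  then have "l2_norm \<Omega> (tder u F) \<le> l2_norm \<Omega> (\<lambda>z. R (snd z))"
    by (rule l2_norm_dominated[OF tder_measurable[OF F] L2_snd(1)[OF R]])
  also have "\<dots> = l2_norm {0..1} R" by (rule L2_snd(2)[OF R])
  also have "\<dots> = P * l2_norm {0..1} (\<lambda>t. (r t + q t) + \<epsilon> * m t)"
    unfolding R_def l2_norm_scale using P by simp
  also have "\<dots> \<le> P * ((l2_norm {0..1} r + l2_norm {0..1} q) + \<epsilon> * l2_norm {0..1} m)"
  proof (rule mult_left_mono[OF _ P])
    have "l2_norm {0..1} (\<lambda>t. (r t + q t) + \<epsilon> * m t) \<le> l2_norm {0..1} (\<lambda>t. r t + q t) + l2_norm {0..1} (\<lambda>t. \<epsilon> * m t)"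
      by (intro l2_norm_triangle L2_add L2_scale r q_L2 m_L2)
    also have "l2_norm {0..1} (\<lambda>t. r t + q t) \<le> l2_norm {0..1} r + l2_norm {0..1} q"
      by (intro l2_norm_triangle r q_L2)
    finally show "l2_norm {0..1} (\<lambda>t. (r t + q t) + \<epsilon> * m t) \<le> (l2_norm {0..1} r + l2_norm {0..1} q) + \<epsilon> * l2_norm {0..1} m"
      using \<epsilon> by (simp add: l2_norm_scale)
  qed
  also have "\<dots> \<le> P * ((\<epsilon> + \<epsilon>) + \<epsilon> * l2_norm {0..1} m)"
    using r(2) q_norm by (intro mult_left_mono[OF _ P]) auto
  finally show ?thesis by (simp add: algebra_simps)
qed

text \<open>Approximate solutions of the transport equation with prescribed values on one face.  The product of the
  gradient factors \<open>1 + L j / N\<close> is at most \<open>exp C\<close>, uniformly in the accuracy.  Prescribed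
  values at time \<open>1\<close> are reduced to the first case by reversing time, which negates the fields and
  reverses the order of the slabs.\<close>

lemma approximate_transport:
  assumes a: "cont_diff a" "\<And>x h. \<bar>frechet_derivative a (at x) h\<bar> \<le> K * norm h" "per \<Longrightarrow> periodic_fun a"
    and \<epsilon>: "0 < \<epsilon>"
  shows "\<exists>F G. C1_closed per F \<and> (\<forall>x. F (x, 0) = a x) \<and>
      l2_norm \<Omega> (tder u F) \<le> K * exp C * (2 + l2_norm {0..1} m) * \<epsilon> \<and>
      C1_closed per G \<and> (\<forall>x. G (x, 1) = a x) \<and>
      l2_norm \<Omega> (tder u G) \<le> K * exp C * (2 + l2_norm {0..1} m) * \<epsilon>"
proof -
  have "\<exists>N>0. \<exists>v L r.
       (\<forall>j. cont_diff (v j) \<and> (L j)-lipschitz_on UNIV (v j) \<and> (per \<longrightarrow> periodic_fun (v j)) \<and>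
          (\<forall>x\<in>space_dom. norm (v j x) \<le> L j) \<and> L j \<le> \<epsilon> * real N) \<and>
       (\<Sum>j<N. L j / real N) \<le> C \<and>
       L2 {0..1} r \<and> l2_norm {0..1} r \<le> \<epsilon> \<and> (\<forall>t\<in>{0..1}. 0 \<le> r t) \<and>
       (\<forall>j<N. \<forall>t\<in>{real j / real N ..< real (Suc j) / real N}. \<forall>x\<in>space_dom. norm (u t x - v j x) \<le> r t)"
    by (rule approx[OF \<epsilon>])
  then obtain N v L r where N: "N > 0"
    and vL: "\<forall>j. cont_diff (v j) \<and> (L j)-lipschitz_on UNIV (v j) \<and> (per \<longrightarrow> periodic_fun (v j)) \<and>
          (\<forall>x\<in>space_dom. norm (v j x) \<le> L j) \<and> L j \<le> \<epsilon> * real N"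
    and LC: "(\<Sum>j<N. L j / real N) \<le> C"
    and r12: "L2 {0..1} r" "l2_norm {0..1} r \<le> \<epsilon>" "\<forall>t\<in>{0..1}. 0 \<le> r t"
    and r4: "\<forall>j<N. \<forall>t\<in>{real j / real N ..< real (Suc j) / real N}. \<forall>x\<in>space_dom. norm (u t x - v j x) \<le> r t"
    by (elim exE conjE) (rule that; assumption)
  have v: "cont_diff (v j)" "(L j)-lipschitz_on UNIV (v j)" "per \<Longrightarrow> periodic_fun (v j)"
      "x \<in> \<omega> \<Longrightarrow> norm (v j x) \<le> L j" "L j \<le> \<epsilon> * real N" for j x
    using vL by auto
  have r: "L2 {0..1} r" "l2_norm {0..1} r \<le> \<epsilon>" "t \<in> {0..1} \<Longrightarrow> 0 \<le> r t"
      "j < N \<Longrightarrow> t \<in> {real j / real N ..< real (Suc j) / real N} \<Longrightarrow> x \<in> \<omega> \<Longrightarrow> norm (u t x - v j x) \<le> r t"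
    for j t x
    using r12 r4 by blast+
  have L0: "0 \<le> L j" for j using v(2) by (rule lipschitz_on_nonneg)
  have "0 \<le> K * norm (axis undefined 1 :: real ^ 'n)" by (rule order_trans[OF abs_ge_zero a(2)])
  then have K: "0 \<le> K" by simp
  \<comment> \<open>short switching times compared to \<open>1 / N\<^sup>2\<close>, as the velocities may be as large as \<open>\<epsilon> * N\<close>\<close>
  define \<kappa> where "\<kappa> = 1 / (2 * real N * (real N)\<^sup>2)"
  have N1: "1 \<le> real N" using N by simp
  have \<kappa>: "0 < \<kappa>" "2 * real N * \<kappa> * (real N)\<^sup>2 \<le> 1" "2 * \<kappa> \<le> 1 / real N"
  proof -
    show "0 < \<kappa>" "2 * real N * \<kappa> * (real N)\<^sup>2 \<le> 1" using N by (auto simp: \<kappa>_def)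
    have "1 \<le> (real N)\<^sup>2" using N1 by simp
    then have "1 / (real N * (real N)\<^sup>2) \<le> 1 / (real N * 1)" using N by (intro divide_left_mono mult_left_mono) auto
    then show "2 * \<kappa> \<le> 1 / real N" by (simp add: \<kappa>_def)
  qed
  define s where "s j = real j / real N" for j :: nat
  have s_diff: "s (Suc j) - s j = 1 / real N" for j by (simp add: s_def add_divide_distrib)
  have s_mono: "mono s" unfolding s_def by (intro monoI divide_right_mono) auto
  define \<Theta> where "\<Theta> j = ramp_int \<kappa> (s j) (s (Suc j))" for j
  define \<theta> where "\<theta> j = ramp \<kappa> (s j) (s (Suc j))" for j
  have \<kappa>': "2 * \<kappa> \<le> s (Suc j) - s j" for j using \<kappa>(3) by (simp add: s_diff)
  note rmp = ramp_int_deriv[OF \<kappa>(1) \<kappa>'] ramp_continuous[OF \<kappa>(1) \<kappa>'] ramp_int_nonneg[OF \<kappa>(1) \<kappa>']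
    ramp_int_le[OF \<kappa>(1) \<kappa>', unfolded s_diff] ramp_int_before[OF \<kappa>(1) \<kappa>'] ramp_outside[OF \<kappa>(1) \<kappa>']
  have chain: "\<exists>F. cont_diff F \<and> (\<forall>x. F (x, 0) = a x) \<and> (per \<longrightarrow> (\<forall>t. periodic_fun (\<lambda>x. F (x, t)))) \<and>
      (\<forall>j<N. \<forall>t\<in>{s j..s (Suc j)}. \<forall>x w. \<bar>frechet_derivative F (at (x, t)) (w, 1)\<bar>
       \<le> K * (\<Prod>i<N. 1 + 1 / real N * L' i) * (norm (w - \<theta> j t *\<^sub>R v' j x) + 1 / real N * L' j * norm w))"
    if v'': "\<forall>j. cont_diff (v' j)" "\<forall>j. (L' j)-lipschitz_on UNIV (v' j)" "\<forall>j. per \<longrightarrow> periodic_fun (v' j)"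
    for v' L'
  proof -
    have v': "\<And>j. cont_diff (v' j)" "\<And>j. (L' j)-lipschitz_on UNIV (v' j)" "\<And>j. per \<Longrightarrow> periodic_fun (v' j)"
      using v'' by blast+
    have "\<exists>F. cont_diff F \<and> (\<forall>x t. t \<le> s 0 \<longrightarrow> F (x, t) = a x) \<and>
      (per \<longrightarrow> (\<forall>t. periodic_fun (\<lambda>x. F (x, t)))) \<and>
      (\<forall>x t h r. s N \<le> t \<longrightarrow> frechet_derivative F (at (x, t)) (h, r) = frechet_derivative F (at (x, t)) (h, 0)) \<and>
      (\<forall>x t h. \<bar>frechet_derivative F (at (x, t)) (h, 0)\<bar> \<le> K * (\<Prod>i<N. 1 + 1 / real N * L' i) * norm h) \<and>
      (\<forall>j<N. \<forall>t\<in>{s j..s (Suc j)}. \<forall>x w. \<bar>frechet_derivative F (at (x, t)) (w, 1)\<bar>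
       \<le> K * (\<Prod>i<N. 1 + 1 / real N * L' i) * (norm (w - \<theta> j t *\<^sub>R v' j x) + 1 / real N * L' j * norm w))"
      by (rule transport_chain[OF a v', where \<Theta> = \<Theta>])
        (auto simp: \<Theta>_def \<theta>_def rmp s_mono)
    then obtain F where F: "cont_diff F" "\<forall>x t. t \<le> s 0 \<longrightarrow> F (x, t) = a x"
        "per \<longrightarrow> (\<forall>t. periodic_fun (\<lambda>x. F (x, t)))"
      and slab: "\<forall>j<N. \<forall>t\<in>{s j..s (Suc j)}. \<forall>x w. \<bar>frechet_derivative F (at (x, t)) (w, 1)\<bar>
       \<le> K * (\<Prod>i<N. 1 + 1 / real N * L' i) * (norm (w - \<theta> j t *\<^sub>R v' j x) + 1 / real N * L' j * norm w)"
      by (elim exE conjE) (rule that; assumption)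
    have "\<forall>x. F (x, 0) = a x" using F(2) by (simp add: s_def)
    with F(1,3) slab show ?thesis by (intro exI[of _ F] conjI)
  qed
  have prod_le: "K * (\<Prod>i<N. 1 + 1 / real N * L' i) \<le> K * exp C"
    if "(\<Sum>j<N. L' j / real N) \<le> C" "\<And>j. 0 \<le> L' j" for L'
  proof (rule mult_left_mono[OF _ K])
    have "(\<Prod>i<N. 1 + 1 / real N * L' i) \<le> (\<Prod>i<N. exp (L' i / real N))"
      using that(2) by (intro prod_mono) (auto simp: add_nonneg_nonneg)
    also have "\<dots> = exp (\<Sum>i<N. L' i / real N)" by (simp add: exp_sum)
    finally show "(\<Prod>i<N. 1 + 1 / real N * L' i) \<le> exp C" using that(1) order_trans[OF _ iffD2[OF exp_le_cancel_iff]] by blast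
  qed
  have P: "0 \<le> K * exp C" using K by simp
  have vP: "\<forall>j. cont_diff (v j)" "\<forall>j. (L j)-lipschitz_on UNIV (v j)" "\<forall>j. per \<longrightarrow> periodic_fun (v j)"
    using v by blast+
  obtain F where F': "cont_diff F" "\<forall>x. F (x, 0) = a x" "per \<longrightarrow> (\<forall>t. periodic_fun (\<lambda>x. F (x, t)))"
    and Fb': "\<forall>j<N. \<forall>t\<in>{s j..s (Suc j)}. \<forall>x w. \<bar>frechet_derivative F (at (x, t)) (w, 1)\<bar>
       \<le> K * (\<Prod>i<N. 1 + 1 / real N * L i) * (norm (w - \<theta> j t *\<^sub>R v j x) + 1 / real N * L j * norm w)"
    using chain[of v L, OF vP] by (elim exE conjE) (rule that; assumption)
  have F: "cont_diff F" "F (x, 0) = a x" "per \<Longrightarrow> periodic_fun (\<lambda>x. F (x, t))" for x t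
    using F' by auto
  note Fb = Fb'[rule_format]
  have F_small: "l2_norm \<Omega> (tder u F) \<le> K * exp C * (2 + l2_norm {0..1} m) * \<epsilon>"
  proof (rule transport_chain_small[OF N v(2,4,5) r \<kappa>(1,3,2) \<epsilon> P F(1)])
    fix j t x assume j: "j < N" and t: "t \<in> {real j / real N ..< real (Suc j) / real N}" and x: "x \<in> \<omega>"
    have "\<bar>tder u F (x, t)\<bar> \<le> K * (\<Prod>i<N. 1 + 1 / real N * L i) * (norm (u t x - \<theta> j t *\<^sub>R v j x) + 1 / real N * L j * norm (u t x))"
      unfolding tder_def snd_conv fst_conv using t by (intro Fb[OF j]) (auto simp: s_def)
    also have "\<dots> \<le> K * exp C * (norm (u t x - \<theta> j t *\<^sub>R v j x) + 1 / real N * L j * norm (u t x))"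
      using L0 by (intro mult_right_mono prod_le[OF LC L0]) auto
    finally show "\<bar>tder u F (x, t)\<bar> \<le> K * exp C * (norm (u t x - ramp \<kappa> (real j / real N) (real (Suc j) / real N) t *\<^sub>R v j x) + 1 / real N * L j * norm (u t x))"
      by (simp add: \<theta>_def s_def)
  qed
  \<comment> \<open>the same construction with time reversed\<close>
  define v' where "v' j = (\<lambda>x. - v (N - 1 - j) x)" for j
  define L' where "L' j = L (N - 1 - j)" for j
  have v': "\<forall>j. cont_diff (v' j)" "\<forall>j. (L' j)-lipschitz_on UNIV (v' j)" "\<forall>j. per \<longrightarrow> periodic_fun (v' j)"
    using v(1-3) unfolding v'_def L'_def
    by (auto intro!: cont_diff_minus simp: lipschitz_on_minus periodic_fun_def lipschitz_on_def dist_minus)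
  have L'C: "(\<Sum>j<N. L' j / real N) \<le> C"
    using LC unfolding L'_def by (subst sum.nat_diff_reindex[symmetric]) simp
  obtain H where H': "cont_diff H" "\<forall>x. H (x, 0) = a x" "per \<longrightarrow> (\<forall>t. periodic_fun (\<lambda>x. H (x, t)))"
    and Hb': "\<forall>j<N. \<forall>t\<in>{s j..s (Suc j)}. \<forall>x w. \<bar>frechet_derivative H (at (x, t)) (w, 1)\<bar>
       \<le> K * (\<Prod>i<N. 1 + 1 / real N * L' i) * (norm (w - \<theta> j t *\<^sub>R v' j x) + 1 / real N * L' j * norm w)"
    using chain[of v' L', OF v'] by (elim exE conjE) (rule that; assumption)
  have H: "cont_diff H" "H (x, 0) = a x" "per \<Longrightarrow> periodic_fun (\<lambda>x. H (x, t))" for x t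
    using H' by auto
  note Hb = Hb'[rule_format]
  define \<rho> where "\<rho> z = (fst z, 1 - snd z)" for z :: "(real ^ 'n) \<times> real"
  define G where "G z = H (\<rho> z)" for z
  have c\<rho>: "cont_diff \<rho>"
    unfolding \<rho>_def[abs_def] by (intro cont_diff_intros cont_diff_fst cont_diff_snd)
  have D\<rho>: "frechet_derivative \<rho> (at z) (h, k) = (h, - k)" for z h k
  proof -
    have "(\<rho> has_derivative (\<lambda>k. (fst k, - snd k))) (at z)"
      unfolding \<rho>_def[abs_def] by (auto intro!: derivative_eq_intros)
    from frechet_derivative_at[OF this, symmetric] show ?thesis by simp
  qed
  have cG: "cont_diff G" unfolding G_def[abs_def] by (rule cont_diff_compose[OF H(1) c\<rho>])
  have tG: "tder u G (x, t) = - frechet_derivative H (at (x, 1 - t)) (- u t x, 1)" for x t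
  proof -
    have "tder u G (x, t) = frechet_derivative H (at (\<rho> (x, t))) (u t x, - 1)"
      unfolding tder_def G_def[abs_def] frechet_derivative_comp[OF H(1) c\<rho>] D\<rho> by simp
    also have "\<dots> = frechet_derivative H (at (x, 1 - t)) (- (- u t x, 1))" by (simp add: \<rho>_def)
    finally show ?thesis by (simp only: linear_neg[OF frechet_derivative_linear[OF H(1)]])
  qed
  have G_small: "l2_norm \<Omega> (tder u G) \<le> K * exp C * (2 + l2_norm {0..1} m) * \<epsilon>"
  proof (rule transport_chain_small[OF N v(2,4,5) r \<kappa>(1,3,2) \<epsilon> P cG])
    fix j t x assume j: "j < N" and t: "t \<in> {real j / real N ..< real (Suc j) / real N}" and x: "x \<in> \<omega>"
    define i where "i = N - 1 - j"
    have i: "i < N" "N - Suc i = j" "real (Suc i) = real N - real j" using j by (auto simp: i_def)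
    have si: "s i = 1 - s (Suc j)" "s (Suc i) = 1 - s j"
      using i(3) N by (auto simp: s_def field_simps)
    have "s j \<le> t" "t < s (Suc j)" using t by (auto simp: s_def)
    then have "1 - t \<in> {s i..s (Suc i)}" unfolding si by simp
    from Hb[OF i(1) this, of x "- u t x"]
    have "\<bar>tder u G (x, t)\<bar> \<le> K * (\<Prod>i<N. 1 + 1 / real N * L' i) * (norm (- u t x - \<theta> i (1 - t) *\<^sub>R v' i x) + 1 / real N * L' i * norm (- u t x))"
      by (simp add: tG)
    also have "norm (- u t x - \<theta> i (1 - t) *\<^sub>R v' i x) = norm (u t x - \<theta> j t *\<^sub>R v j x)"
    proof -
      have "\<theta> i (1 - t) = \<theta> j t" unfolding \<theta>_def si by (rule ramp_reflect)
      then have "- u t x - \<theta> i (1 - t) *\<^sub>R v' i x = - (u t x - \<theta> j t *\<^sub>R v j x)" by (simp add: v'_def i(2))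
      then show ?thesis by (metis norm_minus_cancel)
    qed
    also have "K * (\<Prod>i<N. 1 + 1 / real N * L' i) * (norm (u t x - \<theta> j t *\<^sub>R v j x) + 1 / real N * L' i * norm (- u t x))
        \<le> K * exp C * (norm (u t x - \<theta> j t *\<^sub>R v j x) + 1 / real N * L' i * norm (- u t x))"
      using L0 by (intro mult_right_mono prod_le[OF L'C]) (auto simp: L'_def)
    finally show "\<bar>tder u G (x, t)\<bar> \<le> K * exp C * (norm (u t x - ramp \<kappa> (real j / real N) (real (Suc j) / real N) t *\<^sub>R v j x) + 1 / real N * L j * norm (u t x))"
      by (simp add: \<theta>_def s_def L'_def i(2))
  qed
  have "C1_closed per F" using F by (simp add: C1_closed_def C1_iff_cont_diff)
  moreover have "C1_closed per G" using cG H(3) by (simp add: C1_closed_def C1_iff_cont_diff G_def \<rho>_def)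
  moreover have "G (x, 1) = a x" for x using H(2) by (simp add: G_def \<rho>_def)
  ultimately show ?thesis using F(2) F_small G_small by blast
qed

end

section \<open>Traces\<close>

context transport_setting
begin

lemma G_norm_tendsto_iff:
  assumes f: "\<And>k. L2 \<Omega> (f k)" "\<And>k. L2 \<Omega> (g k)" "\<And>k. weak_transport per u (f k) (g k)"
  shows "(\<lambda>k. G_norm per u (f k)) \<longlonglongrightarrow> 0 \<longleftrightarrow>
    (\<lambda>k. l2_norm \<Omega> (f k)) \<longlonglongrightarrow> 0 \<and> (\<lambda>k. l2_norm \<Omega> (g k)) \<longlonglongrightarrow> 0"
proof -
  have eq: "G_norm per u (f k) = sqrt ((l2_norm \<Omega> (f k))\<^sup>2 + (l2_norm \<Omega> (g k))\<^sup>2)" for k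
    by (rule G_norm_eq[OF f])
  show ?thesis
  proof safe
    assume lim: "(\<lambda>k. G_norm per u (f k)) \<longlonglongrightarrow> 0"
    show "(\<lambda>k. l2_norm \<Omega> (f k)) \<longlonglongrightarrow> 0"
      by (rule Lim_null_comparison[OF _ lim]) (simp add: eq l2_norm_nonneg)
    show "(\<lambda>k. l2_norm \<Omega> (g k)) \<longlonglongrightarrow> 0"
      by (rule Lim_null_comparison[OF _ lim]) (simp add: eq l2_norm_nonneg)
  next
    assume "(\<lambda>k. l2_norm \<Omega> (f k)) \<longlonglongrightarrow> 0" "(\<lambda>k. l2_norm \<Omega> (g k)) \<longlonglongrightarrow> 0"
    then have "(\<lambda>k. sqrt ((l2_norm \<Omega> (f k))\<^sup>2 + (l2_norm \<Omega> (g k))\<^sup>2)) \<longlonglongrightarrow> sqrt (0\<^sup>2 + 0\<^sup>2)"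
      by (intro tendsto_intros)
    then show "(\<lambda>k. G_norm per u (f k)) \<longlonglongrightarrow> 0" by (simp add: eq)
  qed
qed

lemma has_trace_approximation:
  assumes f: "L2 \<Omega> f" "L2 \<Omega> g" "weak_transport per u f g" and F: "\<And>k. C1_closed per (F k)"
  shows "(\<lambda>k. G_norm per u (\<lambda>z. F k z - f z)) \<longlonglongrightarrow> 0 \<longleftrightarrow>
    (\<lambda>k. l2_norm \<Omega> (\<lambda>z. F k z - f z)) \<longlonglongrightarrow> 0 \<and> (\<lambda>k. l2_norm \<Omega> (\<lambda>z. tder u (F k) z - g z)) \<longlonglongrightarrow> 0"
proof (rule G_norm_tendsto_iff)
  fix k
  have cF: "cont_diff (F k)" by (rule C1_closed_cont_diff[OF F])
  show "L2 \<Omega> (\<lambda>z. F k z - f z)" "L2 \<Omega> (\<lambda>z. tder u (F k) z - g z)"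
    by (intro L2_diff C1_L2 tder_L2 cF f)+
  show "weak_transport per u (\<lambda>z. F k z - f z) (\<lambda>z. tder u (F k) z - g z)"
    using weak_transport_combination[OF C1_L2[OF cF] tder_L2[OF cF] f(1,2) weak_transport_C1[OF F] f(3), of "-1"]
    by simp
qed

text \<open>The graph norm is unfolded into convergence of the functions and of their transport derivatives.\<close>

lemma has_traceD:
  assumes "has_trace per u f g0 g1"
  shows "in_G per u f" "L2 \<omega> g0" "L2 \<omega> g1"
    and "\<exists>F. (\<forall>k. C1_closed per (F k)) \<and> (\<lambda>k. l2_norm \<Omega> (\<lambda>z. F k z - f z)) \<longlonglongrightarrow> 0 \<and>
      (\<lambda>k. l2_norm \<Omega> (\<lambda>z. tder u (F k) z - transport per u f z)) \<longlonglongrightarrow> 0 \<and>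
      (\<lambda>k. l2_norm \<omega> (\<lambda>x. F k (x, 0) - g0 x)) \<longlonglongrightarrow> 0 \<and> (\<lambda>k. l2_norm \<omega> (\<lambda>x. F k (x, 1) - g1 x)) \<longlonglongrightarrow> 0"
proof -
  show G: "in_G per u f" and "L2 \<omega> g0" "L2 \<omega> g1" using assms by (auto simp: has_trace_def)
  obtain F where F: "\<forall>k. C1_closed per (F k)" and lim: "(\<lambda>k. G_norm per u (\<lambda>z. F k z - f z)) \<longlonglongrightarrow> 0"
    and tr: "(\<lambda>k. l2_norm \<omega> (\<lambda>x. F k (x, 0) - g0 x)) \<longlonglongrightarrow> 0" "(\<lambda>k. l2_norm \<omega> (\<lambda>x. F k (x, 1) - g1 x)) \<longlonglongrightarrow> 0"
    using assms unfolding has_trace_def by blast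
  have "(\<lambda>k. l2_norm \<Omega> (\<lambda>z. F k z - f z)) \<longlonglongrightarrow> 0 \<and>
      (\<lambda>k. l2_norm \<Omega> (\<lambda>z. tder u (F k) z - transport per u f z)) \<longlonglongrightarrow> 0"
    using has_trace_approximation[OF transport_spec[OF G], of F] F lim by blast
  with F tr show "\<exists>F. (\<forall>k. C1_closed per (F k)) \<and> (\<lambda>k. l2_norm \<Omega> (\<lambda>z. F k z - f z)) \<longlonglongrightarrow> 0 \<and>
      (\<lambda>k. l2_norm \<Omega> (\<lambda>z. tder u (F k) z - transport per u f z)) \<longlonglongrightarrow> 0 \<and>
      (\<lambda>k. l2_norm \<omega> (\<lambda>x. F k (x, 0) - g0 x)) \<longlonglongrightarrow> 0 \<and> (\<lambda>k. l2_norm \<omega> (\<lambda>x. F k (x, 1) - g1 x)) \<longlonglongrightarrow> 0"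
    by (intro exI[of _ F] conjI) auto
qed

lemma has_traceI:
  assumes L: "L2 \<Omega> f" "L2 \<Omega> g" "L2 \<omega> g0" "L2 \<omega> g1" and F: "\<And>k. C1_closed per (F k)"
    and lim: "(\<lambda>k. l2_norm \<Omega> (\<lambda>z. F k z - f z)) \<longlonglongrightarrow> 0" "(\<lambda>k. l2_norm \<Omega> (\<lambda>z. tder u (F k) z - g z)) \<longlonglongrightarrow> 0"
      "(\<lambda>k. l2_norm \<omega> (\<lambda>x. F k (x, 0) - g0 x)) \<longlonglongrightarrow> 0" "(\<lambda>k. l2_norm \<omega> (\<lambda>x. F k (x, 1) - g1 x)) \<longlonglongrightarrow> 0"
  shows "weak_transport per u f g" "has_trace per u f g0 g1"
proof -
  have cF: "cont_diff (F k)" for k by (rule C1_closed_cont_diff[OF F])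
  show w: "weak_transport per u f g"
    by (rule weak_transport_limit[OF C1_L2[OF cF] tder_L2[OF cF] L(1,2) weak_transport_C1[OF F] lim(1,2)])
  have "(\<lambda>k. G_norm per u (\<lambda>z. F k z - f z)) \<longlonglongrightarrow> 0"
    using has_trace_approximation[OF L(1,2) w, of F] F lim(1,2) by blast
  then show "has_trace per u f g0 g1"
    unfolding has_trace_def using transport_eq(1)[OF L(1,2) w] L(3,4) F lim(3,4) by blast
qed

lemma slice_L2: "C1_closed per F \<Longrightarrow> L2 \<omega> (\<lambda>x. F (x, t))"
  by (intro continuous_L2_space cont_diff_continuous cont_diff_slice C1_closed_cont_diff)

lemma l2_norm_combination_tendsto:
  assumes f: "\<And>k. L2 S (f k)" "L2 S f0" "\<And>k. L2 S (g k)" "L2 S g0"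
    and lim: "(\<lambda>k. l2_norm S (\<lambda>x. f k x - f0 x)) \<longlonglongrightarrow> 0" "(\<lambda>k. l2_norm S (\<lambda>x. g k x - g0 x)) \<longlonglongrightarrow> 0"
  shows "(\<lambda>k. l2_norm S (\<lambda>x. (f k x + c * g k x) - (f0 x + c * g0 x))) \<longlonglongrightarrow> 0"
proof (rule Lim_null_comparison)
  have "(\<lambda>k. l2_norm S (\<lambda>x. f k x - f0 x) + \<bar>c\<bar> * l2_norm S (\<lambda>x. g k x - g0 x)) \<longlonglongrightarrow> 0 + \<bar>c\<bar> * 0"
    by (intro tendsto_intros lim)
  then show "(\<lambda>k. l2_norm S (\<lambda>x. f k x - f0 x) + \<bar>c\<bar> * l2_norm S (\<lambda>x. g k x - g0 x)) \<longlonglongrightarrow> 0" by simp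
  have "l2_norm S (\<lambda>x. (f k x + c * g k x) - (f0 x + c * g0 x))
      \<le> l2_norm S (\<lambda>x. f k x - f0 x) + \<bar>c\<bar> * l2_norm S (\<lambda>x. g k x - g0 x)" for k
  proof -
    have "(\<lambda>x. (f k x + c * g k x) - (f0 x + c * g0 x)) = (\<lambda>x. (f k x - f0 x) + c * (g k x - g0 x))"
      by (auto simp: algebra_simps)
    then show ?thesis
      using l2_norm_triangle[OF L2_diff[OF f(1,2), of k] L2_scale[OF L2_diff[OF f(3,4), of k], of c]]
      by (simp add: l2_norm_scale)
  qed
  then show "\<forall>\<^sub>F k in sequentially. norm (l2_norm S (\<lambda>x. (f k x + c * g k x) - (f0 x + c * g0 x)))
      \<le> l2_norm S (\<lambda>x. f k x - f0 x) + \<bar>c\<bar> * l2_norm S (\<lambda>x. g k x - g0 x)"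
    by (simp add: l2_norm_nonneg)
qed

lemma tder_combination:
  assumes "cont_diff F" "cont_diff G"
  shows "tder u (\<lambda>z. F z + c * G z) z = tder u F z + c * tder u G z"
proof -
  have "tder u (\<lambda>z. c * G z) z = c * tder u G z"
    using tder_mult[OF cont_diff_const assms(2), of u c z] by (simp add: tder_def)
  then show ?thesis using tder_add[OF assms(1) cont_diff_mult[OF cont_diff_const assms(2)], of u c z] by simp
qed

lemma has_trace_combination:
  assumes f: "has_trace per u f f0 f1" and g: "has_trace per u g g0 g1"
  shows "has_trace per u (\<lambda>z. f z + c * g z) (\<lambda>x. f0 x + c * g0 x) (\<lambda>x. f1 x + c * g1 x)"
    and "AE z in lebesgue_on \<Omega>. transport per u (\<lambda>z. f z + c * g z) z = transport per u f z + c * transport per u g z"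
proof -
  note sf = transport_spec[OF has_traceD(1)[OF f]] and sg = transport_spec[OF has_traceD(1)[OF g]]
  have w: "weak_transport per u (\<lambda>z. f z + c * g z) (\<lambda>z. transport per u f z + c * transport per u g z)"
    by (rule weak_transport_combination[OF sf(1,2) sg(1,2) sf(3) sg(3)])
  have L: "L2 \<Omega> (\<lambda>z. f z + c * g z)" "L2 \<Omega> (\<lambda>z. transport per u f z + c * transport per u g z)"
    by (intro L2_add L2_scale sf sg)+
  show "AE z in lebesgue_on \<Omega>. transport per u (\<lambda>z. f z + c * g z) z = transport per u f z + c * transport per u g z"
    by (rule transport_eq(2)[OF L w])
  obtain F where F: "\<forall>k. C1_closed per (F k)" "(\<lambda>k. l2_norm \<Omega> (\<lambda>z. F k z - f z)) \<longlonglongrightarrow> 0"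
      "(\<lambda>k. l2_norm \<Omega> (\<lambda>z. tder u (F k) z - transport per u f z)) \<longlonglongrightarrow> 0"
      "(\<lambda>k. l2_norm \<omega> (\<lambda>x. F k (x, 0) - f0 x)) \<longlonglongrightarrow> 0" "(\<lambda>k. l2_norm \<omega> (\<lambda>x. F k (x, 1) - f1 x)) \<longlonglongrightarrow> 0"
    using has_traceD(4)[OF f] by blast
  obtain G where G: "\<forall>k. C1_closed per (G k)" "(\<lambda>k. l2_norm \<Omega> (\<lambda>z. G k z - g z)) \<longlonglongrightarrow> 0"
      "(\<lambda>k. l2_norm \<Omega> (\<lambda>z. tder u (G k) z - transport per u g z)) \<longlonglongrightarrow> 0"
      "(\<lambda>k. l2_norm \<omega> (\<lambda>x. G k (x, 0) - g0 x)) \<longlonglongrightarrow> 0" "(\<lambda>k. l2_norm \<omega> (\<lambda>x. G k (x, 1) - g1 x)) \<longlonglongrightarrow> 0"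
    using has_traceD(4)[OF g] by blast
  have C: "C1_closed per (F k)" "C1_closed per (G k)" for k using F(1) G(1) by auto
  have cF: "cont_diff (F k)" "cont_diff (G k)" for k using C by (auto intro: C1_closed_cont_diff)
  note Lf = has_traceD(2,3)[OF f] and Lg = has_traceD(2,3)[OF g]
  show "has_trace per u (\<lambda>z. f z + c * g z) (\<lambda>x. f0 x + c * g0 x) (\<lambda>x. f1 x + c * g1 x)"
  proof (rule has_traceI(2)[OF L, where F = "\<lambda>k z. F k z + c * G k z"])
    show "L2 \<omega> (\<lambda>x. f0 x + c * g0 x)" "L2 \<omega> (\<lambda>x. f1 x + c * g1 x)" by (intro L2_add L2_scale Lf Lg)+
    show "C1_closed per (\<lambda>z. F k z + c * G k z)" for k by (intro C1_closed_combination C)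
    show "(\<lambda>k. l2_norm \<Omega> (\<lambda>z. F k z + c * G k z - (f z + c * g z))) \<longlonglongrightarrow> 0"
      by (rule l2_norm_combination_tendsto[OF C1_L2[OF cF(1)] sf(1) C1_L2[OF cF(2)] sg(1) F(2) G(2)])
    show "(\<lambda>k. l2_norm \<Omega> (\<lambda>z. tder u (\<lambda>z. F k z + c * G k z) z - (transport per u f z + c * transport per u g z))) \<longlonglongrightarrow> 0"
      unfolding tder_combination[OF cF]
      by (rule l2_norm_combination_tendsto[OF tder_L2[OF cF(1)] sf(2) tder_L2[OF cF(2)] sg(2) F(3) G(3)])
    show "(\<lambda>k. l2_norm \<omega> (\<lambda>x. F k (x, 0) + c * G k (x, 0) - (f0 x + c * g0 x))) \<longlonglongrightarrow> 0"
      by (rule l2_norm_combination_tendsto[OF slice_L2[OF C(1)] Lf(1) slice_L2[OF C(2)] Lg(1) F(4) G(4)])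
    show "(\<lambda>k. l2_norm \<omega> (\<lambda>x. F k (x, 1) + c * G k (x, 1) - (f1 x + c * g1 x))) \<longlonglongrightarrow> 0"
      by (rule l2_norm_combination_tendsto[OF slice_L2[OF C(1)] Lf(2) slice_L2[OF C(2)] Lg(2) F(5) G(5)])
  qed
qed

lemma has_trace_difference:
  assumes f: "has_trace per u f f0 f1" and g: "has_trace per u g f0 f1"
  shows "has_trace per u (\<lambda>z. f z - g z) (\<lambda>x. 0) (\<lambda>x. 0)"
    and "AE z in lebesgue_on \<Omega>. transport per u (\<lambda>z. f z - g z) z = transport per u f z - transport per u g z"
  using has_trace_combination[OF f g, of "-1"] by simp_all

text \<open>A Poincare inequality along the characteristics: the energy estimate with \<open>t0 = 0\<close>, passed to the
  limit of smooth approximations.  It makes the energy coercive on differences of feasible functions.\<close>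

lemma zero_trace_estimate:
  "\<exists>K\<ge>0. \<forall>f. has_trace per u f (\<lambda>x. 0) (\<lambda>x. 0) \<longrightarrow> l2_norm \<Omega> f \<le> K * l2_norm \<Omega> (transport per u f)"
proof -
  obtain K where K: "K \<ge> 0" and est: "\<And>F t0. C1_closed per F \<Longrightarrow> t0 \<in> {0..1} \<Longrightarrow>
    (l2_norm \<Omega> F)\<^sup>2 \<le> K * ((l2_norm \<omega> (\<lambda>x. F (x, t0)))\<^sup>2 + (l2_norm \<Omega> (tder u F))\<^sup>2)"
    using energy_estimate by metis
  have "l2_norm \<Omega> f \<le> sqrt K * l2_norm \<Omega> (transport per u f)" if f: "has_trace per u f (\<lambda>x. 0) (\<lambda>x. 0)" for f
  proof -
    note sf = transport_spec[OF has_traceD(1)[OF f]]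
    obtain F where F: "\<forall>k. C1_closed per (F k)" "(\<lambda>k. l2_norm \<Omega> (\<lambda>z. F k z - f z)) \<longlonglongrightarrow> 0"
      "(\<lambda>k. l2_norm \<Omega> (\<lambda>z. tder u (F k) z - transport per u f z)) \<longlonglongrightarrow> 0"
      "(\<lambda>k. l2_norm \<omega> (\<lambda>x. F k (x, 0) - 0)) \<longlonglongrightarrow> 0"
      using has_traceD(4)[OF f] by blast
    have cF: "cont_diff (F k)" for k using F(1) by (auto intro: C1_closed_cont_diff)
    have "(\<lambda>k. l2_norm \<Omega> (F k)) \<longlonglongrightarrow> l2_norm \<Omega> f"
      by (rule l2_norm_tendsto[OF C1_L2[OF cF] sf(1) F(2)])
    then have a: "(\<lambda>k. (l2_norm \<Omega> (F k))\<^sup>2) \<longlonglongrightarrow> (l2_norm \<Omega> f)\<^sup>2" by (intro tendsto_intros)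
    have "(\<lambda>k. l2_norm \<Omega> (tder u (F k))) \<longlonglongrightarrow> l2_norm \<Omega> (transport per u f)"
      by (rule l2_norm_tendsto[OF tder_L2[OF cF] sf(2) F(3)])
    then have b: "(\<lambda>k. K * ((l2_norm \<omega> (\<lambda>x. F k (x, 0)))\<^sup>2 + (l2_norm \<Omega> (tder u (F k)))\<^sup>2))
        \<longlonglongrightarrow> K * (0\<^sup>2 + (l2_norm \<Omega> (transport per u f))\<^sup>2)"
      using F(4) by (intro tendsto_intros) auto
    have "(l2_norm \<Omega> f)\<^sup>2 \<le> K * (0\<^sup>2 + (l2_norm \<Omega> (transport per u f))\<^sup>2)"
      by (rule LIMSEQ_le[OF a b]) (use est F(1) in auto)
    then have "(l2_norm \<Omega> f)\<^sup>2 \<le> (sqrt K * l2_norm \<Omega> (transport per u f))\<^sup>2"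
      using K by (simp add: power_mult_distrib)
    then show ?thesis using K by (auto intro: power2_le_imp_le simp: l2_norm_nonneg)
  qed
  then show ?thesis using K by (intro exI[of _ "sqrt K"]) auto
qed

text \<open>The set of functions with given traces is closed in the graph norm: a diagonal sequence of smooth
  approximations.\<close>

lemma has_trace_limit:
  assumes f: "\<And>k. has_trace per u (f k) g0 g1" and L: "L2 \<Omega> f0" "L2 \<Omega> h0"
    and lim: "(\<lambda>k. l2_norm \<Omega> (\<lambda>z. f k z - f0 z)) \<longlonglongrightarrow> 0"
      "(\<lambda>k. l2_norm \<Omega> (\<lambda>z. transport per u (f k) z - h0 z)) \<longlonglongrightarrow> 0"
  shows "weak_transport per u f0 h0" "has_trace per u f0 g0 g1"
proof -
  note sf = transport_spec[OF has_traceD(1)[OF f]]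
  have "\<exists>F. C1_closed per F \<and> l2_norm \<Omega> (\<lambda>z. F z - f k z) < 1 / real (Suc k) \<and>
      l2_norm \<Omega> (\<lambda>z. tder u F z - transport per u (f k) z) < 1 / real (Suc k) \<and>
      l2_norm \<omega> (\<lambda>x. F (x, 0) - g0 x) < 1 / real (Suc k) \<and> l2_norm \<omega> (\<lambda>x. F (x, 1) - g1 x) < 1 / real (Suc k)" for k
  proof -
    obtain F where F: "\<forall>j. C1_closed per (F j)" "(\<lambda>j. l2_norm \<Omega> (\<lambda>z. F j z - f k z)) \<longlonglongrightarrow> 0"
      "(\<lambda>j. l2_norm \<Omega> (\<lambda>z. tder u (F j) z - transport per u (f k) z)) \<longlonglongrightarrow> 0"
      "(\<lambda>j. l2_norm \<omega> (\<lambda>x. F j (x, 0) - g0 x)) \<longlonglongrightarrow> 0" "(\<lambda>j. l2_norm \<omega> (\<lambda>x. F j (x, 1) - g1 x)) \<longlonglongrightarrow> 0"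
      using has_traceD(4)[OF f[of k]] by blast
    have pos: "0 < 1 / real (Suc k)" by simp
    have "\<forall>\<^sub>F j in sequentially. l2_norm \<Omega> (\<lambda>z. F j z - f k z) < 1 / real (Suc k) \<and>
      l2_norm \<Omega> (\<lambda>z. tder u (F j) z - transport per u (f k) z) < 1 / real (Suc k) \<and>
      l2_norm \<omega> (\<lambda>x. F j (x, 0) - g0 x) < 1 / real (Suc k) \<and> l2_norm \<omega> (\<lambda>x. F j (x, 1) - g1 x) < 1 / real (Suc k)"
      by (intro eventually_conj order_tendstoD(2)[OF F(2) pos] order_tendstoD(2)[OF F(3) pos]
          order_tendstoD(2)[OF F(4) pos] order_tendstoD(2)[OF F(5) pos])
    then obtain j where "l2_norm \<Omega> (\<lambda>z. F j z - f k z) < 1 / real (Suc k) \<and>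
      l2_norm \<Omega> (\<lambda>z. tder u (F j) z - transport per u (f k) z) < 1 / real (Suc k) \<and>
      l2_norm \<omega> (\<lambda>x. F j (x, 0) - g0 x) < 1 / real (Suc k) \<and> l2_norm \<omega> (\<lambda>x. F j (x, 1) - g1 x) < 1 / real (Suc k)"
      using eventually_happens'[OF sequentially_bot] by fast
    with F(1) show ?thesis by (intro exI[of _ "F j"]) simp
  qed
  then have "\<forall>k. \<exists>F. C1_closed per F \<and> l2_norm \<Omega> (\<lambda>z. F z - f k z) < 1 / real (Suc k) \<and>
      l2_norm \<Omega> (\<lambda>z. tder u F z - transport per u (f k) z) < 1 / real (Suc k) \<and>
      l2_norm \<omega> (\<lambda>x. F (x, 0) - g0 x) < 1 / real (Suc k) \<and> l2_norm \<omega> (\<lambda>x. F (x, 1) - g1 x) < 1 / real (Suc k)"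
    by blast
  from choice[OF this] obtain F where
    "\<forall>k. C1_closed per (F k) \<and> l2_norm \<Omega> (\<lambda>z. F k z - f k z) < 1 / real (Suc k) \<and>
      l2_norm \<Omega> (\<lambda>z. tder u (F k) z - transport per u (f k) z) < 1 / real (Suc k) \<and>
      l2_norm \<omega> (\<lambda>x. F k (x, 0) - g0 x) < 1 / real (Suc k) \<and> l2_norm \<omega> (\<lambda>x. F k (x, 1) - g1 x) < 1 / real (Suc k)"
    by blast
  then have F: "\<And>k. C1_closed per (F k)"
    and F1: "\<And>k. l2_norm \<Omega> (\<lambda>z. F k z - f k z) < 1 / real (Suc k)"
    and F2: "\<And>k. l2_norm \<Omega> (\<lambda>z. tder u (F k) z - transport per u (f k) z) < 1 / real (Suc k)"
    and F3: "\<And>k. l2_norm \<omega> (\<lambda>x. F k (x, 0) - g0 x) < 1 / real (Suc k)"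
    and F4: "\<And>k. l2_norm \<omega> (\<lambda>x. F k (x, 1) - g1 x) < 1 / real (Suc k)"
    by blast+
  have cF: "cont_diff (F k)" for k by (rule C1_closed_cont_diff[OF F])
  have inv: "(\<lambda>k. 1 / real (Suc k)) \<longlonglongrightarrow> 0"
    using LIMSEQ_inverse_real_of_nat by (simp add: inverse_eq_divide)
  have sum_lim: "(\<lambda>k. l2_norm \<Omega> (\<lambda>z. p k z - q0 z)) \<longlonglongrightarrow> 0"
    if "\<And>k. L2 \<Omega> (p k)" "\<And>k. L2 \<Omega> (q k)" "L2 \<Omega> q0" "\<And>k. l2_norm \<Omega> (\<lambda>z. p k z - q k z) < 1 / real (Suc k)"
      "(\<lambda>k. l2_norm \<Omega> (\<lambda>z. q k z - q0 z)) \<longlonglongrightarrow> 0" for p q q0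
  proof (rule Lim_null_comparison)
    have "(\<lambda>k. 1 / real (Suc k) + l2_norm \<Omega> (\<lambda>z. q k z - q0 z)) \<longlonglongrightarrow> 0 + 0"
      by (intro tendsto_add inv that(5))
    then show "(\<lambda>k. 1 / real (Suc k) + l2_norm \<Omega> (\<lambda>z. q k z - q0 z)) \<longlonglongrightarrow> 0" by simp
    have "l2_norm \<Omega> (\<lambda>z. p k z - q0 z) \<le> 1 / real (Suc k) + l2_norm \<Omega> (\<lambda>z. q k z - q0 z)" for k
      using l2_norm_triangle_diff[OF that(1-3), of k k] that(4)[of k] by linarith
    then show "\<forall>\<^sub>F k in sequentially. norm (l2_norm \<Omega> (\<lambda>z. p k z - q0 z)) \<le> 1 / real (Suc k) + l2_norm \<Omega> (\<lambda>z. q k z - q0 z)"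
      by (simp add: l2_norm_nonneg del: of_nat_Suc)
  qed
  have null: "(\<lambda>k. a k) \<longlonglongrightarrow> 0" if "\<And>k. 0 \<le> a k" "\<And>k. a k < 1 / real (Suc k)" for a :: "nat \<Rightarrow> real"
    by (rule Lim_null_comparison[OF _ inv]) (use that in \<open>simp add: less_imp_le del: of_nat_Suc\<close>)
  note all = L has_traceD(2,3)[OF f] F sum_lim[OF C1_L2[OF cF] sf(1) L(1) F1 lim(1)]
    sum_lim[OF tder_L2[OF cF] sf(2) L(2) F2 lim(2)] null[OF l2_norm_nonneg F3] null[OF l2_norm_nonneg F4]
  show "weak_transport per u f0 h0" by (rule has_traceI(1)[OF all])
  show "has_trace per u f0 g0 g1" by (rule has_traceI(2)[OF all])
qed

section \<open>Extension of boundary values\<close>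

text \<open>If the values at one time converge and the transport derivatives tend to zero, then the energy
  estimate applied to differences shows convergence on space-time.\<close>

lemma Cauchy_from_energy:
  assumes F: "\<And>k. C1_closed per (F k)" and t0: "t0 \<in> {0..1}"
    and lim: "(\<lambda>k. l2_norm \<omega> (\<lambda>x. F k (x, t0) - a x)) \<longlonglongrightarrow> 0" "L2 \<omega> a" "(\<lambda>k. l2_norm \<Omega> (tder u (F k))) \<longlonglongrightarrow> 0"
  shows "\<exists>f. L2 \<Omega> f \<and> (\<lambda>k. l2_norm \<Omega> (\<lambda>z. F k z - f z)) \<longlonglongrightarrow> 0"
proof -
  obtain K where K: "K \<ge> 0" and est: "\<And>F t0. C1_closed per F \<Longrightarrow> t0 \<in> {0..1} \<Longrightarrow>
    (l2_norm \<Omega> F)\<^sup>2 \<le> K * ((l2_norm \<omega> (\<lambda>x. F (x, t0)))\<^sup>2 + (l2_norm \<Omega> (tder u F))\<^sup>2)"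
    using energy_estimate by metis
  have cF: "cont_diff (F k)" for k by (rule C1_closed_cont_diff[OF F])
  have c1: "l2_Cauchy \<omega> (\<lambda>k x. F k (x, t0))" by (rule tendsto_imp_l2_Cauchy[OF slice_L2[OF F] lim(2,1)])
  have c2: "l2_Cauchy \<Omega> (\<lambda>k. tder u (F k))"
    by (rule tendsto_imp_l2_Cauchy[OF tder_L2[OF cF] L2_zero]) (simp add: lim(3))
  have "l2_Cauchy \<Omega> F"
    unfolding l2_Cauchy_def
  proof (intro allI impI)
    fix e :: real assume e: "e > 0"
    define \<eta> where "\<eta> = e / (2 * (K + 1))"
    have \<eta>: "\<eta> > 0" using e K by (simp add: \<eta>_def)
    obtain N1 where N1: "\<forall>m\<ge>N1. \<forall>n\<ge>N1. l2_norm \<omega> (\<lambda>x. F m (x, t0) - F n (x, t0)) < \<eta>"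
      using c1 \<eta> unfolding l2_Cauchy_def by blast
    obtain N2 where N2: "\<forall>m\<ge>N2. \<forall>n\<ge>N2. l2_norm \<Omega> (\<lambda>z. tder u (F m) z - tder u (F n) z) < \<eta>"
      using c2 \<eta> unfolding l2_Cauchy_def by blast
    have "l2_norm \<Omega> (\<lambda>z. F m z - F n z) < e" if mn: "m \<ge> max N1 N2" "n \<ge> max N1 N2" for m n
    proof (rule power2_less_imp_less)
      have C: "C1_closed per (\<lambda>z. F m z - F n z)" using C1_closed_combination[OF F F, of m "-1" n] by simp
      have t: "tder u (\<lambda>z. F m z - F n z) = (\<lambda>z. tder u (F m) z - tder u (F n) z)"
        using tder_diff[OF cF cF] by (rule ext)
      have "(l2_norm \<Omega> (\<lambda>z. F m z - F n z))\<^sup>2 \<le> K * ((l2_norm \<omega> (\<lambda>x. F m (x, t0) - F n (x, t0)))\<^sup>2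
          + (l2_norm \<Omega> (\<lambda>z. tder u (F m) z - tder u (F n) z))\<^sup>2)"
        using est[OF C t0] unfolding t .
      also have "\<dots> \<le> K * (\<eta>\<^sup>2 + \<eta>\<^sup>2)"
        using N1 N2 mn K by (intro mult_left_mono add_mono power_mono) (auto simp: l2_norm_nonneg less_imp_le)
      also have "\<dots> \<le> (K + 1)\<^sup>2 * (2 * \<eta>\<^sup>2)"
      proof -
        have "K \<le> (K + 1)\<^sup>2" using K by (simp add: power2_eq_square algebra_simps)
        then have "K * (2 * \<eta>\<^sup>2) \<le> (K + 1)\<^sup>2 * (2 * \<eta>\<^sup>2)" by (intro mult_right_mono) auto
        then show ?thesis by simp
      qed
      also have "\<dots> = e\<^sup>2 / 2"
      proof -
        have "(K + 1) * \<eta> = e / 2" using K by (simp add: \<eta>_def field_simps)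
        then have "((K + 1) * \<eta>)\<^sup>2 = (e / 2)\<^sup>2" by (rule arg_cong[where f = "\<lambda>x. x\<^sup>2"])
        then show ?thesis by (simp add: power_mult_distrib power_divide)
      qed
      also have "\<dots> < e\<^sup>2" using e by simp
      finally show "(l2_norm \<Omega> (\<lambda>z. F m z - F n z))\<^sup>2 < e\<^sup>2" .
    qed (use e in simp)
    then show "\<exists>N. \<forall>m\<ge>N. \<forall>n\<ge>N. l2_norm \<Omega> (\<lambda>z. F m z - F n z) < e" by blast
  qed
  from L2_complete[OF _ C1_L2[OF cF] this] show ?thesis by simp
qed

text \<open>Boundary values are approximated by test functions, and for each of them the accuracy of the
  approximate transport is chosen after its gradient bound is known.\<close>

lemma transported_approximation:
  assumes a: "L2 \<omega> a"
  shows "\<exists>F G. (\<forall>k. C1_closed per (F k)) \<and> (\<forall>k. C1_closed per (G k)) \<and>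
    (\<lambda>k. l2_norm \<omega> (\<lambda>x. F k (x, 0) - a x)) \<longlonglongrightarrow> 0 \<and> (\<lambda>k. l2_norm \<Omega> (tder u (F k))) \<longlonglongrightarrow> 0 \<and>
    (\<lambda>k. l2_norm \<omega> (\<lambda>x. G k (x, 1) - a x)) \<longlonglongrightarrow> 0 \<and> (\<lambda>k. l2_norm \<Omega> (tder u (G k))) \<longlonglongrightarrow> 0"
proof -
  obtain \<phi> where \<phi>: "\<And>k. test_fun per (\<phi> k)" and lim: "(\<lambda>k. l2_norm \<omega> (\<lambda>x. \<phi> k x - a x)) \<longlonglongrightarrow> 0"
    using test_fun_dense[OF a, of per] by metis
  have "\<exists>F G. C1_closed per F \<and> (\<forall>x. F (x, 0) = \<phi> k x) \<and> l2_norm \<Omega> (tder u F) \<le> 1 / real (Suc k) \<and>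
      C1_closed per G \<and> (\<forall>x. G (x, 1) = \<phi> k x) \<and> l2_norm \<Omega> (tder u G) \<le> 1 / real (Suc k)" for k
  proof -
    obtain K where K: "\<And>x h. \<bar>frechet_derivative (\<phi> k) (at x) h\<bar> \<le> K * norm h"
      using test_fun_derivative_bounded[OF \<phi>] by metis
    define M where "M = K * exp C * (2 + l2_norm {0..1} m)"
    define \<epsilon> where "\<epsilon> = 1 / (real (Suc k) * (\<bar>M\<bar> + 1))"
    have \<epsilon>: "\<epsilon> > 0" by (simp add: \<epsilon>_def add_nonneg_pos)
    have "M * \<epsilon> \<le> (\<bar>M\<bar> + 1) * \<epsilon>" using \<epsilon> by (intro mult_right_mono) auto
    also have "\<dots> = 1 / real (Suc k)"
    proof -
      have "\<bar>M\<bar> + 1 \<noteq> 0" by linarith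
      then show ?thesis by (simp add: \<epsilon>_def del: of_nat_Suc)
    qed
    finally have M: "M * \<epsilon> \<le> 1 / real (Suc k)" .
    have p: "per \<Longrightarrow> periodic_fun (\<phi> k)" using \<phi>[of k] by (simp add: test_fun_def)
    from approximate_transport[OF test_fun_cont_diff[OF \<phi>] K p \<epsilon>] obtain F G where
      "C1_closed per F" "\<forall>x. F (x, 0) = \<phi> k x" "l2_norm \<Omega> (tder u F) \<le> M * \<epsilon>"
      "C1_closed per G" "\<forall>x. G (x, 1) = \<phi> k x" "l2_norm \<Omega> (tder u G) \<le> M * \<epsilon>"
      unfolding M_def by blast
    with M show ?thesis by (intro exI[of _ F] exI[of _ G]) (auto intro: order_trans)
  qed
  then obtain F G where FG: "\<And>k. C1_closed per (F k)" "\<And>k x. F k (x, 0) = \<phi> k x"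
    "\<And>k. l2_norm \<Omega> (tder u (F k)) \<le> 1 / real (Suc k)" "\<And>k. C1_closed per (G k)"
    "\<And>k x. G k (x, 1) = \<phi> k x" "\<And>k. l2_norm \<Omega> (tder u (G k)) \<le> 1 / real (Suc k)"
    by metis
  have inv: "(\<lambda>k. 1 / real (Suc k)) \<longlonglongrightarrow> 0"
    using LIMSEQ_inverse_real_of_nat by (simp add: inverse_eq_divide)
  have null: "(\<lambda>k. a k) \<longlonglongrightarrow> 0" if "\<And>k. 0 \<le> a k" "\<And>k. a k \<le> 1 / real (Suc k)" for a :: "nat \<Rightarrow> real"
    by (rule Lim_null_comparison[OF _ inv]) (use that in \<open>simp del: of_nat_Suc\<close>)
  show ?thesis
    using FG lim null[OF l2_norm_nonneg FG(3)] null[OF l2_norm_nonneg FG(6)]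
    by (intro exI[of _ F] exI[of _ G]) simp
qed

lemma frechet_time: "frechet_derivative (\<lambda>t. t) (at (s::real)) 1 = 1"
  "frechet_derivative (\<lambda>t. 1 - t) (at (s::real)) 1 = - 1"
proof -
  have "((\<lambda>t::real. 1 - t) has_derivative (\<lambda>h. - h)) (at s)" by (auto intro!: derivative_eq_intros)
  from frechet_derivative_at[OF this] show "frechet_derivative (\<lambda>t. 1 - t) (at (s::real)) 1 = - 1" by metis
qed simp

text \<open>The boundary values are transported from both faces into the interior, and the two transported
  functions are blended linearly in time: with \<open>f\<close> and \<open>g\<close> having zero transport derivative,
  \<open>(1 - t) * f + t * g\<close> has transport derivative \<open>g - f\<close>, which is square integrable.\<close>

lemma extension_exists:
  assumes a: "L2 \<omega> a0" "L2 \<omega> a1"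
  shows "\<exists>f. has_trace per u f a0 a1"
proof -
  obtain A A' where A: "\<forall>k. C1_closed per (A k)" "(\<lambda>k. l2_norm \<omega> (\<lambda>x. A k (x, 0) - a0 x)) \<longlonglongrightarrow> 0"
    "(\<lambda>k. l2_norm \<Omega> (tder u (A k))) \<longlonglongrightarrow> 0"
    using transported_approximation[OF a(1)] by blast
  obtain B' B where B: "\<forall>k. C1_closed per (B k)" "(\<lambda>k. l2_norm \<omega> (\<lambda>x. B k (x, 1) - a1 x)) \<longlonglongrightarrow> 0"
    "(\<lambda>k. l2_norm \<Omega> (tder u (B k))) \<longlonglongrightarrow> 0"
    using transported_approximation[OF a(2)] by blast
  have C: "C1_closed per (A k)" "C1_closed per (B k)" for k using A(1) B(1) by auto
  have cAB: "cont_diff (A k)" "cont_diff (B k)" for k using C by (auto intro: C1_closed_cont_diff)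
  obtain f where f: "L2 \<Omega> f" "(\<lambda>k. l2_norm \<Omega> (\<lambda>z. A k z - f z)) \<longlonglongrightarrow> 0"
    using Cauchy_from_energy[of A 0 a0] C A a by auto
  obtain g where g: "L2 \<Omega> g" "(\<lambda>k. l2_norm \<Omega> (\<lambda>z. B k z - g z)) \<longlonglongrightarrow> 0"
    using Cauchy_from_energy[of B 1 a1] C B a by auto
  define p where "p z = 1 - snd z" for z :: "(real ^ 'n) \<times> real"
  define q where "q z = snd z" for z :: "(real ^ 'n) \<times> real"
  have pq: "C1_closed per p" "C1_closed per q"
    unfolding p_def[abs_def] q_def[abs_def]
    by (rule C1_closed_time[OF cont_diff_diff[OF cont_diff_const cont_diff_ident]],
        rule C1_closed_time[OF cont_diff_ident])
  have cpq: "cont_diff p" "cont_diff q" using pq by (auto intro: C1_closed_cont_diff)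
  have tpq: "tder u p z = - 1" "tder u q z = 1" for z
    using tder_time[OF cont_diff_diff[OF cont_diff_const cont_diff_ident], of u 1 z] tder_time[OF cont_diff_ident, of u z]
    by (simp_all add: p_def[abs_def] q_def[abs_def] frechet_time)
  have mono: "l2_norm \<Omega> (\<lambda>z. r z * h z) \<le> l2_norm \<Omega> h"
    if "continuous_on UNIV r" "\<And>z. z \<in> \<Omega> \<Longrightarrow> \<bar>r z\<bar> \<le> 1" "L2 \<Omega> h" for r h
  proof (rule l2_norm_dominated)
    show "(\<lambda>z. r z * h z) \<in> borel_measurable (lebesgue_on \<Omega>)"
      using bounded_mult_L2[OF that(1,3)] by (simp add: L2_def)
    show "AE z in lebesgue_on \<Omega>. \<bar>r z * h z\<bar> \<le> \<bar>h z\<bar>"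
      using that(2) by (intro AE_I2) (auto simp: abs_mult intro: mult_left_le_one_le)
  qed (rule that(3))
  have cont_pq: "continuous_on UNIV p" "continuous_on UNIV q" using cpq by (auto intro: cont_diff_continuous)
  have pq1: "\<bar>p z\<bar> \<le> 1" "\<bar>q z\<bar> \<le> 1" if "z \<in> \<Omega>" for z
    using that by (auto simp: p_def q_def spacetime_dom_Times)
  define F where "F k z = p z * A k z + 1 * (q z * B k z)" for k z
  have CF: "C1_closed per (F k)" for k
    unfolding F_def[abs_def] by (intro C1_closed_combination C1_closed_mult pq C)
  have tF: "tder u (F k) z = p z * tder u (A k) z + - A k z + (q z * tder u (B k) z + B k z)" for k z
    unfolding F_def[abs_def] tder_combination[OF cont_diff_mult[OF cpq(1) cAB(1)] cont_diff_mult[OF cpq(2) cAB(2)]]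
      tder_mult[OF cpq(1) cAB(1)] tder_mult[OF cpq(2) cAB(2)] tpq by simp
  define f0 where "f0 z = p z * f z + 1 * (q z * g z)" for z
  define h0 where "h0 z = g z + (- 1) * f z" for z
  have small: "(\<lambda>k. l2_norm \<Omega> (\<lambda>z. r z * h k z)) \<longlonglongrightarrow> 0"
    if "continuous_on UNIV r" "\<And>z. z \<in> \<Omega> \<Longrightarrow> \<bar>r z\<bar> \<le> 1" "\<And>k. L2 \<Omega> (h k)" "(\<lambda>k. l2_norm \<Omega> (h k)) \<longlonglongrightarrow> 0" for r h
    by (rule Lim_null_comparison[OF _ that(4)]) (simp add: l2_norm_nonneg mono[OF that(1-3)])
  have lpA: "(\<lambda>k. l2_norm \<Omega> (\<lambda>z. p z * A k z - p z * f z)) \<longlonglongrightarrow> 0"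
    using small[OF cont_pq(1) pq1(1) L2_diff[OF C1_L2[OF cAB(1)] f(1)] f(2)] by (simp add: right_diff_distrib)
  have lqB: "(\<lambda>k. l2_norm \<Omega> (\<lambda>z. q z * B k z - q z * g z)) \<longlonglongrightarrow> 0"
    using small[OF cont_pq(2) pq1(2) L2_diff[OF C1_L2[OF cAB(2)] g(1)] g(2)] by (simp add: right_diff_distrib)
  have L_pA: "L2 \<Omega> (\<lambda>z. p z * h z)" "L2 \<Omega> (\<lambda>z. q z * h z)" if "L2 \<Omega> h" for h
    using bounded_mult_L2[OF cont_pq(1) that] bounded_mult_L2[OF cont_pq(2) that] by auto
  have Lf0: "L2 \<Omega> f0" "L2 \<Omega> h0"
    unfolding f0_def h0_def by (intro L2_add L2_scale L_pA f g)+
  have "has_trace per u f0 a0 a1"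
  proof (rule has_traceI(2)[OF Lf0 a, of F])
    show "C1_closed per (F k)" for k by (rule CF)
    show "(\<lambda>k. l2_norm \<Omega> (\<lambda>z. F k z - f0 z)) \<longlonglongrightarrow> 0"
      unfolding F_def f0_def
      by (rule l2_norm_combination_tendsto[OF L_pA(1)[OF C1_L2[OF cAB(1)]] L_pA(1)[OF f(1)]
            L_pA(2)[OF C1_L2[OF cAB(2)]] L_pA(2)[OF g(1)] lpA lqB])
    show "(\<lambda>k. l2_norm \<Omega> (\<lambda>z. tder u (F k) z - h0 z)) \<longlonglongrightarrow> 0"
    proof -
      have l1: "(\<lambda>k. l2_norm \<Omega> (\<lambda>z. p z * tder u (A k) z - 0)) \<longlonglongrightarrow> 0"
        using small[OF cont_pq(1) pq1(1) tder_L2[OF cAB(1)] A(3)] by simp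
      have l2: "(\<lambda>k. l2_norm \<Omega> (\<lambda>z. q z * tder u (B k) z - 0)) \<longlonglongrightarrow> 0"
        using small[OF cont_pq(2) pq1(2) tder_L2[OF cAB(2)] B(3)] by simp
      note LA = C1_L2[OF cAB(1)] and LB = C1_L2[OF cAB(2)]
        and Lp = L_pA(1)[OF tder_L2[OF cAB(1)]] and Lq = L_pA(2)[OF tder_L2[OF cAB(2)]]
      have c1: "(\<lambda>k. l2_norm \<Omega> (\<lambda>z. (B k z + (- 1) * A k z) - (g z + (- 1) * f z))) \<longlonglongrightarrow> 0"
        by (rule l2_norm_combination_tendsto[OF LB g(1) LA f(1) g(2) f(2)])
      have c2: "(\<lambda>k. l2_norm \<Omega> (\<lambda>z. (p z * tder u (A k) z + 1 * (q z * tder u (B k) z)) - (0 + 1 * 0))) \<longlonglongrightarrow> 0"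
        by (rule l2_norm_combination_tendsto[OF Lp L2_zero Lq L2_zero l1 l2])
      have L1: "L2 \<Omega> (\<lambda>z. B k z + (- 1) * A k z)" "L2 \<Omega> (\<lambda>z. p z * tder u (A k) z + 1 * (q z * tder u (B k) z))" for k
        by (intro L2_add L2_scale LA LB Lp Lq)+
      have L2': "L2 \<Omega> (\<lambda>z. g z + (- 1) * f z)" "L2 \<Omega> (\<lambda>z. 0 + 1 * 0)"
        by (intro L2_add L2_scale f g) simp
      have "(\<lambda>k. l2_norm \<Omega> (\<lambda>z. ((B k z + (- 1) * A k z) + 1 * (p z * tder u (A k) z + 1 * (q z * tder u (B k) z)))
          - ((g z + (- 1) * f z) + 1 * (0 + 1 * 0)))) \<longlonglongrightarrow> 0"
        by (rule l2_norm_combination_tendsto[OF L1(1) L2'(1) L1(2) L2'(2) c1 c2])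
      moreover have "((B k z + (- 1) * A k z) + 1 * (p z * tder u (A k) z + 1 * (q z * tder u (B k) z)))
          - ((g z + (- 1) * f z) + 1 * (0 + 1 * 0)) = tder u (F k) z - h0 z" for k z
        unfolding tF h0_def by simp
      ultimately show ?thesis by simp
    qed
    show "(\<lambda>k. l2_norm \<omega> (\<lambda>x. F k (x, 0) - a0 x)) \<longlonglongrightarrow> 0" using A(2) by (simp add: F_def p_def q_def)
    show "(\<lambda>k. l2_norm \<omega> (\<lambda>x. F k (x, 1) - a1 x)) \<longlonglongrightarrow> 0" using B(2) by (simp add: F_def p_def q_def)
  qed
  then show ?thesis by blast
qed

section \<open>The minimization problem\<close>

lemma feasible_iff: "feasible per u I0 I1 f \<longleftrightarrow> has_trace per u f I0 I1"
  by (auto simp: feasible_def has_trace_def)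

lemma in_G0_iff: "in_G0 per u f \<longleftrightarrow> has_trace per u f (\<lambda>x. 0) (\<lambda>x. 0)"
  by (auto simp: in_G0_def has_trace_def)

lemma is_minimizer_iff:
  "is_minimizer per u I0 I1 f \<longleftrightarrow> has_trace per u f I0 I1 \<and>
    (\<forall>h. has_trace per u h I0 I1 \<longrightarrow> l2_norm \<Omega> (transport per u f) \<le> l2_norm \<Omega> (transport per u h))"
proof -
  have "1/2 * (E_norm per u f)\<^sup>2 \<le> 1/2 * (E_norm per u h)\<^sup>2 \<longleftrightarrow>
      l2_norm \<Omega> (transport per u f) \<le> l2_norm \<Omega> (transport per u h)" for h
    unfolding E_norm_def
    using abs_le_square_iff[of "l2_norm \<Omega> (transport per u f)" "l2_norm \<Omega> (transport per u h)"]
    by (simp add: l2_norm_nonneg)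
  then show ?thesis unfolding is_minimizer_def feasible_iff by blast
qed

text \<open>The energy is a quadratic form and the feasible functions are an affine space over the functions
  with zero trace: necessity is the first variation, sufficiency the theorem of Pythagoras.\<close>

lemma optimality_condition:
  assumes f: "has_trace per u f I0 I1"
  shows "is_minimizer per u I0 I1 f \<longleftrightarrow>
    (\<forall>\<delta>. in_G0 per u \<delta> \<longrightarrow> l2_inner \<Omega> (transport per u f) (transport per u \<delta>) = 0)" (is "?M \<longleftrightarrow> ?O")
proof
  note sf = transport_spec[OF has_traceD(1)[OF f]]
  assume M: ?M
  show ?O
    unfolding in_G0_iff
  proof (intro allI impI)
    fix \<delta> assume \<delta>: "has_trace per u \<delta> (\<lambda>x. 0) (\<lambda>x. 0)"
    note s\<delta> = transport_spec[OF has_traceD(1)[OF \<delta>]]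
    show "l2_inner \<Omega> (transport per u f) (transport per u \<delta>) = 0"
    proof (rule l2_inner_eq_0_if_minimal[OF sf(2) s\<delta>(2)])
      fix c
      have t: "has_trace per u (\<lambda>z. f z + c * \<delta> z) I0 I1" using has_trace_combination(1)[OF f \<delta>, of c] by simp
      have "l2_norm \<Omega> (transport per u f) \<le> l2_norm \<Omega> (transport per u (\<lambda>z. f z + c * \<delta> z))"
        using M t unfolding is_minimizer_iff by blast
      also have "\<dots> = l2_norm \<Omega> (\<lambda>z. transport per u f z + c * transport per u \<delta> z)"
        by (rule l2_norm_cong_AE[OF transport_spec(2)[OF has_traceD(1)[OF t]]
              L2_add[OF sf(2) L2_scale[OF s\<delta>(2)]] has_trace_combination(2)[OF f \<delta>]])
      finally show "(l2_norm \<Omega> (transport per u f))\<^sup>2 \<le> (l2_norm \<Omega> (\<lambda>z. transport per u f z + c * transport per u \<delta> z))\<^sup>2"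
        by (simp add: l2_norm_nonneg power_mono)
    qed
  qed
next
  note sf = transport_spec[OF has_traceD(1)[OF f]]
  assume O: ?O
  show ?M
    unfolding is_minimizer_iff
  proof (intro conjI allI impI f)
    fix h assume h: "has_trace per u h I0 I1"
    note sh = transport_spec[OF has_traceD(1)[OF h]]
    define \<delta> where "\<delta> z = h z - f z" for z
    have \<delta>: "has_trace per u \<delta> (\<lambda>x. 0) (\<lambda>x. 0)"
      and ae: "AE z in lebesgue_on \<Omega>. transport per u \<delta> z = transport per u h z - transport per u f z"
      using has_trace_difference[OF h f] by (auto simp: \<delta>_def[abs_def])
    note s\<delta> = transport_spec[OF has_traceD(1)[OF \<delta>]]
    have "l2_norm \<Omega> (transport per u h) = l2_norm \<Omega> (\<lambda>z. transport per u f z + 1 * transport per u \<delta> z)"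
    proof (rule l2_norm_cong_AE[OF sh(2) L2_add[OF sf(2) L2_scale[OF s\<delta>(2)]]])
      show "AE z in lebesgue_on \<Omega>. transport per u h z = transport per u f z + 1 * transport per u \<delta> z"
        using ae by eventually_elim simp
    qed
    then have "(l2_norm \<Omega> (transport per u h))\<^sup>2 = (l2_norm \<Omega> (transport per u f))\<^sup>2
        + 2 * 1 * l2_inner \<Omega> (transport per u f) (transport per u \<delta>) + 1\<^sup>2 * (l2_norm \<Omega> (transport per u \<delta>))\<^sup>2"
      using l2_norm_add_power2[OF sf(2) s\<delta>(2), of 1] by simp
    moreover have "l2_inner \<Omega> (transport per u f) (transport per u \<delta>) = 0"
      using O \<delta> unfolding in_G0_iff by blast
    ultimately have "(l2_norm \<Omega> (transport per u f))\<^sup>2 \<le> (l2_norm \<Omega> (transport per u h))\<^sup>2" by simp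
    then show "l2_norm \<Omega> (transport per u f) \<le> l2_norm \<Omega> (transport per u h)"
      by (rule power2_le_imp_le) (rule l2_norm_nonneg)
  qed
qed

text \<open>The difference of two minimizers has zero trace, so its transport derivative is orthogonal to both
  transport derivatives and hence to itself; the Poincare inequality finishes the proof.\<close>

lemma minimizer_unique:
  assumes f: "is_minimizer per u I0 I1 f" and h: "is_minimizer per u I0 I1 h"
  shows "AE z in lebesgue_on \<Omega>. f z = h z"
proof -
  have tf: "has_trace per u f I0 I1" and th: "has_trace per u h I0 I1"
    using f h by (auto simp: is_minimizer_iff)
  note sf = transport_spec[OF has_traceD(1)[OF tf]] and sh = transport_spec[OF has_traceD(1)[OF th]]
  define \<delta> where "\<delta> z = f z - h z" for z
  have \<delta>: "has_trace per u \<delta> (\<lambda>x. 0) (\<lambda>x. 0)"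
    and ae: "AE z in lebesgue_on \<Omega>. transport per u \<delta> z = transport per u f z - transport per u h z"
    using has_trace_difference[OF tf th] by (auto simp: \<delta>_def[abs_def])
  note s\<delta> = transport_spec[OF has_traceD(1)[OF \<delta>]]
  have orth: "l2_inner \<Omega> (transport per u f) (transport per u \<delta>) = 0" "l2_inner \<Omega> (transport per u h) (transport per u \<delta>) = 0"
    using optimality_condition[OF tf] optimality_condition[OF th] f h \<delta> unfolding in_G0_iff by blast+
  have "l2_inner \<Omega> (transport per u \<delta>) (transport per u \<delta>)
      = l2_inner \<Omega> (\<lambda>z. transport per u f z - transport per u h z) (transport per u \<delta>)"
    by (rule l2_inner_cong_AE[OF s\<delta>(2) s\<delta>(2) L2_diff[OF sf(2) sh(2)] s\<delta>(2) ae]) simp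
  also have "\<dots> = 0" using orth by (simp add: l2_inner_diff_left sf sh s\<delta>)
  finally have "l2_norm \<Omega> (transport per u \<delta>) = 0" by (simp add: l2_norm_def)
  then have "l2_norm \<Omega> \<delta> \<le> 0" using zero_trace_estimate \<delta> by fastforce
  then have "l2_norm \<Omega> \<delta> = 0" using l2_norm_nonneg[of \<Omega> \<delta>] by linarith
  then show ?thesis unfolding l2_norm_eq_0_iff[OF s\<delta>(1)] by (rule eventually_mono) (simp add: \<delta>_def)
qed

text \<open>The transport derivatives of a minimizing sequence are Cauchy by the parallelogram law.  The functions
  themselves are then Cauchy by the Poincare inequality, since their differences have zero trace, and
  the limit keeps the traces.\<close>

lemma minimizer_exists:
  assumes I: "L2 \<omega> I0" "L2 \<omega> I1"
  shows "\<exists>f. is_minimizer per u I0 I1 f"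
proof -
  define K where "K = {transport per u f |f. has_trace per u f I0 I1}"
  have K_L2: "L2 \<Omega> g" if "g \<in> K" for g
    using that transport_spec(2) has_traceD(1) by (auto simp: K_def)
  have "K \<noteq> {}" using extension_exists[OF I] by (auto simp: K_def)
  moreover have "\<exists>h\<in>K. AE z in lebesgue_on \<Omega>. h z = 1/2 * (p z + q z)" if pq: "p \<in> K" "q \<in> K" for p q
  proof -
    from pq(1) obtain f where f: "has_trace per u f I0 I1" "p = transport per u f" by (auto simp: K_def)
    from pq(2) obtain g where g: "has_trace per u g I0 I1" "q = transport per u g" by (auto simp: K_def)
    have d: "has_trace per u (\<lambda>z. g z - f z) (\<lambda>x. 0) (\<lambda>x. 0)" by (rule has_trace_difference(1)[OF g(1) f(1)])
    have t: "has_trace per u (\<lambda>z. f z + 1/2 * (g z - f z)) I0 I1"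
      using has_trace_combination(1)[OF f(1) d, of "1/2"] by simp
    have "AE z in lebesgue_on \<Omega>. transport per u (\<lambda>z. f z + 1/2 * (g z - f z)) z = 1/2 * (p z + q z)"
      using has_trace_combination(2)[OF f(1) d, of "1/2"] has_trace_difference(2)[OF g(1) f(1)]
      by eventually_elim (simp add: f(2) g(2) field_simps)
    moreover have "transport per u (\<lambda>z. f z + 1/2 * (g z - f z)) \<in> K" unfolding K_def using t by blast
    ultimately show ?thesis by blast
  qed
  ultimately obtain g where gK: "\<And>k. g k \<in> K" and cau: "l2_Cauchy \<Omega> g"
    and min: "\<And>h e. h \<in> K \<Longrightarrow> e > 0 \<Longrightarrow> \<exists>N. \<forall>k\<ge>N. l2_norm \<Omega> (g k) \<le> l2_norm \<Omega> h + e"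
    using minimizing_sequence[of K \<Omega>] K_L2 by blast
  obtain f where f: "\<And>k. has_trace per u (f k) I0 I1" and g: "\<And>k. g k = transport per u (f k)"
    using gK unfolding K_def by (simp, metis)
  note sf = transport_spec[OF has_traceD(1)[OF f]]
  obtain E where E: "E \<ge> 0" and est: "\<And>f. has_trace per u f (\<lambda>x. 0) (\<lambda>x. 0) \<Longrightarrow> l2_norm \<Omega> f \<le> E * l2_norm \<Omega> (transport per u f)"
    using zero_trace_estimate by blast
  have "l2_Cauchy \<Omega> f"
    unfolding l2_Cauchy_def
  proof (intro allI impI)
    fix e :: real assume e: "e > 0"
    have "e / (E + 1) > 0" using e E by simp
    then obtain N where N: "\<forall>m\<ge>N. \<forall>n\<ge>N. l2_norm \<Omega> (\<lambda>z. g m z - g n z) < e / (E + 1)"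
      using cau unfolding l2_Cauchy_def by blast
    have "l2_norm \<Omega> (\<lambda>z. f m z - f n z) < e" if "m \<ge> N" "n \<ge> N" for m n
    proof -
      have d: "has_trace per u (\<lambda>z. f m z - f n z) (\<lambda>x. 0) (\<lambda>x. 0)" by (rule has_trace_difference(1)[OF f f])
      have "l2_norm \<Omega> (transport per u (\<lambda>z. f m z - f n z)) = l2_norm \<Omega> (\<lambda>z. g m z - g n z)"
        unfolding g by (rule l2_norm_cong_AE[OF transport_spec(2)[OF has_traceD(1)[OF d]] L2_diff[OF sf(2) sf(2)]
              has_trace_difference(2)[OF f f]])
      then have "l2_norm \<Omega> (\<lambda>z. f m z - f n z) \<le> E * l2_norm \<Omega> (\<lambda>z. g m z - g n z)" using est[OF d] by simp
      also have "\<dots> \<le> E * (e / (E + 1))" using N that E by (intro mult_left_mono) (auto intro: less_imp_le)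
      also have "\<dots> < e" using E e by (simp add: field_simps)
      finally show ?thesis .
    qed
    then show "\<exists>N. \<forall>m\<ge>N. \<forall>n\<ge>N. l2_norm \<Omega> (\<lambda>z. f m z - f n z) < e" by blast
  qed
  then obtain f0 where f0: "L2 \<Omega> f0" "(\<lambda>k. l2_norm \<Omega> (\<lambda>z. f k z - f0 z)) \<longlonglongrightarrow> 0"
    using L2_complete[of \<Omega> f, OF _ sf(1)] by auto
  obtain g0 where g0: "L2 \<Omega> g0" "(\<lambda>k. l2_norm \<Omega> (\<lambda>z. g k z - g0 z)) \<longlonglongrightarrow> 0"
    using L2_complete[OF _ K_L2[OF gK] cau] by auto
  have w: "weak_transport per u f0 g0" and t: "has_trace per u f0 I0 I1"
    using has_trace_limit[OF f f0(1) g0(1) f0(2) g0(2)[unfolded g]] by auto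
  have "l2_norm \<Omega> (transport per u f0) = l2_norm \<Omega> g0"
    using E_norm_eq[OF f0(1) g0(1) w] by (simp add: E_norm_def)
  moreover have "l2_norm \<Omega> g0 \<le> l2_norm \<Omega> h" if h: "h \<in> K" for h
  proof (rule field_le_epsilon)
    fix e :: real assume "e > 0"
    then show "l2_norm \<Omega> g0 \<le> l2_norm \<Omega> h + e"
      using min[OF h \<open>e > 0\<close>] by (intro LIMSEQ_le_const2[OF l2_norm_tendsto[OF K_L2[OF gK] g0]]) auto
  qed
  ultimately have "is_minimizer per u I0 I1 f0"
    unfolding is_minimizer_iff using t by (auto simp: K_def)
  then show ?thesis by blast
qed

end

section \<open>Lipschitz bounds from weak derivatives\<close>

lemma box_ne_empty_cart: "box (a :: real ^ 'n) b \<noteq> {} \<longleftrightarrow> (\<forall>i. a $ i < b $ i)"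
  by (auto simp: box_ne_empty Basis_vec_def inner_axis)

lemma integral_space_dom_lborel:
  fixes h :: "real ^ 'n \<Rightarrow> real"
  assumes h: "h \<in> borel_measurable borel" and out: "\<And>x. x \<notin> space_dom \<Longrightarrow> h x = 0"
  shows "(LINT x|lebesgue_on space_dom. h x) = (LINT x|lborel. h x)"
proof -
  have "(LINT x|lebesgue_on space_dom. h x) = (LINT x|lebesgue. indicator space_dom x *\<^sub>R h x)"
    by (rule integral_restrict_space) simp
  also have "(\<lambda>x. indicator space_dom x *\<^sub>R h x) = h" using out by (intro ext) (auto simp: indicator_def)
  also have "(LINT x|lebesgue. h x) = (LINT x|lborel. h x)"
    by (rule integral_completion) (use h in simp)
  finally show ?thesis .
qed

lemma continuous_compact_support_lborel:
  fixes G :: "'a::euclidean_space \<Rightarrow> real"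
  assumes G: "continuous_on UNIV G" and out: "\<And>x. x \<notin> cbox a b \<Longrightarrow> G x = 0"
  shows "integrable lborel G" "integral (cbox a b) G = (LINT x|lborel. G x)"
proof -
  have "integrable lborel (\<lambda>x. indicator (cbox a b) x *\<^sub>R G x)"
    by (rule borel_integrable_compact[OF compact_cbox continuous_on_subset[OF G]]) simp
  also have "(\<lambda>x. indicator (cbox a b) x *\<^sub>R G x) = G" using out by (intro ext) (auto simp: indicator_def)
  finally show int: "integrable lborel G" .
  have "(G has_integral (LINT x|lborel. G x)) UNIV" by (rule has_integral_integral_lborel[OF int])
  moreover have "(\<lambda>x. if x \<in> cbox a b then G x else 0) = G" using out by auto
  ultimately have "(G has_integral (LINT x|lborel. G x)) (cbox a b)"
    using has_integral_restrict_UNIV[of "cbox a b" G] by simp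
  then show "integral (cbox a b) G = (LINT x|lborel. G x)" by (rule integral_unique)
qed

lemma lborel_translation:
  fixes h :: "'a::euclidean_space \<Rightarrow> real"
  assumes h: "integrable lborel h"
  shows "integrable lborel (\<lambda>y. h (c + y))" "(LINT y|lborel. h (c + y)) = (LINT y|lborel. h y)"
proof -
  have m: "h \<in> borel_measurable borel" using borel_measurable_integrable[OF h] by simp
  have "integrable (distr lborel borel ((+) c)) h" using h by (simp add: lborel_distr_plus)
  then show "integrable lborel (\<lambda>y. h (c + y))"
    by (subst (asm) integrable_distr_eq) (use m in auto)
  have "(LINT y|lborel. h y) = (LINT y|distr lborel borel ((+) c). h y)" by (simp add: lborel_distr_plus)
  also have "\<dots> = (LINT y|lborel. h (c + y))" by (rule integral_distr) (use m in auto)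
  finally show "(LINT y|lborel. h (c + y)) = (LINT y|lborel. h y)" by simp
qed

lemma frechet_derivative_outside_support:
  fixes G :: "'a::euclidean_space \<Rightarrow> real"
  assumes "closed K" and out: "\<And>x. x \<notin> K \<Longrightarrow> G x = 0" and x: "x \<notin> K"
  shows "frechet_derivative G (at x) h = 0"
proof -
  have "((\<lambda>_. 0::real) has_derivative (\<lambda>_. 0)) (at x)" by simp
  then have "(G has_derivative (\<lambda>_. 0)) (at x)"
    by (rule has_derivative_transform_within_open[where s = "- K"]) (use assms in auto)
  then show ?thesis using frechet_derivative_at by metis
qed

text \<open>The integral of a function over the whole space is invariant under translations; for a function
  supported in the cube, differentiate under the integral.\<close>

lemma integral_derivative_zero:
  fixes G :: "real ^ 'n \<Rightarrow> real"
  assumes G: "test_fun False G"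
  shows "(LINT x|lebesgue_on space_dom. frechet_derivative G (at x) (axis i 1)) = 0"
proof -
  define b where "b = (axis i 1 :: real ^ 'n)"
  define D where "D y = frechet_derivative G (at y) b" for y
  obtain K where K: "compact K" "K \<subseteq> box 0 1" and out: "\<And>x. x \<notin> K \<Longrightarrow> G x = 0"
    using G unfolding test_fun_def by auto
  have cd: "cont_diff G" by (rule test_fun_cont_diff[OF G])
  have cG: "continuous_on UNIV G" by (rule cont_diff_continuous[OF cd])
  have cD: "continuous_on UNIV D"
    unfolding D_def by (rule cont_diff_continuous_derivative[OF cd]) (auto intro: continuous_intros)
  have D0: "D y = 0" if "y \<notin> K" for y
    unfolding D_def by (rule frechet_derivative_outside_support[OF compact_imp_closed[OF K(1)] out that])
  have K01: "K \<subseteq> cbox 0 1" using K(2) box_subset_cbox by blast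
  let ?B = "cbox (- 1) 2 :: (real ^ 'n) set"
  have const: "integral ?B (\<lambda>y. G (t *\<^sub>R b + y)) = (LINT x|lborel. G x)" if t: "t \<in> {-1<..<1}" for t
  proof -
    have o: "G (t *\<^sub>R b + y) = 0" if y: "y \<notin> ?B" for y
    proof (rule out, rule notI)
      assume "t *\<^sub>R b + y \<in> K"
      then have "t *\<^sub>R b + y \<in> cbox 0 1" using K01 by blast
      then have "0 \<le> t * b $ j + y $ j \<and> t * b $ j + y $ j \<le> 1" for j by (simp add: mem_box_cart)
      moreover have "\<bar>t * b $ j\<bar> \<le> 1" for j using t by (auto simp: b_def axis_def)
      ultimately have "-1 \<le> y $ j \<and> y $ j \<le> 2" for j by (smt (verit))
      then show False using y by (simp add: mem_box_cart)
    qed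
    have "integral ?B (\<lambda>y. G (t *\<^sub>R b + y)) = (LINT y|lborel. G (t *\<^sub>R b + y))"
      by (rule continuous_compact_support_lborel(2)[OF _ o])
        (intro continuous_on_compose2[OF cG] continuous_intros; simp)
    also have "\<dots> = (LINT x|lborel. G x)"
      by (rule lborel_translation(2), rule continuous_compact_support_lborel(1)[OF cG, of 0 1])
        (use K01 out in blast)
    finally show ?thesis .
  qed
  have d: "((\<lambda>t. G (t *\<^sub>R b + y)) has_field_derivative D (t *\<^sub>R b + y)) (at t within U)" for t y U
    using directional_derivative[OF cd, of y b t, THEN has_field_derivative_at_within, of U]
    by (simp add: D_def add.commute)
  have "((\<lambda>t. integral ?B (\<lambda>y. G (t *\<^sub>R b + y))) has_field_derivative
      integral ?B (\<lambda>y. D (0 *\<^sub>R b + y))) (at 0 within {-1<..<1})"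
  proof (rule leibniz_rule_field_derivative)
    show "(\<lambda>y. G (t *\<^sub>R b + y)) integrable_on ?B" for t
      by (rule integrable_continuous, intro continuous_on_compose2[OF cG] continuous_intros) simp
    show "continuous_on ({-1<..<1} \<times> ?B) (\<lambda>(t, y). D (t *\<^sub>R b + y))"
      unfolding case_prod_unfold by (intro continuous_on_compose2[OF cD] continuous_intros) simp
  qed (use d in auto)
  then have "((\<lambda>t. integral ?B (\<lambda>y. G (t *\<^sub>R b + y))) has_field_derivative integral ?B D) (at 0)"
    by (simp add: at_within_open[of 0 "{-1<..<1}"])
  then have "((\<lambda>t. LINT x|lborel. G x) has_field_derivative integral ?B D) (at 0)"
    by (rule has_field_derivative_transform_within_open[of _ _ _ "{-1<..<1}"]) (auto simp: const)
  then have "integral ?B D = 0"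
    using DERIV_unique[of "\<lambda>t::real. LINT x|lborel. G x"] by (metis DERIV_const)
  moreover have "integral ?B D = (LINT x|lborel. D x)"
  proof (rule continuous_compact_support_lborel(2)[OF cD])
    fix y assume y: "y \<notin> ?B"
    have "cbox 0 1 \<subseteq> ?B" by (auto simp: mem_box_cart) (smt (verit))+
    then show "D y = 0" using y K01 D0 by blast
  qed
  moreover have "(LINT x|lebesgue_on space_dom. D x) = (LINT x|lborel. D x)"
    by (rule integral_space_dom_lborel)
      (use borel_measurable_continuous_onI[OF cD] D0 K01 in \<open>auto simp: space_dom_def\<close>)
  ultimately show ?thesis by (simp add: D_def b_def)
qed

text \<open>Products of functions of one coordinate as test functions on the cube or on the torus.  The
  supports lie strictly inside the unit interval, so the periodic extension changes neither values
  nor derivatives on the cube.\<close>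

lemma
  fixes f f' :: "'n::finite \<Rightarrow> real \<Rightarrow> real" and per :: bool
  assumes supp: "\<And>j y. y \<notin> {a j..b j} \<Longrightarrow> f j y = 0" "\<And>j y. y \<notin> {a j..b j} \<Longrightarrow> f' j y = 0"
    and ab: "\<And>j. 0 < a j" "\<And>j. b j < 1"
    and d: "\<And>j y. (f j has_real_derivative f' j y) (at y)" and c: "\<And>j. continuous_on UNIV (f' j)"
  defines "P \<equiv> \<lambda>x::real ^ 'n. \<Prod>j\<in>UNIV. f j (wrap per (x $ j))"
  shows test_fun_product: "test_fun per P"
    and test_fun_product_eq: "x \<in> space_dom \<Longrightarrow> P x = (\<Prod>j\<in>UNIV. f j (x $ j))"
    and test_fun_product_derivative:
      "x \<in> space_dom \<Longrightarrow> frechet_derivative P (at x) (axis i 1) = f' i (x $ i) * (\<Prod>j\<in>UNIV - {i}. f j (x $ j))"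
proof -
  have w: "((\<lambda>y. f j (wrap per y)) has_real_derivative f' j (wrap per y)) (at y)" for j y
    by (rule wrap_deriv[OF supp ab d])
  have wc: "continuous_on UNIV (\<lambda>y. f' j (wrap per y))" for j
    by (rule wrap_continuous[OF supp(2) ab c])
  have "cont_diff (\<lambda>y. f j (wrap per y))" for j
    by (rule cont_diff_real[OF w wc])
  then have "cont_diff (\<lambda>x::real ^ 'n. f j (wrap per (x \<bullet> axis j 1)))" for j
    by (rule cont_diff_compose[OF _ cont_diff_inner])
  then have cd: "cont_diff P" unfolding P_def by (intro cont_diff_prod) (simp add: inner_axis)
  have per: "periodic_fun P" if "per"
    unfolding periodic_fun_def P_def
  proof (intro allI prod.cong refl)
    fix x :: "real ^ 'n" and i j
    show "f j (wrap per ((x + axis i 1) $ j)) = f j (wrap per (x $ j))"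
      using wrap_periodic[of "x $ j"] that by (cases "j = i") (auto simp: axis_def)
  qed
  have "\<exists>K. compact K \<and> K \<subseteq> box 0 1 \<and> (\<forall>x. x \<notin> K \<longrightarrow> P x = 0)" if "\<not> per"
  proof (intro exI[of _ "cbox (\<chi> j. a j) (\<chi> j. b j)"] conjI allI impI)
    show "cbox (\<chi> j. a j) (\<chi> j. b j) \<subseteq> box 0 (1 :: real ^ 'n)"
      using less_le_trans[OF ab(1)] le_less_trans[OF _ ab(2)] by (fastforce simp: mem_box_cart)
    fix x :: "real ^ 'n" assume "x \<notin> cbox (\<chi> j. a j) (\<chi> j. b j)"
    then obtain j where "x $ j \<notin> {a j..b j}" by (auto simp: mem_box_cart)
    then have "f j (wrap per (x $ j)) = 0" using supp that by (simp add: wrap_def)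
    then show "P x = 0" unfolding P_def by (intro prod_zero) auto
  qed simp
  with cd per show "test_fun per P" unfolding test_fun_def C1_iff_cont_diff by simp
  have un: "f j (wrap per (x $ j)) = f j (x $ j)" "f' j (wrap per (x $ j)) = f' j (x $ j)"
    if "x \<in> space_dom" for j and x :: "real ^ 'n"
    by (rule wrap_unit[where a = "a j" and b = "b j"]; use that supp ab in \<open>auto simp: mem_space_dom\<close>)+
  then show "x \<in> space_dom \<Longrightarrow> P x = (\<Prod>j\<in>UNIV. f j (x $ j))" unfolding P_def by simp
  assume x: "x \<in> space_dom"
  have "(\<lambda>t. P (x + t *\<^sub>R axis i 1)) =
      (\<lambda>t. f i (wrap per (t + x $ i)) * (\<Prod>j\<in>UNIV - {i}. f j (wrap per (x $ j))))"
    unfolding P_def by (rule ext, subst prod.remove[of _ i]) (auto simp: axis_def add.commute intro!: prod.cong)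
  moreover have "((\<lambda>t. f i (wrap per (t + x $ i))) has_real_derivative f' i (wrap per (x $ i))) (at 0)"
    using w[of i "0 + x $ i"] DERIV_shift[of "\<lambda>y. f i (wrap per y)" _ 0 "x $ i"] by simp
  ultimately have "((\<lambda>t. P (x + t *\<^sub>R axis i 1)) has_real_derivative
      f' i (wrap per (x $ i)) * (\<Prod>j\<in>UNIV - {i}. f j (wrap per (x $ j)))) (at 0)"
    using DERIV_cmult_right by simp
  from directional_derivative_0[OF cd this]
  show "frechet_derivative P (at x) (axis i 1) = f' i (x $ i) * (\<Prod>j\<in>UNIV - {i}. f j (x $ j))"
    using un[OF x] by simp
qed

lemma continuous_AE_bound:
  fixes f :: "real ^ 'n \<Rightarrow> real"
  assumes f: "continuous_on space_dom f" and ae: "AE x in lebesgue_on space_dom. \<bar>f x\<bar> \<le> M"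
    and x: "x \<in> space_dom"
  shows "\<bar>f x\<bar> \<le> M"
proof -
  let ?g = "\<lambda>x. max 0 (\<bar>f x\<bar> - M)"
  have c: "continuous_on (cbox 0 1) ?g" using f unfolding space_dom_def by (intro continuous_intros)
  have "(?g has_integral (LINT x|lebesgue_on (cbox 0 1). ?g x)) (cbox 0 1)"
    by (rule has_integral_integral_lebesgue_on[OF continuous_integrable_cbox[OF c]]) simp
  moreover have "(LINT x|lebesgue_on (cbox 0 1). ?g x) = 0"
  proof (rule integral_eq_zero_AE)
    show "AE x in lebesgue_on (cbox 0 1). ?g x = 0" using ae unfolding space_dom_def by eventually_elim simp
  qed
  ultimately have "?g x = 0"
    by (intro has_integral_0_cbox_imp_0[OF c]) (use x in \<open>auto simp: space_dom_def box_ne_empty_cart\<close>)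
  then show ?thesis by simp
qed

text \<open>The test function has the \<open>i\<close>-th derivative \<open>\<rho> - \<rho> (\<cdot> - e)\<close>, where \<open>\<rho>\<close> is a nonnegative
  bump near \<open>x\<close> and \<open>e\<close> the displacement.  Testing \<open>\<phi> y = f y - M * y $ i\<close>, whose weak derivative
  \<open>g - M\<close> is at most zero, and translating the second bump yields
  \<open>\<integral> (\<phi> (y + e) - \<phi> y) * \<rho> y \<le> 0\<close>.  As \<open>\<phi>\<close> is continuous, an increment of \<open>\<phi>\<close> that is positive
  at \<open>x\<close> would be bounded below on the support of \<open>\<rho>\<close>.\<close>

lemma weak_partial_increment_interior:
  fixes f g :: "real ^ 'n \<Rightarrow> real"
  assumes wp: "weak_partial per i f g" and f: "continuous_on space_dom f"
    and g: "AE x in lebesgue_on space_dom. g x \<le> M"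
    and x: "\<And>j. 0 < x $ j" "\<And>j. x $ j < 1" and s: "0 < s" "x $ i + s < 1"
  shows "f (x + s *\<^sub>R axis i 1) - f x \<le> M * s"
proof (rule ccontr)
  define e where "e = (s *\<^sub>R axis i 1 :: real ^ 'n)"
  have e: "e $ j = (if j = i then s else 0)" for j by (simp add: e_def axis_def)
  \<comment> \<open>subtracting the linear function reduces the claim to \<open>\<phi> (x + e) \<le> \<phi> x\<close>\<close>
  define \<phi> where "\<phi> y = f y - M * y $ i" for y
  define \<eta> where "\<eta> = \<phi> (x + e) - \<phi> x"
  assume "\<not> f (x + s *\<^sub>R axis i 1) - f x \<le> M * s"
  then have \<eta>: "\<eta> > 0" unfolding \<eta>_def \<phi>_def e_def by (simp add: axis_def algebra_simps)
  have c\<phi>: "continuous_on space_dom \<phi>" unfolding \<phi>_def by (intro continuous_intros f)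
  define S where "S = {y \<in> space_dom. y + e \<in> space_dom}"
  have cS: "continuous_on S (\<lambda>y. \<phi> (y + e) - \<phi> y)"
    by (intro continuous_intros continuous_on_compose2[OF c\<phi>] continuous_on_subset[OF c\<phi>]) (auto simp: S_def)
  have xS: "x \<in> S" using x s unfolding S_def mem_space_dom by (auto simp: e less_imp_le)
  obtain \<delta>0 where \<delta>0: "\<delta>0 > 0" "\<And>y. y \<in> S \<Longrightarrow> dist y x < \<delta>0 \<Longrightarrow> dist (\<phi> (y + e) - \<phi> y) (\<phi> (x + e) - \<phi> x) < \<eta> / 2"
    using cS xS \<eta> unfolding continuous_on_iff by (meson half_gt_zero)
  define c where "c = Min (range (\<lambda>j. 1 - x $ j))"
  have c: "c > 0" "\<And>j. c \<le> 1 - x $ j" unfolding c_def using x by (auto simp: Min_gr_iff)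
  define n where "n = real CARD('n)"
  have n: "n \<ge> 1" unfolding n_def by (simp add: Suc_leI)
  define \<delta> where "\<delta> = min (c / 2) (min ((1 - x $ i - s) / 2) (\<delta>0 / (2 * n)))"
  have \<delta>: "\<delta> > 0" using c \<delta>0 s n by (simp add: \<delta>_def)
  have \<delta>1: "x $ j + \<delta> < 1" for j using c(1) c(2)[of j] min.cobounded1[of "c / 2"] unfolding \<delta>_def by (smt (verit) field_sum_of_halves)
  have \<delta>2: "x $ i + s + \<delta> < 1"
  proof -
    have "\<delta> \<le> (1 - x $ i - s) / 2" unfolding \<delta>_def by (rule order_trans[OF min.cobounded2 min.cobounded1])
    then show ?thesis using s by simp
  qed
  have \<delta>3: "n * \<delta> < \<delta>0"
  proof -
    have "\<delta> \<le> \<delta>0 / (2 * n)" unfolding \<delta>_def by (rule order_trans[OF min.cobounded2 min.cobounded2])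
    then have "n * \<delta> \<le> \<delta>0 / 2" using n by (simp add: field_simps)
    then show ?thesis using \<delta>0 by simp
  qed
  define \<kappa> where "\<kappa> j r = step (2 * (r - x $ j) / \<delta>) * step (2 - 2 * (r - x $ j) / \<delta>)" for j r
  define \<kappa>' where "\<kappa>' j r = step' (2 * (r - x $ j) / \<delta>) * (2 / \<delta>) * step (2 - 2 * (r - x $ j) / \<delta>)
     + step (2 * (r - x $ j) / \<delta>) * (step' (2 - 2 * (r - x $ j) / \<delta>) * (- (2 / \<delta>)))" for j r
  \<comment> \<open>a plateau from \<open>x $ i\<close> to \<open>x $ i + s\<close>; its derivative is a bump minus its translate by \<open>s\<close>\<close>
  define \<beta> where "\<beta> r = step ((r - x $ i) / \<delta>) - step ((r - x $ i - s) / \<delta>)" for r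
  define \<beta>' where "\<beta>' r = step' ((r - x $ i) / \<delta>) / \<delta> - step' ((r - x $ i - s) / \<delta>) / \<delta>" for r
  define F where "F j = (if j = i then \<beta> else \<kappa> j)" for j
  define F' where "F' j = (if j = i then \<beta>' else \<kappa>' j)" for j
  define b where "b j = (if j = i then x $ i + s + \<delta> else x $ j + \<delta>)" for j
  have \<kappa>0: "\<kappa> j r = 0" "\<kappa>' j r = 0" if "r \<notin> {x $ j..x $ j + \<delta>}" for j r
  proof -
    have "2 * (r - x $ j) / \<delta> \<le> 0 \<or> 2 - 2 * (r - x $ j) / \<delta> \<le> 0"
      using that \<delta> by (auto simp: divide_simps)
    then show "\<kappa> j r = 0" "\<kappa>' j r = 0" unfolding \<kappa>_def \<kappa>'_def by (auto simp: step_le0 step'_outside)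
  qed
  have \<beta>0: "\<beta> r = 0" "\<beta>' r = 0" if "r \<notin> {x $ i..x $ i + s + \<delta>}" for r
  proof -
    have "(r - x $ i) / \<delta> \<le> 0 \<and> (r - x $ i - s) / \<delta> \<le> 0 \<or> (r - x $ i) / \<delta> \<ge> 1 \<and> (r - x $ i - s) / \<delta> \<ge> 1"
      using that \<delta> s by (auto simp: divide_simps)
    then show "\<beta> r = 0" "\<beta>' r = 0" unfolding \<beta>_def \<beta>'_def by (auto simp: step_le0 step_ge1 step'_outside)
  qed
  have supp: "y \<notin> {x $ j..b j} \<Longrightarrow> F j y = 0" "y \<notin> {x $ j..b j} \<Longrightarrow> F' j y = 0" for j y
    using \<kappa>0 \<beta>0 unfolding F_def F'_def b_def by (auto split: if_splits)
  have b1: "b j < 1" for j using \<delta>1 \<delta>2 by (simp add: b_def)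
  have dF: "(F j has_real_derivative F' j y) (at y)" for j y
    unfolding F_def F'_def \<beta>_def[abs_def] \<beta>'_def \<kappa>_def[abs_def] \<kappa>'_def using \<delta>
    by (auto intro!: derivative_eq_intros DERIV_chain2[OF step_deriv])
  have cF: "continuous_on UNIV (F' j)" for j
    unfolding F'_def \<beta>'_def[abs_def] \<kappa>'_def[abs_def] using \<delta>
    by (auto intro!: continuous_intros continuous_on_compose2[OF step'_continuous]
        continuous_on_compose2[OF cont_diff_continuous[OF cont_diff_step]])
  define P where "P p y = (\<Prod>j\<in>UNIV. F j (wrap p (y $ j)))" for p and y :: "real ^ 'n"
  define R where "R y = (\<Prod>j\<in>UNIV - {i}. \<kappa> j (y $ j))" for y :: "real ^ 'n"
  define \<rho> where "\<rho> y = step' ((y $ i - x $ i) / \<delta>) / \<delta> * R y" for y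
  have R_e: "R (y + c *\<^sub>R e) = R y" for y c unfolding R_def by (intro prod.cong) (auto simp: e)
  have tf: "test_fun p (P p)" for p
    unfolding P_def[abs_def] by (rule test_fun_product[OF supp x(1) b1 dF cF])
  have tfe: "P p y = (\<Prod>j\<in>UNIV. F j (y $ j))" if "y \<in> space_dom" for p y
    unfolding P_def by (rule test_fun_product_eq[OF supp x(1) b1 dF cF that])
  have tfd: "frechet_derivative (P p) (at y) (axis i 1) = F' i (y $ i) * (\<Prod>j\<in>UNIV - {i}. F j (y $ j))"
    if "y \<in> space_dom" for p y
    unfolding P_def[abs_def] by (rule test_fun_product_derivative[OF supp x(1) b1 dF cF that])
  have DP: "frechet_derivative (P p) (at y) (axis i 1) = \<rho> y - \<rho> (y - e)" if "y \<in> space_dom" for y p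
    unfolding tfd[OF that] using R_e[of y "-1"]
    by (simp add: F'_def \<beta>'_def \<rho>_def e F_def R_def algebra_simps)
  have Pp: "P p y = P False y" "P False y = (\<Prod>j\<in>UNIV. F j (y $ j))" if "y \<in> space_dom" for y p
    using tfe[OF that] by simp_all
  have \<kappa>_nn: "0 \<le> \<kappa> j r" for j r unfolding \<kappa>_def using step_bounds by simp
  have P_nn: "0 \<le> P False y" if "y \<in> space_dom" for y
    unfolding Pp(2)[OF that] F_def \<beta>_def using \<kappa>_nn \<delta> s
    by (intro prod_nonneg) (auto intro!: step_mono divide_right_mono)
  have cP: "cont_diff (P False)" by (rule test_fun_cont_diff[OF tf])
  have LP: "L2 space_dom (P False)" "L2 space_dom (\<lambda>y. y $ i)" "L2 space_dom (\<lambda>y. frechet_derivative (P False) (at y) (axis i 1))"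
    by (intro continuous_L2_space cont_diff_continuous[OF cP] continuous_intros
        cont_diff_continuous_derivative[OF cP])+
  have wf: "(LINT y|lebesgue_on space_dom. f y * (\<rho> y - \<rho> (y - e))) = - (LINT y|lebesgue_on space_dom. g y * P False y)"
  proof -
    have "(LINT y|lebesgue_on space_dom. f y * frechet_derivative (P per) (at y) (axis i 1)) =
        - (LINT y|lebesgue_on space_dom. g y * P per y)"
      using wp tf unfolding weak_partial_def by blast
    moreover have "(LINT y|lebesgue_on space_dom. f y * frechet_derivative (P per) (at y) (axis i 1)) =
        (LINT y|lebesgue_on space_dom. f y * (\<rho> y - \<rho> (y - e)))"
      by (rule Bochner_Integration.integral_cong) (simp_all add: DP)
    moreover have "(LINT y|lebesgue_on space_dom. g y * P per y) = (LINT y|lebesgue_on space_dom. g y * P False y)"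
      by (rule Bochner_Integration.integral_cong) (simp_all add: Pp(1)[where p = per])
    ultimately show ?thesis by simp
  qed
  \<comment> \<open>the linear function is not periodic, so its contribution is computed on the cube in either case\<close>
  have linP: "test_fun False (\<lambda>y. y $ i * P False y)"
  proof -
    have ci: "cont_diff (\<lambda>y::real ^ 'n. y $ i)" using cont_diff_inner[of "axis i 1"] by (simp add: cart_eq_inner_axis)
    have "test_fun False (P False)" by (rule tf)
    then show ?thesis using cont_diff_mult[OF ci cP] unfolding test_fun_def C1_iff_cont_diff by auto
  qed
  have ci: "cont_diff (\<lambda>y::real ^ 'n. y $ i)" using cont_diff_inner[of "axis i 1"] by (simp add: cart_eq_inner_axis)
  have Di: "frechet_derivative (\<lambda>y::real ^ 'n. y $ i) (at y) (axis i 1) = 1" for y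
    by (rule directional_derivative_0[OF ci]) (auto intro!: derivative_eq_intros simp: axis_def)
  have wy: "(LINT y|lebesgue_on space_dom. y $ i * (\<rho> y - \<rho> (y - e))) = - (LINT y|lebesgue_on space_dom. P False y)"
  proof -
    have "0 = (LINT y|lebesgue_on space_dom. y $ i * frechet_derivative (P False) (at y) (axis i 1) + P False y)"
      using integral_derivative_zero[OF linP, of i] unfolding frechet_derivative_mult[OF ci cP] Di by simp
    also have "\<dots> = (LINT y|lebesgue_on space_dom. y $ i * frechet_derivative (P False) (at y) (axis i 1)) +
        (LINT y|lebesgue_on space_dom. P False y)"
      by (intro Bochner_Integration.integral_add L2_mult_integrable LP L2_integrable) simp
    also have "(LINT y|lebesgue_on space_dom. y $ i * frechet_derivative (P False) (at y) (axis i 1)) =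
        (LINT y|lebesgue_on space_dom. y $ i * (\<rho> y - \<rho> (y - e)))"
      by (rule Bochner_Integration.integral_cong) (simp_all add: DP)
    finally show ?thesis by simp
  qed
  have c\<rho>: "continuous_on A \<rho>" for A
    unfolding \<rho>_def R_def \<kappa>_def using \<delta>
    by (auto intro!: continuous_intros continuous_on_compose2[OF step'_continuous]
        continuous_on_compose2[OF cont_diff_continuous[OF cont_diff_step]])
  have c\<rho>e: "continuous_on A (\<lambda>y. \<rho> (y - e))" for A
    by (intro continuous_on_compose2[OF c\<rho>[of UNIV]] continuous_intros) simp
  have fi: "integrable (lebesgue_on space_dom) f" "integrable (lebesgue_on space_dom) g"
    using wp unfolding weak_partial_def by auto
  have key: "0 \<le> (LINT y|lebesgue_on space_dom. \<phi> y * (\<rho> y - \<rho> (y - e)))"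
  proof -
    have "(LINT y|lebesgue_on space_dom. \<phi> y * (\<rho> y - \<rho> (y - e))) =
        (LINT y|lebesgue_on space_dom. f y * (\<rho> y - \<rho> (y - e)) - M * (y $ i * (\<rho> y - \<rho> (y - e))))"
      unfolding \<phi>_def by (simp add: algebra_simps)
    also have "\<dots> = (LINT y|lebesgue_on space_dom. f y * (\<rho> y - \<rho> (y - e))) -
        (LINT y|lebesgue_on space_dom. M * (y $ i * (\<rho> y - \<rho> (y - e))))"
      by (intro Bochner_Integration.integral_diff integrable_mult_continuous_space[OF fi(1)] integrable_mult_right
          L2_mult_integrable continuous_L2_space continuous_intros c\<rho> c\<rho>e)
    also have "\<dots> = M * (LINT y|lebesgue_on space_dom. P False y) - (LINT y|lebesgue_on space_dom. g y * P False y)"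
      by (simp add: wf wy)
    also have "\<dots> = (LINT y|lebesgue_on space_dom. M * P False y - g y * P False y)"
      by (subst Bochner_Integration.integral_diff)
        (auto intro!: integrable_mult_right L2_integrable LP integrable_mult_continuous_space[OF fi(2)] cont_diff_continuous[OF cP])
    also have "\<dots> \<ge> 0"
    proof (rule integral_nonneg_AE)
      show "AE y in lebesgue_on space_dom. 0 \<le> M * P False y - g y * P False y"
        using g AE_space by eventually_elim (use P_nn in \<open>auto intro!: mult_right_mono\<close>)
    qed
    finally show ?thesis .
  qed
  define q where "q y = (if y \<in> space_dom then \<phi> y else 0)" for y
  have iq: "integrable lborel (\<lambda>y. q y * h y)" if "continuous_on UNIV h" for h
  proof -
    have "integrable lborel (\<lambda>y. indicator (cbox 0 1) y *\<^sub>R (\<phi> y * h y))"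
      using c\<phi> that unfolding space_dom_def
      by (intro borel_integrable_compact compact_cbox continuous_intros) (auto intro: continuous_on_subset)
    also have "(\<lambda>y. indicator (cbox 0 1) y *\<^sub>R (\<phi> y * h y)) = (\<lambda>y. q y * h y)"
      by (auto simp: q_def space_dom_def indicator_def)
    finally show ?thesis .
  qed
  have q1: "(LINT y|lebesgue_on space_dom. \<phi> y * (\<rho> y - \<rho> (y - e))) = (LINT y|lborel. q y * (\<rho> y - \<rho> (y - e)))"
  proof -
    have "(LINT y|lebesgue_on space_dom. \<phi> y * (\<rho> y - \<rho> (y - e))) = (LINT y|lebesgue_on space_dom. q y * (\<rho> y - \<rho> (y - e)))"
      by (rule Bochner_Integration.integral_cong) (simp_all add: q_def)
    also have "\<dots> = (LINT y|lborel. q y * (\<rho> y - \<rho> (y - e)))"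
    proof (rule integral_space_dom_lborel)
      show "(\<lambda>y. q y * (\<rho> y - \<rho> (y - e))) \<in> borel_measurable borel"
        using borel_measurable_integrable[OF iq[of "\<lambda>y. \<rho> y - \<rho> (y - e)"]] c\<rho> c\<rho>e
        by (simp add: continuous_on_diff)
    qed (simp add: q_def)
    finally show ?thesis .
  qed
  note tr = lborel_translation[OF iq[OF c\<rho>e], of e]
  have tr1: "integrable lborel (\<lambda>y. q (y + e) * \<rho> y)" and
    tr2: "(LINT y|lborel. q (y + e) * \<rho> y) = (LINT y|lborel. q y * \<rho> (y - e))"
    using tr by (simp_all add: add.commute)
  define B where "B = cbox x (x + (\<chi> j. \<delta>))"
  have \<rho>_out: "\<rho> y = 0" if y: "y \<notin> B" for y
  proof -
    obtain j where j: "y $ j \<notin> {x $ j..x $ j + \<delta>}" using y by (auto simp: B_def mem_box_cart)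
    show ?thesis
    proof (cases "j = i")
      case True
      then have "(y $ i - x $ i) / \<delta> \<le> 0 \<or> 1 \<le> (y $ i - x $ i) / \<delta>" using j \<delta> by (auto simp: divide_simps)
      then show ?thesis by (auto simp: \<rho>_def step'_outside)
    next
      case False
      then have "R y = 0" unfolding R_def using \<kappa>0(1)[OF j] by (intro prod_zero) auto
      then show ?thesis by (simp add: \<rho>_def)
    qed
  qed
  have \<rho>_nn: "0 \<le> \<rho> y" for y
    unfolding \<rho>_def R_def by (intro mult_nonneg_nonneg divide_nonneg_pos prod_nonneg step'_nonneg \<kappa>_nn \<delta>)
  note i\<rho> = continuous_compact_support_lborel[OF c\<rho>, of x "x + (\<chi> j. \<delta>)", folded B_def, OF \<rho>_out]
  have pos: "0 < (LINT y|lborel. \<rho> y)"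
  proof -
    have "(LINT y|lborel. \<rho> y) \<noteq> 0"
    proof
      assume "(LINT y|lborel. \<rho> y) = 0"
      then have "integral B \<rho> = 0" using i\<rho>(2) by simp
      moreover have "\<rho> integrable_on B" unfolding B_def by (rule integrable_continuous[OF c\<rho>])
      ultimately have int0: "(\<rho> has_integral 0) B" by (simp add: has_integral_iff)
      have "\<rho> (x + (\<chi> j. \<delta> / 2)) = 0"
      proof (rule has_integral_0_cbox_imp_0[OF c\<rho> _ int0[unfolded B_def]])
        show "0 \<le> \<rho> y" for y by (rule \<rho>_nn)
        show "x + (\<chi> j. \<delta> / 2) \<in> cbox x (x + (\<chi> j. \<delta>))" using \<delta> by (simp add: mem_box_cart)
        show "box x (x + (\<chi> j. \<delta>)) \<noteq> {}" using \<delta> by (simp add: box_ne_empty_cart)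
      qed
      moreover have "1 \<le> step' (1 / 2)" by (rule step'_ge1) auto
      moreover have "R (x + (\<chi> j. \<delta> / 2)) = 1"
        unfolding R_def \<kappa>_def using \<delta> by (intro prod.neutral) (simp add: step_ge1)
      moreover have "(\<delta> / 2) / \<delta> = 1 / 2" using \<delta> by simp
      ultimately show False using \<delta> unfolding \<rho>_def by simp
    qed
    moreover have "0 \<le> (LINT y|lborel. \<rho> y)" by (simp add: \<rho>_nn)
    ultimately show ?thesis by simp
  qed
  have "\<eta> / 2 * (LINT y|lborel. \<rho> y) = (LINT y|lborel. \<eta> / 2 * \<rho> y)" by simp
  also have "\<dots> \<le> (LINT y|lborel. q (y + e) * \<rho> y - q y * \<rho> y)"
  proof (rule integral_mono)
    fix y
    show "\<eta> / 2 * \<rho> y \<le> q (y + e) * \<rho> y - q y * \<rho> y"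
    proof (cases "y \<in> B")
      case True
      have yj: "x $ j \<le> y $ j \<and> y $ j \<le> x $ j + \<delta>" for j using True by (simp add: B_def mem_box_cart)
      have y01: "0 \<le> y $ j \<and> y $ j \<le> 1 \<and> 0 \<le> (y + e) $ j \<and> (y + e) $ j \<le> 1" for j
        using yj[of j] x(1)[of j] \<delta>1[of j] \<delta>2 s by (cases "j = i") (auto simp: e)
      then have yS: "y \<in> S" unfolding S_def mem_space_dom by blast
      have yd: "\<bar>(y - x) $ j\<bar> \<le> \<delta>" for j using yj[of j] by simp
      have "dist y x \<le> (\<Sum>j\<in>UNIV. \<bar>(y - x) $ j\<bar>)" unfolding dist_norm by (rule norm_le_l1_cart)
      also have "\<dots> \<le> n * \<delta>"
        unfolding n_def by (rule sum_bounded_above[OF yd])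
      finally have "dist y x < \<delta>0" using \<delta>3 by linarith
      from \<delta>0(2)[OF yS this] have "\<bar>(\<phi> (y + e) - \<phi> y) - \<eta>\<bar> < \<eta> / 2"
        unfolding dist_real_def \<eta>_def[symmetric] .
      then have "\<eta> / 2 \<le> \<phi> (y + e) - \<phi> y" by linarith
      then have "\<eta> / 2 * \<rho> y \<le> (\<phi> (y + e) - \<phi> y) * \<rho> y" by (rule mult_right_mono[OF _ \<rho>_nn])
      then show ?thesis using yS by (simp add: q_def S_def algebra_simps)
    qed (simp add: \<rho>_out)
  qed (use i\<rho>(1) tr1 iq[OF c\<rho>] in auto)
  also have "\<dots> = (LINT y|lborel. q (y + e) * \<rho> y) - (LINT y|lborel. q y * \<rho> y)"
    by (rule Bochner_Integration.integral_diff[OF tr1 iq[OF c\<rho>]])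
  also have "\<dots> = - (LINT y|lborel. q y * \<rho> y - q y * \<rho> (y - e))"
    using Bochner_Integration.integral_diff[OF iq[OF c\<rho>] iq[OF c\<rho>e]] tr2 by simp
  also have "\<dots> \<le> 0" using key q1 by (simp add: right_diff_distrib)
  finally show False using pos \<eta> by (simp add: mult_le_0_iff)
qed


text \<open>Points of the closed cube are approached by shrinking towards the centre.\<close>

lemma weak_partial_increment:
  fixes f g :: "real ^ 'n \<Rightarrow> real"
  assumes wp: "weak_partial per i f g" and f: "continuous_on space_dom f"
    and g: "AE x in lebesgue_on space_dom. g x \<le> M"
    and x: "x \<in> space_dom" "x + s *\<^sub>R axis i 1 \<in> space_dom" and s: "0 < s"
  shows "f (x + s *\<^sub>R axis i 1) - f x \<le> M * s"
proof -
  \<comment> \<open>strictly between \<open>0\<close> and \<open>1\<close> for all \<open>k\<close>\<close>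
  define \<theta> where "\<theta> k = inverse (real (Suc k) + 1)" for k
  have \<theta>: "0 < \<theta> k" "\<theta> k < 1" for k by (simp_all add: \<theta>_def inverse_less_1_iff)
  have \<theta>0: "\<theta> \<longlonglongrightarrow> 0"
    unfolding \<theta>_def
    by (rule tendsto_inverse_0_at_top) (intro filterlim_tendsto_add_at_top[OF tendsto_const]
        filterlim_compose[OF filterlim_real_sequentially filterlim_Suc]
        filterlim_at_top_mono[OF filterlim_compose[OF filterlim_real_sequentially filterlim_Suc]] always_eventually allI; simp)
  define X where "X k y = y + \<theta> k *\<^sub>R ((\<chi> j. 1/2) - y)" for k and y :: "real ^ 'n"
  have X: "(\<lambda>k. X k y) \<longlonglongrightarrow> y" for y
    using tendsto_add[OF tendsto_const tendsto_scaleR[OF \<theta>0 tendsto_const], of y "(\<chi> j. 1/2) - y"]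
    unfolding X_def by simp
  have Xj: "0 < X k y $ j" "X k y $ j < 1" if "y \<in> space_dom" for k y j
  proof -
    have "X k y $ j = (1 - \<theta> k) * y $ j + \<theta> k / 2" by (simp add: X_def algebra_simps)
    moreover have "0 \<le> (1 - \<theta> k) * y $ j"
      using \<theta>[of k] that unfolding mem_space_dom by (intro mult_nonneg_nonneg) auto
    moreover have "(1 - \<theta> k) * y $ j \<le> 1 - \<theta> k"
      using \<theta>[of k] that mult_left_mono[of "y $ j" 1 "1 - \<theta> k"] unfolding mem_space_dom by simp
    moreover have "0 < \<theta> k / 2" "1 - \<theta> k + \<theta> k / 2 < 1" using \<theta>[of k] by auto
    ultimately show "0 < X k y $ j" "X k y $ j < 1" by linarith+
  qed
  have Xd: "X k y \<in> space_dom" if "y \<in> space_dom" for k y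
    using Xj[OF that] by (auto simp: mem_space_dom less_imp_le)
  let ?y = "x + s *\<^sub>R axis i 1"
  have Xy: "X k ?y = X k x + ((1 - \<theta> k) * s) *\<^sub>R axis i 1" for k by (simp add: X_def algebra_simps)
  have le: "f (X k ?y) - f (X k x) \<le> M * ((1 - \<theta> k) * s)" for k
    unfolding Xy
  proof (rule weak_partial_increment_interior[OF wp f g])
    show "0 < X k x $ j" "X k x $ j < 1" for j using Xj[OF x(1)] by auto
    show "0 < (1 - \<theta> k) * s" using \<theta>[of k] s by simp
    show "X k x $ i + (1 - \<theta> k) * s < 1" using Xj(2)[OF x(2), of k i] unfolding Xy by (simp add: axis_def)
  qed
  have lim: "(\<lambda>k. f (X k y)) \<longlonglongrightarrow> f y" if "y \<in> space_dom" for y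
    by (rule continuous_on_tendsto_compose[OF f X that]) (simp add: Xd[OF that])
  have "(\<lambda>k. f (X k ?y) - f (X k x)) \<longlonglongrightarrow> f ?y - f x"
    by (intro tendsto_diff lim x)
  moreover have "(\<lambda>k. M * ((1 - \<theta> k) * s)) \<longlonglongrightarrow> M * ((1 - 0) * s)"
    by (intro tendsto_intros \<theta>0)
  ultimately have "f ?y - f x \<le> M * ((1 - 0) * s)"
    by (rule LIMSEQ_le) (use le in auto)
  then show ?thesis by simp
qed

lemma weak_partial_minus:
  assumes "weak_partial per i f g"
  shows "weak_partial per i (\<lambda>x. - f x) (\<lambda>x. - g x)"
  using assms unfolding weak_partial_def by simp

text \<open>A bound on the weak derivative of a continuous function is a Lipschitz constant in the direction of
  the axis; this is how the norm of a velocity controls its Lipschitz constant.\<close>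

lemma weak_partial_lipschitz:
  fixes f g :: "real ^ 'n \<Rightarrow> real"
  assumes wp: "weak_partial per i f g" and f: "continuous_on space_dom f"
    and g: "AE x in lebesgue_on space_dom. \<bar>g x\<bar> \<le> M"
    and x: "x \<in> space_dom" "x + s *\<^sub>R axis i 1 \<in> space_dom"
  shows "\<bar>f (x + s *\<^sub>R axis i 1) - f x\<bar> \<le> M * \<bar>s\<bar>"
proof -
  have pos: "\<bar>f (y + r *\<^sub>R axis i 1) - f y\<bar> \<le> M * r"
    if y: "y \<in> space_dom" "y + r *\<^sub>R axis i 1 \<in> space_dom" and r: "0 < r" for y r
  proof (rule abs_leI)
    show "f (y + r *\<^sub>R axis i 1) - f y \<le> M * r"
      by (rule weak_partial_increment[OF wp f _ y r]) (use g in eventually_elim, simp)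
    have "- f (y + r *\<^sub>R axis i 1) - - f y \<le> M * r"
      by (rule weak_partial_increment[OF weak_partial_minus[OF wp] continuous_on_minus[OF f] _ y r])
        (use g in eventually_elim, simp)
    then show "- (f (y + r *\<^sub>R axis i 1) - f y) \<le> M * r" by simp
  qed
  consider "s = 0" | "s > 0" | "s < 0" by linarith
  then show ?thesis
  proof cases
    case 2 then show ?thesis using pos[OF x] by simp
  next
    case 3
    then show ?thesis using pos[OF x(2), of "- s"] x(1) by (simp add: algebra_simps abs_minus_commute)
  qed simp
qed

section \<open>Divergence and integration by parts\<close>

lemma frechet_derivative_components:
  fixes \<psi> :: "real ^ 'n \<Rightarrow> real"
  assumes "cont_diff \<psi>"
  shows "frechet_derivative \<psi> (at x) h = (\<Sum>i\<in>UNIV. h $ i * frechet_derivative \<psi> (at x) (axis i 1))"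
proof -
  note lin = frechet_derivative_linear[OF assms, of x]
  have "frechet_derivative \<psi> (at x) h = frechet_derivative \<psi> (at x) (\<Sum>i\<in>UNIV. (h $ i) *\<^sub>R axis i 1)"
    using vec_Basis_sum[of h] by simp
  also have "\<dots> = (\<Sum>i\<in>UNIV. h $ i * frechet_derivative \<psi> (at x) (axis i 1))"
    by (simp add: linear_sum[OF lin] linear_scale[OF lin])
  finally show ?thesis .
qed

lemma integrable_components:
  fixes v :: "real ^ 'n \<Rightarrow> real ^ 'n"
  assumes "\<And>i. integrable M (\<lambda>x. v x $ i)"
  shows "integrable M v"
proof -
  have "integrable M (\<lambda>x. \<Sum>i\<in>UNIV. (v x $ i) *\<^sub>R axis i (1::real))"
    by (intro Bochner_Integration.integrable_sum integrable_scaleR_left assms)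
  then show ?thesis by (simp add: vec_Basis_sum[symmetric])
qed

text \<open>Stated for a single \<open>\<psi>\<close>, so that it serves test functions as well as \<open>C\<^sup>1\<close> functions without
  support condition.\<close>

lemma weak_div_by_parts:
  fixes v :: "real ^ 'n \<Rightarrow> real ^ 'n" and g :: "'n \<Rightarrow> real ^ 'n \<Rightarrow> real"
  assumes v: "\<And>i. integrable (lebesgue_on space_dom) (\<lambda>x. v x $ i)"
    and g: "\<And>i. integrable (lebesgue_on space_dom) (g i)" and \<psi>: "cont_diff \<psi>"
    and eq: "\<And>i. (LINT x|lebesgue_on space_dom. v x $ i * frechet_derivative \<psi> (at x) (axis i 1)) =
      - (LINT x|lebesgue_on space_dom. g i x * \<psi> x)"
  shows "(LINT x|lebesgue_on space_dom. frechet_derivative \<psi> (at x) (v x)) =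
    - (LINT x|lebesgue_on space_dom. (\<Sum>i\<in>UNIV. g i x) * \<psi> x)"
proof -
  have "(LINT x|lebesgue_on space_dom. frechet_derivative \<psi> (at x) (v x)) =
      (LINT x|lebesgue_on space_dom. (\<Sum>i\<in>UNIV. v x $ i * frechet_derivative \<psi> (at x) (axis i 1)))"
    by (intro Bochner_Integration.integral_cong refl frechet_derivative_components[OF \<psi>])
  also have "\<dots> = (\<Sum>i\<in>UNIV. (LINT x|lebesgue_on space_dom. v x $ i * frechet_derivative \<psi> (at x) (axis i 1)))"
    by (intro Bochner_Integration.integral_sum integrable_mult_continuous_space v
        cont_diff_continuous_derivative[OF \<psi>] continuous_intros)
  also have "\<dots> = - (\<Sum>i\<in>UNIV. (LINT x|lebesgue_on space_dom. g i x * \<psi> x))"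
    by (simp add: eq sum_negf)
  also have "(\<Sum>i\<in>UNIV. (LINT x|lebesgue_on space_dom. g i x * \<psi> x)) =
      (LINT x|lebesgue_on space_dom. (\<Sum>i\<in>UNIV. g i x * \<psi> x))"
    by (intro Bochner_Integration.integral_sum[symmetric] integrable_mult_continuous_space g cont_diff_continuous[OF \<psi>])
  finally show ?thesis by (simp add: sum_distrib_right)
qed

lemma weak_div_from_partials:
  fixes v :: "real ^ 'n \<Rightarrow> real ^ 'n"
  assumes wp: "\<And>i. weak_partial per i (\<lambda>x. v x $ i) (g i)"
  shows "weak_div per v (\<lambda>x. \<Sum>i\<in>UNIV. g i x)"
  unfolding weak_div_def
proof (intro conjI allI impI)
  have i: "integrable (lebesgue_on space_dom) (\<lambda>x. v x $ i)" "integrable (lebesgue_on space_dom) (g i)" for i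
    using wp[of i] unfolding weak_partial_def by auto
  show "integrable (lebesgue_on space_dom) v" by (rule integrable_components[OF i(1)])
  show "integrable (lebesgue_on space_dom) (\<lambda>x. \<Sum>i\<in>UNIV. g i x)"
    by (intro Bochner_Integration.integrable_sum i)
  fix \<psi> :: "real ^ 'n \<Rightarrow> real" assume \<psi>: "test_fun per \<psi>"
  show "(LINT x|lebesgue_on space_dom. frechet_derivative \<psi> (at x) (v x)) =
      - (LINT x|lebesgue_on space_dom. (\<Sum>i\<in>UNIV. g i x) * \<psi> x)"
    by (rule weak_div_by_parts[OF i test_fun_cont_diff[OF \<psi>]])
      (use wp \<psi> in \<open>auto simp: weak_partial_def\<close>)
qed

lemma weak_div_cong_AE:
  assumes w: "weak_div per v d" and ae: "AE x in lebesgue_on space_dom. d' x = d x"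
  shows "weak_div per v d'"
proof -
  have d: "integrable (lebesgue_on space_dom) d" using w unfolding weak_div_def by simp
  have m: "d' \<in> borel_measurable (lebesgue_on space_dom)"
    by (rule lebesgue_on_measurable_AE[OF borel_measurable_integrable[OF d] ae]) simp
  have "integrable (lebesgue_on space_dom) d'"
    by (rule integrable_cong_AE_imp[OF d m]) (use ae in eventually_elim, simp)
  moreover have "(LINT x|lebesgue_on space_dom. d' x * \<psi> x) = (LINT x|lebesgue_on space_dom. d x * \<psi> x)"
    if "test_fun per \<psi>" for \<psi>
  proof (rule integral_cong_AE)
    have "\<psi> \<in> borel_measurable (lebesgue_on space_dom)" using test_fun_L2[OF that] by (simp add: L2_def)
    then show "(\<lambda>x. d' x * \<psi> x) \<in> borel_measurable (lebesgue_on space_dom)"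
      "(\<lambda>x. d x * \<psi> x) \<in> borel_measurable (lebesgue_on space_dom)"
      using m borel_measurable_integrable[OF d] by auto
    show "AE x in lebesgue_on space_dom. d' x * \<psi> x = d x * \<psi> x" using ae by eventually_elim simp
  qed
  ultimately show ?thesis using w unfolding weak_div_def by simp
qed

lemma weak_div_diff:
  fixes v w :: "real ^ 'n \<Rightarrow> real ^ 'n"
  assumes v: "weak_div per v d" and w: "weak_div per w e"
  shows "weak_div per (\<lambda>x. v x - w x) (\<lambda>x. d x - e x)"
  unfolding weak_div_def
proof (intro conjI allI impI)
  have i: "integrable (lebesgue_on space_dom) v" "integrable (lebesgue_on space_dom) w"
    "integrable (lebesgue_on space_dom) d" "integrable (lebesgue_on space_dom) e"
    using v w unfolding weak_div_def by auto
  then show "integrable (lebesgue_on space_dom) (\<lambda>x. v x - w x)" "integrable (lebesgue_on space_dom) (\<lambda>x. d x - e x)"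
    by auto
  fix \<psi> :: "real ^ 'n \<Rightarrow> real" assume \<psi>: "test_fun per \<psi>"
  have cd: "cont_diff \<psi>" by (rule test_fun_cont_diff[OF \<psi>])
  have int: "integrable (lebesgue_on space_dom) (\<lambda>x. frechet_derivative \<psi> (at x) (f x))"
    if "integrable (lebesgue_on space_dom) f" for f
    unfolding frechet_derivative_components[OF cd, of _ "f _"]
  proof (intro Bochner_Integration.integrable_sum integrable_mult_continuous_space
      cont_diff_continuous_derivative[OF cd] continuous_intros)
    show "integrable (lebesgue_on space_dom) (\<lambda>x. f x $ i)" for i
      using integrable_inner_left[OF that, of "axis i 1"] by (simp add: cart_eq_inner_axis)
  qed
  have "(LINT x|lebesgue_on space_dom. frechet_derivative \<psi> (at x) (v x - w x)) =
      (LINT x|lebesgue_on space_dom. frechet_derivative \<psi> (at x) (v x)) - (LINT x|lebesgue_on space_dom. frechet_derivative \<psi> (at x) (w x))"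
    by (subst Bochner_Integration.integral_diff[OF int[OF i(1)] int[OF i(2)], symmetric])
      (simp add: linear_diff[OF frechet_derivative_linear[OF cd]])
  also have "\<dots> = - ((LINT x|lebesgue_on space_dom. d x * \<psi> x) - (LINT x|lebesgue_on space_dom. e x * \<psi> x))"
    using v w \<psi> unfolding weak_div_def by simp
  also have "(LINT x|lebesgue_on space_dom. d x * \<psi> x) - (LINT x|lebesgue_on space_dom. e x * \<psi> x) =
      (LINT x|lebesgue_on space_dom. (d x - e x) * \<psi> x)"
    by (subst Bochner_Integration.integral_diff[OF integrable_mult_continuous_space[OF i(3) cont_diff_continuous[OF cd]]
          integrable_mult_continuous_space[OF i(4) cont_diff_continuous[OF cd]], symmetric])
      (simp add: algebra_simps)
  finally show "(LINT x|lebesgue_on space_dom. frechet_derivative \<psi> (at x) (v x - w x)) =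
      - (LINT x|lebesgue_on space_dom. (d x - e x) * \<psi> x)" .
qed

text \<open>If a component is approximated by compactly supported \<open>F k\<close>, then \<open>G * F k\<close> is compactly supported
  for any \<open>C\<^sup>1\<close> function \<open>G\<close>, and the integral of its derivative vanishes; pass to the limit.  This is
  where the boundary condition on the velocity enters.\<close>

lemma H10_by_parts:
  fixes v :: "real ^ 'n \<Rightarrow> real ^ 'n"
  assumes v: "\<And>i. H10 (\<lambda>x. v x $ i)" and d: "weak_div False v d" and G: "cont_diff G"
  shows "(LINT x|lebesgue_on space_dom. frechet_derivative G (at x) (v x)) =
    - (LINT x|lebesgue_on space_dom. d x * G x)"
proof -
  have "\<exists>g. weak_partial False i (\<lambda>x. v x $ i) g \<and>
      (LINT x|lebesgue_on space_dom. v x $ i * frechet_derivative G (at x) (axis i 1)) =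
      - (LINT x|lebesgue_on space_dom. g x * G x)" for i
  proof -
    let ?D = "\<lambda>F x. frechet_derivative F (at x) (axis i 1)"
    obtain F where F': "\<forall>k. test_fun False (F k)" and limF: "(\<lambda>k. l2_norm space_dom (\<lambda>x. F k x - v x $ i)) \<longlonglongrightarrow> 0"
      and ex: "\<forall>i'. \<exists>g. L2 space_dom g \<and> weak_partial False i' (\<lambda>x. v x $ i) g \<and>
        (\<lambda>k. l2_norm space_dom (\<lambda>x. frechet_derivative (F k) (at x) (axis i' 1) - g x)) \<longlonglongrightarrow> 0"
      using v[of i] unfolding H10_def by (elim exE conjE) (rule that; assumption)
    note F = F'[rule_format]
    obtain g where g: "L2 space_dom g" "weak_partial False i (\<lambda>x. v x $ i) g"
      "(\<lambda>k. l2_norm space_dom (\<lambda>x. ?D (F k) x - g x)) \<longlonglongrightarrow> 0"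
      using ex[rule_format, of i] by (elim exE conjE) (rule that; assumption)
    have Lv: "L2 space_dom (\<lambda>x. v x $ i)" using v[of i] unfolding H10_def by simp
    have cF: "cont_diff (F k)" for k by (rule test_fun_cont_diff[OF F])
    have LG: "L2 space_dom G" by (rule continuous_L2_space[OF cont_diff_continuous[OF G]])
    have LD: "L2 space_dom (?D H)" if "cont_diff H" for H :: "real ^ 'n \<Rightarrow> real"
      by (intro continuous_L2_space cont_diff_continuous_derivative[OF that] continuous_intros)
    have z: "l2_inner space_dom (F k) (?D G) + l2_inner space_dom (?D (F k)) G = 0" for k
    proof -
      have t: "test_fun False (\<lambda>x. G x * F k x)"
        using F[of k] cont_diff_mult[OF G cF[of k]] unfolding test_fun_def C1_iff_cont_diff by auto
      have "0 = (LINT x|lebesgue_on space_dom. F k x * ?D G x + ?D (F k) x * G x)"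
        using integral_derivative_zero[OF t, of i] unfolding frechet_derivative_mult[OF G cF] by (simp add: algebra_simps)
      then show ?thesis unfolding l2_inner_def
        by (simp add: Bochner_Integration.integral_add[OF L2_mult_integrable[OF test_fun_L2[OF F] LD[OF G]]
              L2_mult_integrable[OF LD[OF cF] LG]])
    qed
    have "(\<lambda>k. l2_inner space_dom (F k) (?D G) + l2_inner space_dom (?D (F k)) G) \<longlonglongrightarrow>
        l2_inner space_dom (\<lambda>x. v x $ i) (?D G) + l2_inner space_dom g G"
      by (intro tendsto_add l2_inner_tendsto[OF test_fun_L2[OF F] Lv LD[OF G] limF]
          l2_inner_tendsto[OF LD[OF cF] g(1) LG g(3)])
    then have "l2_inner space_dom (\<lambda>x. v x $ i) (?D G) + l2_inner space_dom g G = 0"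
      unfolding z using LIMSEQ_const_iff by metis
    then show ?thesis using g(2) unfolding l2_inner_def by (intro exI[of _ g]) auto
  qed
  then obtain g where g: "\<And>i. weak_partial False i (\<lambda>x. v x $ i) (g i)"
    and eq: "\<And>i. (LINT x|lebesgue_on space_dom. v x $ i * frechet_derivative G (at x) (axis i 1)) =
      - (LINT x|lebesgue_on space_dom. g i x * G x)" by metis
  have i: "integrable (lebesgue_on space_dom) (\<lambda>x. v x $ i)" "integrable (lebesgue_on space_dom) (g i)" for i
    using g[of i] unfolding weak_partial_def by auto
  have ae: "AE x in lebesgue_on space_dom. d x = (\<Sum>i\<in>UNIV. g i x)"
    by (rule weak_div_unique[OF d weak_div_from_partials[OF g]])
  have id: "integrable (lebesgue_on space_dom) d" using d unfolding weak_div_def by simp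
  have "(LINT x|lebesgue_on space_dom. d x * G x) = (LINT x|lebesgue_on space_dom. (\<Sum>i\<in>UNIV. g i x) * G x)"
    by (intro integral_cong_AE borel_measurable_integrable integrable_mult_continuous_space[OF id]
        integrable_mult_continuous_space[OF Bochner_Integration.integrable_sum] i cont_diff_continuous[OF G])
      (use ae in eventually_elim, simp)
  then show ?thesis using weak_div_by_parts[OF i G eq] by simp
qed

section \<open>Estimates in the space of velocities\<close>

lemma lipschitz_extension_clamp:
  fixes v :: "real ^ 'n \<Rightarrow> real ^ 'n"
  assumes "L-lipschitz_on space_dom v"
  shows "L-lipschitz_on UNIV (\<lambda>x. v (clamp 0 1 x))"
proof -
  have "1-lipschitz_on UNIV (clamp 0 1 :: real ^ 'n \<Rightarrow> real ^ 'n)"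
    by (rule lipschitz_onI) (auto intro: dist_clamps_le_dist_args)
  moreover have "L-lipschitz_on (clamp 0 1 ` UNIV) v"
    by (rule lipschitz_on_subset[OF assms]) (auto simp: space_dom_def Basis_vec_def inner_axis intro!: clamp_in_interval)
  ultimately show ?thesis
    using lipschitz_on_compose[of 1 UNIV "clamp 0 1" L v] by (simp add: comp_def)
qed

text \<open>Periodic fields are already defined on the whole space; other fields are extended by projecting
  onto the cube.  The extension is then mollified.\<close>

lemma smooth_velocity_approximation:
  fixes v :: "real ^ 'n \<Rightarrow> real ^ 'n"
  assumes lip: "L-lipschitz_on space_dom v" and per: "per \<Longrightarrow> periodic_fun v" and e: "e > 0"
  shows "\<exists>w. cont_diff w \<and> (real CARD('n) * L)-lipschitz_on UNIV w \<and> (per \<longrightarrow> periodic_fun w) \<and>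
    (\<forall>x\<in>space_dom. norm (w x - v x) \<le> e)"
proof -
  have L: "0 \<le> L" by (rule lipschitz_on_nonneg[OF lip])
  have n: "L \<le> real CARD('n) * L" using L mult_right_mono[of 1 "real CARD('n)" L] by (simp add: Suc_leI)
  show ?thesis
  proof (cases per)
    case True
    show ?thesis
      using lipschitz_smooth_approximation[OF periodic_lipschitz[OF per[OF True] lip] e] per[OF True] by blast
  next
    case False
    obtain w where w: "cont_diff w" "L-lipschitz_on UNIV w" "\<And>x. norm (w x - v (clamp 0 1 x)) \<le> e"
      using lipschitz_smooth_approximation[OF lipschitz_extension_clamp[OF lip] e] by blast
    have "clamp 0 1 x = x" if "x \<in> space_dom" for x :: "real ^ 'n"
      by (rule clamp_cancel_cbox) (use that in \<open>simp add: space_dom_def\<close>)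
    then show ?thesis
      using w lipschitz_on_le[OF w(2) n] False by (intro exI[of _ w]) (metis (no_types))
  qed
qed

text \<open>The embedding into \<open>W\<^sup>1\<^sup>,\<^sup>\<infinity>\<close> turned into pointwise estimates with one constant for all fields:
  supremum, Lipschitz constant and divergence are controlled by the norm.\<close>

lemma velocity_space_bounds:
  fixes V :: "(real ^ 'n \<Rightarrow> real ^ 'n) set"
  assumes V: "velocity_space per V nV"
  shows "\<exists>K\<ge>0. \<forall>v\<in>V. (\<forall>x\<in>space_dom. norm (v x) \<le> K * nV v) \<and> (K * nV v)-lipschitz_on space_dom v \<and>
    (\<exists>d. weak_div per v d \<and> (AE x in lebesgue_on space_dom. \<bar>d x\<bar> \<le> K * nV v))"
proof -
  obtain C where C': "\<forall>v\<in>V. \<forall>i. W1inf_le per (\<lambda>x. v x $ i) (C * nV v)"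
    using V unfolding velocity_space_def by (elim conjE exE) (rule that; assumption)
  note C = C'[rule_format]
  define n where "n = real CARD('n)"
  have n: "n \<ge> 1" unfolding n_def by (simp add: Suc_leI)
  define K where "K = n * (n * \<bar>C\<bar>)"
  have nC: "n * \<bar>C\<bar> \<le> K" unfolding K_def using n mult_right_mono[OF n, of "n * \<bar>C\<bar>"] by simp
  show ?thesis
  proof (intro exI[of _ K] conjI ballI)
    show "0 \<le> K" using n by (simp add: K_def)
    fix v assume v: "v \<in> V"
    have nV: "0 \<le> nV v" using V v unfolding velocity_space_def by blast
    define M where "M = \<bar>C\<bar> * nV v"
    have M: "0 \<le> M" "C * nV v \<le> M" using nV by (auto simp: M_def intro: mult_right_mono)
    have nM: "n * M \<le> K * nV v" using mult_right_mono[OF nC nV] by (simp add: M_def mult.assoc)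
    obtain L where L: "L-lipschitz_on space_dom v" using V v unfolding velocity_space_def by blast
    have cv: "continuous_on space_dom (\<lambda>x. v x $ i)" for i
      by (intro continuous_intros lipschitz_on_continuous_on[OF L])
    have "\<exists>g. weak_partial per i (\<lambda>x. v x $ j) g \<and> (AE x in lebesgue_on space_dom. \<bar>g x\<bar> \<le> M)" for i j
    proof -
      obtain g where g: "weak_partial per i (\<lambda>x. v x $ j) g" "AE x in lebesgue_on space_dom. \<bar>g x\<bar> \<le> C * nV v"
        using C[OF v, of j] unfolding W1inf_le_def Linf_le_def by blast
      have "AE x in lebesgue_on space_dom. \<bar>g x\<bar> \<le> M" using g(2) by eventually_elim (use M(2) in linarith)
      with g(1) show ?thesis by blast
    qed
    then obtain g where g: "\<And>i j. weak_partial per i (\<lambda>x. v x $ j) (g i j)"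
      and gM: "\<And>i j. AE x in lebesgue_on space_dom. \<bar>g i j x\<bar> \<le> M" by metis
    have norm_le: "norm y \<le> n * B" if "\<And>i. \<bar>y $ i\<bar> \<le> B" for y :: "real ^ 'n" and B
    proof -
      have "norm y \<le> (\<Sum>i\<in>UNIV. \<bar>y $ i\<bar>)" by (rule norm_le_l1_cart)
      also have "\<dots> \<le> n * B" unfolding n_def by (rule sum_bounded_above) (use that in auto)
      finally show ?thesis .
    qed
    have vM: "\<bar>v x $ i\<bar> \<le> M" if "x \<in> space_dom" for x i
    proof (rule continuous_AE_bound[OF cv _ that])
      have "AE x in lebesgue_on space_dom. \<bar>v x $ i\<bar> \<le> C * nV v"
        using C[OF v, of i] unfolding W1inf_le_def Linf_le_def by blast
      then show "AE x in lebesgue_on space_dom. \<bar>v x $ i\<bar> \<le> M" by eventually_elim (use M(2) in linarith)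
    qed
    show "norm (v x) \<le> K * nV v" if "x \<in> space_dom" for x
      using norm_le[OF vM[OF that]] nM by linarith
    have "(n * (n * M))-lipschitz_on space_dom v"
      unfolding n_def
    proof (rule lipschitz_from_coordinates)
      show "mix S x y \<in> space_dom" if "x \<in> space_dom" "y \<in> space_dom" for S and x y :: "real ^ 'n"
        using that by (auto simp: mem_space_dom mix_def)
      fix x :: "real ^ 'n" and i s
      assume "x \<in> space_dom" "x + s *\<^sub>R axis i 1 \<in> space_dom"
      then have "\<bar>(v (x + s *\<^sub>R axis i 1) - v x) $ j\<bar> \<le> M * \<bar>s\<bar>" for j
        using weak_partial_lipschitz[OF g cv gM] by simp
      from norm_le[OF this]
      show "norm (v (x + s *\<^sub>R axis i 1) - v x) \<le> real CARD('n) * M * \<bar>s\<bar>" by (simp add: n_def mult.assoc)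
    qed (use M in auto)
    then show "(K * nV v)-lipschitz_on space_dom v" by (simp add: K_def M_def mult.assoc)
    have "AE x in lebesgue_on space_dom. \<bar>\<Sum>i\<in>UNIV. g i i x\<bar> \<le> K * nV v"
    proof -
      have "AE x in lebesgue_on space_dom. \<forall>i. \<bar>g i i x\<bar> \<le> M" using gM by (simp add: AE_all_countable)
      then show ?thesis
      proof eventually_elim
        case (elim x)
        have "\<bar>\<Sum>i\<in>UNIV. g i i x\<bar> \<le> (\<Sum>i\<in>UNIV. \<bar>g i i x\<bar>)" by (rule sum_abs)
        also have "\<dots> \<le> n * M" unfolding n_def by (rule sum_bounded_above) (use elim in auto)
        finally show ?case using nM by linarith
      qed
    qed
    then show "\<exists>d. weak_div per v d \<and> (AE x in lebesgue_on space_dom. \<bar>d x\<bar> \<le> K * nV v)"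
      using weak_div_from_partials[of per v "\<lambda>i. g i i", OF g] by blast
  qed
qed

section \<open>Velocities depending on time\<close>

lemma l2_dominated_convergence:
  assumes f: "\<And>k. f k \<in> borel_measurable (lebesgue_on S)" and b: "L2 S b"
    and le: "\<And>k. AE x in lebesgue_on S. \<bar>f k x\<bar> \<le> \<bar>b x\<bar>"
    and lim: "AE x in lebesgue_on S. (\<lambda>k. f k x) \<longlonglongrightarrow> 0"
  shows "(\<lambda>k. l2_norm S (f k)) \<longlonglongrightarrow> 0"
proof -
  have "(\<lambda>k. LINT x|lebesgue_on S. (f k x)\<^sup>2) \<longlonglongrightarrow> (LINT x|lebesgue_on S. 0)"
  proof (rule integral_dominated_convergence[where w = "\<lambda>x. (b x)\<^sup>2"])
    show "integrable (lebesgue_on S) (\<lambda>x. (b x)\<^sup>2)" using b by (simp add: L2_def)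
    show "AE x in lebesgue_on S. (\<lambda>k. (f k x)\<^sup>2) \<longlonglongrightarrow> 0"
      using lim by eventually_elim (auto dest: tendsto_power[of _ 0 _ 2])
    show "AE x in lebesgue_on S. norm ((f k x)\<^sup>2) \<le> (b x)\<^sup>2" for k
      using le[of k] by eventually_elim (simp add: abs_le_square_iff)
  qed (use f in auto)
  then have "(\<lambda>k. sqrt (LINT x|lebesgue_on S. (f k x)\<^sup>2)) \<longlonglongrightarrow> sqrt 0"
    by (intro tendsto_real_sqrt) simp
  then show ?thesis unfolding l2_norm_def l2_inner_def by (simp add: power2_eq_square)
qed

lemma l2_norm_const: "L2 {0..1::real} (\<lambda>t. c)" "l2_norm {0..1::real} (\<lambda>t. c) = \<bar>c\<bar>"
proof -
  have "integrable (lebesgue_on {0..1::real}) (\<lambda>t. c\<^sup>2)"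
    using continuous_integrable_cbox[of 0 "1::real" "\<lambda>t. c\<^sup>2"] by simp
  then show "L2 {0..1::real} (\<lambda>t. c)" by (simp add: L2_def)
  show "l2_norm {0..1::real} (\<lambda>t. c) = \<bar>c\<bar>"
    unfolding l2_norm_def l2_inner_def by (simp add: measure_restrict_space space_restrict_space)
qed

lemma integral_le_l2_norm:
  assumes "L2 {0..1::real} f"
  shows "integrable (lebesgue_on {0..1}) f" "(LINT t|lebesgue_on {0..1}. f t) \<le> l2_norm {0..1} f"
proof -
  show "integrable (lebesgue_on {0..1}) f" by (rule L2_integrable[OF _ assms]) simp
  show "(LINT t|lebesgue_on {0..1}. f t) \<le> l2_norm {0..1} f"
    using l2_cauchy_schwarz[OF assms l2_norm_const(1)[of 1]] l2_norm_const(2)[of 1]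
    by (simp add: l2_inner_def)
qed

lemma L2_sum:
  assumes "finite F" "\<And>w. w \<in> F \<Longrightarrow> L2 S (f w)"
  shows "L2 S (\<lambda>x. \<Sum>w\<in>F. f w x)" "l2_norm S (\<lambda>x. \<Sum>w\<in>F. f w x) \<le> (\<Sum>w\<in>F. l2_norm S (f w))"
proof -
  have "L2 S (\<lambda>x. \<Sum>w\<in>F. f w x) \<and> l2_norm S (\<lambda>x. \<Sum>w\<in>F. f w x) \<le> (\<Sum>w\<in>F. l2_norm S (f w))"
    using assms
  proof (induction F)
    case empty
    then show ?case by (simp add: l2_norm_def l2_inner_def)
  next
    case (insert w F)
    then have L: "L2 S (f w)" "L2 S (\<lambda>x. \<Sum>w\<in>F. f w x)" by auto
    then show ?case using insert L2_add[OF L] l2_norm_triangle[OF L] by fastforce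
  qed
  then show "L2 S (\<lambda>x. \<Sum>w\<in>F. f w x)" "l2_norm S (\<lambda>x. \<Sum>w\<in>F. f w x) \<le> (\<Sum>w\<in>F. l2_norm S (f w))" by auto
qed

text \<open>Lebesgue measurable functions are almost everywhere limits of continuous functions; truncation
  to \<open>[0, 1]\<close> allows dominated convergence.\<close>

lemma indicator_continuous_approximation:
  fixes A :: "real set"
  assumes A: "A \<in> sets lebesgue" and e: "e > 0"
  shows "\<exists>\<theta>. continuous_on UNIV \<theta> \<and> (\<forall>t. 0 \<le> \<theta> t \<and> \<theta> t \<le> 1) \<and>
    L2 {0..1} (\<lambda>t. indicator A t - \<theta> t) \<and> l2_norm {0..1} (\<lambda>t. indicator A t - \<theta> t) \<le> e"
proof -
  have mA: "(indicator A :: real \<Rightarrow> real) \<in> borel_measurable lebesgue" using A by simp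
  have "(indicator A :: real \<Rightarrow> real) measurable_on UNIV"
    by (rule lebesgue_measurable_imp_measurable_on_real[OF mA]) simp
  then obtain N and g :: "nat \<Rightarrow> real \<Rightarrow> real" where N: "negligible N"
    and g: "\<forall>n. continuous_on UNIV (g n)"
    and lim: "\<forall>x. x \<notin> N \<longrightarrow> (\<lambda>n. g n x) \<longlonglongrightarrow> (if x \<in> UNIV then indicator A x else 0)"
    unfolding measurable_on_def by (elim exE conjE) (rule that; assumption)
  define \<theta> where "\<theta> n t = max 0 (min 1 (g n t))" for n t
  have c: "continuous_on UNIV (\<theta> n)" for n unfolding \<theta>_def by (intro continuous_intros g[rule_format])
  have b: "0 \<le> \<theta> n t \<and> \<theta> n t \<le> 1" for n t by (simp add: \<theta>_def)
  have m: "(\<lambda>t. indicator A t - \<theta> n t) \<in> borel_measurable (lebesgue_on {0..1})" for n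
  proof -
    have "\<theta> n \<in> borel_measurable lebesgue"
      by (rule measurable_completion) (use borel_measurable_continuous_onI[OF c[of n]] in simp)
    then have "(\<lambda>t. indicator A t - \<theta> n t) \<in> borel_measurable lebesgue"
      by (rule borel_measurable_diff[OF mA])
    then show ?thesis by (rule measurable_restrict_space1)
  qed
  have le: "AE t in lebesgue_on {0..1}. \<bar>indicator A t - \<theta> n t\<bar> \<le> \<bar>1::real\<bar>" for n
  proof (rule AE_I2)
    fix t
    show "\<bar>indicator A t - \<theta> n t\<bar> \<le> \<bar>1::real\<bar>" using b[of n t] by (cases "t \<in> A") (simp_all add: abs_if)
  qed
  have notN: "AE t in lebesgue_on {0..1}. t \<notin> N"
  proof -
    have "AE t in lebesgue. t \<notin> N" using N by (simp add: AE_not_in negligible_iff_null_sets)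
    then have "AE t in lebesgue. t \<in> {0..1} \<longrightarrow> t \<notin> N" by eventually_elim simp
    then show ?thesis by (subst AE_restrict_space_iff) simp_all
  qed
  have l0: "AE t in lebesgue_on {0..1}. (\<lambda>n. indicator A t - \<theta> n t) \<longlonglongrightarrow> 0"
    using notN
  proof eventually_elim
    case (elim t)
    have "(\<lambda>n. g n t) \<longlonglongrightarrow> indicator A t" using lim elim by simp
    then have "(\<lambda>n. indicator A t - \<theta> n t) \<longlonglongrightarrow> indicator A t - max 0 (min 1 (indicator A t))"
      unfolding \<theta>_def by (intro tendsto_intros)
    then show ?case by (simp add: indicator_def split: if_splits)
  qed
  have "(\<lambda>n. l2_norm {0..1} (\<lambda>t. indicator A t - \<theta> n t)) \<longlonglongrightarrow> 0"
    by (rule l2_dominated_convergence[OF m l2_norm_const(1) le l0])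
  then have "eventually (\<lambda>n. l2_norm {0..1} (\<lambda>t. indicator A t - \<theta> n t) < e) sequentially"
    using e by (rule order_tendstoD)
  then obtain n where n: "l2_norm {0..1} (\<lambda>t. indicator A t - \<theta> n t) < e"
    by (auto simp: eventually_sequentially)
  have "L2 {0..1} (\<lambda>t. indicator A t - \<theta> n t)" by (rule L2_dominated[OF m l2_norm_const(1) le])
  then show ?thesis using c[of n] b[of n] n by (intro exI[of _ "\<theta> n"]) auto
qed

text \<open>The constants and choices extracted from an admissible velocity: \<open>K\<close> bounds supremum,
  Lipschitz constant and divergence by the norm, \<open>s\<close> is a sequence of simple functions converging to
  \<open>u\<close> in the norm of \<open>V\<close>, and \<open>D v\<close> is a representative of the divergence of \<open>v\<close>.\<close>

locale velocity_field =
  fixes per :: bool and V :: "(real ^ 'n \<Rightarrow> real ^ 'n) set" and nV :: "(real ^ 'n \<Rightarrow> real ^ 'n) \<Rightarrow> real"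
    and u :: "real \<Rightarrow> real ^ 'n \<Rightarrow> real ^ 'n" and K :: real
    and s :: "nat \<Rightarrow> real \<Rightarrow> real ^ 'n \<Rightarrow> real ^ 'n" and D :: "(real ^ 'n \<Rightarrow> real ^ 'n) \<Rightarrow> real ^ 'n \<Rightarrow> real"
  assumes vs: "velocity_space per V nV" and K: "0 \<le> K"
    and sup_bound: "\<And>v x. v \<in> V \<Longrightarrow> x \<in> space_dom \<Longrightarrow> norm (v x) \<le> K * nV v"
    and lip: "\<And>v. v \<in> V \<Longrightarrow> (K * nV v)-lipschitz_on space_dom v"
    and D: "\<And>v. v \<in> V \<Longrightarrow> weak_div per v (D v)"
    and D_bound: "\<And>v. v \<in> V \<Longrightarrow> AE x in lebesgue_on space_dom. \<bar>D v x\<bar> \<le> K * nV v"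
    and u: "\<And>t. t \<in> {0..1} \<Longrightarrow> u t \<in> V"
    and s: "\<And>k. finite (s k ` {0..1})" "\<And>k t. t \<in> {0..1} \<Longrightarrow> s k t \<in> V"
      "\<And>k v. {t\<in>{0..1}. s k t = v} \<in> sets lebesgue"
    and s_lim: "AE t in lebesgue_on {0..1}. (\<lambda>k. nV (\<lambda>x. s k t x - u t x)) \<longlonglongrightarrow> 0"
    and u_L2: "integrable (lebesgue_on {0..1}) (\<lambda>t. (nV (u t))\<^sup>2)"
    and u_H10: "\<And>t i. \<not> per \<Longrightarrow> t \<in> {0..1} \<Longrightarrow> H10 (\<lambda>x. u t x $ i)"
begin

lemma V_0: "(\<lambda>x. 0) \<in> V"
  and V_add: "v \<in> V \<Longrightarrow> w \<in> V \<Longrightarrow> (\<lambda>x. v x + w x) \<in> V"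
  and V_scale: "v \<in> V \<Longrightarrow> (\<lambda>x. c *\<^sub>R v x) \<in> V"
  and nV_nonneg: "v \<in> V \<Longrightarrow> 0 \<le> nV v"
  and nV_scale: "v \<in> V \<Longrightarrow> nV (\<lambda>x. c *\<^sub>R v x) = \<bar>c\<bar> * nV v"
  and nV_triangle: "v \<in> V \<Longrightarrow> w \<in> V \<Longrightarrow> nV (\<lambda>x. v x + w x) \<le> nV v + nV w"
  and V_periodic: "v \<in> V \<Longrightarrow> per \<Longrightarrow> periodic_fun v"
  using vs unfolding velocity_space_def by blast+

lemma nV_0: "nV (\<lambda>x. 0) = 0"
  using nV_scale[OF V_0, of 0] by simp

lemma V_diff: "v \<in> V \<Longrightarrow> w \<in> V \<Longrightarrow> (\<lambda>x. v x - w x) \<in> V"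
  using V_add[OF _ V_scale[of w "-1"], of v] by simp

lemma nV_commute: "v \<in> V \<Longrightarrow> w \<in> V \<Longrightarrow> nV (\<lambda>x. v x - w x) = nV (\<lambda>x. w x - v x)"
  using nV_scale[OF V_diff[of v w], of "-1"] by simp

lemma nV_triangle_diff:
  "a \<in> V \<Longrightarrow> b \<in> V \<Longrightarrow> c \<in> V \<Longrightarrow> nV (\<lambda>x. a x - c x) \<le> nV (\<lambda>x. a x - b x) + nV (\<lambda>x. b x - c x)"
  using nV_triangle[OF V_diff[of a b] V_diff[of b c]] by simp

lemma nV_reverse_triangle:
  assumes "a \<in> V" "b \<in> V" "c \<in> V"
  shows "\<bar>nV (\<lambda>x. a x - c x) - nV (\<lambda>x. b x - c x)\<bar> \<le> nV (\<lambda>x. a x - b x)"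
  using nV_triangle_diff[OF assms] nV_triangle_diff[OF assms(2,1,3)] nV_commute[OF assms(1,2)] by linarith

lemma V_sum:
  assumes "finite F" "F \<subseteq> V"
  shows "(\<lambda>x. \<Sum>w\<in>F. a w *\<^sub>R w x) \<in> V" "nV (\<lambda>x. \<Sum>w\<in>F. a w *\<^sub>R w x) \<le> (\<Sum>w\<in>F. \<bar>a w\<bar> * nV w)"
proof -
  have "(\<lambda>x. \<Sum>w\<in>F. a w *\<^sub>R w x) \<in> V \<and> nV (\<lambda>x. \<Sum>w\<in>F. a w *\<^sub>R w x) \<le> (\<Sum>w\<in>F. \<bar>a w\<bar> * nV w)"
    using assms
  proof (induction F)
    case empty
    then show ?case by (simp add: V_0 nV_0)
  next
    case (insert w F)
    then have w: "w \<in> V" and i: "(\<lambda>x. \<Sum>w\<in>F. a w *\<^sub>R w x) \<in> V"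
      "nV (\<lambda>x. \<Sum>w\<in>F. a w *\<^sub>R w x) \<le> (\<Sum>w\<in>F. \<bar>a w\<bar> * nV w)" by auto
    show ?case
      using V_add[OF V_scale[OF w, of "a w"] i(1)] nV_triangle[OF V_scale[OF w, of "a w"] i(1)] i(2) insert.hyps
      by (simp add: nV_scale[OF w])
  qed
  then show "(\<lambda>x. \<Sum>w\<in>F. a w *\<^sub>R w x) \<in> V" "nV (\<lambda>x. \<Sum>w\<in>F. a w *\<^sub>R w x) \<le> (\<Sum>w\<in>F. \<bar>a w\<bar> * nV w)" by auto
qed

subsection \<open>Measurability\<close>

abbreviation "level k w \<equiv> {t\<in>{0..1}. s k t = w}"

lemma level_measurable: "(\<lambda>t. indicator (level k w) t :: real) \<in> borel_measurable (lebesgue_on {0..1})"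
  by (intro measurable_restrict_space1 borel_measurable_indicator s(3))

text \<open>A quantity depending on a simple function is a finite combination of indicators; measurability
  in time, and jointly in space and time, is obtained from this.\<close>

lemma simple_sum:
  fixes h :: "(real ^ 'n \<Rightarrow> real ^ 'n) \<Rightarrow> real"
  assumes t: "t \<in> {0..1}"
  shows "h (s k t) = (\<Sum>w\<in>s k ` {0..1}. h w * indicator (level k w) t)"
proof -
  have "(\<Sum>w\<in>s k ` {0..1}. h w * indicator (level k w) t) = (\<Sum>w\<in>s k ` {0..1}. if w = s k t then h w else 0)"
    using t by (intro sum.cong) auto
  then show ?thesis using t s(1)[of k] by (simp add: sum.delta)
qed

lemma simple_measurable:
  fixes h :: "real \<Rightarrow> (real ^ 'n \<Rightarrow> real ^ 'n) \<Rightarrow> real"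
  assumes "\<And>w. w \<in> V \<Longrightarrow> (\<lambda>t. h t w) \<in> borel_measurable (lebesgue_on {0..1})"
  shows "(\<lambda>t. h t (s k t)) \<in> borel_measurable (lebesgue_on {0..1})"
proof -
  have "(\<lambda>t. \<Sum>w\<in>s k ` {0..1}. h t w * indicator (level k w) t) \<in> borel_measurable (lebesgue_on {0..1})"
    using s(2) by (intro borel_measurable_sum borel_measurable_times assms level_measurable) auto
  then show ?thesis
    by (rule measurable_cong[THEN iffD2, rotated]) (simp add: simple_sum[of _ "h _"])
qed

lemma simple_spacetime_measurable:
  fixes h :: "(real ^ 'n \<Rightarrow> real ^ 'n) \<Rightarrow> real ^ 'n \<Rightarrow> real"
  assumes "\<And>w. w \<in> V \<Longrightarrow> h w \<in> borel_measurable (lebesgue_on space_dom)"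
  shows "(\<lambda>z. h (s k (snd z)) (fst z)) \<in> borel_measurable (lebesgue_on spacetime_dom)"
proof -
  have "(\<lambda>z. \<Sum>w\<in>s k ` {0..1}. h w (fst z) * indicator (level k w) (snd z)) \<in>
      borel_measurable (lebesgue_on (space_dom \<times> {0..1}))"
    using s(2)
    by (intro borel_measurable_sum borel_measurable_times
        lebesgue_on_measurable_fst[OF _ _ assms] lebesgue_on_measurable_snd[OF _ _ level_measurable]) auto
  then show ?thesis unfolding spacetime_dom_def
    by (rule measurable_cong[THEN iffD2, rotated])
      (auto simp: simple_sum[where h = "\<lambda>w. h w _"] space_restrict_space)
qed

lemma nV_difference_measurable:
  assumes w: "w \<in> V"
  shows "(\<lambda>t. nV (\<lambda>x. u t x - w x)) \<in> borel_measurable (lebesgue_on {0..1})"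
proof (rule lebesgue_on_measurable_AE)
  show "(\<lambda>t. lim (\<lambda>k. nV (\<lambda>x. s k t x - w x))) \<in> borel_measurable (lebesgue_on {0..1})"
    by (intro borel_measurable_lim_metric simple_measurable[of "\<lambda>t v. nV (\<lambda>x. v x - w x)"]) simp
  show "AE t in lebesgue_on {0..1}. nV (\<lambda>x. u t x - w x) = lim (\<lambda>k. nV (\<lambda>x. s k t x - w x))"
    using s_lim AE_space
  proof eventually_elim
    case (elim t)
    then have t: "t \<in> {0..1}" by simp
    have "(\<lambda>k. nV (\<lambda>x. s k t x - w x) - nV (\<lambda>x. u t x - w x)) \<longlonglongrightarrow> 0"
      by (rule tendsto_rabs_zero_cancel, rule tendsto_sandwich[OF _ _ tendsto_const elim(1)])
        (auto intro!: always_eventually nV_reverse_triangle s(2) u w t)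
    then have "(\<lambda>k. nV (\<lambda>x. s k t x - w x)) \<longlonglongrightarrow> nV (\<lambda>x. u t x - w x)" by (simp add: LIM_zero_iff)
    then show ?case by (simp add: limI)
  qed
qed simp

lemma nV_measurable: "(\<lambda>t. nV (u t)) \<in> borel_measurable (lebesgue_on {0..1})"
  using nV_difference_measurable[OF V_0] by simp

lemma nV_L2: "L2 {0..1} (\<lambda>t. nV (u t))"
  using nV_measurable u_L2 by (simp add: L2_def)

lemma error_measurable: "(\<lambda>t. nV (\<lambda>x. s k t x - u t x)) \<in> borel_measurable (lebesgue_on {0..1})"
proof -
  have "(\<lambda>t. nV (\<lambda>x. u t x - s k t x)) \<in> borel_measurable (lebesgue_on {0..1})"
    by (rule simple_measurable[of "\<lambda>t w. nV (\<lambda>x. u t x - w x)", OF nV_difference_measurable])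
  then show ?thesis
    by (rule measurable_cong[THEN iffD2, rotated]) (auto intro!: nV_commute s(2) u)
qed

lemma velocity_measurable: "(\<lambda>z. u (snd z) (fst z) $ i) \<in> borel_measurable (lebesgue_on spacetime_dom)"
proof (rule lebesgue_on_measurable_AE)
  have "(\<lambda>x. w x $ i) \<in> borel_measurable (lebesgue_on space_dom)" if "w \<in> V" for w
    by (rule continuous_imp_measurable_on_sets_lebesgue)
      (auto intro!: continuous_intros lipschitz_on_continuous_on[OF lip[OF that]])
  then show "(\<lambda>z. lim (\<lambda>k. s k (snd z) (fst z) $ i)) \<in> borel_measurable (lebesgue_on spacetime_dom)"
    by (intro borel_measurable_lim_metric simple_spacetime_measurable[of "\<lambda>w x. w x $ i"])
  show "AE z in lebesgue_on spacetime_dom. u (snd z) (fst z) $ i = lim (\<lambda>k. s k (snd z) (fst z) $ i)"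
    using AE_spacetime_snd[OF s_lim] AE_space
  proof eventually_elim
    case (elim z)
    then have z: "snd z \<in> {0..1}" "fst z \<in> space_dom" by (auto simp: spacetime_dom_def)
    have "(\<lambda>k. K * nV (\<lambda>x. s k (snd z) x - u (snd z) x)) \<longlonglongrightarrow> K * 0" by (intro tendsto_intros elim(1))
    then have l: "(\<lambda>k. K * nV (\<lambda>x. s k (snd z) x - u (snd z) x)) \<longlonglongrightarrow> 0" by simp
    have "\<bar>s k (snd z) (fst z) $ i - u (snd z) (fst z) $ i\<bar> \<le> K * nV (\<lambda>x. s k (snd z) x - u (snd z) x)" for k
      using sup_bound[OF V_diff[OF s(2)[OF z(1), of k] u[OF z(1)]] z(2)]
        component_le_norm_cart[of "s k (snd z) (fst z) - u (snd z) (fst z)" i] by simp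
    then have "(\<lambda>k. s k (snd z) (fst z) $ i - u (snd z) (fst z) $ i) \<longlonglongrightarrow> 0"
      by (intro tendsto_rabs_zero_cancel[OF tendsto_sandwich[OF _ _ tendsto_const l]] always_eventually) auto
    then have "(\<lambda>k. s k (snd z) (fst z) $ i) \<longlonglongrightarrow> u (snd z) (fst z) $ i" by (simp add: LIM_zero_iff)
    then show ?case by (simp add: limI)
  qed
qed simp

text \<open>The divergences of the fields \<open>u t\<close> are only determined up to null sets for each \<open>t\<close>; a jointly
  measurable choice is the pointwise limit along the simple functions, which exists almost
  everywhere.\<close>

definition divergence :: "(real ^ 'n) \<times> real \<Rightarrow> real" where
  "divergence z = lim (\<lambda>k. D (s k (snd z)) (fst z))"

lemma divergence_measurable: "divergence \<in> borel_measurable (lebesgue_on spacetime_dom)"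
proof -
  have "D w \<in> borel_measurable (lebesgue_on space_dom)" if "w \<in> V" for w
    using D[OF that] unfolding weak_div_def by auto
  then show ?thesis unfolding divergence_def[abs_def]
    by (intro borel_measurable_lim_metric simple_spacetime_measurable)
qed

lemma D_difference:
  assumes "v \<in> V" "w \<in> V"
  shows "AE x in lebesgue_on space_dom. \<bar>D v x - D w x\<bar> \<le> K * nV (\<lambda>x. v x - w x)"
  using weak_div_unique[OF weak_div_diff[OF D[OF assms(1)] D[OF assms(2)]] D[OF V_diff[OF assms]]]
    D_bound[OF V_diff[OF assms]]
  by eventually_elim simp

lemma divergence_eq:
  "AE t in lebesgue_on {0..1}. AE x in lebesgue_on space_dom. divergence (x, t) = D (u t) x"
  using s_lim AE_space
proof eventually_elim
  case (elim t)
  then have t: "t \<in> {0..1}" by simp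
  have "AE x in lebesgue_on space_dom. \<forall>k. \<bar>D (s k t) x - D (u t) x\<bar> \<le> K * nV (\<lambda>x. s k t x - u t x)"
    unfolding AE_all_countable using D_difference[OF s(2)[OF t] u[OF t]] by blast
  then show ?case
  proof eventually_elim
    case (elim x)
    have "(\<lambda>k. K * nV (\<lambda>x. s k t x - u t x)) \<longlonglongrightarrow> K * 0" by (intro tendsto_intros \<open>(\<lambda>k. nV (\<lambda>x. s k t x - u t x)) \<longlonglongrightarrow> 0\<close>)
    then have l: "(\<lambda>k. K * nV (\<lambda>x. s k t x - u t x)) \<longlonglongrightarrow> 0" by simp
    have "(\<lambda>k. D (s k t) x - D (u t) x) \<longlonglongrightarrow> 0"
      by (intro tendsto_rabs_zero_cancel[OF tendsto_sandwich[OF _ _ tendsto_const l]] always_eventually)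
        (use elim in auto)
    then have "(\<lambda>k. D (s k t) x) \<longlonglongrightarrow> D (u t) x" by (simp add: LIM_zero_iff)
    then show ?case by (simp add: divergence_def limI)
  qed
qed

lemma divergence_weak_div: "AE t in lebesgue_on {0..1}. weak_div per (u t) (\<lambda>x. divergence (x, t))"
  using divergence_eq AE_space
proof eventually_elim
  case (elim t)
  then show ?case by (intro weak_div_cong_AE[OF D[OF u]]) auto
qed

lemma divergence_bound:
  "AE t in lebesgue_on {0..1}. AE x in lebesgue_on space_dom. \<bar>divergence (x, t)\<bar> \<le> K * nV (u t)"
  using divergence_eq AE_space
proof eventually_elim
  case (elim t)
  then have "t \<in> {0..1}" by simp
  from elim(1) D_bound[OF u[OF this]] show ?case by eventually_elim simp
qed

lemma by_parts:
  "AE t in lebesgue_on {0..1}. \<forall>G. cont_diff G \<longrightarrow> (per \<longrightarrow> periodic_fun G) \<longrightarrow>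
     (LINT x|lebesgue_on space_dom. frechet_derivative G (at x) (u t x)) =
     - (LINT x|lebesgue_on space_dom. divergence (x, t) * G x)"
  using divergence_weak_div AE_space
proof eventually_elim
  case (elim t)
  then have t: "t \<in> {0..1}" by simp
  show ?case
  proof (intro allI impI)
    fix G :: "real ^ 'n \<Rightarrow> real" assume G: "cont_diff G" "per \<longrightarrow> periodic_fun G"
    show "(LINT x|lebesgue_on space_dom. frechet_derivative G (at x) (u t x)) =
        - (LINT x|lebesgue_on space_dom. divergence (x, t) * G x)"
    proof (cases per)
      case True
      then have "test_fun per G" using G by (simp add: test_fun_def C1_iff_cont_diff)
      then show ?thesis using elim(1) unfolding weak_div_def by blast
    next
      case False
      then show ?thesis using H10_by_parts[OF u_H10[OF False t] _ G(1)] elim(1) by simp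
    qed
  qed
qed

subsection \<open>Approximation by velocities that are constant on short time intervals\<close>

text \<open>The velocity is first approximated by a simple function \<open>s k\<close>, set to zero where it is further from
  \<open>u\<close> than \<open>1 + nV (u t)\<close>, so that the errors are dominated by \<open>1 + nV (u t)\<close>.  Then the indicators of
  its level sets are replaced by continuous functions.  The result \<open>c\<close> is a continuous curve in \<open>V\<close>, and
  \<open>q\<close> bounds its distance to \<open>u\<close> in norm.\<close>

lemma continuous_time_approximation:
  assumes e: "e > 0"
  shows "\<exists>c q B. (\<forall>t. c t \<in> V \<and> nV (c t) \<le> B) \<and> L2 {0..1} q \<and> l2_norm {0..1} q \<le> e \<and>
    (\<forall>t\<in>{0..1}. 0 \<le> q t \<and> nV (\<lambda>x. u t x - c t x) \<le> q t) \<and>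
    (\<forall>\<eta>>0. \<exists>\<delta>>0. \<forall>t\<in>{0..1}. \<forall>t'\<in>{0..1}. \<bar>t' - t\<bar> < \<delta> \<longrightarrow> nV (\<lambda>x. c t x - c t' x) \<le> \<eta>)"
proof -
  define good where "good k t \<longleftrightarrow> nV (\<lambda>x. s k t x - u t x) \<le> 1 + nV (u t)" for k t
  define r where "r k t = (if good k t then nV (\<lambda>x. s k t x - u t x) else nV (u t))" for k t
  have good_sets: "{t \<in> space (lebesgue_on {0..1}). good k t} \<in> sets (lebesgue_on {0..1})" for k
    unfolding good_def
    by (intro borel_measurable_le error_measurable borel_measurable_add nV_measurable borel_measurable_const)
  have r_meas: "r k \<in> borel_measurable (lebesgue_on {0..1})" for k
    unfolding r_def[abs_def]
    by (rule measurable_If[OF error_measurable nV_measurable good_sets])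
  have b: "L2 {0..1} (\<lambda>t. 1 + nV (u t))" by (rule L2_add[OF l2_norm_const(1) nV_L2])
  have r0: "0 \<le> r k t" "r k t \<le> 1 + nV (u t)" if "t \<in> {0..1}" for k t
    using nV_nonneg[OF V_diff[OF s(2)[OF that, of k] u[OF that]]] nV_nonneg[OF u[OF that]]
    by (auto simp: r_def good_def)
  have r_le: "AE t in lebesgue_on {0..1}. \<bar>r k t\<bar> \<le> \<bar>1 + nV (u t)\<bar>" for k
    using AE_space
  proof eventually_elim
    case (elim t)
    then have t: "t \<in> {0..1}" by simp
    show ?case using r0[OF t, of k] by linarith
  qed
  have r_lim: "AE t in lebesgue_on {0..1}. (\<lambda>k. r k t) \<longlonglongrightarrow> 0"
    using s_lim AE_space
  proof eventually_elim
    case (elim t)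
    then have t: "t \<in> {0..1}" by simp
    have "eventually (\<lambda>k. nV (\<lambda>x. s k t x - u t x) < 1) sequentially"
      using elim(1) by (rule order_tendstoD) simp
    then have "eventually (\<lambda>k. nV (\<lambda>x. s k t x - u t x) = r k t) sequentially"
      by eventually_elim (use nV_nonneg[OF u[OF t]] in \<open>auto simp: r_def good_def\<close>)
    then show ?case by (rule Lim_transform_eventually[OF elim(1)])
  qed
  have "(\<lambda>k. l2_norm {0..1} (r k)) \<longlonglongrightarrow> 0"
    by (rule l2_dominated_convergence[OF r_meas b r_le r_lim])
  then have "eventually (\<lambda>k. l2_norm {0..1} (r k) < e / 2) sequentially"
    using e by (intro order_tendstoD) auto
  then obtain k where k: "l2_norm {0..1} (r k) < e / 2" by (auto simp: eventually_sequentially)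
  have rL2: "L2 {0..1} (r k)" by (rule L2_dominated[OF r_meas b r_le])
  define F where "F = s k ` {0..1}"
  have F: "finite F" "F \<subseteq> V" using s by (auto simp: F_def)
  define A where "A w = level k w \<inter> {t \<in> space (lebesgue_on {0..1}). good k t}" for w
  have A: "A w \<in> sets lebesgue" for w
  proof -
    have "{t \<in> space (lebesgue_on {0..1}). good k t} \<in> sets lebesgue"
      using good_sets[of k] by (subst (asm) sets_restrict_space_iff) auto
    then show ?thesis unfolding A_def using s(3)[of k w] by (intro sets.Int)
  qed
  define S where "S = (\<Sum>w\<in>F. nV w)"
  have S: "0 \<le> S" unfolding S_def using F nV_nonneg by (auto intro!: sum_nonneg)
  \<comment> \<open>\<open>1 + S\<close> because \<open>S\<close> may vanish\<close>
  define e' where "e' = e / (2 * (1 + S))"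
  have e': "e' > 0" "S * e' \<le> e / 2" using e S by (auto simp: e'_def field_simps)
  have "\<forall>w. \<exists>\<theta>. continuous_on UNIV \<theta> \<and> (\<forall>t. 0 \<le> \<theta> t \<and> \<theta> t \<le> 1) \<and>
    L2 {0..1} (\<lambda>t. indicator (A w) t - \<theta> t) \<and> l2_norm {0..1} (\<lambda>t. indicator (A w) t - \<theta> t) \<le> e'"
    by (intro allI indicator_continuous_approximation A e')
  from choice[OF this] obtain \<theta> where \<theta>: "\<And>w. continuous_on UNIV (\<theta> w)" "\<And>w t. 0 \<le> \<theta> w t" "\<And>w t. \<theta> w t \<le> 1"
    "\<And>w. L2 {0..1} (\<lambda>t. indicator (A w) t - \<theta> w t)" "\<And>w. l2_norm {0..1} (\<lambda>t. indicator (A w) t - \<theta> w t) \<le> e'" by blast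
  define c where "c t x = (\<Sum>w\<in>F. \<theta> w t *\<^sub>R w x)" for t x
  define p where "p w t = nV w * \<bar>indicator (A w) t - \<theta> w t\<bar>" for w t
  define q where "q t = r k t + (\<Sum>w\<in>F. p w t)" for t
  have cV: "c t \<in> V" "nV (c t) \<le> S" for t
  proof -
    show "c t \<in> V" unfolding c_def[abs_def] by (rule V_sum[OF F])
    have "nV (c t) \<le> (\<Sum>w\<in>F. \<bar>\<theta> w t\<bar> * nV w)" unfolding c_def[abs_def] by (rule V_sum[OF F])
    also have "\<dots> \<le> S"
      unfolding S_def using F \<theta>(2,3) nV_nonneg by (intro sum_mono mult_left_le_one_le) (auto simp: abs_le_iff intro: order_trans[of _ 0])
    finally show "nV (c t) \<le> S" .
  qed
  have pL2: "L2 {0..1} (p w)" "l2_norm {0..1} (p w) \<le> nV w * e'" if "w \<in> F" for w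
  proof -
    have m: "(\<lambda>t. \<bar>indicator (A w) t - \<theta> w t\<bar>) \<in> borel_measurable (lebesgue_on {0..1})"
      using \<theta>(4)[of w] unfolding L2_def by (intro borel_measurable_abs) simp
    have L: "L2 {0..1} (\<lambda>t. \<bar>indicator (A w) t - \<theta> w t\<bar>)"
      by (rule L2_dominated[OF m \<theta>(4)[of w]]) simp
    have n: "l2_norm {0..1} (\<lambda>t. \<bar>indicator (A w) t - \<theta> w t\<bar>) \<le> e'"
      using l2_norm_dominated[OF m \<theta>(4)[of w]] \<theta>(5)[of w] by simp
    show "L2 {0..1} (p w)" unfolding p_def[abs_def] by (rule L2_scale[OF L])
    have "0 \<le> nV w" using F that nV_nonneg by auto
    then show "l2_norm {0..1} (p w) \<le> nV w * e'"
      unfolding p_def[abs_def] l2_norm_scale using n by (simp add: mult_left_mono)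
  qed
  have sL2: "L2 {0..1} (\<lambda>t. \<Sum>w\<in>F. p w t)" by (rule L2_sum(1)[OF F(1) pL2(1)])
  have qL2: "L2 {0..1} q" unfolding q_def[abs_def] by (rule L2_add[OF rL2 sL2])
  have "l2_norm {0..1} q \<le> l2_norm {0..1} (r k) + l2_norm {0..1} (\<lambda>t. \<Sum>w\<in>F. p w t)"
    unfolding q_def[abs_def] by (rule l2_norm_triangle[OF rL2 sL2])
  also have "l2_norm {0..1} (\<lambda>t. \<Sum>w\<in>F. p w t) \<le> (\<Sum>w\<in>F. l2_norm {0..1} (p w))"
    by (rule L2_sum(2)[OF F(1) pL2(1)])
  also have "\<dots> \<le> (\<Sum>w\<in>F. nV w * e')" by (intro sum_mono pL2)
  also have "\<dots> = S * e'" by (simp add: S_def sum_distrib_right)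
  finally have q_le: "l2_norm {0..1} q \<le> e" using k e'(2) by simp
  have p0: "0 \<le> p w t" if "w \<in> F" for w t unfolding p_def using F that nV_nonneg by auto
  have close: "nV (\<lambda>x. u t x - c t x) \<le> q t" if t: "t \<in> {0..1}" for t
  proof -
    let ?a = "\<lambda>w. indicator (A w) t :: real"
    define c0 where "c0 x = (\<Sum>w\<in>F. ?a w *\<^sub>R w x)" for x
    have c0V: "c0 \<in> V" unfolding c0_def[abs_def] by (rule V_sum[OF F])
    have "c0 = (if good k t then s k t else (\<lambda>x. 0))"
    proof
      fix x
      have "c0 x = (\<Sum>w\<in>F. if w = s k t then (if good k t then w x else 0) else 0)"
        unfolding c0_def using t by (intro sum.cong) (auto simp: A_def)
      then show "c0 x = (if good k t then s k t else (\<lambda>x. 0)) x"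
        using F t by (simp add: sum.delta F_def)
    qed
    then have "nV (\<lambda>x. u t x - c0 x) = r k t"
      using nV_commute[OF u[OF t] s(2)[OF t]] by (simp add: r_def)
    moreover have "nV (\<lambda>x. c0 x - c t x) \<le> (\<Sum>w\<in>F. p w t)"
    proof -
      have "(\<lambda>x. c0 x - c t x) = (\<lambda>x. \<Sum>w\<in>F. (?a w - \<theta> w t) *\<^sub>R w x)"
        by (simp add: c0_def c_def sum_subtractf scaleR_diff_left)
      then show ?thesis using V_sum(2)[OF F, of "\<lambda>w. ?a w - \<theta> w t"] by (simp add: p_def mult.commute)
    qed
    ultimately show ?thesis
      using nV_triangle_diff[OF u[OF t] c0V cV(1)[of t]] by (simp add: q_def)
  qed
  have q0: "0 \<le> q t" if "t \<in> {0..1}" for t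
    unfolding q_def using r0[OF that] p0 by (intro add_nonneg_nonneg sum_nonneg) auto
  have unif: "\<exists>\<delta>>0. \<forall>t\<in>{0..1}. \<forall>t'\<in>{0..1}. \<bar>t' - t\<bar> < \<delta> \<longrightarrow> nV (\<lambda>x. c t x - c t' x) \<le> \<eta>" if \<eta>: "\<eta> > 0" for \<eta>
  proof -
    \<comment> \<open>a single continuous function vanishing on the diagonal controls all \<open>w\<close> at once\<close>
    define \<Phi> where "\<Phi> z = (\<Sum>w\<in>F. \<bar>\<theta> w (fst z) - \<theta> w (snd z)\<bar> * nV w)" for z
    have "continuous_on ({0..1} \<times> {0..1}) \<Phi>"
      unfolding \<Phi>_def[abs_def] by (intro continuous_intros continuous_on_compose2[OF \<theta>(1)]) auto
    then have "uniformly_continuous_on ({0..1} \<times> {0..1}) \<Phi>"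
      by (intro compact_uniformly_continuous compact_Times) auto
    then obtain \<delta> where \<delta>: "\<delta> > 0" "\<forall>z\<in>{0..1} \<times> {0..1}. \<forall>z'\<in>{0..1} \<times> {0..1}. dist z' z < \<delta> \<longrightarrow> dist (\<Phi> z') (\<Phi> z) < \<eta>"
      using \<eta> unfolding uniformly_continuous_on_def by meson
    have "nV (\<lambda>x. c t x - c t' x) \<le> \<eta>" if "t \<in> {0..1}" "t' \<in> {0..1}" "\<bar>t' - t\<bar> < \<delta>" for t t'
    proof -
      have "(\<lambda>x. c t x - c t' x) = (\<lambda>x. \<Sum>w\<in>F. (\<theta> w t - \<theta> w t') *\<^sub>R w x)"
        by (simp add: c_def sum_subtractf scaleR_diff_left)
      then have "nV (\<lambda>x. c t x - c t' x) \<le> \<Phi> (t, t')"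
        using V_sum(2)[OF F, of "\<lambda>w. \<theta> w t - \<theta> w t'"] by (simp add: \<Phi>_def)
      moreover have "dist (\<Phi> (t, t')) (\<Phi> (t, t)) < \<eta>"
        using \<delta>(2) that by (auto simp: dist_Pair_Pair dist_real_def)
      moreover have "\<Phi> (t, t) = 0" by (simp add: \<Phi>_def)
      ultimately show ?thesis by (simp add: dist_real_def)
    qed
    then show ?thesis using \<delta>(1) by blast
  qed
  show ?thesis
    by (rule exI[of _ c], rule exI[of _ q], rule exI[of _ S])
      (use cV qL2 q_le q0 close unif in blast)
qed

text \<open>The factor \<open>CARD('n)\<close> is lost when a field is extended from the cube to the whole space.\<close>

definition "L \<equiv> real CARD('n) * K"

lemma L_ge: "K \<le> L" "0 \<le> L"
proof -
  show "K \<le> L" unfolding L_def using K mult_right_mono[of 1 "real CARD('n)" K] by (simp add: Suc_leI)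
  then show "0 \<le> L" using K by simp
qed

lemma m_L2: "L2 {0..1} (\<lambda>t. L * nV (u t))" by (rule L2_scale[OF nV_L2])

lemma sum_le_integral_of_slabs:
  assumes N: "N > 0" and h: "integrable (lebesgue_on {0..1}) h" "\<And>t. t \<in> {0..1} \<Longrightarrow> 0 \<le> h t"
    and le: "\<And>j t. j < N \<Longrightarrow> t \<in> {real j / real N .. real (Suc j) / real N} \<Longrightarrow> l j \<le> h t"
  shows "(\<Sum>j<N. l j / real N) \<le> (LINT t|lebesgue_on {0..1}. h t)"
proof -
  have h1: "h integrable_on {0..1}" by (rule integrable_on_lebesgue_on[OF h(1)]) simp
  have sub: "h integrable_on {a..b}" if "0 \<le> a" "b \<le> 1" for a b
    by (rule integrable_on_subinterval[OF h1]) (use that in auto)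
  have "n \<le> N \<Longrightarrow> (\<Sum>j<n. l j / real N) \<le> integral {0..real n / real N} h" for n
  proof (induction n)
    case (Suc n)
    let ?a = "real n / real N" and ?b = "real (Suc n) / real N"
    have ab: "0 \<le> ?a" "?a \<le> ?b" "?b \<le> 1" using Suc.prems N by (auto simp: divide_simps)
    have "l n / real N = integral {?a..?b} (\<lambda>t. l n)"
      using ab N by (simp add: field_simps)
    also have "\<dots> \<le> integral {?a..?b} h"
      by (intro integral_le integrable_on_const sub ab le) (use Suc.prems in auto)
    finally show ?case
      using Suc Henstock_Kurzweil_Integration.integral_combine[OF ab(1,2) sub[OF order_refl ab(3)]] by simp
  qed simp
  from this[of N] show ?thesis using N lebesgue_integral_eq_integral[OF h(1)] by simp
qed

text \<open>Freeze the continuous curve at the left end of each slab and smooth the resulting fields.  On slab \<open>j\<close>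
  the Lipschitz constant \<open>l j\<close> exceeds \<open>L * nV (u t)\<close> only by errors that are small in \<open>L\<^sup>2\<close>, so
  the average of the \<open>l j\<close> is bounded by the norm of \<open>u\<close> plus one.\<close>

lemma piecewise_constant_approximation:
  assumes \<epsilon>: "\<epsilon> > 0"
  shows "\<exists>N>0. \<exists>v l r.
    (\<forall>j. cont_diff (v j) \<and> (l j)-lipschitz_on UNIV (v j) \<and> (per \<longrightarrow> periodic_fun (v j)) \<and>
       (\<forall>x\<in>space_dom. norm (v j x) \<le> l j) \<and> l j \<le> \<epsilon> * real N) \<and>
    (\<Sum>j<N. l j / real N) \<le> l2_norm {0..1} (\<lambda>t. L * nV (u t)) + 1 \<and>
    L2 {0..1} r \<and> l2_norm {0..1} r \<le> \<epsilon> \<and> (\<forall>t\<in>{0..1}. 0 \<le> r t) \<and>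
    (\<forall>j<N. \<forall>t\<in>{real j / real N ..< real (Suc j) / real N}. \<forall>x\<in>space_dom. norm (u t x - v j x) \<le> r t)"
proof -
  define \<epsilon>1 where "\<epsilon>1 = min \<epsilon> 1"
  have \<epsilon>1: "0 < \<epsilon>1" "\<epsilon>1 \<le> \<epsilon>" "\<epsilon>1 \<le> 1" using \<epsilon> by (auto simp: \<epsilon>1_def)
  define \<eta> where "\<eta> = (\<epsilon>1 / 4) / (L + 1)"
  have \<eta>: "\<eta> > 0" using \<epsilon>1 L_ge by (simp add: \<eta>_def)
  have L\<eta>: "L * \<eta> + \<eta> = \<epsilon>1 / 4"
  proof -
    have L1: "L + 1 \<noteq> 0" using L_ge(2) by linarith
    have "\<eta> * (L + 1) = \<epsilon>1 / 4"
      using nonzero_eq_divide_eq[OF L1, of \<eta> "\<epsilon>1 / 4"] \<eta>_def by blast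
    then show ?thesis by (simp add: algebra_simps)
  qed
  obtain c q B where "\<forall>t. c t \<in> V \<and> nV (c t) \<le> B" and q: "L2 {0..1} q" "l2_norm {0..1} q \<le> \<eta>"
    and "\<forall>t\<in>{0..1}. 0 \<le> q t \<and> nV (\<lambda>x. u t x - c t x) \<le> q t"
    and unif: "\<forall>\<eta>>0. \<exists>\<delta>>0. \<forall>t\<in>{0..1}. \<forall>t'\<in>{0..1}. \<bar>t' - t\<bar> < \<delta> \<longrightarrow> nV (\<lambda>x. c t x - c t' x) \<le> \<eta>"
    using continuous_time_approximation[OF \<eta>] by (elim exE conjE) (rule that; assumption)
  then have c: "\<And>t. c t \<in> V" "\<And>t. nV (c t) \<le> B" and q0: "\<And>t. t \<in> {0..1} \<Longrightarrow> 0 \<le> q t"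
    and uc: "\<And>t. t \<in> {0..1} \<Longrightarrow> nV (\<lambda>x. u t x - c t x) \<le> q t" by auto
  obtain \<delta> where \<delta>: "\<delta> > 0" and c\<delta>: "\<And>t t'. t \<in> {0..1} \<Longrightarrow> t' \<in> {0..1} \<Longrightarrow> \<bar>t' - t\<bar> < \<delta> \<Longrightarrow> nV (\<lambda>x. c t x - c t' x) \<le> \<eta>"
    using unif[rule_format, OF \<eta>] by (elim exE conjE) (rule that; blast)
  obtain N :: nat where N: "real N > 1 / \<delta> + (L * \<bar>B\<bar> + \<eta>) / \<epsilon>" using reals_Archimedean2 by blast
  have "0 \<le> (L * \<bar>B\<bar> + \<eta>) / \<epsilon>" "0 < 1 / \<delta>" using L_ge \<eta> \<epsilon> \<delta> by auto
  then have N1: "real N > 1 / \<delta>" "real N > (L * \<bar>B\<bar> + \<eta>) / \<epsilon>" "real N > 0" using N by linarith+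
  have N\<delta>: "1 / real N < \<delta>" using N1 \<delta> by (simp add: field_simps)
  have NB: "L * \<bar>B\<bar> + \<eta> \<le> \<epsilon> * real N" using N1 \<epsilon> by (simp add: field_simps)
  have Npos: "N > 0" using N1 by simp
  define cj where "cj j = c (real j / real N)" for j
  define l where "l j = L * nV (cj j) + \<eta>" for j
  have cj: "cj j \<in> V" "nV (cj j) \<le> \<bar>B\<bar>" "0 \<le> nV (cj j)" for j
    unfolding cj_def using c[of "real j / real N"] nV_nonneg by (auto intro: order_trans[OF _ abs_ge_self])
  have "\<forall>j. \<exists>w. cont_diff w \<and> (real CARD('n) * (K * nV (cj j)))-lipschitz_on UNIV w \<and> (per \<longrightarrow> periodic_fun w) \<and>
      (\<forall>x\<in>space_dom. norm (w x - cj j x) \<le> \<eta>)"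
    by (intro allI smooth_velocity_approximation lip cj V_periodic \<eta>)
  from choice[OF this] obtain v where v: "\<And>j. cont_diff (v j)"
    "\<And>j. (real CARD('n) * (K * nV (cj j)))-lipschitz_on UNIV (v j)" "\<And>j. per \<Longrightarrow> periodic_fun (v j)"
    "\<And>j x. x \<in> space_dom \<Longrightarrow> norm (v j x - cj j x) \<le> \<eta>" by blast
  define r where "r t = K * q t + (K * \<eta> + \<eta>)" for t
  have slab: "nV (\<lambda>x. u t x - cj j x) \<le> q t + \<eta>" "t \<in> {0..1}"
    if "j < N" "t \<in> {real j / real N .. real (Suc j) / real N}" for j t
  proof -
    have tj: "real j / real N \<in> {0..1}" "real (Suc j) / real N \<le> 1" using that Npos by (auto simp: field_simps)
    have jt: "real j / real N \<le> t \<and> t \<le> real (Suc j) / real N" using that(2) by (simp only: atLeastAtMost_iff)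
    with tj show t: "t \<in> {0..1}" unfolding atLeastAtMost_iff by linarith
    have "real (Suc j) / real N = real j / real N + 1 / real N" by (simp add: add_divide_distrib)
    then have "\<bar>real j / real N - t\<bar> < \<delta>" using jt N\<delta> by linarith
    then have "nV (\<lambda>x. c t x - cj j x) \<le> \<eta>" unfolding cj_def by (rule c\<delta>[OF t tj(1)])
    then show "nV (\<lambda>x. u t x - cj j x) \<le> q t + \<eta>"
      using nV_triangle_diff[OF u[OF t] c(1)[of t] cj(1)[of j]] uc[OF t] by linarith
  qed
  have r0: "0 \<le> r t" if "t \<in> {0..1}" for t using q0[OF that] K \<eta> by (simp add: r_def)
  have Lq: "L2 {0..1} (\<lambda>t. k * q t + d)" "l2_norm {0..1} (\<lambda>t. k * q t + d) \<le> k * \<eta> + d" if "0 \<le> k" "0 \<le> d" for k d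
  proof -
    show "L2 {0..1} (\<lambda>t. k * q t + d)" by (rule L2_add[OF L2_scale[OF q(1)] l2_norm_const(1)])
    have "l2_norm {0..1} (\<lambda>t. k * q t + d) \<le> l2_norm {0..1} (\<lambda>t. k * q t) + l2_norm {0..1} (\<lambda>t::real. d)"
      by (rule l2_norm_triangle[OF L2_scale[OF q(1)] l2_norm_const(1)])
    also have "\<dots> \<le> k * \<eta> + d"
      using that mult_left_mono[OF q(2) that(1)] by (simp add: l2_norm_scale l2_norm_const)
    finally show "l2_norm {0..1} (\<lambda>t. k * q t + d) \<le> k * \<eta> + d" .
  qed
  have K\<eta>: "K * \<eta> \<le> L * \<eta>" using L_ge \<eta> by (intro mult_right_mono) auto
  have rL2: "L2 {0..1} r" unfolding r_def[abs_def] by (rule Lq) (use K \<eta> in auto)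
  have r_le: "l2_norm {0..1} r \<le> \<epsilon>"
  proof -
    have "l2_norm {0..1} r \<le> K * \<eta> + (K * \<eta> + \<eta>)" unfolding r_def[abs_def] by (rule Lq) (use K \<eta> in auto)
    then show ?thesis using K\<eta> L\<eta> \<epsilon>1 \<eta> by linarith
  qed
  have close: "norm (u t x - v j x) \<le> r t"
    if "j < N" "t \<in> {real j / real N ..< real (Suc j) / real N}" "x \<in> space_dom" for j t x
  proof -
    have t: "nV (\<lambda>x. u t x - cj j x) \<le> q t + \<eta>" "t \<in> {0..1}" using slab[of j t] that by auto
    have "norm (u t x - cj j x) \<le> K * nV (\<lambda>x. u t x - cj j x)"
      by (rule sup_bound[OF V_diff[OF u[OF t(2)] cj(1)] that(3)])
    also have "\<dots> \<le> K * (q t + \<eta>)" by (rule mult_left_mono[OF t(1) K])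
    finally show ?thesis
      using v(4)[OF that(3), of j] norm_triangle_ineq[of "u t x - cj j x" "cj j x - v j x"]
      by (simp add: r_def norm_minus_commute algebra_simps)
  qed
  define h where "h t = L * nV (u t) + (L * q t + (L * \<eta> + \<eta>))" for t
  have Lqt: "L2 {0..1} (\<lambda>t. L * q t + (L * \<eta> + \<eta>))" "l2_norm {0..1} (\<lambda>t. L * q t + (L * \<eta> + \<eta>)) \<le> L * \<eta> + (L * \<eta> + \<eta>)"
    using Lq[of L "L * \<eta> + \<eta>"] L_ge \<eta> by auto
  have hL2: "L2 {0..1} h" unfolding h_def[abs_def] by (rule L2_add[OF m_L2 Lqt(1)])
  have h_le: "l2_norm {0..1} h \<le> l2_norm {0..1} (\<lambda>t. L * nV (u t)) + 1"
    unfolding h_def[abs_def] using l2_norm_triangle[OF m_L2 Lqt(1)] Lqt(2) L\<eta> \<epsilon>1 \<eta> by linarith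
  have lh: "l j \<le> h t" if "j < N" "t \<in> {real j / real N .. real (Suc j) / real N}" for j t
  proof -
    note t = slab[OF that]
    have "nV (cj j) \<le> nV (\<lambda>x. cj j x - u t x) + nV (u t)"
      using nV_triangle[OF V_diff[OF cj(1)[of j] u[OF t(2)]] u[OF t(2)]] by simp
    also have "\<dots> \<le> (q t + \<eta>) + nV (u t)" using t(1) nV_commute[OF cj(1)[of j] u[OF t(2)]] by simp
    finally have "L * nV (cj j) \<le> L * ((q t + \<eta>) + nV (u t))" by (rule mult_left_mono[OF _ L_ge(2)])
    then show ?thesis unfolding l_def h_def by (simp add: algebra_simps)
  qed
  have h0: "0 \<le> h t" if "t \<in> {0..1}" for t
    unfolding h_def using L_ge q0[OF that] nV_nonneg[OF u[OF that]] \<eta> by (intro add_nonneg_nonneg mult_nonneg_nonneg) auto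
  have "(\<Sum>j<N. l j / real N) \<le> (LINT t|lebesgue_on {0..1}. h t)"
    by (rule sum_le_integral_of_slabs[OF Npos integral_le_l2_norm(1)[OF hL2] h0 lh])
  then have sum: "(\<Sum>j<N. l j / real N) \<le> l2_norm {0..1} (\<lambda>t. L * nV (u t)) + 1"
    using integral_le_l2_norm(2)[OF hL2] h_le by linarith
  have vl: "(l j)-lipschitz_on UNIV (v j)" for j
    by (rule lipschitz_on_le[OF v(2)]) (use \<eta> in \<open>simp add: l_def L_def\<close>)
  have vb: "norm (v j x) \<le> l j" if "x \<in> space_dom" for j x
  proof -
    have "norm (v j x) \<le> norm (cj j x) + \<eta>"
      using v(4)[OF that, of j] norm_triangle_ineq2[of "v j x" "cj j x"] by linarith
    also have "norm (cj j x) \<le> K * nV (cj j)" by (rule sup_bound[OF cj(1) that])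
    also have "\<dots> \<le> L * nV (cj j)" by (rule mult_right_mono[OF L_ge(1) cj(3)])
    finally show ?thesis by (simp add: l_def)
  qed
  have lN: "l j \<le> \<epsilon> * real N" for j
    using NB mult_left_mono[OF cj(2)[of j] L_ge(2)] unfolding l_def by linarith
  show ?thesis
    by (rule exI[of _ N], rule conjI[OF Npos], rule exI[of _ v], rule exI[of _ l], rule exI[of _ r])
      (use v vl vb lN sum rL2 r_le r0 close in blast)
qed

lemma transport_setting: "transport_setting per u divergence (\<lambda>t. L * nV (u t)) (l2_norm {0..1} (\<lambda>t. L * nV (u t)) + 1)"
proof
  show "(\<lambda>z. u (snd z) (fst z) $ i) \<in> borel_measurable (lebesgue_on spacetime_dom)" for i
    by (rule velocity_measurable)
  show "divergence \<in> borel_measurable (lebesgue_on spacetime_dom)" by (rule divergence_measurable)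
  show "L2 {0..1} (\<lambda>t. L * nV (u t))" by (rule m_L2)
  have KL: "K * nV (u t) \<le> L * nV (u t)" if "t \<in> {0..1}" for t
    by (rule mult_right_mono[OF L_ge(1) nV_nonneg[OF u[OF that]]])
  show "0 \<le> L * nV (u t)" if "t \<in> {0..1}" for t using L_ge nV_nonneg[OF u[OF that]] by simp
  show "norm (u t x) \<le> L * nV (u t)" if "t \<in> {0..1}" "x \<in> space_dom" for t x
    using sup_bound[OF u[OF that(1)] that(2)] KL[OF that(1)] by linarith
  show "AE t in lebesgue_on {0..1}. AE x in lebesgue_on space_dom. \<bar>divergence (x, t)\<bar> \<le> L * nV (u t)"
    using divergence_bound AE_space
  proof eventually_elim
    case (elim t)
    then have t: "t \<in> {0..1}" by simp
    from elim(1) show ?case by eventually_elim (use KL[OF t] in linarith)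
  qed
qed (use divergence_weak_div by_parts piecewise_constant_approximation in \<open>assumption | blast\<close>)+

end

section \<open>Existence, uniqueness and optimality\<close>

theorem theorem4:
  fixes per :: bool
    and V :: "(real ^ 'n \<Rightarrow> real ^ 'n) set"
    and nV :: "(real ^ 'n \<Rightarrow> real ^ 'n) \<Rightarrow> real"
    and u :: "real \<Rightarrow> real ^ 'n \<Rightarrow> real ^ 'n"
    and I0 I1 :: "real ^ 'n \<Rightarrow> real"
  assumes "admissible_velocity per V nV u"
    and "Hhalf per I0" and "Hhalf per I1"
  shows "(\<exists>f. is_minimizer per u I0 I1 f) \<and>
    (\<forall>f h. is_minimizer per u I0 I1 f \<longrightarrow> is_minimizer per u I0 I1 h \<longrightarrow>
       (AE z in lebesgue_on spacetime_dom. f z = h z)) \<and>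
    (\<forall>f. in_G per u f \<and> has_trace per u f I0 I1 \<longrightarrow>
       (is_minimizer per u I0 I1 f \<longleftrightarrow>
        (\<forall>\<delta>. in_G0 per u \<delta> \<longrightarrow>
           l2_inner spacetime_dom (transport per u f) (transport per u \<delta>) = 0)))"
proof -
  have vs: "velocity_space per V nV" and uL: "L2_in_time V nV u"
    and H: "\<not> per \<longrightarrow> (\<forall>t\<in>{0..1}. \<forall>i. H10 (\<lambda>x. u t x $ i) \<and> W1inf False (\<lambda>x. u t x $ i))"
    using assms(1) unfolding admissible_velocity_def by auto
  obtain K where K: "K \<ge> 0" and b: "\<forall>v\<in>V. (\<forall>x\<in>space_dom. norm (v x) \<le> K * nV v) \<and> (K * nV v)-lipschitz_on space_dom v \<and>
    (\<exists>d. weak_div per v d \<and> (AE x in lebesgue_on space_dom. \<bar>d x\<bar> \<le> K * nV v))"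
    using velocity_space_bounds[OF vs] by (elim exE conjE) (rule that; assumption)
  have "\<forall>v. \<exists>d. v \<in> V \<longrightarrow> weak_div per v d \<and> (AE x in lebesgue_on space_dom. \<bar>d x\<bar> \<le> K * nV v)"
    using b by blast
  from choice[OF this] obtain D where D: "\<forall>v. v \<in> V \<longrightarrow> weak_div per v (D v) \<and> (AE x in lebesgue_on space_dom. \<bar>D v x\<bar> \<le> K * nV v)" ..
  obtain s :: "nat \<Rightarrow> real \<Rightarrow> real ^ 'n \<Rightarrow> real ^ 'n" where
    s: "\<forall>k. finite (s k ` {0..1}) \<and> s k ` {0..1} \<subseteq> V \<and> (\<forall>v. {t\<in>{0..1}. s k t = v} \<in> sets lebesgue)"
    and s_lim: "AE t in lebesgue_on {0..1}. (\<lambda>k. nV (\<lambda>x. s k t x - u t x)) \<longlonglongrightarrow> 0"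
    using uL unfolding L2_in_time_def by (elim exE conjE) (rule that; assumption)
  interpret velocity_field per V nV u K s D
  proof
    show "integrable (lebesgue_on {0..1}) (\<lambda>t. (nV (u t))\<^sup>2)" and "t \<in> {0..1} \<Longrightarrow> u t \<in> V" for t
      using uL unfolding L2_in_time_def by blast+
  qed (use vs K b D s s_lim H in blast)+
  interpret transport_setting per u divergence "\<lambda>t. L * nV (u t)" "l2_norm {0..1} (\<lambda>t. L * nV (u t)) + 1"
    by (rule transport_setting)
  have "L2 space_dom I0" "L2 space_dom I1" using assms(2,3) unfolding Hhalf_def by auto
  then show ?thesis using minimizer_exists minimizer_unique optimality_condition by blast
qed

end
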